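(* For a directed restriction species $R$, the groupoids $\mathbf{R}_k$ of $R$-structures on finite posets equipped with a $k$-layering, with the structure maps described in the context, form a simplicial groupoid $\mathbf{R}$, which is a decomposition space. Morphisms of directed restriction species induce CULF functors between decomposition spaces. The construction defines a functor from the category of directed restriction species and their morphisms to that of decomposition spaces and CULF maps.
   Context: Conventions: functors into groupoids $\mathbf{Grpd}$ (in particular simplicial groupoids $\Delta^{\mathrm{op}}\to\mathbf{Grpd}$) are pseudo-functors, transformations are pseudo-natural, pullbacks are homotopy pullbacks. A map of posets $f:K\to P$ is convex if for all $a,b\in K$ and $fa\le x\le fb$ in $P$ there is a unique $k\in K$ with $a\le k\le b$ and $fk=x$. $\mathbb{C}$ is the category of finite posets and convex maps. A directed restriction species is a pseudo-functor $R:\mathbb{C}^{\mathrm{op}}\to\mathbf{Grpd}$ whose values are locally finite groupoids (all automorphism groups finite); morphisms are pseudo-natural transformations. For $K\subset P$ convex and $X\in R[P]$, $X|K\in R[K]$ is the restriction. $\Delta$ has objects $[n]=\{0,\dots,n\}$. A map $a:[m]\to[n]$ is generic if $a(0)=0$ and $a(m)=n$, and free if $a(i+1)=a(i)+1$ for $0\le i\le m-1$; every map factors uniquely as generic followed by free, and generic and free maps admit pushouts along each other. A decomposition space is a simplicial groupoid sending generic–free pushouts in $\Delta$ to pullbacks. A simplicial map is CULF if its naturality squares on all generic maps are pullbacks. $\underline{\Delta}$ has objects $\underline n=\{1,\dots,n\}$, $n\ge0$, and monotone maps. A generic map $g:[n]\to[m]$ corresponds to $\underline g:\underline m\to\underline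 n$ sending $j$ to the unique $i$ with $g(i-1)<j\le g(i)$. A free map $f:[n]\to[m]$, $f(i)=i+c$, with $n\ge1$, corresponds to $\underline f:\underline n\to\underline m$, $i\mapsto i+c$; every map $[0]\to[m]$ corresponds to $\underline 0\to\underline m$. Given $R$, $\mathbf{R}_n$ is the groupoid of triples $(P,\ell,X)$ with $P$ a finite poset, $\ell:P\to\underline n$ a monotone map (an $n$-layering) and $X\in R[P]$, with morphisms the isomorphisms of $R$-structures whose underlying poset isomorphism is over $\underline n$. A generic map $g:[n]\to[m]$ acts by $\mathbf{R}_m\to\mathbf{R}_n$, $(P,\ell,X)\mapsto(P,\underline g\circ\ell,X)$; a free map $f:[n]\to[m]$ acts by $\mathbf{R}_m\to\mathbf{R}_n$, $(P,\ell,X)\mapsto(P',\ell',X|P')$ where $\ell':P'\to\underline n$ is the pullback of $\ell$ along $\underline f$ (so $P'\subset P$ is a convex subposet). A morphism $\phi:R'\to R$ induces $(P,\ell,X)\mapsto(P,\ell,\phi(X))$. *)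

theory Defs
  imports "HOL-Library.FuncSet" "HOL-Library.Infinite_Typeclass"
begin

section \<open>Categories, functors and groupoids\<close>

text \<open>
  Categories are given by explicit sets of objects and arrows; the values of the structure maps
  outside these sets are irrelevant.  Functors and pseudo-natural transformations, on the other
  hand, occur as arrows of categories, so their component functions are required to be
  extensional (in the sense of \<^theory>\<open>HOL-Library.FuncSet\<close>): HOL equality
  of two of them is then equality on the objects and arrows of the source.
\<close>

record ('o, 'm) cat =
  Obj :: "'o set"
  Arr :: "'m set"
  Dom :: "'m \<Rightarrow> 'o"
  Cod :: "'m \<Rightarrow> 'o"
  Id :: "'o \<Rightarrow> 'm"
  Comp :: "'m \<Rightarrow> 'm \<Rightarrow> 'm" (infixl "\<cdot>\<index>" 70)

definition Hom :: "('o, 'm) cat \<Rightarrow> 'o \<Rightarrow> 'o \<Rightarrow> 'm set" where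
  "Hom C x y = {f \<in> Arr C. Dom C f = x \<and> Cod C f = y}"

locale category =
  fixes C :: "('o, 'm) cat" (structure)
  assumes Dom_Obj: "f \<in> Arr C \<Longrightarrow> Dom C f \<in> Obj C"
    and Cod_Obj: "f \<in> Arr C \<Longrightarrow> Cod C f \<in> Obj C"
    and Id_Hom: "x \<in> Obj C \<Longrightarrow> Id C x \<in> Hom C x x"
    and Comp_Hom: "f \<in> Hom C x y \<Longrightarrow> g \<in> Hom C y z \<Longrightarrow> g \<cdot> f \<in> Hom C x z"
    and Comp_Id_right: "f \<in> Hom C x y \<Longrightarrow> f \<cdot> Id C x = f"
    and Comp_Id_left: "f \<in> Hom C x y \<Longrightarrow> Id C y \<cdot> f = f"
    and Comp_assoc: "f \<in> Hom C w x \<Longrightarrow> g \<in> Hom C x y \<Longrightarrow> h \<in> Hom C y z \<Longrightarrow>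
      (h \<cdot> g) \<cdot> f = h \<cdot> (g \<cdot> f)"

definition inverse_arrows :: "('o, 'm) cat \<Rightarrow> 'm \<Rightarrow> 'm \<Rightarrow> bool" where
  "inverse_arrows C f g \<longleftrightarrow>
     f \<in> Arr C \<and> g \<in> Hom C (Cod C f) (Dom C f) \<and>
     g \<cdot>\<^bsub>C\<^esub> f = Id C (Dom C f) \<and> f \<cdot>\<^bsub>C\<^esub> g = Id C (Cod C f)"

definition is_iso :: "('o, 'm) cat \<Rightarrow> 'm \<Rightarrow> bool" where
  "is_iso C f \<longleftrightarrow> (\<exists>g. inverse_arrows C f g)"

definition inv_arr :: "('o, 'm) cat \<Rightarrow> 'm \<Rightarrow> 'm" where
  "inv_arr C f = (THE g. inverse_arrows C f g)"

locale groupoid = category +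
  assumes all_iso: "f \<in> Arr C \<Longrightarrow> is_iso C f"

text \<open>All automorphism groups, equivalently all hom sets, are finite.\<close>

locale locally_finite_groupoid = groupoid +
  assumes finite_aut: "x \<in> Obj C \<Longrightarrow> finite (Hom C x x)"

record ('o, 'm, 'p, 'n) funct =
  on_obj :: "'o \<Rightarrow> 'p"
  on_arr :: "'m \<Rightarrow> 'n"

definition is_functor ::
  "('o, 'm) cat \<Rightarrow> ('p, 'n) cat \<Rightarrow> ('o, 'm, 'p, 'n) funct \<Rightarrow> bool" where
  "is_functor C D F \<longleftrightarrow>
     category C \<and> category D \<and>
     on_obj F \<in> Obj C \<rightarrow>\<^sub>E Obj D \<and>
     on_arr F \<in> Arr C \<rightarrow>\<^sub>E Arr D \<and>
     (\<forall>f \<in> Arr C. Dom D (on_arr F f) = on_obj F (Dom C f) \<and>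
                 Cod D (on_arr F f) = on_obj F (Cod C f)) \<and>
     (\<forall>x \<in> Obj C. on_arr F (Id C x) = Id D (on_obj F x)) \<and>
     (\<forall>f \<in> Arr C. \<forall>g \<in> Arr C. Dom C g = Cod C f \<longrightarrow>
        on_arr F (g \<cdot>\<^bsub>C\<^esub> f) = on_arr F g \<cdot>\<^bsub>D\<^esub> on_arr F f)"

definition id_funct :: "('o, 'm) cat \<Rightarrow> ('o, 'm, 'o, 'm) funct" where
  "id_funct C = \<lparr>on_obj = (\<lambda>x \<in> Obj C. x), on_arr = (\<lambda>f \<in> Arr C. f)\<rparr>"

text \<open>The composite of \<open>F\<close> followed by \<open>G\<close>, where \<open>C\<close> is the source of \<open>F\<close>.\<close>

definition comp_funct :: "('o, 'm) cat \<Rightarrow> ('p, 'n, 'q, 'k) funct \<Rightarrow> ('o, 'm, 'p, 'n) funct \<Rightarrow>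
    ('o, 'm, 'q, 'k) funct" where
  "comp_funct C G F =
     \<lparr>on_obj = compose (Obj C) (on_obj G) (on_obj F),
      on_arr = compose (Arr C) (on_arr G) (on_arr F)\<rparr>"

definition nat_iso :: "('o, 'm) cat \<Rightarrow> ('p, 'n) cat \<Rightarrow> ('o, 'm, 'p, 'n) funct \<Rightarrow>
    ('o, 'm, 'p, 'n) funct \<Rightarrow> ('o \<Rightarrow> 'n) \<Rightarrow> bool" where
  "nat_iso C D F G \<alpha> \<longleftrightarrow>
     is_functor C D F \<and> is_functor C D G \<and>
     (\<forall>x \<in> Obj C. \<alpha> x \<in> Hom D (on_obj F x) (on_obj G x) \<and> is_iso D (\<alpha> x)) \<and>
     (\<forall>f \<in> Arr C. \<alpha> (Cod C f) \<cdot>\<^bsub>D\<^esub> on_arr F f = on_arr G f \<cdot>\<^bsub>D\<^esub> \<alpha> (Dom C f))"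

definition is_equivalence ::
  "('o, 'm) cat \<Rightarrow> ('p, 'n) cat \<Rightarrow> ('o, 'm, 'p, 'n) funct \<Rightarrow> bool" where
  "is_equivalence C D F \<longleftrightarrow>
     is_functor C D F \<and>
     (\<exists>G \<eta> \<epsilon>. is_functor D C G \<and>
        nat_iso C C (id_funct C) (comp_funct C G F) \<eta> \<and>
        nat_iso D D (comp_funct D F G) (id_funct D) \<epsilon>)"


section \<open>Homotopy pullbacks of groupoids\<close>

text \<open>
  The standard model of the homotopy pullback of \<open>F : B \<rightarrow> D\<close> and \<open>G : C \<rightarrow> D\<close>: objects are
  triples \<open>(b, \<delta>, c)\<close> with \<open>\<delta> : F b \<rightarrow> G c\<close> invertible, arrows are pairs of arrows in \<open>B\<close> and \<open>C\<close>
  compatible with the \<open>\<delta>\<close>'s (recorded together with their source and target).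
\<close>

definition iso_comma :: "('b, 'bm) cat \<Rightarrow> ('c, 'cm) cat \<Rightarrow> ('d, 'dm) cat \<Rightarrow>
    ('b, 'bm, 'd, 'dm) funct \<Rightarrow> ('c, 'cm, 'd, 'dm) funct \<Rightarrow>
    ('b \<times> 'dm \<times> 'c, ('b \<times> 'dm \<times> 'c) \<times> ('bm \<times> 'cm) \<times> ('b \<times> 'dm \<times> 'c)) cat" where
  "iso_comma B C D F G =
     (let Ob = {(b, \<delta>, c). b \<in> Obj B \<and> c \<in> Obj C \<and>
                  \<delta> \<in> Hom D (on_obj F b) (on_obj G c) \<and> is_iso D \<delta>}
      in \<lparr>Obj = Ob,
          Arr = {((b, \<delta>, c), (\<beta>, \<gamma>), (b', \<delta>', c')).
                   (b, \<delta>, c) \<in> Ob \<and> (b', \<delta>', c') \<in> Ob \<and>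
                   \<beta> \<in> Hom B b b' \<and> \<gamma> \<in> Hom C c c' \<and>
                   on_arr G \<gamma> \<cdot>\<^bsub>D\<^esub> \<delta> = \<delta>' \<cdot>\<^bsub>D\<^esub> on_arr F \<beta>},
          Dom = (\<lambda>(s, _, _). s),
          Cod = (\<lambda>(_, _, t). t),
          Id = (\<lambda>(b, \<delta>, c). ((b, \<delta>, c), (Id B b, Id C c), (b, \<delta>, c))),
          Comp = (\<lambda>(_, (\<beta>', \<gamma>'), t) (s, (\<beta>, \<gamma>), _). (s, (\<beta>' \<cdot>\<^bsub>B\<^esub> \<beta>, \<gamma>' \<cdot>\<^bsub>C\<^esub> \<gamma>), t))\<rparr>)"

text \<open>
  The functor \<open>A \<rightarrow> B \<times>\<^sub>D C\<close> induced by a square \<open>\<alpha> : F \<circ> P \<Rightarrow> G \<circ> Q\<close>,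
  where \<open>P : A \<rightarrow> B\<close> and \<open>Q : A \<rightarrow> C\<close>.
\<close>

definition comparison :: "('a, 'am) cat \<Rightarrow>
    ('a, 'am, 'b, 'bm) funct \<Rightarrow> ('a, 'am, 'c, 'cm) funct \<Rightarrow> ('a \<Rightarrow> 'dm) \<Rightarrow>
    ('a, 'am, 'b \<times> 'dm \<times> 'c, ('b \<times> 'dm \<times> 'c) \<times> ('bm \<times> 'cm) \<times> ('b \<times> 'dm \<times> 'c)) funct" where
  "comparison A P Q \<alpha> =
     (let ob = (\<lambda>a. (on_obj P a, \<alpha> a, on_obj Q a))
      in \<lparr>on_obj = (\<lambda>a \<in> Obj A. ob a),
          on_arr = (\<lambda>f \<in> Arr A. (ob (Dom A f), (on_arr P f, on_arr Q f), ob (Cod A f)))\<rparr>)"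

definition is_hpullback :: "('a, 'am) cat \<Rightarrow> ('b, 'bm) cat \<Rightarrow> ('c, 'cm) cat \<Rightarrow> ('d, 'dm) cat \<Rightarrow>
    ('a, 'am, 'b, 'bm) funct \<Rightarrow> ('a, 'am, 'c, 'cm) funct \<Rightarrow>
    ('b, 'bm, 'd, 'dm) funct \<Rightarrow> ('c, 'cm, 'd, 'dm) funct \<Rightarrow> ('a \<Rightarrow> 'dm) \<Rightarrow> bool" where
  "is_hpullback A B C D P Q F G \<alpha> \<longleftrightarrow>
     is_functor A B P \<and> is_functor A C Q \<and> is_functor B D F \<and> is_functor C D G \<and>
     nat_iso A D (comp_funct A F P) (comp_funct A G Q) \<alpha> \<and>
     is_equivalence A (iso_comma B C D F G) (comparison A P Q \<alpha>)"


section \<open>Contravariant pseudo-functors into groupoids\<close>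

text \<open>
  A pseudo-functor \<open>F : C\<^sup>o\<^sup>p \<rightarrow> Grpd\<close>: \<open>pull F f : F d \<rightarrow> F c\<close> for \<open>f : c \<rightarrow> d\<close>, with coherence
  isomorphisms \<open>unitor F c : id \<Rightarrow> pull F (id c)\<close> and
  \<open>compositor F f g : pull F f \<circ> pull F g \<Rightarrow> pull F (g \<cdot> f)\<close>.
\<close>

record ('x, 'f, 'o, 'm) psf =
  grpd :: "'x \<Rightarrow> ('o, 'm) cat"
  pull :: "'f \<Rightarrow> ('o, 'm, 'o, 'm) funct"
  unitor :: "'x \<Rightarrow> 'o \<Rightarrow> 'm"
  compositor :: "'f \<Rightarrow> 'f \<Rightarrow> 'o \<Rightarrow> 'm"

locale pseudofunctor = category C for C :: "('x, 'f) cat" +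
  fixes F :: "('x, 'f, 'o, 'm) psf"
  assumes grpd_groupoid: "c \<in> Obj C \<Longrightarrow> groupoid (grpd F c)"
    and pull_functor: "f \<in> Hom C c d \<Longrightarrow> is_functor (grpd F d) (grpd F c) (pull F f)"
    and unitor_iso: "c \<in> Obj C \<Longrightarrow>
      nat_iso (grpd F c) (grpd F c) (id_funct (grpd F c)) (pull F (Id C c)) (unitor F c)"
    and compositor_iso: "f \<in> Hom C b c \<Longrightarrow> g \<in> Hom C c d \<Longrightarrow>
      nat_iso (grpd F d) (grpd F b)
        (comp_funct (grpd F d) (pull F f) (pull F g)) (pull F (g \<cdot>\<^bsub>C\<^esub> f)) (compositor F f g)"
    and unit_left: "f \<in> Hom C c d \<Longrightarrow> y \<in> Obj (grpd F d) \<Longrightarrow>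
      compositor F f (Id C d) y \<cdot>\<^bsub>grpd F c\<^esub> on_arr (pull F f) (unitor F d y)
        = Id (grpd F c) (on_obj (pull F f) y)"
    and unit_right: "f \<in> Hom C c d \<Longrightarrow> y \<in> Obj (grpd F d) \<Longrightarrow>
      compositor F (Id C c) f y \<cdot>\<^bsub>grpd F c\<^esub> unitor F c (on_obj (pull F f) y)
        = Id (grpd F c) (on_obj (pull F f) y)"
    and associativity: "f \<in> Hom C a b \<Longrightarrow> g \<in> Hom C b c \<Longrightarrow> h \<in> Hom C c d \<Longrightarrow>
      y \<in> Obj (grpd F d) \<Longrightarrow>
      compositor F (g \<cdot>\<^bsub>C\<^esub> f) h y \<cdot>\<^bsub>grpd F a\<^esub> compositor F f g (on_obj (pull F h) y)
        = compositor F f (h \<cdot>\<^bsub>C\<^esub> g) y \<cdot>\<^bsub>grpd F a\<^esub> on_arr (pull F f) (compositor F g h y)"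

text \<open>
  A pseudo-natural transformation \<open>t : F \<Rightarrow> G\<close>: functors \<open>cmpt t c : F c \<rightarrow> G c\<close> and, for
  \<open>f : c \<rightarrow> d\<close>, natural isomorphisms
  \<open>nati t f : cmpt t c \<circ> pull F f \<Rightarrow> pull G f \<circ> cmpt t d\<close>.
\<close>

record ('x, 'f, 'o, 'm, 'p, 'n) pnt =
  cmpt :: "'x \<Rightarrow> ('o, 'm, 'p, 'n) funct"
  nati :: "'f \<Rightarrow> 'o \<Rightarrow> 'n"

locale pseudonat = F: pseudofunctor C F + G: pseudofunctor C G
  for C :: "('x, 'f) cat"
    and F :: "('x, 'f, 'o, 'm) psf" and G :: "('x, 'f, 'p, 'n) psf" +
  fixes t :: "('x, 'f, 'o, 'm, 'p, 'n) pnt"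
  assumes cmpt_ext: "cmpt t \<in> extensional (Obj C)"
    and nati_ext: "nati t \<in> extensional (Arr C)"
    and nati_ext2: "f \<in> Arr C \<Longrightarrow> nati t f \<in> extensional (Obj (grpd F (Cod C f)))"
    and cmpt_functor: "c \<in> Obj C \<Longrightarrow> is_functor (grpd F c) (grpd G c) (cmpt t c)"
    and nati_iso: "f \<in> Hom C c d \<Longrightarrow>
      nat_iso (grpd F d) (grpd G c)
        (comp_funct (grpd F d) (cmpt t c) (pull F f))
        (comp_funct (grpd F d) (pull G f) (cmpt t d)) (nati t f)"
    and nati_Id: "c \<in> Obj C \<Longrightarrow> y \<in> Obj (grpd F c) \<Longrightarrow>
      nati t (Id C c) y \<cdot>\<^bsub>grpd G c\<^esub> on_arr (cmpt t c) (unitor F c y)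
        = unitor G c (on_obj (cmpt t c) y)"
    and nati_Comp: "f \<in> Hom C b c \<Longrightarrow> g \<in> Hom C c d \<Longrightarrow> y \<in> Obj (grpd F d) \<Longrightarrow>
      nati t (g \<cdot>\<^bsub>C\<^esub> f) y \<cdot>\<^bsub>grpd G b\<^esub> on_arr (cmpt t b) (compositor F f g y)
        = (compositor G f g (on_obj (cmpt t d) y) \<cdot>\<^bsub>grpd G b\<^esub> on_arr (pull G f) (nati t g y))
            \<cdot>\<^bsub>grpd G b\<^esub> nati t f (on_obj (pull F g) y)"

definition id_pnt :: "('x, 'f) cat \<Rightarrow> ('x, 'f, 'o, 'm) psf \<Rightarrow> ('x, 'f, 'o, 'm, 'o, 'm) pnt" where
  "id_pnt C F =
     \<lparr>cmpt = (\<lambda>c \<in> Obj C. id_funct (grpd F c)),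
      nati = (\<lambda>f \<in> Arr C. \<lambda>y \<in> Obj (grpd F (Cod C f)).
                Id (grpd F (Dom C f)) (on_obj (pull F f) y))\<rparr>"

text \<open>The composite of \<open>t : F \<Rightarrow> G\<close> followed by \<open>u : G \<Rightarrow> H\<close>.\<close>

definition comp_pnt :: "('x, 'f) cat \<Rightarrow> ('x, 'f, 'o, 'm) psf \<Rightarrow> ('x, 'f, 'q, 'k) psf \<Rightarrow>
    ('x, 'f, 'p, 'n, 'q, 'k) pnt \<Rightarrow> ('x, 'f, 'o, 'm, 'p, 'n) pnt \<Rightarrow>
    ('x, 'f, 'o, 'm, 'q, 'k) pnt" where
  "comp_pnt C F H u t =
     \<lparr>cmpt = (\<lambda>c \<in> Obj C. comp_funct (grpd F c) (cmpt u c) (cmpt t c)),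
      nati = (\<lambda>f \<in> Arr C. \<lambda>y \<in> Obj (grpd F (Cod C f)).
                nati u f (on_obj (cmpt t (Cod C f)) y)
                  \<cdot>\<^bsub>grpd H (Dom C f)\<^esub> on_arr (cmpt u (Dom C f)) (nati t f y))\<rparr>"

type_synonym ('x, 'f, 'o, 'm) psf_arrow =
  "('x, 'f, 'o, 'm) psf \<times> ('x, 'f, 'o, 'm, 'o, 'm) pnt \<times> ('x, 'f, 'o, 'm) psf"

definition psf_cat :: "('x, 'f) cat \<Rightarrow>
    (('x, 'f, 'o, 'm) psf, ('x, 'f, 'o, 'm) psf_arrow) cat" where
  "psf_cat C =
     \<lparr>Obj = {F. pseudofunctor C F},
      Arr = {(F, t, G). pseudonat C F G t},
      Dom = (\<lambda>(F, _, _). F),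
      Cod = (\<lambda>(_, _, G). G),
      Id = (\<lambda>F. (F, id_pnt C F, F)),
      Comp = (\<lambda>(G, u, H) (F, t, _). (F, comp_pnt C F H u t, H))\<rparr>"

text \<open>
  The category of elements (Grothendieck construction) of \<open>F\<close>.  An arrow \<open>(c, x) \<rightarrow> (d, y)\<close> is
  \<open>(f, \<alpha>, y)\<close> with \<open>f : c \<rightarrow> d\<close> and \<open>\<alpha> : x \<rightarrow> pull F f y\<close> in \<open>F c\<close>.
\<close>

definition elements :: "('x, 'f) cat \<Rightarrow> ('x, 'f, 'o, 'm) psf \<Rightarrow> ('x \<times> 'o, 'f \<times> 'm \<times> 'o) cat" where
  "elements C F =
     \<lparr>Obj = (SIGMA c : Obj C. Obj (grpd F c)),
      Arr = {(f, \<alpha>, y). f \<in> Arr C \<and> y \<in> Obj (grpd F (Cod C f)) \<and>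
               \<alpha> \<in> Arr (grpd F (Dom C f)) \<and>
               Cod (grpd F (Dom C f)) \<alpha> = on_obj (pull F f) y},
      Dom = (\<lambda>(f, \<alpha>, y). (Dom C f, Dom (grpd F (Dom C f)) \<alpha>)),
      Cod = (\<lambda>(f, \<alpha>, y). (Cod C f, y)),
      Id = (\<lambda>(c, x). (Id C c, unitor F c x, x)),
      Comp = (\<lambda>(g, \<beta>, z) (f, \<alpha>, y).
                (g \<cdot>\<^bsub>C\<^esub> f,
                 compositor F f g z \<cdot>\<^bsub>grpd F (Dom C f)\<^esub>
                   (on_arr (pull F f) \<beta> \<cdot>\<^bsub>grpd F (Dom C f)\<^esub> \<alpha>),
                 z))\<rparr>"

text \<open>The action of a pseudo-natural transformation \<open>t : F \<Rightarrow> G\<close> on arrows of \<open>elements C F\<close>.\<close>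

definition elements_map :: "('x, 'f) cat \<Rightarrow> ('x, 'f, 'p, 'n) psf \<Rightarrow>
    ('x, 'f, 'o, 'm, 'p, 'n) pnt \<Rightarrow> 'f \<times> 'm \<times> 'o \<Rightarrow> 'f \<times> 'n \<times> 'p" where
  "elements_map C G t =
     (\<lambda>(f, \<alpha>, y).
        (f, nati t f y \<cdot>\<^bsub>grpd G (Dom C f)\<^esub> on_arr (cmpt t (Dom C f)) \<alpha>,
         on_obj (cmpt t (Cod C f)) y))"


section \<open>Finite posets and convex maps\<close>

text \<open>A poset is a carrier with an order relation \<open>r\<close> on it; \<open>(a, b) \<in> r\<close> means \<open>a \<le> b\<close>.\<close>

type_synonym 'a poset = "'a set \<times> 'a rel"
type_synonym 'a pmap = "'a poset \<times> ('a \<Rightarrow> 'a) \<times> 'a poset"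

definition finite_poset :: "'a poset \<Rightarrow> bool" where
  "finite_poset P \<longleftrightarrow> finite (fst P) \<and> partial_order_on (fst P) (snd P)"

definition poset_map :: "'a poset \<Rightarrow> 'a poset \<Rightarrow> ('a \<Rightarrow> 'a) \<Rightarrow> bool" where
  "poset_map K P f \<longleftrightarrow>
     f \<in> fst K \<rightarrow>\<^sub>E fst P \<and> (\<forall>a b. (a, b) \<in> snd K \<longrightarrow> (f a, f b) \<in> snd P)"

definition convex_map :: "'a poset \<Rightarrow> 'a poset \<Rightarrow> ('a \<Rightarrow> 'a) \<Rightarrow> bool" where
  "convex_map K P f \<longleftrightarrow>
     poset_map K P f \<and>
     (\<forall>a \<in> fst K. \<forall>b \<in> fst K. \<forall>x \<in> fst P.
        (f a, x) \<in> snd P \<and> (x, f b) \<in> snd P \<longrightarrow>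
        (\<exists>!k. k \<in> fst K \<and> (a, k) \<in> snd K \<and> (k, b) \<in> snd K \<and> f k = x))"

definition poset_cat :: "('a poset, 'a pmap) cat" where
  "poset_cat =
     \<lparr>Obj = {P. finite_poset P},
      Arr = {(K, f, P). finite_poset K \<and> finite_poset P \<and> convex_map K P f},
      Dom = (\<lambda>(K, _, _). K),
      Cod = (\<lambda>(_, _, P). P),
      Id = (\<lambda>P. (P, (\<lambda>p \<in> fst P. p), P)),
      Comp = (\<lambda>(_, g, Q) (K, f, _). (K, compose (fst K) g f, Q))\<rparr>"

definition subposet :: "'a poset \<Rightarrow> 'a set \<Rightarrow> 'a poset" where
  "subposet P K = (K, Restr (snd P) K)"

definition inclusion :: "'a poset \<Rightarrow> 'a poset \<Rightarrow> 'a pmap" where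
  "inclusion K P = (K, (\<lambda>k \<in> fst K. k), P)"


section \<open>Directed restriction species\<close>

type_synonym ('a, 'o, 'm) species = "('a poset, 'a pmap, 'o, 'm) psf"
type_synonym ('a, 'o, 'm) species_arrow = "('a poset, 'a pmap, 'o, 'm) psf_arrow"

definition directed_restriction_species :: "('a, 'o, 'm) species \<Rightarrow> bool" where
  "directed_restriction_species R \<longleftrightarrow>
     pseudofunctor poset_cat R \<and>
     (\<forall>P. finite_poset P \<longrightarrow> locally_finite_groupoid (grpd R P))"

definition species_cat :: "(('a, 'o, 'm) species, ('a, 'o, 'm) species_arrow) cat" where
  "species_cat =
     (psf_cat poset_cat)
       \<lparr>Obj := {R. directed_restriction_species R},
        Arr := {(R', \<phi>, R). directed_restriction_species R' \<and> directed_restriction_species R \<and>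
                   pseudonat poset_cat R' R \<phi>}\<rparr>"


section \<open>The simplex category; decomposition spaces and CULF maps\<close>

text \<open>The object \<open>[n] = {0, \<dots>, n}\<close> of the simplex category is represented by \<open>n\<close>.\<close>

type_synonym smap = "nat \<times> (nat \<Rightarrow> nat) \<times> nat"

definition Delta :: "(nat, smap) cat" where
  "Delta =
     \<lparr>Obj = UNIV,
      Arr = {(m, a, n). a \<in> {0..m} \<rightarrow>\<^sub>E {0..n} \<and> mono_on {0..m} a},
      Dom = (\<lambda>(m, _, _). m),
      Cod = (\<lambda>(_, _, n). n),
      Id = (\<lambda>n. (n, (\<lambda>i \<in> {0..n}. i), n)),
      Comp = (\<lambda>(_, b, k) (m, a, _). (m, compose {0..m} b a, k))\<rparr>"

definition generic :: "smap \<Rightarrow> bool" where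
  "generic = (\<lambda>(m, a, n). (m, a, n) \<in> Arr Delta \<and> a 0 = 0 \<and> a m = n)"

definition free :: "smap \<Rightarrow> bool" where
  "free = (\<lambda>(m, a, n). (m, a, n) \<in> Arr Delta \<and> (\<forall>i < m. a (i + 1) = a i + 1))"

text \<open>The generic--free factorisation \<open>a = free_part a \<circ> generic_part a\<close>.\<close>

definition generic_part :: "smap \<Rightarrow> smap" where
  "generic_part = (\<lambda>(m, a, n). (m, (\<lambda>i \<in> {0..m}. a i - a 0), a m - a 0))"

definition free_part :: "smap \<Rightarrow> smap" where
  "free_part = (\<lambda>(m, a, n). (a m - a 0, (\<lambda>i \<in> {0..a m - a 0}. i + a 0), n))"

lemma generic_free_factorisation:
  assumes "a \<in> Arr Delta"
  shows "generic (generic_part a)" "free (free_part a)"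
    "Cod Delta (generic_part a) = Dom Delta (free_part a)"
    "free_part a \<cdot>\<^bsub>Delta\<^esub> generic_part a = a"
proof -
  obtain m f n where a: "a = (m, f, n)" by (cases a)
  have f: "f \<in> {0..m} \<rightarrow>\<^sub>E {0..n}" "mono_on {0..m} f" using assms by (auto simp: a Delta_def)
  have le: "f i \<le> f j" if "i \<le> j" "j \<le> m" for i j using f(2) that by (auto simp: mono_on_def)
  have n: "f i \<le> n" if "i \<le> m" for i using f(1) that by (auto simp: PiE_iff)
  show "generic (generic_part a)"
    by (auto simp: a generic_def generic_part_def Delta_def mono_on_def intro!: diff_le_mono le)
  show "free (free_part a)"
    using n[of m] le[of 0 m] by (auto simp: a free_def free_part_def Delta_def mono_on_def)
  show "Cod Delta (generic_part a) = Dom Delta (free_part a)"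
    by (simp add: a generic_part_def free_part_def Delta_def)
  show "free_part a \<cdot>\<^bsub>Delta\<^esub> generic_part a = a"
    using le f(1) by (auto simp: a generic_part_def free_part_def Delta_def compose_def fun_eq_iff
        diff_le_mono PiE_iff extensional_def)
qed

text \<open>\<open>f'\<close>, \<open>g'\<close> form a pushout of \<open>g\<close>, \<open>f\<close>, with \<open>f' \<cdot> g = g' \<cdot> f\<close>.\<close>

definition is_pushout :: "('o, 'm) cat \<Rightarrow> 'm \<Rightarrow> 'm \<Rightarrow> 'm \<Rightarrow> 'm \<Rightarrow> bool" where
  "is_pushout C g f f' g' \<longleftrightarrow>
     (\<exists>n m k l. g \<in> Hom C n m \<and> f \<in> Hom C n k \<and> f' \<in> Hom C m l \<and> g' \<in> Hom C k l \<and>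
        f' \<cdot>\<^bsub>C\<^esub> g = g' \<cdot>\<^bsub>C\<^esub> f \<and>
        (\<forall>z. \<forall>p \<in> Hom C m z. \<forall>q \<in> Hom C k z. p \<cdot>\<^bsub>C\<^esub> g = q \<cdot>\<^bsub>C\<^esub> f \<longrightarrow>
           (\<exists>!h. h \<in> Hom C l z \<and> h \<cdot>\<^bsub>C\<^esub> f' = p \<and> h \<cdot>\<^bsub>C\<^esub> g' = q)))"

type_synonym ('o, 'm) sgrpd = "(nat, smap, 'o, 'm) psf"
type_synonym ('o, 'm) sgrpd_arrow = "(nat, smap, 'o, 'm) psf_arrow"

abbreviation simplicial_groupoid :: "('o, 'm) sgrpd \<Rightarrow> bool" where
  "simplicial_groupoid X \<equiv> pseudofunctor Delta X"

abbreviation simplicial_map ::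
  "('o, 'm) sgrpd \<Rightarrow> ('p, 'n) sgrpd \<Rightarrow> (nat, smap, 'o, 'm, 'p, 'n) pnt \<Rightarrow> bool" where
  "simplicial_map X Y t \<equiv> pseudonat Delta X Y t"

text \<open>
  The image of a commutative square \<open>f' \<cdot> g = g' \<cdot> f\<close> under \<open>X\<close> commutes up to the composite
  \<open>pull X g (pull X f' x) \<rightarrow> pull X (f' \<cdot> g) x = pull X (g' \<cdot> f) x \<rightarrow> pull X f (pull X g' x)\<close>
  of coherence isomorphisms.
\<close>

definition decomposition_space :: "('o, 'm) sgrpd \<Rightarrow> bool" where
  "decomposition_space X \<longleftrightarrow>
     simplicial_groupoid X \<and>
     (\<forall>g f f' g'. generic g \<and> free f \<and> is_pushout Delta g f f' g' \<longrightarrow>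
        is_hpullback
          (grpd X (Cod Delta f')) (grpd X (Cod Delta g)) (grpd X (Cod Delta f)) (grpd X (Dom Delta g))
          (pull X f') (pull X g') (pull X g) (pull X f)
          (\<lambda>x. inv_arr (grpd X (Dom Delta g)) (compositor X f g' x)
                 \<cdot>\<^bsub>grpd X (Dom Delta g)\<^esub> compositor X g f' x))"

definition culf ::
  "('o, 'm) sgrpd \<Rightarrow> ('p, 'n) sgrpd \<Rightarrow> (nat, smap, 'o, 'm, 'p, 'n) pnt \<Rightarrow> bool" where
  "culf X Y t \<longleftrightarrow>
     simplicial_map X Y t \<and>
     (\<forall>g. generic g \<longrightarrow>
        is_hpullback
          (grpd X (Cod Delta g)) (grpd X (Dom Delta g)) (grpd Y (Cod Delta g)) (grpd Y (Dom Delta g))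
          (pull X g) (cmpt t (Cod Delta g)) (cmpt t (Dom Delta g)) (pull Y g)
          (nati t g))"

definition decomposition_cat :: "(('o, 'm) sgrpd, ('o, 'm) sgrpd_arrow) cat" where
  "decomposition_cat =
     (psf_cat Delta)
       \<lparr>Obj := {X. decomposition_space X},
        Arr := {(X, t, Y). decomposition_space X \<and> decomposition_space Y \<and> culf X Y t}\<rparr>"


section \<open>The simplicial groupoid of layered structures\<close>

text \<open>
  The maps between the sets \<open>{1, \<dots>, n}\<close> corresponding to generic maps (contravariantly)
  and to free maps (covariantly).
\<close>

definition under_generic :: "smap \<Rightarrow> nat \<Rightarrow> nat" where
  "under_generic = (\<lambda>(n, g, m). \<lambda>j \<in> {1..m}. THE i. i \<in> {1..n} \<and> g (i - 1) < j \<and> j \<le> g i)"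

definition under_free :: "smap \<Rightarrow> nat \<Rightarrow> nat" where
  "under_free = (\<lambda>(n, f, m). \<lambda>i \<in> {1..n}. i + f 0)"

definition layering :: "nat \<Rightarrow> 'a poset \<Rightarrow> ('a \<Rightarrow> nat) \<Rightarrow> bool" where
  "layering n P l \<longleftrightarrow>
     l \<in> fst P \<rightarrow>\<^sub>E {1..n} \<and> (\<forall>p q. (p, q) \<in> snd P \<longrightarrow> l p \<le> l q)"

type_synonym ('a, 'o) lstr = "'a poset \<times> ('a \<Rightarrow> nat) \<times> 'o"
type_synonym ('a, 'o, 'm) lstr_arrow =
  "('a, 'o) lstr \<times> ('a pmap \<times> 'm \<times> 'o) \<times> ('a, 'o) lstr"

text \<open>
  The arrows of \<open>elements poset_cat R\<close> are the maps of \<open>R\<close>-structures over convex maps of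
  posets.  An arrow \<open>(P, l, X) \<rightarrow> (Q, l', Y)\<close> of \<open>layered R n\<close> is an isomorphism
  \<open>((P, u, Q), \<alpha>, Y)\<close> in that category whose underlying poset isomorphism \<open>u\<close> satisfies
  \<open>l' \<circ> u = l\<close>.
\<close>

definition layered :: "('a, 'o, 'm) species \<Rightarrow> nat \<Rightarrow>
    (('a, 'o) lstr, ('a, 'o, 'm) lstr_arrow) cat" where
  "layered R n =
     (let Ob = {(P, l, X). finite_poset P \<and> layering n P l \<and> X \<in> Obj (grpd R P)};
          E = elements poset_cat R
      in \<lparr>Obj = Ob,
          Arr = {((P, l, X), e, (Q, l', Y)).
                   (P, l, X) \<in> Ob \<and> (Q, l', Y) \<in> Ob \<and>
                   e \<in> Hom E (P, X) (Q, Y) \<and> is_iso E e \<and>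
                   (\<forall>p \<in> fst P. l' (fst (snd (fst e)) p) = l p)},
          Dom = (\<lambda>(s, _, _). s),
          Cod = (\<lambda>(_, _, t). t),
          Id = (\<lambda>(P, l, X). ((P, l, X), Id E (P, X), (P, l, X))),
          Comp = (\<lambda>(_, d, t) (s, e, _). (s, d \<cdot>\<^bsub>E\<^esub> e, t))\<rparr>)"

text \<open>
  The action on objects.  Pulling \<open>l\<close> back along the injection \<open>under_free f\<close> gives the
  subposet of points whose layer is hit by \<open>under_free f\<close>.
\<close>

definition generic_act :: "smap \<Rightarrow> ('a, 'o) lstr \<Rightarrow> ('a, 'o) lstr" where
  "generic_act g = (\<lambda>(P, l, X). (P, compose (fst P) (under_generic g) l, X))"

definition preimage_poset :: "smap \<Rightarrow> 'a poset \<Rightarrow> ('a \<Rightarrow> nat) \<Rightarrow> 'a poset" where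
  "preimage_poset f P l = subposet P {p \<in> fst P. l p \<in> under_free f ` {1..Dom Delta f}}"

definition free_act :: "('a, 'o, 'm) species \<Rightarrow> smap \<Rightarrow> ('a, 'o) lstr \<Rightarrow> ('a, 'o) lstr" where
  "free_act R f = (\<lambda>(P, l, X).
     let P' = preimage_poset f P l
     in (P',
         (\<lambda>p \<in> fst P'. inv_into {1..Dom Delta f} (under_free f) (l p)),
         on_obj (pull R (inclusion P' P)) X))"

text \<open>
  An arbitrary map acts through its generic--free factorisation.  An identity map is both
  generic and free, and the two prescriptions give \<open>X\<close> and \<open>X|P\<close>, which are only canonically
  isomorphic; we take \<open>X\<close>, so that generic maps (exactly those whose free part is an identity)
  act by \<open>generic_act\<close>.
\<close>

definition act_obj :: "('a, 'o, 'm) species \<Rightarrow> smap \<Rightarrow> ('a, 'o) lstr \<Rightarrow> ('a, 'o) lstr" where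
  "act_obj R a x = generic_act (generic_part a) (if generic a then x else free_act R (free_part a) x)"

lemma act_obj_generic:
  assumes "generic g" shows "act_obj R g x = generic_act g x"
proof -
  obtain m f n where g: "g = (m, f, n)" by (cases g)
  have "generic_part g = g"
    using assms by (auto simp: g generic_def generic_part_def Delta_def fun_eq_iff PiE_iff extensional_def)
  then show ?thesis using assms by (simp add: act_obj_def)
qed

lemma act_obj_free:
  assumes "free f" "\<not> generic f" "layering (Cod Delta f) P l"
  shows "act_obj R f (P, l, X) = free_act R f (P, l, X)"
proof -
  obtain m h n where f: "f = (m, h, n)" by (cases f)
  have h: "h \<in> {0..m} \<rightarrow>\<^sub>E {0..n}" and step: "\<And>i. i < m \<Longrightarrow> h (i + 1) = h i + 1"
    using assms(1) by (auto simp: f free_def Delta_def)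
  have shift: "i \<le> m \<Longrightarrow> i + h 0 = h i" for i
  proof (induction i)
    case (Suc i) then show ?case using step[of i] by simp
  qed simp
  have shift': "i \<le> m \<Longrightarrow> h i - h 0 = i" for i using shift[of i] by linarith
  have fp: "free_part f = f"
    using h shift shift'[of m] by (auto simp: f free_part_def fun_eq_iff PiE_iff extensional_def)
  have gp: "generic_part f = (m, (\<lambda>i \<in> {0..m}. i), m)"
    using shift' by (auto simp: f generic_part_def fun_eq_iff restrict_def)
  have ug: "under_generic (generic_part f) j = j" if "j \<in> {1..m}" for j
  proof -
    have "(THE i. i \<in> {1..m} \<and> (\<lambda>i \<in> {0..m}. i) (i - 1) < j \<and> j \<le> (\<lambda>i \<in> {0..m}. i) i) = j"
      using that by (intro the_equality) (auto split: if_splits)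
    then show ?thesis using that by (simp add: gp under_generic_def)
  qed
  have inv: "inv_into {1..m} (under_free f) (l p) \<in> {1..m}" if "l p \<in> under_free f ` {1..m}" for p
    using that by (rule inv_into_into)
  have D: "Dom Delta f = m" by (simp add: f Delta_def)
  show ?thesis
    unfolding act_obj_def fp free_act_def generic_act_def Let_def D preimage_poset_def subposet_def
    using assms(2) ug inv by (auto simp: compose_def fun_eq_iff simp del: atLeastAtMost_iff)
qed

text \<open>
  The canonical arrow \<open>X|P' \<rightarrow> X\<close> of \<open>elements poset_cat R\<close> over the inclusion \<open>P' \<subseteq> P\<close>,
  from the underlying structure of \<open>act_obj R a (P, l, X)\<close> to \<open>(P, X)\<close>.
  It is a cartesian arrow, which makes the arrows defined below by \<open>THE\<close> well defined.
\<close>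

definition restr_arrow ::
  "('a, 'o, 'm) species \<Rightarrow> smap \<Rightarrow> ('a, 'o) lstr \<Rightarrow> 'a pmap \<times> 'm \<times> 'o" where
  "restr_arrow R a = (\<lambda>(P, l, X).
     if generic a then Id (elements poset_cat R) (P, X)
     else let P' = preimage_poset (free_part a) P l; i = inclusion P' P
          in (i, Id (grpd R P') (on_obj (pull R i) X), X))"

text \<open>For \<open>e : x \<rightarrow> y\<close>, the unique arrow between the restrictions of \<open>x\<close> and \<open>y\<close> induced by \<open>e\<close>.\<close>

definition act_arr :: "('a, 'o, 'm) species \<Rightarrow> smap \<Rightarrow>
    ('a, 'o, 'm) lstr_arrow \<Rightarrow> ('a, 'o, 'm) lstr_arrow" where
  "act_arr R a = (\<lambda>(x, e, y).
     THE d. d \<in> Hom (layered R (Dom Delta a)) (act_obj R a x) (act_obj R a y) \<and>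
       restr_arrow R a y \<cdot>\<^bsub>elements poset_cat R\<^esub> fst (snd d)
         = e \<cdot>\<^bsub>elements poset_cat R\<^esub> restr_arrow R a x)"

text \<open>
  The compositor at \<open>x\<close> is the canonical isomorphism \<open>(X|P')|P'' \<rightarrow> X|P''\<close>: the unique one that
  is compatible with the canonical arrows to \<open>X\<close>.  Identity maps act as the identity functor.
\<close>

definition layered_space :: "('a, 'o, 'm) species \<Rightarrow>
    (('a, 'o) lstr, ('a, 'o, 'm) lstr_arrow) sgrpd" where
  "layered_space R =
     \<lparr>grpd = layered R,
      pull = (\<lambda>a. \<lparr>on_obj = (\<lambda>x \<in> Obj (layered R (Cod Delta a)). act_obj R a x),
                   on_arr = (\<lambda>e \<in> Arr (layered R (Cod Delta a)). act_arr R a e)\<rparr>),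
      unitor = (\<lambda>n. Id (layered R n)),
      compositor = (\<lambda>a b x.
        THE d. d \<in> Hom (layered R (Dom Delta a))
                     (act_obj R a (act_obj R b x)) (act_obj R (b \<cdot>\<^bsub>Delta\<^esub> a) x) \<and>
          restr_arrow R (b \<cdot>\<^bsub>Delta\<^esub> a) x \<cdot>\<^bsub>elements poset_cat R\<^esub> fst (snd d)
            = restr_arrow R b x \<cdot>\<^bsub>elements poset_cat R\<^esub> restr_arrow R a (act_obj R b x))\<rparr>"

text \<open>
  The simplicial map induced by \<open>\<phi> : R' \<rightarrow> R\<close>.  Its naturality isomorphism at \<open>a\<close> and
  \<open>(P, l, X)\<close> is the canonical one \<open>\<phi>(X|P') \<rightarrow> \<phi>(X)|P'\<close> over the identity of \<open>P'\<close>.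
\<close>

definition induced_obj :: "('a poset, 'a pmap, 'o, 'm, 'p, 'n) pnt \<Rightarrow>
    ('a, 'o) lstr \<Rightarrow> ('a, 'p) lstr" where
  "induced_obj \<phi> = (\<lambda>(P, l, X). (P, l, on_obj (cmpt \<phi> P) X))"

definition induced_map :: "('a, 'o, 'm) species \<Rightarrow> ('a, 'p, 'n) species \<Rightarrow>
    ('a poset, 'a pmap, 'o, 'm, 'p, 'n) pnt \<Rightarrow>
    (nat, smap, ('a, 'o) lstr, ('a, 'o, 'm) lstr_arrow, ('a, 'p) lstr, ('a, 'p, 'n) lstr_arrow) pnt"
  where
  "induced_map R' R \<phi> =
     \<lparr>cmpt = (\<lambda>n.
        \<lparr>on_obj = (\<lambda>x \<in> Obj (layered R' n). induced_obj \<phi> x),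
         on_arr = (\<lambda>(x, e, y) \<in> Arr (layered R' n).
           (induced_obj \<phi> x, elements_map poset_cat R \<phi> e, induced_obj \<phi> y))\<rparr>),
      nati = (\<lambda>a \<in> Arr Delta. \<lambda>x \<in> Obj (layered R' (Cod Delta a)).
        THE d. d \<in> Hom (layered R (Dom Delta a))
                     (induced_obj \<phi> (act_obj R' a x)) (act_obj R a (induced_obj \<phi> x)) \<and>
          restr_arrow R a (induced_obj \<phi> x) \<cdot>\<^bsub>elements poset_cat R\<^esub> fst (snd d)
            = elements_map poset_cat R \<phi> (restr_arrow R' a x))\<rparr>"

definition layered_functor ::
  "(('a, 'o, 'm) species, ('a, 'o, 'm) species_arrow,
    (('a, 'o) lstr, ('a, 'o, 'm) lstr_arrow) sgrpd,
    (('a, 'o) lstr, ('a, 'o, 'm) lstr_arrow) sgrpd_arrow) funct" where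
  "layered_functor =
     \<lparr>on_obj = (\<lambda>R \<in> Obj species_cat. layered_space R),
      on_arr = (\<lambda>(R', \<phi>, R) \<in> Arr species_cat.
        (layered_space R', induced_map R' R \<phi>, layered_space R))\<rparr>"

end

theory Submission
  imports Defs
begin

text \<open>
  For a species \<open>R\<close> the fibres of its category of elements over posets are groupoids, and convex maps are
  embeddings.  Hence every arrow of that category is a monomorphism, and one arrow factors through
  another with the same target exactly when the images of the underlying embeddings are nested.  Call
  an arrow \<open>e : x \<rightarrow> y\<close> of layered structures an arrow over \<open>a : [m] \<rightarrow> [n]\<close> if it identifies \<open>x\<close> with the
  restriction of \<open>y\<close> along \<open>a\<close>.  Such arrows compose and have unique factorisations over factorisations
  of \<open>a\<close>, that is, they form a fibration in groupoids over the simplex category.  The groupoids of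
  layered structures are its fibres and the simplicial structure maps are a choice of cartesian lifts,
  so every coherence law follows by cancelling a cartesian arrow.

  A generic map does not change the underlying structure.  So the CULF condition for an induced map
  only asks to transport a layering along an isomorphism of posets.  The pushout of a generic \<open>g\<close> along a
  free map stretches one block of layers by \<open>g\<close>, and the decomposition space condition says that a finer
  layering of that block extends uniquely to a layering of the whole poset.
\<close>

section \<open>Categories, functors and natural isomorphisms\<close>

text \<open>The structure maps are prescribed by generic-free factorisation, and factorisations do
  not compose: a free map followed by a generic one has to be factored again, so a direct check of
  the compositors would run through many cases. The relation \<open>over\<close> avoids this. It
  asks that a point of layer \<open>i\<close> lands in a layer \<open>j\<close> with
  \<open>app a (i - 1) < j\<close> and \<open>j \<le> app a i\<close>. These half-open intervals
  make sense for every monotone map at once and are visibly compatible with composition; for a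
  generic map they are the fibres of the corresponding map of layers, for a free map they are single
  shifted layers. The factorisation has to be confronted with \<open>over\<close> only once, for the
  chosen restriction arrows.

  Homotopy pullbacks are tested by full faithfulness and essential surjectivity of the comparison
  functor, which turns them into statements about single arrows and objects. A pushout in the
  simplex category is known only through its universal property, so its shape has to be recovered;
  this is possible without ambiguity because isomorphisms in that category are identities.\<close>

lemma HomI: "f \<in> Arr C \<Longrightarrow> Dom C f = x \<Longrightarrow> Cod C f = y \<Longrightarrow> f \<in> Hom C x y"
  by (simp add: Hom_def)

lemma HomD:
  assumes "f \<in> Hom C x y"
  shows "f \<in> Arr C" "Dom C f = x" "Cod C f = y"
  using assms by (auto simp: Hom_def)

context category
begin

lemma Hom_Obj:
  assumes "f \<in> Hom C x y"
  shows "x \<in> Obj C" "y \<in> Obj C"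
  using assms Dom_Obj Cod_Obj by (auto simp: Hom_def)

text \<open>Justifies the \<open>THE\<close> in \<open>inv_arr\<close>.\<close>

lemma inverse_arrows_unique:
  assumes "inverse_arrows C f g" "inverse_arrows C f h"
  shows "g = h"
proof -
  have f: "f \<in> Hom C (Dom C f) (Cod C f)" using assms(1) by (simp add: inverse_arrows_def Hom_def)
  have g: "g \<in> Hom C (Cod C f) (Dom C f)" "g \<cdot> f = Id C (Dom C f)"
    and h: "h \<in> Hom C (Cod C f) (Dom C f)" "f \<cdot> h = Id C (Cod C f)"
    using assms by (auto simp: inverse_arrows_def)
  have "g = g \<cdot> (f \<cdot> h)" using Comp_Id_right[OF g(1)] h by simp
  also have "\<dots> = h" using Comp_assoc[OF h(1) f g(1)] g Comp_Id_left[OF h(1)] by simp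
  finally show ?thesis .
qed

end

lemma is_isoI:
  assumes "f \<in> Hom C x y" "g \<in> Hom C y x" "g \<cdot>\<^bsub>C\<^esub> f = Id C x" "f \<cdot>\<^bsub>C\<^esub> g = Id C y"
  shows "is_iso C f"
  using assms unfolding is_iso_def inverse_arrows_def Hom_def by auto

lemma groupoidI:
  assumes "category C"
    and "\<And>x y f. f \<in> Hom C x y \<Longrightarrow> \<exists>g \<in> Hom C y x. g \<cdot>\<^bsub>C\<^esub> f = Id C x \<and> f \<cdot>\<^bsub>C\<^esub> g = Id C y"
  shows "groupoid C"
proof -
  interpret category C by fact
  show ?thesis
  proof
    fix f assume "f \<in> Arr C"
    then have f: "f \<in> Hom C (Dom C f) (Cod C f)" by (simp add: Hom_def)
    from assms(2)[OF this] is_isoI[OF f] show "is_iso C f" by blast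
  qed
qed

context groupoid
begin

lemma inv_arr:
  assumes f: "f \<in> Hom C x y"
  shows inv_Hom: "inv_arr C f \<in> Hom C y x"
    and inv_left: "inv_arr C f \<cdot> f = Id C x"
    and inv_right: "f \<cdot> inv_arr C f = Id C y"
proof -
  obtain g where g: "inverse_arrows C f g"
    using all_iso[OF HomD(1)[OF f]] by (auto simp: is_iso_def)
  then have "inv_arr C f = g"
    unfolding inv_arr_def using inverse_arrows_unique by blast
  with g f show "inv_arr C f \<in> Hom C y x" "inv_arr C f \<cdot> f = Id C x" "f \<cdot> inv_arr C f = Id C y"
    by (auto simp: inverse_arrows_def Hom_def)
qed

lemma Hom_iso: "f \<in> Hom C x y \<Longrightarrow> is_iso C f"
  using all_iso by (simp add: Hom_def)

lemma inv_Comp_cancel_left: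
  assumes "f \<in> Hom C y z" "g \<in> Hom C x y"
  shows "inv_arr C f \<cdot> (f \<cdot> g) = g"
  using Comp_assoc[OF assms(2,1) inv_Hom[OF assms(1)]] inv_left[OF assms(1)] Comp_Id_left[OF assms(2)]
  by simp

lemma Comp_inv_cancel_left:
  assumes "f \<in> Hom C y z" "g \<in> Hom C x z"
  shows "f \<cdot> (inv_arr C f \<cdot> g) = g"
  using Comp_assoc[OF assms(2) inv_Hom[OF assms(1)] assms(1)] inv_right[OF assms(1)] Comp_Id_left[OF assms(2)]
  by simp

lemma Comp_inv_cancel_right:
  assumes "f \<in> Hom C x y" "g \<in> Hom C y z"
  shows "(g \<cdot> f) \<cdot> inv_arr C f = g"
  using Comp_assoc[OF inv_Hom[OF assms(1)] assms] inv_right[OF assms(1)] Comp_Id_right[OF assms(2)]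
  by simp

lemma left_cancel:
  assumes "f \<in> Hom C y z" "g \<in> Hom C x y" "h \<in> Hom C x y" "f \<cdot> g = f \<cdot> h"
  shows "g = h"
  using arg_cong[OF assms(4), of "\<lambda>u. inv_arr C f \<cdot> u"]
  unfolding inv_Comp_cancel_left[OF assms(1,2)] inv_Comp_cancel_left[OF assms(1,3)] .

lemma right_cancel:
  assumes "f \<in> Hom C x y" "g \<in> Hom C y z" "h \<in> Hom C y z" "g \<cdot> f = h \<cdot> f"
  shows "g = h"
  using arg_cong[OF assms(4), of "\<lambda>u. u \<cdot> inv_arr C f"]
  unfolding Comp_inv_cancel_right[OF assms(1,2)] Comp_inv_cancel_right[OF assms(1,3)] .

end

lemma is_functorD:
  assumes "is_functor C D F"
  shows functor_source: "category C" and functor_target: "category D"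
    and functor_obj_ext: "on_obj F \<in> extensional (Obj C)"
    and functor_arr_ext: "on_arr F \<in> extensional (Arr C)"
  using assms by (auto simp: is_functor_def PiE_iff)

lemma functor_Obj: "is_functor C D F \<Longrightarrow> x \<in> Obj C \<Longrightarrow> on_obj F x \<in> Obj D"
  by (auto simp: is_functor_def)

lemma functor_Hom:
  "is_functor C D F \<Longrightarrow> f \<in> Hom C x y \<Longrightarrow> on_arr F f \<in> Hom D (on_obj F x) (on_obj F y)"
  by (auto simp: is_functor_def Hom_def)

lemma functor_Id: "is_functor C D F \<Longrightarrow> x \<in> Obj C \<Longrightarrow> on_arr F (Id C x) = Id D (on_obj F x)"
  by (auto simp: is_functor_def)

lemma functor_Comp:
  "is_functor C D F \<Longrightarrow> f \<in> Hom C x y \<Longrightarrow> g \<in> Hom C y z \<Longrightarrow>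
    on_arr F (g \<cdot>\<^bsub>C\<^esub> f) = on_arr F g \<cdot>\<^bsub>D\<^esub> on_arr F f"
  by (auto simp: is_functor_def Hom_def)

lemma is_functorI:
  assumes "category C" "category D"
    and "on_obj F \<in> extensional (Obj C)" "on_arr F \<in> extensional (Arr C)"
    and "\<And>x. x \<in> Obj C \<Longrightarrow> on_obj F x \<in> Obj D"
    and "\<And>f x y. f \<in> Hom C x y \<Longrightarrow> on_arr F f \<in> Hom D (on_obj F x) (on_obj F y)"
    and "\<And>x. x \<in> Obj C \<Longrightarrow> on_arr F (Id C x) = Id D (on_obj F x)"
    and "\<And>f g x y z. f \<in> Hom C x y \<Longrightarrow> g \<in> Hom C y z \<Longrightarrow>
      on_arr F (g \<cdot>\<^bsub>C\<^esub> f) = on_arr F g \<cdot>\<^bsub>D\<^esub> on_arr F f"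
  shows "is_functor C D F"
proof -
  have "Dom D (on_arr F f) = on_obj F (Dom C f) \<and> Cod D (on_arr F f) = on_obj F (Cod C f) \<and> on_arr F f \<in> Arr D"
    if "f \<in> Arr C" for f
    using assms(6)[OF HomI[OF that refl refl]] by (simp add: Hom_def)
  moreover have "on_arr F (g \<cdot>\<^bsub>C\<^esub> f) = on_arr F g \<cdot>\<^bsub>D\<^esub> on_arr F f"
    if "f \<in> Arr C" "g \<in> Arr C" "Dom C g = Cod C f" for f g
    using assms(8)[OF HomI[OF that(1) refl refl] HomI[OF that(2,3) refl]] .
  ultimately show ?thesis
    unfolding is_functor_def PiE_iff using assms(1-5,7) by blast
qed

lemma functor_eqI:
  assumes "is_functor C D F" "is_functor C E G"
    and "\<And>x. x \<in> Obj C \<Longrightarrow> on_obj F x = on_obj G x"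
    and "\<And>f x y. f \<in> Hom C x y \<Longrightarrow> on_arr F f = on_arr G f"
  shows "F = G"
proof -
  have "on_obj F = on_obj G"
    by (rule extensionalityI[OF functor_obj_ext[OF assms(1)] functor_obj_ext[OF assms(2)] assms(3)])
  moreover have "on_arr F = on_arr G"
    by (rule extensionalityI[OF functor_arr_ext[OF assms(1)] functor_arr_ext[OF assms(2)]
          assms(4)[OF HomI[OF _ refl refl]]])
  ultimately show ?thesis by simp
qed

lemma id_funct_simps [simp]:
  "x \<in> Obj C \<Longrightarrow> on_obj (id_funct C) x = x"
  "f \<in> Arr C \<Longrightarrow> on_arr (id_funct C) f = f"
  "f \<in> Hom C x y \<Longrightarrow> on_arr (id_funct C) f = f"
  by (auto simp: id_funct_def Hom_def)

lemma id_functor: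
  assumes "category C"
  shows "is_functor C C (id_funct C)"
proof -
  interpret category C by fact
  show ?thesis
  proof (rule is_functorI)
    fix x y f assume f: "f \<in> Hom C x y"
    then show "on_arr (id_funct C) f \<in> Hom C (on_obj (id_funct C) x) (on_obj (id_funct C) y)"
      using Hom_Obj[OF f] by simp
  next
    fix x y z f g assume f: "f \<in> Hom C x y" and g: "g \<in> Hom C y z"
    show "on_arr (id_funct C) (g \<cdot>\<^bsub>C\<^esub> f) = on_arr (id_funct C) g \<cdot>\<^bsub>C\<^esub> on_arr (id_funct C) f"
      using f g Comp_Hom[OF f g] by simp
  next
    fix x assume x: "x \<in> Obj C"
    show "on_arr (id_funct C) (Id C x) = Id C (on_obj (id_funct C) x)"
      using x Id_Hom[OF x] by simp
  qed (auto simp: id_funct_def category_axioms)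
qed

lemma comp_funct_simps [simp]:
  "x \<in> Obj C \<Longrightarrow> on_obj (comp_funct C G F) x = on_obj G (on_obj F x)"
  "f \<in> Arr C \<Longrightarrow> on_arr (comp_funct C G F) f = on_arr G (on_arr F f)"
  "f \<in> Hom C x y \<Longrightarrow> on_arr (comp_funct C G F) f = on_arr G (on_arr F f)"
  by (auto simp: comp_funct_def compose_def Hom_def)

lemma comp_functor:
  assumes F: "is_functor C D F" and G: "is_functor D E G"
  shows "is_functor C E (comp_funct C G F)"
proof -
  interpret C: category C by (rule functor_source[OF F])
  show ?thesis
  proof (rule is_functorI)
    show "category C" "category E" using functor_source[OF F] functor_target[OF G] by auto
    show "on_obj (comp_funct C G F) \<in> extensional (Obj C)"
      "on_arr (comp_funct C G F) \<in> extensional (Arr C)"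
      by (auto simp: comp_funct_def compose_def)
  next
    fix x y f assume f: "f \<in> Hom C x y"
    then show "on_arr (comp_funct C G F) f \<in>
        Hom E (on_obj (comp_funct C G F) x) (on_obj (comp_funct C G F) y)"
      using C.Hom_Obj[OF f] by (auto intro: functor_Hom[OF F] functor_Hom[OF G])
  next
    fix x y z f g assume f: "f \<in> Hom C x y" and g: "g \<in> Hom C y z"
    show "on_arr (comp_funct C G F) (g \<cdot>\<^bsub>C\<^esub> f) =
        on_arr (comp_funct C G F) g \<cdot>\<^bsub>E\<^esub> on_arr (comp_funct C G F) f"
      using f g C.Comp_Hom[OF f g]
      by (simp add: functor_Comp[OF F f g] functor_Comp[OF G functor_Hom[OF F f] functor_Hom[OF F g]])
  next
    fix x assume x: "x \<in> Obj C"
    show "on_arr (comp_funct C G F) (Id C x) = Id E (on_obj (comp_funct C G F) x)"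
      using x functor_Id[OF F x] functor_Id[OF G functor_Obj[OF F x]] HomD(1)[OF C.Id_Hom[OF x]] by simp
    show "on_obj (comp_funct C G F) x \<in> Obj E"
      using x functor_Obj[OF G functor_Obj[OF F x]] by simp
  qed
qed

lemma comp_funct_assoc:
  assumes F: "is_functor A B F" and G: "is_functor B C G" and H: "is_functor C D H"
  shows "comp_funct A (comp_funct B H G) F = comp_funct A H (comp_funct A G F)"
proof (rule functor_eqI)
  show "is_functor A D (comp_funct A (comp_funct B H G) F)"
    "is_functor A D (comp_funct A H (comp_funct A G F))"
    by (intro comp_functor[OF F] comp_functor[OF G] comp_functor[OF _ H] H G)+
  show "on_obj (comp_funct A (comp_funct B H G) F) x = on_obj (comp_funct A H (comp_funct A G F)) x"
    if "x \<in> Obj A" for x using that functor_Obj[OF F that] by simp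
  show "on_arr (comp_funct A (comp_funct B H G) F) f = on_arr (comp_funct A H (comp_funct A G F)) f"
    if "f \<in> Hom A x y" for f x y using that functor_Hom[OF F that] by simp
qed

lemma comp_funct_id:
  assumes F: "is_functor C D F"
  shows "comp_funct C F (id_funct C) = F" "comp_funct C (id_funct D) F = F"
proof -
  have "is_functor C D (comp_funct C F (id_funct C))" "is_functor C D (comp_funct C (id_funct D) F)"
    using comp_functor F id_functor functor_source[OF F] functor_target[OF F] by blast+
  then show "comp_funct C F (id_funct C) = F" "comp_funct C (id_funct D) F = F"
    using functor_Obj[OF F] HomD(1)[OF functor_Hom[OF F]] by (auto intro!: functor_eqI[OF _ F])
qed

lemma nat_isoD:
  assumes "nat_iso C D F G \<alpha>"
  shows nat_iso_Hom: "x \<in> Obj C \<Longrightarrow> \<alpha> x \<in> Hom D (on_obj F x) (on_obj G x)"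
    and nat_iso_natural: "f \<in> Hom C x y \<Longrightarrow> \<alpha> y \<cdot>\<^bsub>D\<^esub> on_arr F f = on_arr G f \<cdot>\<^bsub>D\<^esub> \<alpha> x"
  using assms by (auto simp: nat_iso_def Hom_def)

text \<open>In a groupoid the components are invertible for free, so only typing and naturality are
  asked for.\<close>

lemma nat_isoI:
  assumes "groupoid D" "is_functor C D F" "is_functor C D G"
    and "\<And>x. x \<in> Obj C \<Longrightarrow> \<alpha> x \<in> Hom D (on_obj F x) (on_obj G x)"
    and "\<And>f x y. f \<in> Hom C x y \<Longrightarrow> \<alpha> y \<cdot>\<^bsub>D\<^esub> on_arr F f = on_arr G f \<cdot>\<^bsub>D\<^esub> \<alpha> x"
  shows "nat_iso C D F G \<alpha>"
  using assms groupoid.Hom_iso[OF assms(1)] by (auto simp: nat_iso_def Hom_def)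


section \<open>Equivalences and homotopy pullbacks of groupoids\<close>

text \<open>Essential surjectivity lets an inverse be chosen on objects together with a counit
  \<open>\<epsilon>\<close>. On arrows it is then forced by naturality of \<open>\<epsilon>\<close>,
  since full faithfulness solves each such square uniquely.\<close>

lemma equivalence_if_fully_faithful_ess_surj:
  assumes C: "groupoid C" and D: "groupoid D" and F: "is_functor C D F"
    and ff: "\<And>x y g. x \<in> Obj C \<Longrightarrow> y \<in> Obj C \<Longrightarrow> g \<in> Hom D (on_obj F x) (on_obj F y) \<Longrightarrow>
      \<exists>!f. f \<in> Hom C x y \<and> on_arr F f = g"
    and es: "\<And>d. d \<in> Obj D \<Longrightarrow> \<exists>c \<in> Obj C. \<exists>h. h \<in> Hom D (on_obj F c) d"
  shows "is_equivalence C D F"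
proof -
  interpret C: groupoid C by fact
  interpret D: groupoid D by fact
  obtain G0 \<epsilon> where G0: "\<And>d. d \<in> Obj D \<Longrightarrow> G0 d \<in> Obj C"
    and \<epsilon>: "\<And>d. d \<in> Obj D \<Longrightarrow> \<epsilon> d \<in> Hom D (on_obj F (G0 d)) d"
    using es by metis
  note FO = functor_Obj[OF F] and FH = functor_Hom[OF F] and FC = functor_Comp[OF F]
  define lift where "lift x y g = (THE f. f \<in> Hom C x y \<and> on_arr F f = g)" for x y g
  have lift: "lift x y g \<in> Hom C x y" "on_arr F (lift x y g) = g"
    if "x \<in> Obj C" "y \<in> Obj C" "g \<in> Hom D (on_obj F x) (on_obj F y)" for x y g
    using theI'[OF ff[OF that]] by (auto simp: lift_def)
  have faithful: "f = f'" if "f \<in> Hom C x y" "f' \<in> Hom C x y" "on_arr F f = on_arr F f'" for f f' x y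
    using ff[OF C.Hom_Obj[OF that(1)] FH[OF that(1)]] that by auto
  define G1 where "G1 g = lift (G0 (Dom D g)) (G0 (Cod D g))
      (inv_arr D (\<epsilon> (Cod D g)) \<cdot>\<^bsub>D\<^esub> (g \<cdot>\<^bsub>D\<^esub> \<epsilon> (Dom D g)))" for g
  have G1: "G1 g \<in> Hom C (G0 x) (G0 y)" "\<epsilon> y \<cdot>\<^bsub>D\<^esub> on_arr F (G1 g) = g \<cdot>\<^bsub>D\<^esub> \<epsilon> x"
    if "g \<in> Hom D x y" for g x y
  proof -
    have xy: "x \<in> Obj D" "y \<in> Obj D" using D.Hom_Obj that by auto
    have g: "g \<cdot>\<^bsub>D\<^esub> \<epsilon> x \<in> Hom D (on_obj F (G0 x)) y"
      using D.Comp_Hom[OF \<epsilon>[OF xy(1)] that] .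
    have *: "inv_arr D (\<epsilon> y) \<cdot>\<^bsub>D\<^esub> (g \<cdot>\<^bsub>D\<^esub> \<epsilon> x) \<in> Hom D (on_obj F (G0 x)) (on_obj F (G0 y))"
      using D.Comp_Hom[OF g D.inv_Hom[OF \<epsilon>[OF xy(2)]]] .
    from lift[OF G0 G0 *] xy that
    show "G1 g \<in> Hom C (G0 x) (G0 y)" "\<epsilon> y \<cdot>\<^bsub>D\<^esub> on_arr F (G1 g) = g \<cdot>\<^bsub>D\<^esub> \<epsilon> x"
      using D.Comp_inv_cancel_left[OF \<epsilon>[OF xy(2)] g]
      by (auto simp: G1_def HomD[OF that])
  qed
  \<comment> \<open>Uniqueness of the solution of the square with \<open>\<epsilon>\<close>: for
    each functor law it is enough that the expected arrow solves it.\<close>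
  have G1_eqI: "G1 g = f"
    if "g \<in> Hom D x y" "f \<in> Hom C (G0 x) (G0 y)" "\<epsilon> y \<cdot>\<^bsub>D\<^esub> on_arr F f = g \<cdot>\<^bsub>D\<^esub> \<epsilon> x" for f g x y
  proof (rule faithful)
    have "y \<in> Obj D" using D.Hom_Obj that by auto
    show "on_arr F (G1 g) = on_arr F f"
      using D.left_cancel[OF \<epsilon>[OF \<open>y \<in> Obj D\<close>] FH[OF G1(1)] FH] that G1 by auto
  qed (use that G1 in auto)
  define G where "G = \<lparr>on_obj = (\<lambda>d \<in> Obj D. G0 d), on_arr = (\<lambda>g \<in> Arr D. G1 g)\<rparr>"
  have G_obj: "on_obj G d = G0 d" if "d \<in> Obj D" for d using that by (simp add: G_def)
  have G_arr: "on_arr G g = G1 g" if "g \<in> Hom D x y" for g x y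
    using HomD[OF that] by (simp add: G_def)
  have G: "is_functor D C G"
  proof (rule is_functorI)
    fix x assume x: "x \<in> Obj D"
    have "\<epsilon> x \<cdot>\<^bsub>D\<^esub> on_arr F (Id C (G0 x)) = Id D x \<cdot>\<^bsub>D\<^esub> \<epsilon> x"
      using functor_Id[OF F G0[OF x]] D.Comp_Id_right D.Comp_Id_left \<epsilon>[OF x] by simp
    then show "on_arr G (Id D x) = Id C (on_obj G x)"
      using G1_eqI[OF D.Id_Hom[OF x] C.Id_Hom[OF G0[OF x]]] G_obj G_arr x D.Id_Hom by metis
  next
    fix f g x y z assume f: "f \<in> Hom D x y" and g: "g \<in> Hom D y z"
    note xyz = D.Hom_Obj[OF f] D.Hom_Obj[OF g]
    note Ff = FH[OF G1(1)[OF f]] and Fg = FH[OF G1(1)[OF g]]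
    have "\<epsilon> z \<cdot>\<^bsub>D\<^esub> on_arr F (G1 g \<cdot>\<^bsub>C\<^esub> G1 f) = (\<epsilon> z \<cdot>\<^bsub>D\<^esub> on_arr F (G1 g)) \<cdot>\<^bsub>D\<^esub> on_arr F (G1 f)"
      using FC[OF G1(1)[OF f] G1(1)[OF g]] D.Comp_assoc[OF Ff Fg \<epsilon>] xyz by simp
    also have "\<dots> = g \<cdot>\<^bsub>D\<^esub> (f \<cdot>\<^bsub>D\<^esub> \<epsilon> x)"
      using G1(2)[OF g] G1(2)[OF f] D.Comp_assoc[OF Ff \<epsilon>[OF xyz(2)] g] by simp
    also have "\<dots> = (g \<cdot>\<^bsub>D\<^esub> f) \<cdot>\<^bsub>D\<^esub> \<epsilon> x"
      using D.Comp_assoc[OF \<epsilon>[OF xyz(1)] f g] by simp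
    finally show "on_arr G (g \<cdot>\<^bsub>D\<^esub> f) = on_arr G g \<cdot>\<^bsub>C\<^esub> on_arr G f"
      using G1_eqI[OF D.Comp_Hom[OF f g] C.Comp_Hom[OF G1(1)[OF f] G1(1)[OF g]]]
        G_arr[OF f] G_arr[OF g] G_arr[OF D.Comp_Hom[OF f g]] by simp
  qed (use G0 G1 C.category_axioms D.category_axioms D.Hom_Obj in
      \<open>auto simp: G_obj G_arr\<close>, auto simp: G_def)
  \<comment> \<open>The unit is the lift of the inverse counit at the image of \<open>x\<close>. Its
    naturality is tested after applying \<open>F\<close>, which is faithful, and composing with
    \<open>\<epsilon>\<close>.\<close>
  define \<eta> where "\<eta> x = lift x (G0 (on_obj F x)) (inv_arr D (\<epsilon> (on_obj F x)))" for x
  have \<eta>: "\<eta> x \<in> Hom C x (G0 (on_obj F x))" "on_arr F (\<eta> x) = inv_arr D (\<epsilon> (on_obj F x))"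
    if x: "x \<in> Obj C" for x
    using lift[OF x G0[OF FO[OF x]] D.inv_Hom[OF \<epsilon>[OF FO[OF x]]]] by (auto simp: \<eta>_def)
  have "nat_iso C C (id_funct C) (comp_funct C G F) \<eta>"
  proof (rule nat_isoI)
    fix x assume "x \<in> Obj C"
    then show "\<eta> x \<in> Hom C (on_obj (id_funct C) x) (on_obj (comp_funct C G F) x)"
      using \<eta> FO G_obj by simp
  next
    fix f x y assume f: "f \<in> Hom C x y"
    note xy = C.Hom_Obj[OF f] and Ff = FH[OF f]
    let ?ex = "\<epsilon> (on_obj F x)" and ?ey = "\<epsilon> (on_obj F y)"
    note ex = \<epsilon>[OF FO[OF xy(1)]] and ey = \<epsilon>[OF FO[OF xy(2)]] and G1f = G1[OF Ff]
    have "\<eta> y \<cdot>\<^bsub>C\<^esub> f = G1 (on_arr F f) \<cdot>\<^bsub>C\<^esub> \<eta> x"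
    proof (rule faithful)
      show l: "\<eta> y \<cdot>\<^bsub>C\<^esub> f \<in> Hom C x (G0 (on_obj F y))"
        and r: "G1 (on_arr F f) \<cdot>\<^bsub>C\<^esub> \<eta> x \<in> Hom C x (G0 (on_obj F y))"
        using C.Comp_Hom \<eta> xy G1f f by blast+
      have "?ey \<cdot>\<^bsub>D\<^esub> on_arr F (\<eta> y \<cdot>\<^bsub>C\<^esub> f) = on_arr F f"
        using FC[OF f \<eta>(1)] \<eta>(2) D.Comp_inv_cancel_left[OF ey Ff] xy by simp
      moreover have "?ey \<cdot>\<^bsub>D\<^esub> on_arr F (G1 (on_arr F f) \<cdot>\<^bsub>C\<^esub> \<eta> x) = on_arr F f"
      proof -
        have "?ey \<cdot>\<^bsub>D\<^esub> on_arr F (G1 (on_arr F f) \<cdot>\<^bsub>C\<^esub> \<eta> x)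
            = (?ey \<cdot>\<^bsub>D\<^esub> on_arr F (G1 (on_arr F f))) \<cdot>\<^bsub>D\<^esub> inv_arr D ?ex"
          using FC[OF \<eta>(1) G1f(1)] \<eta>(2) D.Comp_assoc[OF D.inv_Hom[OF ex] FH[OF G1f(1)] ey] xy
          by simp
        then show ?thesis using G1f(2) D.Comp_inv_cancel_right[OF ex Ff] by simp
      qed
      ultimately show "on_arr F (\<eta> y \<cdot>\<^bsub>C\<^esub> f) = on_arr F (G1 (on_arr F f) \<cdot>\<^bsub>C\<^esub> \<eta> x)"
        using D.left_cancel[OF ey FH[OF l] FH[OF r]] by simp
    qed
    then show "\<eta> y \<cdot>\<^bsub>C\<^esub> on_arr (id_funct C) f = on_arr (comp_funct C G F) f \<cdot>\<^bsub>C\<^esub> \<eta> x"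
      using f G_arr[OF Ff] by simp
  qed (use C F G C.category_axioms in \<open>auto intro: id_functor comp_functor\<close>)
  moreover have "nat_iso D D (comp_funct D F G) (id_funct D) \<epsilon>"
  proof (rule nat_isoI)
    fix f x y assume "f \<in> Hom D x y"
    then show "\<epsilon> y \<cdot>\<^bsub>D\<^esub> on_arr (comp_funct D F G) f = on_arr (id_funct D) f \<cdot>\<^bsub>D\<^esub> \<epsilon> x"
      using G1(2) by (simp add: G_arr)
  qed (use D F G D.category_axioms \<epsilon> in \<open>auto intro: id_functor comp_functor simp: G_obj\<close>)
  ultimately show ?thesis unfolding is_equivalence_def using F G by blast
qed

lemma equivalence_ess_surj:
  assumes "is_equivalence C D F" "d \<in> Obj D"
  obtains c h where "c \<in> Obj C" "h \<in> Hom D (on_obj F c) d"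
proof -
  obtain G \<epsilon> where G: "is_functor D C G" "nat_iso D D (comp_funct D F G) (id_funct D) \<epsilon>"
    using assms by (auto simp: is_equivalence_def)
  from nat_iso_Hom[OF G(2) assms(2)] functor_Obj[OF G(1)] assms(2) show ?thesis
    by (intro that[of "on_obj G d" "\<epsilon> d"]) auto
qed

text \<open>\<open>F\<close> is faithful because \<open>G\<close> after \<open>F\<close> is
  isomorphic to the identity through \<open>\<eta>\<close>, and \<open>G\<close> is faithful in the
  same way through \<open>\<epsilon>\<close>. Faithfulness of \<open>G\<close> gives fullness of
  \<open>F\<close>: the candidate preimage, built from \<open>G\<close> and \<open>\<eta>\<close>,
  has to be compared with \<open>g\<close> only after applying \<open>G\<close>.\<close>

lemma equivalence_fully_faithful:
  assumes C: "groupoid C" and D: "groupoid D" and eq: "is_equivalence C D F"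
    and x: "x \<in> Obj C" and y: "y \<in> Obj C" and g: "g \<in> Hom D (on_obj F x) (on_obj F y)"
  shows "\<exists>!f. f \<in> Hom C x y \<and> on_arr F f = g"
proof -
  interpret C: groupoid C by fact
  interpret D: groupoid D by fact
  obtain G \<eta> \<epsilon> where F: "is_functor C D F" and G: "is_functor D C G"
    and \<eta>: "nat_iso C C (id_funct C) (comp_funct C G F) \<eta>"
    and \<epsilon>: "nat_iso D D (comp_funct D F G) (id_funct D) \<epsilon>"
    using eq by (auto simp: is_equivalence_def)
  have \<eta>H: "\<eta> z \<in> Hom C z (on_obj G (on_obj F z))" if "z \<in> Obj C" for z
    using nat_iso_Hom[OF \<eta> that] that by simp
  have \<eta>N: "\<eta> z' \<cdot>\<^bsub>C\<^esub> f = on_arr G (on_arr F f) \<cdot>\<^bsub>C\<^esub> \<eta> z" if "f \<in> Hom C z z'" for f z z'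
    using nat_iso_natural[OF \<eta> that] that by simp
  have F_faithful: "f = f'" if "f \<in> Hom C x y" "f' \<in> Hom C x y" "on_arr F f = on_arr F f'" for f f'
    using C.left_cancel[OF \<eta>H[OF y] that(1,2)] \<eta>N that by metis
  have G_faithful: "h = h'"
    if "h \<in> Hom D a b" "h' \<in> Hom D a b" "on_arr G h = on_arr G h'" for h h' a b
  proof -
    have "\<epsilon> a \<in> Hom D (on_obj F (on_obj G a)) a"
      using nat_iso_Hom[OF \<epsilon>] D.Hom_Obj[OF that(1)] by fastforce
    moreover have "h \<cdot>\<^bsub>D\<^esub> \<epsilon> a = h' \<cdot>\<^bsub>D\<^esub> \<epsilon> a"
      using nat_iso_natural[OF \<epsilon> that(1)] nat_iso_natural[OF \<epsilon> that(2)] that by simp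
    ultimately show ?thesis using D.right_cancel that by blast
  qed
  have Gg: "on_arr G g \<cdot>\<^bsub>C\<^esub> \<eta> x \<in> Hom C x (on_obj G (on_obj F y))"
    using C.Comp_Hom[OF \<eta>H[OF x] functor_Hom[OF G g]] .
  define f where "f = inv_arr C (\<eta> y) \<cdot>\<^bsub>C\<^esub> (on_arr G g \<cdot>\<^bsub>C\<^esub> \<eta> x)"
  have f: "f \<in> Hom C x y" unfolding f_def using C.Comp_Hom[OF Gg C.inv_Hom[OF \<eta>H[OF y]]] .
  have "on_arr G (on_arr F f) \<cdot>\<^bsub>C\<^esub> \<eta> x = on_arr G g \<cdot>\<^bsub>C\<^esub> \<eta> x"
    using \<eta>N[OF f] C.Comp_inv_cancel_left[OF \<eta>H[OF y] Gg] by (simp add: f_def)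
  then have "on_arr G (on_arr F f) = on_arr G g"
    using C.right_cancel[OF \<eta>H[OF x]] functor_Hom[OF G functor_Hom[OF F f]] functor_Hom[OF G g] by blast
  then have "on_arr F f = g" using G_faithful functor_Hom[OF F f] g by blast
  then show ?thesis using f F_faithful by blast
qed

section \<open>The iso-comma groupoid and a criterion for homotopy pullbacks\<close>

context
  fixes B :: "('b, 'bm) cat" and C :: "('c, 'cm) cat" and D :: "('d, 'dm) cat"
    and F :: "('b, 'bm, 'd, 'dm) funct" and G :: "('c, 'cm, 'd, 'dm) funct"
  assumes B: "groupoid B" and C: "groupoid C" and D: "groupoid D"
    and F: "is_functor B D F" and G: "is_functor C D G"
begin

interpretation B: groupoid B by (rule B)
interpretation C: groupoid C by (rule C)
interpretation D: groupoid D by (rule D)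

lemma iso_comma_Obj:
  "(b, \<delta>, c) \<in> Obj (iso_comma B C D F G) \<longleftrightarrow>
    b \<in> Obj B \<and> c \<in> Obj C \<and> \<delta> \<in> Hom D (on_obj F b) (on_obj G c)"
  using D.Hom_iso by (auto simp: iso_comma_def Let_def)

lemma iso_comma_Hom:
  "h \<in> Hom (iso_comma B C D F G) (b, \<delta>, c) (b', \<delta>', c') \<longleftrightarrow>
    (b, \<delta>, c) \<in> Obj (iso_comma B C D F G) \<and> (b', \<delta>', c') \<in> Obj (iso_comma B C D F G) \<and>
    (\<exists>\<beta> \<gamma>. h = ((b, \<delta>, c), (\<beta>, \<gamma>), (b', \<delta>', c')) \<and> \<beta> \<in> Hom B b b' \<and> \<gamma> \<in> Hom C c c' \<and>
      on_arr G \<gamma> \<cdot>\<^bsub>D\<^esub> \<delta> = \<delta>' \<cdot>\<^bsub>D\<^esub> on_arr F \<beta>)"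
  unfolding Hom_def[of "iso_comma B C D F G"] by (auto simp: iso_comma_def Let_def)

lemma iso_comma_Comp:
  "(s, (\<beta>', \<gamma>'), t) \<cdot>\<^bsub>iso_comma B C D F G\<^esub> (s', (\<beta>, \<gamma>), t') = (s', (\<beta>' \<cdot>\<^bsub>B\<^esub> \<beta>, \<gamma>' \<cdot>\<^bsub>C\<^esub> \<gamma>), t)"
  by (simp add: iso_comma_def Let_def)

lemma iso_comma_Id:
  "Id (iso_comma B C D F G) (b, \<delta>, c) = ((b, \<delta>, c), (Id B b, Id C c), (b, \<delta>, c))"
  by (simp add: iso_comma_def Let_def)

lemma iso_comma_square_paste:
  assumes "\<delta> \<in> Hom D (on_obj F b) (on_obj G c)" "\<delta>' \<in> Hom D (on_obj F b') (on_obj G c')"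
    "\<delta>'' \<in> Hom D (on_obj F b'') (on_obj G c'')"
    and \<beta>: "\<beta> \<in> Hom B b b'" and \<gamma>: "\<gamma> \<in> Hom C c c'" and \<beta>': "\<beta>' \<in> Hom B b' b''" and \<gamma>': "\<gamma>' \<in> Hom C c' c''"
    and sq: "on_arr G \<gamma> \<cdot>\<^bsub>D\<^esub> \<delta> = \<delta>' \<cdot>\<^bsub>D\<^esub> on_arr F \<beta>"
    and sq': "on_arr G \<gamma>' \<cdot>\<^bsub>D\<^esub> \<delta>' = \<delta>'' \<cdot>\<^bsub>D\<^esub> on_arr F \<beta>'"
  shows "on_arr G (\<gamma>' \<cdot>\<^bsub>C\<^esub> \<gamma>) \<cdot>\<^bsub>D\<^esub> \<delta> = \<delta>'' \<cdot>\<^bsub>D\<^esub> on_arr F (\<beta>' \<cdot>\<^bsub>B\<^esub> \<beta>)"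
proof -
  note FH = functor_Hom[OF F] and GH = functor_Hom[OF G]
  have "on_arr G (\<gamma>' \<cdot>\<^bsub>C\<^esub> \<gamma>) \<cdot>\<^bsub>D\<^esub> \<delta> = on_arr G \<gamma>' \<cdot>\<^bsub>D\<^esub> (on_arr G \<gamma> \<cdot>\<^bsub>D\<^esub> \<delta>)"
    using functor_Comp[OF G \<gamma> \<gamma>'] D.Comp_assoc[OF assms(1) GH[OF \<gamma>] GH[OF \<gamma>']] by simp
  also have "\<dots> = (on_arr G \<gamma>' \<cdot>\<^bsub>D\<^esub> \<delta>') \<cdot>\<^bsub>D\<^esub> on_arr F \<beta>"
    using sq D.Comp_assoc[OF FH[OF \<beta>] assms(2) GH[OF \<gamma>']] by simp
  also have "\<dots> = \<delta>'' \<cdot>\<^bsub>D\<^esub> on_arr F (\<beta>' \<cdot>\<^bsub>B\<^esub> \<beta>)"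
    using sq' D.Comp_assoc[OF FH[OF \<beta>] FH[OF \<beta>'] assms(3)] functor_Comp[OF F \<beta> \<beta>'] by simp
  finally show ?thesis .
qed

lemma iso_comma_category: "category (iso_comma B C D F G)"
proof
  let ?I = "iso_comma B C D F G"
  show "Dom ?I f \<in> Obj ?I" "Cod ?I f \<in> Obj ?I" if "f \<in> Arr ?I" for f
    using that by (auto simp: iso_comma_def Let_def)
  show "Id ?I x \<in> Hom ?I x x" if "x \<in> Obj ?I" for x
  proof -
    obtain b \<delta> c where x: "x = (b, \<delta>, c)" by (cases x)
    with that have *: "b \<in> Obj B" "c \<in> Obj C" "\<delta> \<in> Hom D (on_obj F b) (on_obj G c)"
      by (auto simp: iso_comma_Obj)
    then show ?thesis
      using that functor_Id[OF F *(1)] functor_Id[OF G *(2)] D.Comp_Id_left[OF *(3)] D.Comp_Id_right[OF *(3)]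
      by (auto simp: x iso_comma_Hom iso_comma_Id B.Id_Hom C.Id_Hom)
  qed
  show "g \<cdot>\<^bsub>?I\<^esub> f \<in> Hom ?I x z" if f: "f \<in> Hom ?I x y" and g: "g \<in> Hom ?I y z" for f g x y z
  proof -
    obtain b \<delta> c where x: "x = (b, \<delta>, c)" by (cases x)
    obtain b' \<delta>' c' where y: "y = (b', \<delta>', c')" by (cases y)
    obtain b'' \<delta>'' c'' where z: "z = (b'', \<delta>'', c'')" by (cases z)
    obtain \<beta> \<gamma> where f': "f = (x, (\<beta>, \<gamma>), y)" "\<beta> \<in> Hom B b b'" "\<gamma> \<in> Hom C c c'"
        "on_arr G \<gamma> \<cdot>\<^bsub>D\<^esub> \<delta> = \<delta>' \<cdot>\<^bsub>D\<^esub> on_arr F \<beta>"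
      using f unfolding x y iso_comma_Hom by blast
    obtain \<beta>' \<gamma>' where g': "g = (y, (\<beta>', \<gamma>'), z)" "\<beta>' \<in> Hom B b' b''" "\<gamma>' \<in> Hom C c' c''"
        "on_arr G \<gamma>' \<cdot>\<^bsub>D\<^esub> \<delta>' = \<delta>'' \<cdot>\<^bsub>D\<^esub> on_arr F \<beta>'"
      using g unfolding y z iso_comma_Hom by blast
    show ?thesis
      using f g iso_comma_square_paste[OF _ _ _ f'(2,3) g'(2,3) f'(4) g'(4)]
        B.Comp_Hom[OF f'(2) g'(2)] C.Comp_Hom[OF f'(3) g'(3)]
      unfolding f'(1) g'(1) iso_comma_Comp unfolding x y z iso_comma_Hom iso_comma_Obj by blast
  qed
  show "f \<cdot>\<^bsub>?I\<^esub> Id ?I x = f" "Id ?I y \<cdot>\<^bsub>?I\<^esub> f = f" if "f \<in> Hom ?I x y" for f x y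
    using that by (cases x; cases y; auto simp: iso_comma_Hom iso_comma_Id iso_comma_Comp
        B.Comp_Id_left C.Comp_Id_left B.Comp_Id_right C.Comp_Id_right)+
  show "(h \<cdot>\<^bsub>?I\<^esub> g) \<cdot>\<^bsub>?I\<^esub> f = h \<cdot>\<^bsub>?I\<^esub> (g \<cdot>\<^bsub>?I\<^esub> f)"
    if "f \<in> Hom ?I w x" "g \<in> Hom ?I x y" "h \<in> Hom ?I y z" for f g h w x y z
    using that by (cases w; cases x; cases y; cases z;
        auto simp: iso_comma_Hom iso_comma_Comp B.Comp_assoc C.Comp_assoc)
qed

lemma iso_comma_groupoid: "groupoid (iso_comma B C D F G)"
proof (rule groupoidI[OF iso_comma_category])
  fix x y f let ?I = "iso_comma B C D F G"
  assume f: "f \<in> Hom ?I x y"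
  obtain b \<delta> c where x: "x = (b, \<delta>, c)" by (cases x)
  obtain b' \<delta>' c' where y: "y = (b', \<delta>', c')" by (cases y)
  obtain \<beta> \<gamma> where f': "f = (x, (\<beta>, \<gamma>), y)" "\<beta> \<in> Hom B b b'" "\<gamma> \<in> Hom C c c'"
      "on_arr G \<gamma> \<cdot>\<^bsub>D\<^esub> \<delta> = \<delta>' \<cdot>\<^bsub>D\<^esub> on_arr F \<beta>"
    and xy: "x \<in> Obj ?I" "y \<in> Obj ?I"
    using f unfolding x y iso_comma_Hom by blast
  then have \<delta>: "\<delta> \<in> Hom D (on_obj F b) (on_obj G c)" "\<delta>' \<in> Hom D (on_obj F b') (on_obj G c')"
    and obj: "b \<in> Obj B" "b' \<in> Obj B" "c \<in> Obj C" "c' \<in> Obj C"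
    by (auto simp: x y iso_comma_Obj)
  note \<beta>i = B.inv_Hom[OF f'(2)] and \<gamma>i = C.inv_Hom[OF f'(3)]
  have Fi: "on_arr F \<beta> \<cdot>\<^bsub>D\<^esub> on_arr F (inv_arr B \<beta>) = Id D (on_obj F b')"
    using functor_Comp[OF F \<beta>i f'(2)] B.inv_right[OF f'(2)] functor_Id[OF F] obj by simp
  have Gi: "on_arr G (inv_arr C \<gamma>) \<cdot>\<^bsub>D\<^esub> on_arr G \<gamma> = Id D (on_obj G c)"
    using functor_Comp[OF G f'(3) \<gamma>i] C.inv_left[OF f'(3)] functor_Id[OF G] obj by simp
  note FH = functor_Hom[OF F] and GH = functor_Hom[OF G]
  \<comment> \<open>The square of the inverse arrows: insert \<open>F \<beta>\<close> followed back
    along its inverse on the right, use the given square, and cancel \<open>G \<gamma>\<close> on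
    the left.\<close>
  have "on_arr G (inv_arr C \<gamma>) \<cdot>\<^bsub>D\<^esub> \<delta>' = on_arr G (inv_arr C \<gamma>) \<cdot>\<^bsub>D\<^esub> ((\<delta>' \<cdot>\<^bsub>D\<^esub> on_arr F \<beta>) \<cdot>\<^bsub>D\<^esub> on_arr F (inv_arr B \<beta>))"
    using D.Comp_assoc[OF FH[OF \<beta>i] FH[OF f'(2)] \<delta>(2)] Fi D.Comp_Id_right[OF \<delta>(2)] by simp
  also have "\<dots> = on_arr G (inv_arr C \<gamma>) \<cdot>\<^bsub>D\<^esub> (on_arr G \<gamma> \<cdot>\<^bsub>D\<^esub> (\<delta> \<cdot>\<^bsub>D\<^esub> on_arr F (inv_arr B \<beta>)))"
    using D.Comp_assoc[OF FH[OF \<beta>i] \<delta>(1) GH[OF f'(3)]] f'(4) by simp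
  also have "\<dots> = \<delta> \<cdot>\<^bsub>D\<^esub> on_arr F (inv_arr B \<beta>)"
    using D.Comp_assoc[OF D.Comp_Hom[OF FH[OF \<beta>i] \<delta>(1)] GH[OF f'(3)] GH[OF \<gamma>i]] Gi
      D.Comp_Id_left[OF D.Comp_Hom[OF FH[OF \<beta>i] \<delta>(1)]] by simp
  finally have "(y, (inv_arr B \<beta>, inv_arr C \<gamma>), x) \<in> Hom ?I y x"
    unfolding x y iso_comma_Hom using xy \<beta>i \<gamma>i by (auto simp: x y)
  then show "\<exists>g \<in> Hom ?I y x. g \<cdot>\<^bsub>?I\<^esub> f = Id ?I x \<and> f \<cdot>\<^bsub>?I\<^esub> g = Id ?I y"
    by (rule rev_bexI)
      (simp add: x y f'(1) iso_comma_Comp iso_comma_Id B.inv_left[OF f'(2)] B.inv_right[OF f'(2)]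
        C.inv_left[OF f'(3)] C.inv_right[OF f'(3)])
qed

text \<open>The comparison functor is an equivalence iff it is fully faithful and essentially surjective.\<close>

lemma is_hpullback_iff:
  assumes A: "groupoid A" and P: "is_functor A B P" and Q: "is_functor A C Q"
    and \<alpha>: "nat_iso A D (comp_funct A F P) (comp_funct A G Q) \<alpha>"
  shows "is_hpullback A B C D P Q F G \<alpha> \<longleftrightarrow>
    (\<forall>x \<in> Obj A. \<forall>y \<in> Obj A. \<forall>\<beta> \<in> Hom B (on_obj P x) (on_obj P y). \<forall>\<gamma> \<in> Hom C (on_obj Q x) (on_obj Q y).
       on_arr G \<gamma> \<cdot>\<^bsub>D\<^esub> \<alpha> x = \<alpha> y \<cdot>\<^bsub>D\<^esub> on_arr F \<beta> \<longrightarrow>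
       (\<exists>!f. f \<in> Hom A x y \<and> on_arr P f = \<beta> \<and> on_arr Q f = \<gamma>)) \<and>
    (\<forall>b \<in> Obj B. \<forall>c \<in> Obj C. \<forall>\<delta> \<in> Hom D (on_obj F b) (on_obj G c).
       \<exists>x \<in> Obj A. \<exists>\<beta> \<in> Hom B (on_obj P x) b. \<exists>\<gamma> \<in> Hom C (on_obj Q x) c.
         on_arr G \<gamma> \<cdot>\<^bsub>D\<^esub> \<alpha> x = \<delta> \<cdot>\<^bsub>D\<^esub> on_arr F \<beta>)" (is "_ \<longleftrightarrow> ?ff \<and> ?es")
proof -
  interpret A: groupoid A by fact
  let ?I = "iso_comma B C D F G" and ?K = "comparison A P Q \<alpha>"
  have K_obj: "on_obj ?K x = (on_obj P x, \<alpha> x, on_obj Q x)" if "x \<in> Obj A" for x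
    using that by (simp add: comparison_def)
  have K_arr: "on_arr ?K f = (on_obj ?K x, (on_arr P f, on_arr Q f), on_obj ?K y)"
    if "f \<in> Hom A x y" for f x y
    using HomD[OF that] A.Hom_Obj[OF that] by (simp add: comparison_def)
  have \<alpha>H: "\<alpha> x \<in> Hom D (on_obj F (on_obj P x)) (on_obj G (on_obj Q x))" if "x \<in> Obj A" for x
    using nat_iso_Hom[OF \<alpha> that] that by simp
  have KO: "on_obj ?K x \<in> Obj ?I" if "x \<in> Obj A" for x
    using that \<alpha>H functor_Obj[OF P] functor_Obj[OF Q] by (simp add: K_obj iso_comma_Obj)
  have K: "is_functor A ?I ?K"
  proof (rule is_functorI)
    fix f x y assume f: "f \<in> Hom A x y"
    then have xy: "x \<in> Obj A" "y \<in> Obj A" using A.Hom_Obj by auto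
    show "on_arr ?K f \<in> Hom ?I (on_obj ?K x) (on_obj ?K y)"
      using KO[OF xy(1)] KO[OF xy(2)] functor_Hom[OF P f] functor_Hom[OF Q f] nat_iso_natural[OF \<alpha> f] f
      by (simp add: K_arr[OF f] K_obj xy iso_comma_Hom)
  next
    fix f g x y z assume f: "f \<in> Hom A x y" and g: "g \<in> Hom A y z"
    show "on_arr ?K (g \<cdot>\<^bsub>A\<^esub> f) = on_arr ?K g \<cdot>\<^bsub>?I\<^esub> on_arr ?K f"
      by (simp add: K_arr[OF f] K_arr[OF g] K_arr[OF A.Comp_Hom[OF f g]] iso_comma_Comp
          functor_Comp[OF P f g] functor_Comp[OF Q f g])
  next
    fix x assume x: "x \<in> Obj A"
    show "on_arr ?K (Id A x) = Id ?I (on_obj ?K x)"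
      by (simp add: K_arr[OF A.Id_Hom[OF x]] K_obj[OF x] iso_comma_Id functor_Id[OF P x] functor_Id[OF Q x])
  qed (use KO A.category_axioms iso_comma_category in \<open>auto simp: comparison_def\<close>)
  have K_Hom: "h \<in> Hom ?I (on_obj ?K x) (on_obj ?K y) \<longleftrightarrow>
      (\<exists>\<beta> \<gamma>. h = (on_obj ?K x, (\<beta>, \<gamma>), on_obj ?K y) \<and> \<beta> \<in> Hom B (on_obj P x) (on_obj P y) \<and>
        \<gamma> \<in> Hom C (on_obj Q x) (on_obj Q y) \<and> on_arr G \<gamma> \<cdot>\<^bsub>D\<^esub> \<alpha> x = \<alpha> y \<cdot>\<^bsub>D\<^esub> on_arr F \<beta>)"
    if "x \<in> Obj A" "y \<in> Obj A" for h x y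
    using KO[OF that(1)] KO[OF that(2)] by (simp add: K_obj that iso_comma_Hom)
  \<comment> \<open>Stated as an equality of predicates, so that it can be rewritten underneath the
    unique existence quantifier.\<close>
  have ff_eq: "(\<lambda>f. f \<in> Hom A x y \<and> on_arr ?K f = (on_obj ?K x, (\<beta>, \<gamma>), on_obj ?K y)) =
      (\<lambda>f. f \<in> Hom A x y \<and> on_arr P f = \<beta> \<and> on_arr Q f = \<gamma>)" for x y \<beta> \<gamma>
    by (intro ext conj_cong refl) (simp add: K_arr)
  have "is_hpullback A B C D P Q F G \<alpha> \<longleftrightarrow> is_equivalence A ?I ?K"
    using P Q F G \<alpha> by (simp add: is_hpullback_def)
  also have "\<dots> \<longleftrightarrow> ?ff \<and> ?es"
  proof
    assume eq: "is_equivalence A ?I ?K"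
    have ?ff
    proof (intro ballI impI)
      fix x y \<beta> \<gamma>
      assume *: "x \<in> Obj A" "y \<in> Obj A" "\<beta> \<in> Hom B (on_obj P x) (on_obj P y)"
        "\<gamma> \<in> Hom C (on_obj Q x) (on_obj Q y)" "on_arr G \<gamma> \<cdot>\<^bsub>D\<^esub> \<alpha> x = \<alpha> y \<cdot>\<^bsub>D\<^esub> on_arr F \<beta>"
      then have "(on_obj ?K x, (\<beta>, \<gamma>), on_obj ?K y) \<in> Hom ?I (on_obj ?K x) (on_obj ?K y)"
        by (simp add: K_Hom)
      from equivalence_fully_faithful[OF A iso_comma_groupoid eq *(1,2) this]
      show "\<exists>!f. f \<in> Hom A x y \<and> on_arr P f = \<beta> \<and> on_arr Q f = \<gamma>"
        unfolding ff_eq .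
    qed
    moreover have ?es
    proof (intro ballI)
      fix b c \<delta> assume *: "b \<in> Obj B" "c \<in> Obj C" "\<delta> \<in> Hom D (on_obj F b) (on_obj G c)"
      then have "(b, \<delta>, c) \<in> Obj ?I" by (simp add: iso_comma_Obj)
      from equivalence_ess_surj[OF eq this] obtain x h
        where x: "x \<in> Obj A" and "h \<in> Hom ?I (on_obj ?K x) (b, \<delta>, c)" .
      then have "\<exists>\<beta> \<gamma>. \<beta> \<in> Hom B (on_obj P x) b \<and> \<gamma> \<in> Hom C (on_obj Q x) c \<and>
          on_arr G \<gamma> \<cdot>\<^bsub>D\<^esub> \<alpha> x = \<delta> \<cdot>\<^bsub>D\<^esub> on_arr F \<beta>"
        unfolding K_obj[OF x] iso_comma_Hom by blast
      with x show "\<exists>x \<in> Obj A. \<exists>\<beta> \<in> Hom B (on_obj P x) b. \<exists>\<gamma> \<in> Hom C (on_obj Q x) c.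
          on_arr G \<gamma> \<cdot>\<^bsub>D\<^esub> \<alpha> x = \<delta> \<cdot>\<^bsub>D\<^esub> on_arr F \<beta>"
        by blast
    qed
    ultimately show "?ff \<and> ?es" ..
  next
    assume *: "?ff \<and> ?es"
    show "is_equivalence A ?I ?K"
    proof (rule equivalence_if_fully_faithful_ess_surj[OF A iso_comma_groupoid K])
      fix x y h assume xy: "x \<in> Obj A" "y \<in> Obj A" and "h \<in> Hom ?I (on_obj ?K x) (on_obj ?K y)"
      then obtain \<beta> \<gamma> where h: "h = (on_obj ?K x, (\<beta>, \<gamma>), on_obj ?K y)"
        "\<beta> \<in> Hom B (on_obj P x) (on_obj P y)" "\<gamma> \<in> Hom C (on_obj Q x) (on_obj Q y)"
        "on_arr G \<gamma> \<cdot>\<^bsub>D\<^esub> \<alpha> x = \<alpha> y \<cdot>\<^bsub>D\<^esub> on_arr F \<beta>"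
        using K_Hom by blast
      with * xy have "\<exists>!f. f \<in> Hom A x y \<and> on_arr P f = \<beta> \<and> on_arr Q f = \<gamma>" by blast
      then show "\<exists>!f. f \<in> Hom A x y \<and> on_arr ?K f = h"
        unfolding h(1) ff_eq .
    next
      fix d assume d: "d \<in> Obj ?I"
      obtain b \<delta> c where d': "d = (b, \<delta>, c)" by (cases d)
      with d * obtain x \<beta> \<gamma> where "x \<in> Obj A" "\<beta> \<in> Hom B (on_obj P x) b" "\<gamma> \<in> Hom C (on_obj Q x) c"
        "on_arr G \<gamma> \<cdot>\<^bsub>D\<^esub> \<alpha> x = \<delta> \<cdot>\<^bsub>D\<^esub> on_arr F \<beta>"
        unfolding d' iso_comma_Obj by blast
      then have "(on_obj ?K x, (\<beta>, \<gamma>), d) \<in> Hom ?I (on_obj ?K x) d"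
        using KO d by (simp add: d' K_obj iso_comma_Hom)
      with \<open>x \<in> Obj A\<close> show "\<exists>x \<in> Obj A. \<exists>h. h \<in> Hom ?I (on_obj ?K x) d" by blast
    qed
  qed
  finally show ?thesis .
qed

end

section \<open>Categories of pseudo-functors\<close>

context category
begin

text \<open>Together with \<open>comp_assoc\<close> below, a form fit for the simplifier: side
  conditions speak of \<open>Dom\<close> and \<open>Cod\<close> of the factors, so long composites
  can be rebracketed once the sources and targets of their factors are supplied as rewrite
  rules.\<close>

lemma comp_simps:
  assumes "f \<in> Arr C" "g \<in> Arr C" "Dom C g = Cod C f"
  shows comp_Arr: "g \<cdot> f \<in> Arr C" and Dom_comp: "Dom C (g \<cdot> f) = Dom C f"
    and Cod_comp: "Cod C (g \<cdot> f) = Cod C g"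
  using Comp_Hom[OF HomI[OF assms(1) refl refl] HomI[OF assms(2,3) refl]] by (auto simp: Hom_def)

lemma comp_assoc:
  assumes "f \<in> Arr C" "g \<in> Arr C" "h \<in> Arr C" "Dom C g = Cod C f" "Dom C h = Cod C g"
  shows "(h \<cdot> g) \<cdot> f = h \<cdot> (g \<cdot> f)"
  using Comp_assoc[OF HomI[OF assms(1) refl refl] HomI[OF assms(2,4) refl] HomI[OF assms(3,5) refl]] .

end

context pseudofunctor
begin

lemma unitor_Hom: "c \<in> Obj C \<Longrightarrow> x \<in> Obj (grpd F c) \<Longrightarrow>
    unitor F c x \<in> Hom (grpd F c) x (on_obj (pull F (Id C c)) x)"
  using nat_iso_Hom[OF unitor_iso] by fastforce

lemma unitor_natural: "c \<in> Obj C \<Longrightarrow> h \<in> Hom (grpd F c) x y \<Longrightarrow>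
    unitor F c y \<cdot>\<^bsub>grpd F c\<^esub> h = on_arr (pull F (Id C c)) h \<cdot>\<^bsub>grpd F c\<^esub> unitor F c x"
  using nat_iso_natural[OF unitor_iso] by fastforce

lemma compositor_Hom: "f \<in> Hom C b c \<Longrightarrow> g \<in> Hom C c d \<Longrightarrow> x \<in> Obj (grpd F d) \<Longrightarrow>
    compositor F f g x \<in> Hom (grpd F b) (on_obj (pull F f) (on_obj (pull F g) x)) (on_obj (pull F (g \<cdot>\<^bsub>C\<^esub> f)) x)"
  using nat_iso_Hom[OF compositor_iso] by fastforce

lemma compositor_natural:
  assumes "f \<in> Hom C b c" "g \<in> Hom C c d" "h \<in> Hom (grpd F d) x y"
  shows "compositor F f g y \<cdot>\<^bsub>grpd F b\<^esub> on_arr (pull F f) (on_arr (pull F g) h)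
    = on_arr (pull F (g \<cdot>\<^bsub>C\<^esub> f)) h \<cdot>\<^bsub>grpd F b\<^esub> compositor F f g x"
  using nat_iso_natural[OF compositor_iso[OF assms(1,2)] assms(3)] assms(3) by simp

end

context pseudonat
begin

lemma nati_Hom: "f \<in> Hom C c d \<Longrightarrow> y \<in> Obj (grpd F d) \<Longrightarrow>
    nati t f y \<in> Hom (grpd G c) (on_obj (cmpt t c) (on_obj (pull F f) y)) (on_obj (pull G f) (on_obj (cmpt t d) y))"
  using nat_iso_Hom[OF nati_iso] by fastforce

lemma nati_natural:
  assumes "f \<in> Hom C c d" "h \<in> Hom (grpd F d) x y"
  shows "nati t f y \<cdot>\<^bsub>grpd G c\<^esub> on_arr (cmpt t c) (on_arr (pull F f) h)
    = on_arr (pull G f) (on_arr (cmpt t d) h) \<cdot>\<^bsub>grpd G c\<^esub> nati t f x"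
  using nat_iso_natural[OF nati_iso[OF assms(1)] assms(2)] assms(2) by simp

end

text \<open>The values are groupoids, so \<open>nati\<close> needs only typing and naturality;
  invertibility of its components is automatic.\<close>

lemma pseudonatI:
  assumes F: "pseudofunctor C F" and G: "pseudofunctor C G"
    and "cmpt t \<in> extensional (Obj C)" "nati t \<in> extensional (Arr C)"
    and "\<And>f. f \<in> Arr C \<Longrightarrow> nati t f \<in> extensional (Obj (grpd F (Cod C f)))"
    and cmpt: "\<And>c. c \<in> Obj C \<Longrightarrow> is_functor (grpd F c) (grpd G c) (cmpt t c)"
    and nati: "\<And>f c d y. f \<in> Hom C c d \<Longrightarrow> y \<in> Obj (grpd F d) \<Longrightarrow>
      nati t f y \<in> Hom (grpd G c) (on_obj (cmpt t c) (on_obj (pull F f) y))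
        (on_obj (pull G f) (on_obj (cmpt t d) y))"
    and natural: "\<And>f c d h x y. f \<in> Hom C c d \<Longrightarrow> h \<in> Hom (grpd F d) x y \<Longrightarrow>
      nati t f y \<cdot>\<^bsub>grpd G c\<^esub> on_arr (cmpt t c) (on_arr (pull F f) h)
        = on_arr (pull G f) (on_arr (cmpt t d) h) \<cdot>\<^bsub>grpd G c\<^esub> nati t f x"
    and "\<And>c y. c \<in> Obj C \<Longrightarrow> y \<in> Obj (grpd F c) \<Longrightarrow>
      nati t (Id C c) y \<cdot>\<^bsub>grpd G c\<^esub> on_arr (cmpt t c) (unitor F c y)
        = unitor G c (on_obj (cmpt t c) y)"
    and "\<And>f g b c d y. f \<in> Hom C b c \<Longrightarrow> g \<in> Hom C c d \<Longrightarrow> y \<in> Obj (grpd F d) \<Longrightarrow>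
      nati t (g \<cdot>\<^bsub>C\<^esub> f) y \<cdot>\<^bsub>grpd G b\<^esub> on_arr (cmpt t b) (compositor F f g y)
        = (compositor G f g (on_obj (cmpt t d) y) \<cdot>\<^bsub>grpd G b\<^esub> on_arr (pull G f) (nati t g y))
            \<cdot>\<^bsub>grpd G b\<^esub> nati t f (on_obj (pull F g) y)"
  shows "pseudonat C F G t"
proof -
  interpret F: pseudofunctor C F by (rule F)
  interpret G: pseudofunctor C G by (rule G)
  show ?thesis
  proof (intro pseudonat.intro pseudonat_axioms.intro F G)
    fix f c d assume f: "f \<in> Hom C c d"
    then have c: "c \<in> Obj C" "d \<in> Obj C" using F.Hom_Obj by auto
    show "nat_iso (grpd F d) (grpd G c) (comp_funct (grpd F d) (cmpt t c) (pull F f))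
        (comp_funct (grpd F d) (pull G f) (cmpt t d)) (nati t f)"
    proof (rule nat_isoI)
      show "is_functor (grpd F d) (grpd G c) (comp_funct (grpd F d) (cmpt t c) (pull F f))"
        using comp_functor[OF F.pull_functor[OF f] cmpt] c by auto
      show "is_functor (grpd F d) (grpd G c) (comp_funct (grpd F d) (pull G f) (cmpt t d))"
        using comp_functor[OF cmpt G.pull_functor[OF f]] c by auto
    qed (use G.grpd_groupoid c f nati natural in auto)
  qed (use assms in auto)
qed

section \<open>Identities and composites of pseudo-natural transformations\<close>

lemma id_pseudonat:
  assumes "pseudofunctor C F"
  shows "pseudonat C F F (id_pnt C F)"
proof -
  interpret F: pseudofunctor C F by fact
  have gr: "category (grpd F c)" if "c \<in> Obj C" for c
    using F.grpd_groupoid[OF that] by (simp add: groupoid_def)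
  have cm: "cmpt (id_pnt C F) c = id_funct (grpd F c)" if "c \<in> Obj C" for c
    using that by (simp add: id_pnt_def)
  have na: "nati (id_pnt C F) f y = Id (grpd F c) (on_obj (pull F f) y)"
    if "f \<in> Hom C c d" "y \<in> Obj (grpd F d)" for f c d y
    using that HomD[OF that(1)] by (simp add: id_pnt_def)
  show ?thesis
  proof (rule pseudonatI[OF assms assms])
    fix f c d y assume f: "f \<in> Hom C c d" and y: "y \<in> Obj (grpd F d)"
    note cd = F.Hom_Obj[OF f] and fy = functor_Obj[OF F.pull_functor[OF f] y]
    show "nati (id_pnt C F) f y \<in> Hom (grpd F c) (on_obj (cmpt (id_pnt C F) c) (on_obj (pull F f) y))
        (on_obj (pull F f) (on_obj (cmpt (id_pnt C F) d) y))"
      using category.Id_Hom[OF gr[OF cd(1)] fy] y fy by (simp add: na[OF f y] cm cd)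
  next
    fix f c d h x y assume f: "f \<in> Hom C c d" and h: "h \<in> Hom (grpd F d) x y"
    note cd = F.Hom_Obj[OF f] and fh = functor_Hom[OF F.pull_functor[OF f] h]
    have xy: "x \<in> Obj (grpd F d)" "y \<in> Obj (grpd F d)"
      using category.Hom_Obj[OF gr[OF cd(2)] h] by auto
    show "nati (id_pnt C F) f y \<cdot>\<^bsub>grpd F c\<^esub> on_arr (cmpt (id_pnt C F) c) (on_arr (pull F f) h)
        = on_arr (pull F f) (on_arr (cmpt (id_pnt C F) d) h) \<cdot>\<^bsub>grpd F c\<^esub> nati (id_pnt C F) f x"
      using category.Comp_Id_left[OF gr[OF cd(1)] fh] category.Comp_Id_right[OF gr[OF cd(1)] fh]
        HomD(1)[OF h] HomD(1)[OF fh] by (simp add: na[OF f] cm cd xy)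
  next
    fix c y assume c: "c \<in> Obj C" and y: "y \<in> Obj (grpd F c)"
    note u = F.unitor_Hom[OF c y]
    show "nati (id_pnt C F) (Id C c) y \<cdot>\<^bsub>grpd F c\<^esub> on_arr (cmpt (id_pnt C F) c) (unitor F c y)
        = unitor F c (on_obj (cmpt (id_pnt C F) c) y)"
      using category.Comp_Id_left[OF gr[OF c] u] HomD(1)[OF u] c y
      by (simp add: na[OF F.Id_Hom[OF c]] cm)
  next
    fix f g b c d y assume f: "f \<in> Hom C b c" and g: "g \<in> Hom C c d" and y: "y \<in> Obj (grpd F d)"
    note bcd = F.Hom_Obj[OF f] F.Hom_Obj[OF g] and gf = F.Comp_Hom[OF f g]
    note k = F.compositor_Hom[OF f g y] and gy = functor_Obj[OF F.pull_functor[OF g] y]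
    interpret B: category "grpd F b" by (rule gr[OF bcd(1)])
    show "nati (id_pnt C F) (g \<cdot>\<^bsub>C\<^esub> f) y \<cdot>\<^bsub>grpd F b\<^esub> on_arr (cmpt (id_pnt C F) b) (compositor F f g y)
        = (compositor F f g (on_obj (cmpt (id_pnt C F) d) y) \<cdot>\<^bsub>grpd F b\<^esub>
            on_arr (pull F f) (nati (id_pnt C F) g y)) \<cdot>\<^bsub>grpd F b\<^esub>
            nati (id_pnt C F) f (on_obj (pull F g) y)"
      using B.Comp_Id_left[OF k] B.Comp_Id_right[OF k] HomD(1)[OF k]
      by (simp add: na[OF f gy] na[OF g y] na[OF gf y] cm bcd y functor_Id[OF F.pull_functor[OF f] gy])
  qed (use gr in \<open>auto simp: id_pnt_def intro: id_functor\<close>)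
qed

lemma comp_pnt_cmpt:
  "c \<in> Obj C \<Longrightarrow> cmpt (comp_pnt C F H u t) c = comp_funct (grpd F c) (cmpt u c) (cmpt t c)"
  by (simp add: comp_pnt_def)

lemma comp_pnt_nati:
  "f \<in> Hom C c d \<Longrightarrow> y \<in> Obj (grpd F d) \<Longrightarrow>
    nati (comp_pnt C F H u t) f y =
      nati u f (on_obj (cmpt t d) y) \<cdot>\<^bsub>grpd H c\<^esub> on_arr (cmpt u c) (nati t f y)"
  by (auto simp: comp_pnt_def Hom_def)

text \<open>Pasting of squares: each law for the composite is the law for \<open>t\<close>, carried
  along by the functor \<open>cmpt u\<close>, followed by the law for \<open>u\<close> at the image
  under \<open>t\<close>. Compatibility with composition needs in addition naturality of
  \<open>u\<close> at \<open>nati t g y\<close>, to move this component past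
  \<open>nati u f\<close>.\<close>

lemma comp_pseudonat:
  assumes t: "pseudonat C F G t" and u: "pseudonat C G H u"
  shows "pseudonat C F H (comp_pnt C F H u t)"
proof -
  interpret t: pseudonat C F G t by (rule t)
  interpret u: pseudonat C G H u by (rule u)
  note cm = comp_pnt_cmpt[of _ C F H u t] and na = comp_pnt_nati[of _ C _ _ _ F H u t]
  have catF: "category (grpd F c)" and catG: "category (grpd G c)" and catH: "category (grpd H c)"
    if "c \<in> Obj C" for c
    using t.F.grpd_groupoid t.G.grpd_groupoid u.G.grpd_groupoid that by (auto simp: groupoid_def)
  show ?thesis
  proof (rule pseudonatI)
    fix f c d y assume f: "f \<in> Hom C c d" and y: "y \<in> Obj (grpd F d)"
    note cd = t.F.Hom_Obj[OF f]
    note ty = functor_Obj[OF t.cmpt_functor[OF cd(2)] y] and fy = functor_Obj[OF t.F.pull_functor[OF f] y]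
    show "nati (comp_pnt C F H u t) f y \<in> Hom (grpd H c)
        (on_obj (cmpt (comp_pnt C F H u t) c) (on_obj (pull F f) y))
        (on_obj (pull H f) (on_obj (cmpt (comp_pnt C F H u t) d) y))"
      using category.Comp_Hom[OF catH[OF cd(1)]
          functor_Hom[OF u.cmpt_functor[OF cd(1)] t.nati_Hom[OF f y]] u.nati_Hom[OF f ty]]
      by (simp add: na[OF f y] cm cd y fy)
  next
    fix f c d h x y assume f: "f \<in> Hom C c d" and h: "h \<in> Hom (grpd F d) x y"
    note cd = t.F.Hom_Obj[OF f]
    interpret H: category "grpd H c" by (rule catH[OF cd(1)])
    have xy: "x \<in> Obj (grpd F d)" "y \<in> Obj (grpd F d)"
      using category.Hom_Obj[OF catF[OF cd(2)] h] by auto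
    note tx = functor_Obj[OF t.cmpt_functor[OF cd(2)] xy(1)]
      and ty = functor_Obj[OF t.cmpt_functor[OF cd(2)] xy(2)]
    note th = functor_Hom[OF t.cmpt_functor[OF cd(2)] h]
    note fh = functor_Hom[OF t.F.pull_functor[OF f] h]
    note tfh = functor_Hom[OF t.cmpt_functor[OF cd(1)] fh]
    note fth = functor_Hom[OF t.G.pull_functor[OF f] th]
    note U = u.cmpt_functor[OF cd(1)]
    note nx = t.nati_Hom[OF f xy(1)] and ny = t.nati_Hom[OF f xy(2)]
      and ntx = u.nati_Hom[OF f tx] and nty = u.nati_Hom[OF f ty]
    have "(nati u f (on_obj (cmpt t d) y) \<cdot>\<^bsub>grpd H c\<^esub> on_arr (cmpt u c) (nati t f y))
          \<cdot>\<^bsub>grpd H c\<^esub> on_arr (cmpt u c) (on_arr (cmpt t c) (on_arr (pull F f) h))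
        = nati u f (on_obj (cmpt t d) y) \<cdot>\<^bsub>grpd H c\<^esub> on_arr (cmpt u c)
            (nati t f y \<cdot>\<^bsub>grpd G c\<^esub> on_arr (cmpt t c) (on_arr (pull F f) h))"
      using H.Comp_assoc[OF functor_Hom[OF U tfh] functor_Hom[OF U ny] nty] functor_Comp[OF U tfh ny] by simp
    also have "\<dots> = nati u f (on_obj (cmpt t d) y) \<cdot>\<^bsub>grpd H c\<^esub>
        (on_arr (cmpt u c) (on_arr (pull G f) (on_arr (cmpt t d) h)) \<cdot>\<^bsub>grpd H c\<^esub> on_arr (cmpt u c) (nati t f x))"
      using t.nati_natural[OF f h] functor_Comp[OF U nx fth] by simp
    also have "\<dots> = (on_arr (pull H f) (on_arr (cmpt u d) (on_arr (cmpt t d) h)) \<cdot>\<^bsub>grpd H c\<^esub>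
        nati u f (on_obj (cmpt t d) x)) \<cdot>\<^bsub>grpd H c\<^esub> on_arr (cmpt u c) (nati t f x)"
      using H.Comp_assoc[OF functor_Hom[OF U nx] functor_Hom[OF U fth] nty] u.nati_natural[OF f th] by simp
    also have "\<dots> = on_arr (pull H f) (on_arr (cmpt u d) (on_arr (cmpt t d) h)) \<cdot>\<^bsub>grpd H c\<^esub>
        (nati u f (on_obj (cmpt t d) x) \<cdot>\<^bsub>grpd H c\<^esub> on_arr (cmpt u c) (nati t f x))"
      using H.Comp_assoc[OF functor_Hom[OF U nx] ntx
          functor_Hom[OF u.G.pull_functor[OF f] functor_Hom[OF u.cmpt_functor[OF cd(2)] th]]] by simp
    finally show "nati (comp_pnt C F H u t) f y \<cdot>\<^bsub>grpd H c\<^esub>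
          on_arr (cmpt (comp_pnt C F H u t) c) (on_arr (pull F f) h)
        = on_arr (pull H f) (on_arr (cmpt (comp_pnt C F H u t) d) h) \<cdot>\<^bsub>grpd H c\<^esub>
          nati (comp_pnt C F H u t) f x"
      using HomD(1)[OF fh] HomD(1)[OF h] by (simp add: na[OF f] cm cd xy)
  next
    fix c y assume c: "c \<in> Obj C" and y: "y \<in> Obj (grpd F c)"
    interpret H: category "grpd H c" by (rule catH[OF c])
    note i = t.F.Id_Hom[OF c] and ty = functor_Obj[OF t.cmpt_functor[OF c] y]
    note v = t.F.unitor_Hom[OF c y]
    note tv = functor_Hom[OF t.cmpt_functor[OF c] v] and n = t.nati_Hom[OF i y]
      and U = u.cmpt_functor[OF c]
    have "(nati u (Id C c) (on_obj (cmpt t c) y) \<cdot>\<^bsub>grpd H c\<^esub> on_arr (cmpt u c) (nati t (Id C c) y))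
          \<cdot>\<^bsub>grpd H c\<^esub> on_arr (cmpt u c) (on_arr (cmpt t c) (unitor F c y))
        = nati u (Id C c) (on_obj (cmpt t c) y) \<cdot>\<^bsub>grpd H c\<^esub> on_arr (cmpt u c)
            (nati t (Id C c) y \<cdot>\<^bsub>grpd G c\<^esub> on_arr (cmpt t c) (unitor F c y))"
      using H.Comp_assoc[OF functor_Hom[OF U tv] functor_Hom[OF U n] u.nati_Hom[OF i ty]]
        functor_Comp[OF U tv n] by simp
    also have "\<dots> = unitor H c (on_obj (cmpt u c) (on_obj (cmpt t c) y))"
      using t.nati_Id[OF c y] u.nati_Id[OF c ty] by simp
    finally show "nati (comp_pnt C F H u t) (Id C c) y \<cdot>\<^bsub>grpd H c\<^esub>
          on_arr (cmpt (comp_pnt C F H u t) c) (unitor F c y)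
        = unitor H c (on_obj (cmpt (comp_pnt C F H u t) c) y)"
      using HomD(1)[OF v] by (simp add: na[OF i y] cm c y)
  next
    fix f g b c d y assume f: "f \<in> Hom C b c" and g: "g \<in> Hom C c d" and y: "y \<in> Obj (grpd F d)"
    note bcd = t.F.Hom_Obj[OF f] t.F.Hom_Obj[OF g] and gf = t.F.Comp_Hom[OF f g]
    interpret H: category "grpd H b" by (rule catH[OF bcd(1)])
    interpret G: category "grpd G b" by (rule catG[OF bcd(1)])
    interpret Hc: category "grpd H c" by (rule catH[OF bcd(3)])
    note ty = functor_Obj[OF t.cmpt_functor[OF bcd(4)] y] and gy = functor_Obj[OF t.F.pull_functor[OF g] y]
    note tgy = functor_Obj[OF t.cmpt_functor[OF bcd(3)] gy]
      and gty = functor_Obj[OF t.G.pull_functor[OF g] ty]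
    note U = u.cmpt_functor[OF bcd(1)] and Hf = u.G.pull_functor[OF f]
    let ?ty = "on_obj (cmpt t d) y" and ?gy = "on_obj (pull F g) y"
    note k = t.F.compositor_Hom[OF f g y] note tk = functor_Hom[OF t.cmpt_functor[OF bcd(1)] k]
    note kG = t.G.compositor_Hom[OF f g ty] and kH = u.G.compositor_Hom[OF f g
        functor_Obj[OF u.cmpt_functor[OF bcd(4)] ty]]
    note n1 = t.nati_Hom[OF gf y] and n2 = t.nati_Hom[OF g y] and n3 = t.nati_Hom[OF f gy]
    note n4 = u.nati_Hom[OF gf ty] and n5 = u.nati_Hom[OF f gty] and n6 = u.nati_Hom[OF f tgy]
      and n7 = u.nati_Hom[OF g ty]
    note Gn2 = functor_Hom[OF t.G.pull_functor[OF f] n2]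
    note Un2 = functor_Hom[OF u.cmpt_functor[OF bcd(3)] n2]
    \<comment> \<open>The indecomposable factors of the composites below. With their sources and
      targets in \<open>simps\<close> all bracketings are normalised, so that every link of the
      chain shows only the law it uses.\<close>
    note atoms = functor_Hom[OF U tk] functor_Hom[OF U n1] functor_Hom[OF U n3] functor_Hom[OF U kG]
      functor_Hom[OF U Gn2] n4 n5 n6 functor_Hom[OF Hf n7] functor_Hom[OF Hf Un2] kH
    note simps = H.comp_simps H.comp_assoc atoms[THEN HomD(1)] atoms[THEN HomD(2)] atoms[THEN HomD(3)]
    have "(nati u (g \<cdot>\<^bsub>C\<^esub> f) ?ty \<cdot>\<^bsub>grpd H b\<^esub> on_arr (cmpt u b) (nati t (g \<cdot>\<^bsub>C\<^esub> f) y))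
          \<cdot>\<^bsub>grpd H b\<^esub> on_arr (cmpt u b) (on_arr (cmpt t b) (compositor F f g y))
        = nati u (g \<cdot>\<^bsub>C\<^esub> f) ?ty \<cdot>\<^bsub>grpd H b\<^esub> on_arr (cmpt u b)
            ((compositor G f g ?ty \<cdot>\<^bsub>grpd G b\<^esub> on_arr (pull G f) (nati t g y)) \<cdot>\<^bsub>grpd G b\<^esub> nati t f ?gy)"
      using functor_Comp[OF U tk n1] t.nati_Comp[OF f g y] by (simp add: simps)
    also have "\<dots> = (nati u (g \<cdot>\<^bsub>C\<^esub> f) ?ty \<cdot>\<^bsub>grpd H b\<^esub> on_arr (cmpt u b) (compositor G f g ?ty))
        \<cdot>\<^bsub>grpd H b\<^esub> (on_arr (cmpt u b) (on_arr (pull G f) (nati t g y)) \<cdot>\<^bsub>grpd H b\<^esub> on_arr (cmpt u b) (nati t f ?gy))"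
      using functor_Comp[OF U n3 G.Comp_Hom[OF Gn2 kG]] functor_Comp[OF U Gn2 kG] by (simp add: simps)
    also have "\<dots> = (compositor H f g (on_obj (cmpt u d) ?ty) \<cdot>\<^bsub>grpd H b\<^esub> on_arr (pull H f) (nati u g ?ty))
        \<cdot>\<^bsub>grpd H b\<^esub> ((nati u f (on_obj (pull G g) ?ty) \<cdot>\<^bsub>grpd H b\<^esub>
          on_arr (cmpt u b) (on_arr (pull G f) (nati t g y))) \<cdot>\<^bsub>grpd H b\<^esub> on_arr (cmpt u b) (nati t f ?gy))"
      unfolding u.nati_Comp[OF f g ty] by (simp add: simps)
    also have "\<dots> = (compositor H f g (on_obj (cmpt u d) ?ty) \<cdot>\<^bsub>grpd H b\<^esub>
        on_arr (pull H f) (nati u g ?ty \<cdot>\<^bsub>grpd H c\<^esub> on_arr (cmpt u c) (nati t g y)))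
        \<cdot>\<^bsub>grpd H b\<^esub> (nati u f (on_obj (cmpt t c) ?gy) \<cdot>\<^bsub>grpd H b\<^esub> on_arr (cmpt u b) (nati t f ?gy))"
      unfolding u.nati_natural[OF f n2] functor_Comp[OF Hf Un2 n7] by (simp add: simps)
    finally show "nati (comp_pnt C F H u t) (g \<cdot>\<^bsub>C\<^esub> f) y \<cdot>\<^bsub>grpd H b\<^esub>
          on_arr (cmpt (comp_pnt C F H u t) b) (compositor F f g y)
        = (compositor H f g (on_obj (cmpt (comp_pnt C F H u t) d) y) \<cdot>\<^bsub>grpd H b\<^esub>
            on_arr (pull H f) (nati (comp_pnt C F H u t) g y)) \<cdot>\<^bsub>grpd H b\<^esub>
            nati (comp_pnt C F H u t) f (on_obj (pull F g) y)"
      using HomD(1)[OF k] by (simp add: na[OF gf y] na[OF g y] na[OF f gy] cm bcd y)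
  qed (use t.F.pseudofunctor_axioms u.G.pseudofunctor_axioms t.cmpt_functor u.cmpt_functor in
      \<open>auto simp: comp_pnt_def intro: comp_functor\<close>)
qed

lemma pseudonat_eqI:
  assumes t: "pseudonat C F G t" and u: "pseudonat C F G u"
    and cmpt: "\<And>c. c \<in> Obj C \<Longrightarrow> cmpt t c = cmpt u c"
    and nati: "\<And>f c d y. f \<in> Hom C c d \<Longrightarrow> y \<in> Obj (grpd F d) \<Longrightarrow> nati t f y = nati u f y"
  shows "t = u"
proof -
  interpret t: pseudonat C F G t by (rule t)
  interpret u: pseudonat C F G u by (rule u)
  have "cmpt t = cmpt u"
    by (rule extensionalityI[OF t.cmpt_ext u.cmpt_ext cmpt])
  moreover have "nati t f = nati u f" if "f \<in> Arr C" for f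
    by (rule extensionalityI[OF t.nati_ext2[OF that] u.nati_ext2[OF that] nati[OF HomI[OF that refl refl]]])
  then have "nati t = nati u"
    by (rule extensionalityI[OF t.nati_ext u.nati_ext])
  ultimately show ?thesis by simp
qed

text \<open>Functors compose strictly, hence so do pseudo-natural transformations. This is why
  pseudo-functors can be organised in an ordinary category, with no higher cells.\<close>

lemma comp_pnt_assoc:
  assumes t: "pseudonat C F G t" and u: "pseudonat C G H u" and v: "pseudonat C H K v"
  shows "comp_pnt C F K (comp_pnt C G K v u) t = comp_pnt C F K v (comp_pnt C F H u t)"
proof (rule pseudonat_eqI)
  interpret t: pseudonat C F G t by (rule t)
  interpret u: pseudonat C G H u by (rule u)
  interpret v: pseudonat C H K v by (rule v)
  show "pseudonat C F K (comp_pnt C F K (comp_pnt C G K v u) t)"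
    "pseudonat C F K (comp_pnt C F K v (comp_pnt C F H u t))"
    by (intro comp_pseudonat[OF t] comp_pseudonat[OF u] comp_pseudonat[OF _ v] u v)+
  show "cmpt (comp_pnt C F K (comp_pnt C G K v u) t) c = cmpt (comp_pnt C F K v (comp_pnt C F H u t)) c"
    if c: "c \<in> Obj C" for c
    using comp_funct_assoc[OF t.cmpt_functor[OF c] u.cmpt_functor[OF c] v.cmpt_functor[OF c]] c
    by (simp add: comp_pnt_cmpt)
  fix f c d y assume f: "f \<in> Hom C c d" and y: "y \<in> Obj (grpd F d)"
  note cd = t.F.Hom_Obj[OF f]
  interpret K: groupoid "grpd K c" by (rule v.G.grpd_groupoid[OF cd(1)])
  note ty = functor_Obj[OF t.cmpt_functor[OF cd(2)] y]
  note uty = functor_Obj[OF u.cmpt_functor[OF cd(2)] ty]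
  note n = t.nati_Hom[OF f y] and V = v.cmpt_functor[OF cd(1)]
  note un = functor_Hom[OF u.cmpt_functor[OF cd(1)] n] and nu = u.nati_Hom[OF f ty]
  show "nati (comp_pnt C F K (comp_pnt C G K v u) t) f y = nati (comp_pnt C F K v (comp_pnt C F H u t)) f y"
    using K.Comp_assoc[OF functor_Hom[OF V un] functor_Hom[OF V nu] v.nati_Hom[OF f uty]]
      functor_Comp[OF V un nu] HomD(1)[OF n]
    by (simp add: comp_pnt_nati[OF f] comp_pnt_cmpt cd y ty)
qed

lemma comp_pnt_id:
  assumes t: "pseudonat C F G t"
  shows "comp_pnt C F G t (id_pnt C F) = t" "comp_pnt C F G (id_pnt C G) t = t"
proof -
  interpret t: pseudonat C F G t by (rule t)
  have p: "pseudonat C F G (comp_pnt C F G t (id_pnt C F))" "pseudonat C F G (comp_pnt C F G (id_pnt C G) t)"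
    using comp_pseudonat[OF id_pseudonat t] comp_pseudonat[OF t id_pseudonat]
      t.F.pseudofunctor_axioms t.G.pseudofunctor_axioms by auto
  show "comp_pnt C F G t (id_pnt C F) = t"
  proof (rule pseudonat_eqI[OF p(1) t])
    show "cmpt (comp_pnt C F G t (id_pnt C F)) c = cmpt t c" if c: "c \<in> Obj C" for c
      using comp_funct_id[OF t.cmpt_functor[OF c]] c by (simp add: comp_pnt_cmpt) (simp add: id_pnt_def)
    fix f c d y assume f: "f \<in> Hom C c d" and y: "y \<in> Obj (grpd F d)"
    note cd = t.F.Hom_Obj[OF f] and fy = functor_Obj[OF t.F.pull_functor[OF f] y]
    interpret G: groupoid "grpd G c" by (rule t.G.grpd_groupoid[OF cd(1)])
    show "nati (comp_pnt C F G t (id_pnt C F)) f y = nati t f y"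
      using G.Comp_Id_right[OF t.nati_Hom[OF f y]] functor_Id[OF t.cmpt_functor[OF cd(1)] fy] y HomD[OF f] cd
      by (simp add: comp_pnt_nati[OF f y]) (simp add: id_pnt_def)
  qed
  show "comp_pnt C F G (id_pnt C G) t = t"
  proof (rule pseudonat_eqI[OF p(2) t])
    show "cmpt (comp_pnt C F G (id_pnt C G) t) c = cmpt t c" if c: "c \<in> Obj C" for c
      using comp_funct_id[OF t.cmpt_functor[OF c]] c by (simp add: comp_pnt_cmpt) (simp add: id_pnt_def)
    fix f c d y assume f: "f \<in> Hom C c d" and y: "y \<in> Obj (grpd F d)"
    note cd = t.F.Hom_Obj[OF f] and ty = functor_Obj[OF t.cmpt_functor[OF t.F.Hom_Obj(2)[OF f]] y]
    interpret G: groupoid "grpd G c" by (rule t.G.grpd_groupoid[OF cd(1)])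
    note n = t.nati_Hom[OF f y]
    show "nati (comp_pnt C F G (id_pnt C G) t) f y = nati t f y"
      using G.Comp_Id_left[OF n] HomD[OF n] ty HomD[OF f] cd
      by (simp add: comp_pnt_nati[OF f y]) (simp add: id_pnt_def)
  qed
qed

text \<open>Species and decomposition spaces are both obtained from \<open>psf_cat\<close> by
  restricting objects and arrows, so one proof serves both categories.\<close>

lemma psf_subcategory:
  assumes S: "\<And>F. F \<in> S \<Longrightarrow> pseudofunctor C F"
    and T: "\<And>F t G. (F, t, G) \<in> T \<Longrightarrow> F \<in> S \<and> G \<in> S \<and> pseudonat C F G t"
    and id: "\<And>F. F \<in> S \<Longrightarrow> (F, id_pnt C F, F) \<in> T"
    and comp: "\<And>F t G u H. (F, t, G) \<in> T \<Longrightarrow> (G, u, H) \<in> T \<Longrightarrow> (F, comp_pnt C F H u t, H) \<in> T"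
  shows "category ((psf_cat C)\<lparr>Obj := S, Arr := T\<rparr>)" (is "category ?C")
proof
  have Hom: "f \<in> Hom ?C F G \<longleftrightarrow> (\<exists>t. f = (F, t, G) \<and> (F, t, G) \<in> T)" for f F G
    by (cases f) (auto simp: Hom_def psf_cat_def)
  have Comp: "(G, u, H) \<cdot>\<^bsub>psf_cat C\<^esub> (F, t, G') = (F, comp_pnt C F H u t, H)" for F t G' G u H
    by (simp add: psf_cat_def)
  have Id: "Id (psf_cat C) F = (F, id_pnt C F, F)" for F
    by (simp add: psf_cat_def)
  show "Dom ?C f \<in> Obj ?C" "Cod ?C f \<in> Obj ?C" if "f \<in> Arr ?C" for f
    using that T by (cases f; auto simp: psf_cat_def)+
  show "Id ?C x \<in> Hom ?C x x" if "x \<in> Obj ?C" for x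
    using that id by (simp add: Hom Id)
  show "g \<cdot>\<^bsub>?C\<^esub> f \<in> Hom ?C x z" if "f \<in> Hom ?C x y" "g \<in> Hom ?C y z" for f g x y z
    using that comp unfolding Hom by (auto simp: Comp)
  show "f \<cdot>\<^bsub>?C\<^esub> Id ?C x = f" "Id ?C y \<cdot>\<^bsub>?C\<^esub> f = f" if "f \<in> Hom ?C x y" for f x y
    using that comp_pnt_id T unfolding Hom by (fastforce simp: Comp Id)+
  show "(h \<cdot>\<^bsub>?C\<^esub> g) \<cdot>\<^bsub>?C\<^esub> f = h \<cdot>\<^bsub>?C\<^esub> (g \<cdot>\<^bsub>?C\<^esub> f)"
    if fgh: "f \<in> Hom ?C w x" "g \<in> Hom ?C x y" "h \<in> Hom ?C y z" for f g h w x y z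
  proof -
    obtain t u v where "f = (w, t, x)" "(w, t, x) \<in> T" "g = (x, u, y)" "(x, u, y) \<in> T"
      "h = (y, v, z)" "(y, v, z) \<in> T"
      using fgh unfolding Hom by blast
    then show ?thesis using comp_pnt_assoc[of C w x t y u z v] T by (simp add: Comp)
  qed
qed

section \<open>The category of elements\<close>

context pseudofunctor
begin

abbreviation "E \<equiv> elements C F"

lemma grpd_category: "c \<in> Obj C \<Longrightarrow> category (grpd F c)"
  using grpd_groupoid by (simp add: groupoid_def)

lemma elements_Obj: "(c, x) \<in> Obj E \<longleftrightarrow> c \<in> Obj C \<and> x \<in> Obj (grpd F c)"
  by (simp add: elements_def)

lemma elements_Hom:
  "h \<in> Hom E (c, x) (d, y) \<longleftrightarrow> (\<exists>f \<alpha>. h = (f, \<alpha>, y) \<and> f \<in> Hom C c d \<and> y \<in> Obj (grpd F d) \<and>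
    \<alpha> \<in> Hom (grpd F c) x (on_obj (pull F f) y))"
  by (cases h) (auto simp: Hom_def elements_def)

lemma elements_Comp:
  assumes "f \<in> Hom C c d"
  shows "(g, \<beta>, z) \<cdot>\<^bsub>E\<^esub> (f, \<alpha>, y) = (g \<cdot>\<^bsub>C\<^esub> f, compositor F f g z \<cdot>\<^bsub>grpd F c\<^esub>
    (on_arr (pull F f) \<beta> \<cdot>\<^bsub>grpd F c\<^esub> \<alpha>), z)"
  using HomD(2)[OF assms] by (simp add: elements_def)

lemma elements_Id: "Id E (c, x) = (Id C c, unitor F c x, x)"
  by (simp add: elements_def)

lemma elements_Comp_Hom:
  assumes f: "f \<in> Hom C b c" and g: "g \<in> Hom C c d" and z: "z \<in> Obj (grpd F d)"
    and \<beta>: "\<beta> \<in> Hom (grpd F c) y (on_obj (pull F g) z)" and \<alpha>: "\<alpha> \<in> Hom (grpd F b) x (on_obj (pull F f) y)"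
  shows "compositor F f g z \<cdot>\<^bsub>grpd F b\<^esub> (on_arr (pull F f) \<beta> \<cdot>\<^bsub>grpd F b\<^esub> \<alpha>)
    \<in> Hom (grpd F b) x (on_obj (pull F (g \<cdot>\<^bsub>C\<^esub> f)) z)"
proof -
  interpret B: category "grpd F b" using grpd_category Hom_Obj[OF f] by blast
  show ?thesis
    by (rule B.Comp_Hom[OF B.Comp_Hom[OF \<alpha> functor_Hom[OF pull_functor[OF f] \<beta>]] compositor_Hom[OF f g z]])
qed

text \<open>The axioms of a pseudo-functor are what is needed here: \<open>unit_right\<close> and
  naturality of the unitor give the right identity law, \<open>unit_left\<close> the left one, and
  associativity with naturality of the compositor gives associativity.\<close>

lemma elements_category: "category E"
proof
  show "Dom E h \<in> Obj E" "Cod E h \<in> Obj E" if "h \<in> Arr E" for h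
  proof -
    obtain f \<alpha> y where h: "h = (f, \<alpha>, y)" by (cases h)
    then have f: "f \<in> Arr C" "\<alpha> \<in> Arr (grpd F (Dom C f))" "y \<in> Obj (grpd F (Cod C f))"
      using that by (auto simp: elements_def)
    then show "Dom E h \<in> Obj E" "Cod E h \<in> Obj E"
      using category.Dom_Obj[OF grpd_category[OF Dom_Obj[OF f(1)]] f(2)] Dom_Obj Cod_Obj
      by (auto simp: h elements_def)
  qed
  show "Id E a \<in> Hom E a a" if "a \<in> Obj E" for a
    using that unitor_Hom Id_Hom by (cases a) (auto simp: elements_Obj elements_Id elements_Hom)
  show "k \<cdot>\<^bsub>E\<^esub> h \<in> Hom E a1 a3" if hs: "h \<in> Hom E a1 a2" "k \<in> Hom E a2 a3" for h k a1 a2 a3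
  proof -
    obtain b x c y d z where a: "a1 = (b, x)" "a2 = (c, y)" "a3 = (d, z)" by (cases a1, cases a2, cases a3)
    obtain f \<alpha> where h: "h = (f, \<alpha>, y)" "f \<in> Hom C b c" "\<alpha> \<in> Hom (grpd F b) x (on_obj (pull F f) y)"
      using hs(1) by (auto simp: a elements_Hom)
    obtain g \<beta> where k: "k = (g, \<beta>, z)" "g \<in> Hom C c d" "\<beta> \<in> Hom (grpd F c) y (on_obj (pull F g) z)"
      "z \<in> Obj (grpd F d)"
      using hs(2) by (auto simp: a elements_Hom)
    show ?thesis
      using elements_Comp_Hom[OF h(2) k(2,4,3) h(3)] Comp_Hom[OF h(2) k(2)] k(4)
      by (simp add: h(1) k(1) a elements_Comp[OF h(2)] elements_Hom)
  qed
  show "h \<cdot>\<^bsub>E\<^esub> Id E a1 = h" "Id E a2 \<cdot>\<^bsub>E\<^esub> h = h" if hs: "h \<in> Hom E a1 a2" for h a1 a2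
  proof -
    obtain b x c y where a: "a1 = (b, x)" "a2 = (c, y)" by (cases a1, cases a2)
    obtain f \<alpha> where h: "h = (f, \<alpha>, y)" "f \<in> Hom C b c" "\<alpha> \<in> Hom (grpd F b) x (on_obj (pull F f) y)"
      "y \<in> Obj (grpd F c)"
      using hs(1) by (auto simp: a elements_Hom)
    note bc = Hom_Obj[OF h(2)]
    interpret B: groupoid "grpd F b" by (rule grpd_groupoid[OF bc(1)])
    note fy = functor_Obj[OF pull_functor[OF h(2)] h(4)] note x = B.Hom_Obj[OF h(3)]
    note P = pull_functor[OF h(2)] and i = Id_Hom[OF bc(1)] and j = Id_Hom[OF bc(2)]
    \<comment> \<open>Naturality of the unitor moves \<open>\<alpha>\<close> to the right end; the
      remaining factor is the left side of \<open>unit_right\<close>.\<close>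
    have "compositor F (Id C b) f y \<cdot>\<^bsub>grpd F b\<^esub> (on_arr (pull F (Id C b)) \<alpha> \<cdot>\<^bsub>grpd F b\<^esub> unitor F b x)
        = (compositor F (Id C b) f y \<cdot>\<^bsub>grpd F b\<^esub> unitor F b (on_obj (pull F f) y)) \<cdot>\<^bsub>grpd F b\<^esub> \<alpha>"
      using B.Comp_assoc[OF h(3) unitor_Hom[OF bc(1) fy] compositor_Hom[OF i h(2,4)]]
        unitor_natural[OF bc(1) h(3)] by simp
    also have "\<dots> = \<alpha>"
      using unit_right[OF h(2,4)] B.Comp_Id_left[OF h(3)] by simp
    finally show "h \<cdot>\<^bsub>E\<^esub> Id E a1 = h"
      using Comp_Id_right[OF h(2)] by (simp add: a h(1) elements_Id elements_Comp[OF i])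
    have "compositor F f (Id C c) y \<cdot>\<^bsub>grpd F b\<^esub> (on_arr (pull F f) (unitor F c y) \<cdot>\<^bsub>grpd F b\<^esub> \<alpha>)
        = (compositor F f (Id C c) y \<cdot>\<^bsub>grpd F b\<^esub> on_arr (pull F f) (unitor F c y)) \<cdot>\<^bsub>grpd F b\<^esub> \<alpha>"
      using B.Comp_assoc[OF h(3) functor_Hom[OF P unitor_Hom[OF bc(2) h(4)]] compositor_Hom[OF h(2) j h(4)]]
      by simp
    also have "\<dots> = \<alpha>"
      using unit_left[OF h(2,4)] B.Comp_Id_left[OF h(3)] by simp
    finally show "Id E a2 \<cdot>\<^bsub>E\<^esub> h = h"
      using Comp_Id_left[OF h(2)] by (simp add: a h(1) elements_Id elements_Comp[OF h(2)])
  qed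
  show "(h3 \<cdot>\<^bsub>E\<^esub> h2) \<cdot>\<^bsub>E\<^esub> h1 = h3 \<cdot>\<^bsub>E\<^esub> (h2 \<cdot>\<^bsub>E\<^esub> h1)"
    if hs: "h1 \<in> Hom E a1 a2" "h2 \<in> Hom E a2 a3" "h3 \<in> Hom E a3 a4" for h1 h2 h3 a1 a2 a3 a4
  proof -
    obtain a x b y c z d w where as: "a1 = (a, x)" "a2 = (b, y)" "a3 = (c, z)" "a4 = (d, w)"
      by (cases a1, cases a2, cases a3, cases a4)
    obtain f \<alpha> where h1: "h1 = (f, \<alpha>, y)" "f \<in> Hom C a b" "\<alpha> \<in> Hom (grpd F a) x (on_obj (pull F f) y)"
      using hs(1) by (auto simp: as elements_Hom)
    obtain g \<beta> where h2: "h2 = (g, \<beta>, z)" "g \<in> Hom C b c" "\<beta> \<in> Hom (grpd F b) y (on_obj (pull F g) z)"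
      "z \<in> Obj (grpd F c)"
      using hs(2) by (auto simp: as elements_Hom)
    obtain h \<gamma> where h3: "h3 = (h, \<gamma>, w)" "h \<in> Hom C c d" "\<gamma> \<in> Hom (grpd F c) z (on_obj (pull F h) w)"
      "w \<in> Obj (grpd F d)"
      using hs(3) by (auto simp: as elements_Hom)
    interpret A: groupoid "grpd F a" using grpd_groupoid Hom_Obj[OF h1(2)] by blast
    interpret B: groupoid "grpd F b" using grpd_groupoid Hom_Obj[OF h2(2)] by blast
    note Pf = pull_functor[OF h1(2)] and Pg = pull_functor[OF h2(2)]
    note gf = Comp_Hom[OF h1(2) h2(2)] and hg = Comp_Hom[OF h2(2) h3(2)]
    note hw = functor_Obj[OF pull_functor[OF h3(2)] h3(4)]
    note g\<gamma> = functor_Hom[OF Pg h3(3)] and k = compositor_Hom[OF h2(2) h3(2,4)]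
    note atoms = h1(3) functor_Hom[OF Pf h2(3)] functor_Hom[OF Pf g\<gamma>] functor_Hom[OF pull_functor[OF gf] h3(3)]
      functor_Hom[OF Pf k] compositor_Hom[OF h1(2) hg h3(4)] compositor_Hom[OF gf h3(2,4)]
      compositor_Hom[OF h1(2) h2(2) hw] compositor_Hom[OF h1(2) h2(2,4)]
    note simps = A.comp_simps A.comp_assoc atoms[THEN HomD(1)] atoms[THEN HomD(2)] atoms[THEN HomD(3)]
    have "compositor F f (h \<cdot>\<^bsub>C\<^esub> g) w \<cdot>\<^bsub>grpd F a\<^esub>
          (on_arr (pull F f) (compositor F g h w \<cdot>\<^bsub>grpd F b\<^esub> (on_arr (pull F g) \<gamma> \<cdot>\<^bsub>grpd F b\<^esub> \<beta>)) \<cdot>\<^bsub>grpd F a\<^esub> \<alpha>)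
        = (compositor F f (h \<cdot>\<^bsub>C\<^esub> g) w \<cdot>\<^bsub>grpd F a\<^esub> on_arr (pull F f) (compositor F g h w))
          \<cdot>\<^bsub>grpd F a\<^esub> (on_arr (pull F f) (on_arr (pull F g) \<gamma>) \<cdot>\<^bsub>grpd F a\<^esub> (on_arr (pull F f) \<beta> \<cdot>\<^bsub>grpd F a\<^esub> \<alpha>))"
      using functor_Comp[OF Pf B.Comp_Hom[OF h2(3) g\<gamma>] k] functor_Comp[OF Pf h2(3) g\<gamma>] by (simp add: simps)
    also have "\<dots> = compositor F (g \<cdot>\<^bsub>C\<^esub> f) h w \<cdot>\<^bsub>grpd F a\<^esub>
        ((compositor F f g (on_obj (pull F h) w) \<cdot>\<^bsub>grpd F a\<^esub> on_arr (pull F f) (on_arr (pull F g) \<gamma>))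
          \<cdot>\<^bsub>grpd F a\<^esub> (on_arr (pull F f) \<beta> \<cdot>\<^bsub>grpd F a\<^esub> \<alpha>))"
      unfolding associativity[OF h1(2) h2(2) h3(2,4), symmetric] by (simp add: simps)
    \<comment> \<open>Naturality of the compositor at \<open>\<gamma>\<close> replaces the two
      successive pullbacks of \<open>\<gamma>\<close> by one, which is the fibre component of the
      other bracketing.\<close>
    also have "\<dots> = compositor F (g \<cdot>\<^bsub>C\<^esub> f) h w \<cdot>\<^bsub>grpd F a\<^esub>
        (on_arr (pull F (g \<cdot>\<^bsub>C\<^esub> f)) \<gamma> \<cdot>\<^bsub>grpd F a\<^esub>
          (compositor F f g z \<cdot>\<^bsub>grpd F a\<^esub> (on_arr (pull F f) \<beta> \<cdot>\<^bsub>grpd F a\<^esub> \<alpha>)))"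
      unfolding compositor_natural[OF h1(2) h2(2) h3(3)] by (simp add: simps)
    finally show ?thesis
      using Comp_assoc[OF h1(2) h2(2) h3(2)]
      by (simp add: h1(1) h2(1) h3(1) elements_Comp[OF h1(2)] elements_Comp[OF h2(2)] elements_Comp[OF gf])
  qed
qed

text \<open>The fibres are groupoids, so every arrow of the category of elements is cartesian.\<close>

lemma elements_cartesian:
  assumes u: "u \<in> Hom E (k, x) (p, z)" and v: "v \<in> Hom E (l, y) (p, z)"
    and h: "h \<in> Hom C l k" and fst: "fst u \<cdot>\<^bsub>C\<^esub> h = fst v"
  shows "\<exists>!w. w \<in> Hom E (l, y) (k, x) \<and> fst w = h \<and> u \<cdot>\<^bsub>E\<^esub> w = v"
proof -
  obtain f \<alpha> where u': "u = (f, \<alpha>, z)" "f \<in> Hom C k p" "\<alpha> \<in> Hom (grpd F k) x (on_obj (pull F f) z)"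
    "z \<in> Obj (grpd F p)"
    using u by (auto simp: elements_Hom)
  obtain \<beta> where v': "v = (f \<cdot>\<^bsub>C\<^esub> h, \<beta>, z)" "\<beta> \<in> Hom (grpd F l) y (on_obj (pull F (f \<cdot>\<^bsub>C\<^esub> h)) z)"
    using v fst by (auto simp: elements_Hom u')
  interpret L: groupoid "grpd F l" using grpd_groupoid Hom_Obj[OF h] by blast
  interpret K: groupoid "grpd F k" using grpd_groupoid Hom_Obj[OF h] by blast
  \<comment> \<open>Composition with \<open>u\<close> multiplies the fibre component by this arrow.
    It is invertible in the groupoid over \<open>l\<close>, so the equation for \<open>w\<close> has
    the single solution \<open>?k\<close> inverse times \<open>\<beta>\<close>.\<close>
  let ?k = "compositor F h f z \<cdot>\<^bsub>grpd F l\<^esub> on_arr (pull F h) \<alpha>"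
  note ha = functor_Hom[OF pull_functor[OF h] u'(3)] and c = compositor_Hom[OF h u'(2,4)]
  have k: "?k \<in> Hom (grpd F l) (on_obj (pull F h) x) (on_obj (pull F (f \<cdot>\<^bsub>C\<^esub> h)) z)"
    by (rule L.Comp_Hom[OF ha c])
  have Comp: "u \<cdot>\<^bsub>E\<^esub> (h, \<gamma>, x) = (f \<cdot>\<^bsub>C\<^esub> h, ?k \<cdot>\<^bsub>grpd F l\<^esub> \<gamma>, z)"
    if "\<gamma> \<in> Hom (grpd F l) y (on_obj (pull F h) x)" for \<gamma>
    using L.Comp_assoc[OF that ha c] by (simp add: u' elements_Comp[OF h])
  note \<gamma> = L.Comp_Hom[OF v'(2) L.inv_Hom[OF k]]
  note x = K.Hom_Obj(1)[OF u'(3)]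
  show ?thesis
  proof (rule ex1I)
    show "(h, inv_arr (grpd F l) ?k \<cdot>\<^bsub>grpd F l\<^esub> \<beta>, x) \<in> Hom E (l, y) (k, x) \<and>
        fst (h, inv_arr (grpd F l) ?k \<cdot>\<^bsub>grpd F l\<^esub> \<beta>, x) = h \<and>
        u \<cdot>\<^bsub>E\<^esub> (h, inv_arr (grpd F l) ?k \<cdot>\<^bsub>grpd F l\<^esub> \<beta>, x) = v"
      using \<gamma> h x L.Comp_inv_cancel_left[OF k v'(2)] by (simp add: elements_Hom Comp[OF \<gamma>] v'(1))
    fix w assume w: "w \<in> Hom E (l, y) (k, x) \<and> fst w = h \<and> u \<cdot>\<^bsub>E\<^esub> w = v"
    then obtain \<gamma>' where \<gamma>': "w = (h, \<gamma>', x)" "\<gamma>' \<in> Hom (grpd F l) y (on_obj (pull F h) x)"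
      by (auto simp: elements_Hom)
    have "?k \<cdot>\<^bsub>grpd F l\<^esub> \<gamma>' = \<beta>" using w Comp[OF \<gamma>'(2)] by (simp add: \<gamma>'(1) v'(1))
    with L.inv_Comp_cancel_left[OF k \<gamma>'(2)]
    show "w = (h, inv_arr (grpd F l) ?k \<cdot>\<^bsub>grpd F l\<^esub> \<beta>, x)" by (simp add: \<gamma>'(1))
  qed
qed

end

section \<open>The functor on categories of elements given by a pseudo-natural
  transformation\<close>

context pseudonat
begin

lemma elements_map_Hom:
  assumes "h \<in> Hom (elements C F) (c, x) (d, y)"
  shows "elements_map C G t h \<in> Hom (elements C G) (c, on_obj (cmpt t c) x) (d, on_obj (cmpt t d) y)"
proof -
  obtain f \<alpha> where h: "h = (f, \<alpha>, y)" "f \<in> Hom C c d" "\<alpha> \<in> Hom (grpd F c) x (on_obj (pull F f) y)"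
    "y \<in> Obj (grpd F d)"
    using assms by (auto simp: F.elements_Hom)
  note cd = F.Hom_Obj[OF h(2)]
  interpret Gc: groupoid "grpd G c" by (rule G.grpd_groupoid[OF cd(1)])
  show ?thesis
    using h Gc.Comp_Hom[OF functor_Hom[OF cmpt_functor[OF cd(1)] h(3)] nati_Hom[OF h(2,4)]]
      functor_Obj[OF cmpt_functor[OF cd(2)] h(4)] HomD[OF h(2)]
    by (simp add: elements_map_def G.elements_Hom)
qed

lemma fst_elements_map [simp]: "fst (elements_map C G t h) = fst h"
  by (cases h) (simp add: elements_map_def)

lemma elements_map_Id:
  assumes "a \<in> Obj (elements C F)"
  shows "elements_map C G t (Id (elements C F) a) = Id (elements C G) (fst a, on_obj (cmpt t (fst a)) (snd a))"
  using assms nati_Id F.Id_Hom[THEN HomD(2)] F.Id_Hom[THEN HomD(3)]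
  by (cases a) (auto simp: F.elements_Obj F.elements_Id G.elements_Id elements_map_def)

text \<open>\<open>nati_Comp\<close> trades \<open>nati\<close> at a composite for the compositor of
  \<open>G\<close> and the two single \<open>nati\<close>; naturality of \<open>nati t f\<close> at
  \<open>\<beta>\<close> then separates the contributions of the two arrows.\<close>

lemma elements_map_Comp:
  assumes "h1 \<in> Hom (elements C F) a1 a2" "h2 \<in> Hom (elements C F) a2 a3"
  shows "elements_map C G t (h2 \<cdot>\<^bsub>elements C F\<^esub> h1) =
    elements_map C G t h2 \<cdot>\<^bsub>elements C G\<^esub> elements_map C G t h1"
proof -
  obtain b x c y d z where a: "a1 = (b, x)" "a2 = (c, y)" "a3 = (d, z)" by (cases a1, cases a2, cases a3)
  obtain f \<alpha> where h: "h1 = (f, \<alpha>, y)" "f \<in> Hom C b c" "\<alpha> \<in> Hom (grpd F b) x (on_obj (pull F f) y)"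
    "y \<in> Obj (grpd F c)"
    using assms(1) by (auto simp: a F.elements_Hom)
  obtain g \<beta> where k: "h2 = (g, \<beta>, z)" "g \<in> Hom C c d" "\<beta> \<in> Hom (grpd F c) y (on_obj (pull F g) z)"
    "z \<in> Obj (grpd F d)"
    using assms(2) by (auto simp: a F.elements_Hom)
  note bcd = F.Hom_Obj[OF h(2)] F.Hom_Obj[OF k(2)] and gf = F.Comp_Hom[OF h(2) k(2)]
  interpret Fb: groupoid "grpd F b" by (rule F.grpd_groupoid[OF bcd(1)])
  interpret Gb: groupoid "grpd G b" by (rule G.grpd_groupoid[OF bcd(1)])
  note T = cmpt_functor[OF bcd(1)] and Gf = G.pull_functor[OF h(2)]
  note f\<beta> = functor_Hom[OF F.pull_functor[OF h(2)] k(3)] and K = F.compositor_Hom[OF h(2) k(2,4)]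
  note t\<beta> = functor_Hom[OF cmpt_functor[OF bcd(2)] k(3)]
  note gz = functor_Obj[OF F.pull_functor[OF k(2)] k(4)] and tz = functor_Obj[OF cmpt_functor[OF bcd(4)] k(4)]
  note n = nati_Hom[OF k(2,4)]
  note atoms = functor_Hom[OF T h(3)] functor_Hom[OF T f\<beta>] functor_Hom[OF T K] nati_Hom[OF gf k(4)]
    nati_Hom[OF h(2,4)] nati_Hom[OF h(2) gz] functor_Hom[OF Gf t\<beta>] functor_Hom[OF Gf n]
    G.compositor_Hom[OF h(2) k(2) tz]
  note simps = Gb.comp_simps Gb.comp_assoc atoms[THEN HomD(1)] atoms[THEN HomD(2)] atoms[THEN HomD(3)]
  let ?tz = "on_obj (cmpt t d) z"
  have "nati t (g \<cdot>\<^bsub>C\<^esub> f) z \<cdot>\<^bsub>grpd G b\<^esub> on_arr (cmpt t b)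
        (compositor F f g z \<cdot>\<^bsub>grpd F b\<^esub> (on_arr (pull F f) \<beta> \<cdot>\<^bsub>grpd F b\<^esub> \<alpha>))
      = (nati t (g \<cdot>\<^bsub>C\<^esub> f) z \<cdot>\<^bsub>grpd G b\<^esub> on_arr (cmpt t b) (compositor F f g z)) \<cdot>\<^bsub>grpd G b\<^esub>
        (on_arr (cmpt t b) (on_arr (pull F f) \<beta>) \<cdot>\<^bsub>grpd G b\<^esub> on_arr (cmpt t b) \<alpha>)"
    using functor_Comp[OF T Fb.Comp_Hom[OF h(3) f\<beta>] K] functor_Comp[OF T h(3) f\<beta>] by (simp add: simps)
  also have "\<dots> = compositor G f g ?tz \<cdot>\<^bsub>grpd G b\<^esub> (on_arr (pull G f) (nati t g z) \<cdot>\<^bsub>grpd G b\<^esub>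
      ((nati t f (on_obj (pull F g) z) \<cdot>\<^bsub>grpd G b\<^esub> on_arr (cmpt t b) (on_arr (pull F f) \<beta>))
        \<cdot>\<^bsub>grpd G b\<^esub> on_arr (cmpt t b) \<alpha>))"
    unfolding nati_Comp[OF h(2) k(2,4)] by (simp add: simps)
  also have "\<dots> = compositor G f g ?tz \<cdot>\<^bsub>grpd G b\<^esub>
      (on_arr (pull G f) (nati t g z \<cdot>\<^bsub>grpd G c\<^esub> on_arr (cmpt t c) \<beta>)
        \<cdot>\<^bsub>grpd G b\<^esub> (nati t f y \<cdot>\<^bsub>grpd G b\<^esub> on_arr (cmpt t b) \<alpha>))"
    unfolding nati_natural[OF h(2) k(3)] functor_Comp[OF Gf t\<beta> n] by (simp add: simps)
  finally show ?thesis
    using HomD[OF h(2)] HomD[OF k(2)] HomD[OF gf]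
    by (simp add: h(1) k(1) F.elements_Comp[OF h(2)] elements_map_def G.elements_Comp[OF h(2)])
qed

end

lemma elements_map_id_pnt:
  assumes "pseudofunctor C F" "h \<in> Hom (elements C F) a b"
  shows "elements_map C F (id_pnt C F) h = h"
proof -
  interpret F: pseudofunctor C F by fact
  obtain c x d y where a: "a = (c, x)" "b = (d, y)" by (cases a, cases b)
  obtain f \<alpha> where h: "h = (f, \<alpha>, y)" "f \<in> Hom C c d" "\<alpha> \<in> Hom (grpd F c) x (on_obj (pull F f) y)"
    "y \<in> Obj (grpd F d)"
    using assms(2) by (auto simp: a F.elements_Hom)
  interpret Fc: groupoid "grpd F c" using F.grpd_groupoid F.Hom_Obj[OF h(2)] by blast
  show ?thesis
    using h HomD[OF h(2)] HomD[OF h(3)] F.Hom_Obj[OF h(2)] Fc.Comp_Id_left[OF h(3)]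
    by (simp add: elements_map_def id_pnt_def)
qed

text \<open>Functoriality of \<open>cmpt u\<close> and one rebracketing. This equality, on the nose,
  is what lets induced simplicial maps compose strictly.\<close>

lemma elements_map_comp_pnt:
  assumes t: "pseudonat C F G t" and u: "pseudonat C G H u" and h: "h \<in> Hom (elements C F) a b"
  shows "elements_map C H (comp_pnt C F H u t) h = elements_map C H u (elements_map C G t h)"
proof -
  interpret t: pseudonat C F G t by (rule t)
  interpret u: pseudonat C G H u by (rule u)
  obtain c x d y where a: "a = (c, x)" "b = (d, y)" by (cases a, cases b)
  obtain f \<alpha> where h: "h = (f, \<alpha>, y)" "f \<in> Hom C c d" "\<alpha> \<in> Hom (grpd F c) x (on_obj (pull F f) y)"
    "y \<in> Obj (grpd F d)"
    using h by (auto simp: a t.F.elements_Hom)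
  note cd = t.F.Hom_Obj[OF h(2)]
  interpret H: groupoid "grpd H c" by (rule u.G.grpd_groupoid[OF cd(1)])
  note ta = functor_Hom[OF t.cmpt_functor[OF cd(1)] h(3)] and n = t.nati_Hom[OF h(2,4)]
    and U = u.cmpt_functor[OF cd(1)]
  note nu = u.nati_Hom[OF h(2) functor_Obj[OF t.cmpt_functor[OF cd(2)] h(4)]]
  show ?thesis
    using H.Comp_assoc[OF functor_Hom[OF U ta] functor_Hom[OF U n] nu] functor_Comp[OF U ta n]
      HomD[OF h(2)] HomD(1)[OF h(3)] cd h(4)
    by (simp add: h(1) elements_map_def comp_pnt_nati[OF h(2,4)] comp_pnt_cmpt)
qed

section \<open>Finite posets, convex maps and structures on them\<close>

lemma finite_posetD:
  assumes "finite_poset P"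
  shows poset_refl: "a \<in> fst P \<Longrightarrow> (a, a) \<in> snd P"
    and poset_antisym: "(a, b) \<in> snd P \<Longrightarrow> (b, a) \<in> snd P \<Longrightarrow> a = b"
    and poset_trans: "(a, b) \<in> snd P \<Longrightarrow> (b, c) \<in> snd P \<Longrightarrow> (a, c) \<in> snd P"
    and poset_carrier: "(a, b) \<in> snd P \<Longrightarrow> a \<in> fst P \<and> b \<in> fst P"
  using assms unfolding finite_poset_def partial_order_on_def preorder_on_def refl_on_def
  by (auto dest: antisymD transD)

lemma finite_poset_subposet:
  assumes "finite_poset P" "K \<subseteq> fst P"
  shows "finite_poset (subposet P K)"
  unfolding finite_poset_def partial_order_on_def preorder_on_def refl_on_def trans_def antisym_def subposet_def
  using assms(2) finite_subset[OF assms(2)] assms(1)[unfolded finite_poset_def]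
    poset_refl[OF assms(1)] poset_trans[OF assms(1)] poset_antisym[OF assms(1)]
  by auto

text \<open>Lifting \<open>x = f a\<close> between \<open>f a\<close> and \<open>f b\<close> yields
  a point between \<open>a\<close> and \<open>b\<close>, so a convex map reflects the order.
  Conversely, reflection and antisymmetry give injectivity, hence uniqueness of lifts. Convex maps
  are thus the order embeddings with convex image.\<close>

lemma convex_map_iff:
  assumes K: "finite_poset K" and P: "finite_poset P"
  shows "convex_map K P f \<longleftrightarrow> f \<in> fst K \<rightarrow>\<^sub>E fst P \<and>
    (\<forall>a \<in> fst K. \<forall>b \<in> fst K. (f a, f b) \<in> snd P \<longleftrightarrow> (a, b) \<in> snd K) \<and>
    (\<forall>a \<in> fst K. \<forall>b \<in> fst K. \<forall>x \<in> fst P. (f a, x) \<in> snd P \<and> (x, f b) \<in> snd P \<longrightarrow> x \<in> f ` fst K)"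
    (is "_ \<longleftrightarrow> ?r")
proof
  assume c: "convex_map K P f"
  then have f: "f \<in> fst K \<rightarrow>\<^sub>E fst P" and mono: "\<And>a b. (a, b) \<in> snd K \<Longrightarrow> (f a, f b) \<in> snd P"
    and lift: "\<And>a b x. a \<in> fst K \<Longrightarrow> b \<in> fst K \<Longrightarrow> x \<in> fst P \<Longrightarrow> (f a, x) \<in> snd P \<Longrightarrow> (x, f b) \<in> snd P \<Longrightarrow>
      \<exists>k. k \<in> fst K \<and> (a, k) \<in> snd K \<and> (k, b) \<in> snd K \<and> f k = x"
    by (auto simp: convex_map_def poset_map_def) blast
  have "(a, b) \<in> snd K" if "a \<in> fst K" "b \<in> fst K" "(f a, f b) \<in> snd P" for a b
  proof -
    have "f a \<in> fst P" using f that by auto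
    with lift[OF that(1,2) _ poset_refl[OF P] that(3)] show ?thesis
      using poset_trans[OF K] by blast
  qed
  with f mono lift show ?r by blast
next
  assume r: ?r
  have inj: "a = b" if "a \<in> fst K" "b \<in> fst K" "f a = f b" for a b
  proof -
    have "(f a, f a) \<in> snd P" using r that poset_refl[OF P] by blast
    then have "(a, b) \<in> snd K" "(b, a) \<in> snd K" using r that by metis+
    then show ?thesis by (rule poset_antisym[OF K])
  qed
  show "convex_map K P f"
    unfolding convex_map_def poset_map_def
  proof (intro conjI ballI allI impI)
    fix a b x assume *: "a \<in> fst K" "b \<in> fst K" "x \<in> fst P" "(f a, x) \<in> snd P \<and> (x, f b) \<in> snd P"
    then obtain k where "k \<in> fst K" "f k = x" using r by blast
    with * r inj show "\<exists>!k. k \<in> fst K \<and> (a, k) \<in> snd K \<and> (k, b) \<in> snd K \<and> f k = x" by blast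
  qed (use r poset_carrier[OF K] in auto)
qed

lemma convex_map_inj:
  assumes K: "finite_poset K" and P: "finite_poset P" and f: "convex_map K P f"
  shows "inj_on f (fst K)"
proof (rule inj_onI)
  fix a b assume ab: "a \<in> fst K" "b \<in> fst K" "f a = f b"
  note r = f[unfolded convex_map_iff[OF K P]]
  have "(f a, f a) \<in> snd P" using r ab poset_refl[OF P] by blast
  then have "(a, b) \<in> snd K" "(b, a) \<in> snd K" using r ab by metis+
  then show "a = b" by (rule poset_antisym[OF K])
qed

lemma poset_cat_Hom:
  "e \<in> Hom poset_cat K P \<longleftrightarrow> (\<exists>f. e = (K, f, P) \<and> finite_poset K \<and> finite_poset P \<and> convex_map K P f)"
  by (cases e) (auto simp: Hom_def poset_cat_def)

lemma poset_cat_simps: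
  "Obj poset_cat = {P. finite_poset P}"
  "(Q', g, S) \<cdot>\<^bsub>poset_cat\<^esub> (K, f, Q) = (K, compose (fst K) g f, S)"
  "Id poset_cat P = (P, (\<lambda>p \<in> fst P. p), P)"
  by (auto simp: poset_cat_def)

text \<open>Since \<open>u\<close> is injective, the factor can only be the pointwise inverse. It is
  an order embedding because \<open>u\<close> and \<open>v\<close> are, and its image is convex
  because that of \<open>v\<close> is: a point \<open>x\<close> between \<open>w a\<close> and
  \<open>w b\<close> goes under \<open>u\<close> to a point between \<open>v a\<close> and
  \<open>v b\<close>.\<close>

lemma convex_map_factor:
  assumes K: "finite_poset K" and L: "finite_poset L" and P: "finite_poset P"
    and u: "convex_map K P u" and v: "convex_map L P v" and sub: "v ` fst L \<subseteq> u ` fst K"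
  obtains w where "convex_map L K w" "compose (fst L) u w = v"
proof -
  define w where "w = (\<lambda>q \<in> fst L. inv_into (fst K) u (v q))"
  note u' = u[unfolded convex_map_iff[OF K P]] and v' = v[unfolded convex_map_iff[OF L P]]
  have w: "w q \<in> fst K" "u (w q) = v q" if "q \<in> fst L" for q
    using sub that by (auto simp: w_def inv_into_into f_inv_into_f image_subset_iff)
  have vL: "v q \<in> fst P" if "q \<in> fst L" for q using v' that by auto
  have "convex_map L K w"
    unfolding convex_map_iff[OF L K]
  proof (intro conjI ballI impI)
    show "w \<in> fst L \<rightarrow>\<^sub>E fst K" using w by (auto simp: w_def)
    fix a b assume ab: "a \<in> fst L" "b \<in> fst L"
    show "(w a, w b) \<in> snd K \<longleftrightarrow> (a, b) \<in> snd L"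
      using u' v' w[OF ab(1)] w[OF ab(2)] ab by metis
    fix x assume x: "x \<in> fst K" "(w a, x) \<in> snd K \<and> (x, w b) \<in> snd K"
    then have "(v a, u x) \<in> snd P" "(u x, v b) \<in> snd P" "u x \<in> fst P"
      using u' w[OF ab(1)] w[OF ab(2)] by (metis, metis, auto)
    then obtain q where q: "q \<in> fst L" "u x = v q" using v' ab by blast
    then have "u x = u (w q)" using w by simp
    then have "x = w q" using inj_onD[OF convex_map_inj[OF K P u]] x(1) w(1)[OF q(1)] by blast
    then show "x \<in> w ` fst L" using q by blast
  qed
  moreover have "compose (fst L) u w = v"
    using w v' by (auto simp: compose_def fun_eq_iff PiE_iff extensional_def)
  ultimately show ?thesis by (rule that)
qed

lemma poset_cat_mono:
  assumes u: "u \<in> Hom poset_cat K P" and w: "w \<in> Hom poset_cat L K" "w' \<in> Hom poset_cat L K"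
    and eq: "u \<cdot>\<^bsub>poset_cat\<^esub> w = u \<cdot>\<^bsub>poset_cat\<^esub> w'"
  shows "w = w'"
proof -
  obtain f where f: "u = (K, f, P)" "finite_poset K" "finite_poset P" "convex_map K P f"
    using u by (auto simp: poset_cat_Hom)
  obtain g g' where g: "w = (L, g, K)" "convex_map L K g" "w' = (L, g', K)" "convex_map L K g'"
    using w by (auto simp: poset_cat_Hom)
  then have ext: "g \<in> fst L \<rightarrow>\<^sub>E fst K" "g' \<in> fst L \<rightarrow>\<^sub>E fst K"
    by (auto simp: convex_map_def poset_map_def)
  have "g q = g' q" if "q \<in> fst L" for q
  proof -
    have "compose (fst L) f g q = compose (fst L) f g' q" using eq by (simp add: f g poset_cat_simps)
    with that ext show ?thesis
      using convex_map_inj[OF f(2-4)] by (auto simp: compose_def dest: inj_onD)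
  qed
  with ext have "g = g'" by (intro extensionalityI[of _ "fst L"]) (auto simp: PiE_iff)
  with g show ?thesis by simp
qed

section \<open>Structures over convex maps: monomorphisms, factorisations and isomorphisms\<close>

abbreviation base :: "'a pmap \<times> 'm \<times> 'o \<Rightarrow> 'a \<Rightarrow> 'a" where
  "base e \<equiv> fst (snd (fst e))"

locale species = pseudofunctor poset_cat R for R :: "('a, 'o, 'm) species"
begin

lemma E_HomD:
  assumes "e \<in> Hom E A B"
  shows fst_E: "fst e = (fst A, base e, fst B)" and E_Hom_poset: "fst e \<in> Hom poset_cat (fst A) (fst B)"
    and base_convex: "convex_map (fst A) (fst B) (base e)"
    and base_poset: "finite_poset (fst A)" "finite_poset (fst B)"
    and base_mem: "p \<in> fst (fst A) \<Longrightarrow> base e p \<in> fst (fst B)"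
    and base_inj: "inj_on (base e) (fst (fst A))"
    and base_reflect: "p \<in> fst (fst A) \<Longrightarrow> q \<in> fst (fst A) \<Longrightarrow>
      (base e p, base e q) \<in> snd (fst B) \<longleftrightarrow> (p, q) \<in> snd (fst A)"
proof -
  obtain K x P y where A: "A = (K, x)" "B = (P, y)" by (cases A, cases B)
  then obtain f \<alpha> where e: "e = ((K, f, P), \<alpha>, y)" "convex_map K P f" "finite_poset K" "finite_poset P"
    using assms by (auto simp: elements_Hom poset_cat_Hom)
  note r = e(2)[unfolded convex_map_iff[OF e(3,4)]]
  show "fst e = (fst A, base e, fst B)" "fst e \<in> Hom poset_cat (fst A) (fst B)"
    "convex_map (fst A) (fst B) (base e)" "finite_poset (fst A)" "finite_poset (fst B)"
    "p \<in> fst (fst A) \<Longrightarrow> base e p \<in> fst (fst B)" "inj_on (base e) (fst (fst A))"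
    "p \<in> fst (fst A) \<Longrightarrow> q \<in> fst (fst A) \<Longrightarrow> (base e p, base e q) \<in> snd (fst B) \<longleftrightarrow> (p, q) \<in> snd (fst A)"
    using e r convex_map_inj[OF e(3,4,2)] by (auto simp: A poset_cat_Hom)
qed

lemma E_fst_Comp:
  assumes "e \<in> Hom E A B" "d \<in> Hom E B D"
  shows "fst (d \<cdot>\<^bsub>E\<^esub> e) = fst d \<cdot>\<^bsub>poset_cat\<^esub> fst e"
  by (cases e, cases d) (simp add: elements_def)

lemma base_Comp:
  assumes "e \<in> Hom E A B" "d \<in> Hom E B D" "p \<in> fst (fst A)"
  shows "base (d \<cdot>\<^bsub>E\<^esub> e) p = base d (base e p)"
proof -
  obtain f g where "fst e = (fst A, f, fst B)" "fst d = (fst B, g, fst D)"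
    using fst_E[OF assms(1)] fst_E[OF assms(2)] by blast
  then show ?thesis
    using assms(3) E_fst_Comp[OF assms(1,2)] by (simp add: poset_cat_simps compose_def)
qed

lemma base_Id: "p \<in> fst (fst A) \<Longrightarrow> base (Id E A) p = p"
  by (cases A) (simp add: elements_Id poset_cat_simps)

text \<open>The base maps can be cancelled because convex maps are injective; over a common base
  map, both arrows solve the same cartesian lifting problem.\<close>

lemma E_mono:
  assumes u: "u \<in> Hom E A B" and w: "w \<in> Hom E A' A" "w' \<in> Hom E A' A" and eq: "u \<cdot>\<^bsub>E\<^esub> w = u \<cdot>\<^bsub>E\<^esub> w'"
  shows "w = w'"
proof -
  obtain K x P y L z where AB: "A = (K, x)" "B = (P, y)" "A' = (L, z)" by (cases A, cases B, cases A')
  have "fst u \<cdot>\<^bsub>poset_cat\<^esub> fst w = fst u \<cdot>\<^bsub>poset_cat\<^esub> fst w'"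
    using arg_cong[OF eq, of fst] unfolding E_fst_Comp[OF w(1) u] E_fst_Comp[OF w(2) u] .
  then have "fst w = fst w'"
    by (rule poset_cat_mono[OF E_Hom_poset[OF u] E_Hom_poset[OF w(1)] E_Hom_poset[OF w(2)]])
  moreover have "fst w \<in> Hom poset_cat L K" "fst u \<cdot>\<^bsub>poset_cat\<^esub> fst w = fst (u \<cdot>\<^bsub>E\<^esub> w)"
    using E_Hom_poset[OF w(1)] E_fst_Comp[OF w(1) u] by (simp_all add: AB)
  moreover have "u \<cdot>\<^bsub>E\<^esub> w \<in> Hom E (L, z) (P, y)"
    using category.Comp_Hom[OF elements_category w(1) u] by (simp add: AB)
  ultimately have "\<exists>!v. v \<in> Hom E (L, z) (K, x) \<and> fst v = fst w' \<and> u \<cdot>\<^bsub>E\<^esub> v = u \<cdot>\<^bsub>E\<^esub> w"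
    using u by (intro elements_cartesian) (simp_all add: AB)
  note the = the1_equality[OF this]
  show ?thesis
  proof (rule trans[OF sym[OF the] the])
    show "w \<in> Hom E (L, z) (K, x) \<and> fst w = fst w' \<and> u \<cdot>\<^bsub>E\<^esub> w = u \<cdot>\<^bsub>E\<^esub> w"
      using w(1) \<open>fst w = fst w'\<close> unfolding AB by blast
    show "w' \<in> Hom E (L, z) (K, x) \<and> fst w' = fst w' \<and> u \<cdot>\<^bsub>E\<^esub> w' = u \<cdot>\<^bsub>E\<^esub> w"
      using w(2) eq[symmetric] unfolding AB by blast
  qed
qed

text \<open>Nested images provide the base map, and cartesianness of \<open>u\<close> provides the
  component in the fibre.\<close>

lemma E_factor:
  assumes u: "u \<in> Hom E A B" and v: "v \<in> Hom E A' B"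
    and sub: "\<And>q. q \<in> fst (fst A') \<Longrightarrow> base v q \<in> base u ` fst (fst A)"
  obtains w where "w \<in> Hom E A' A" "u \<cdot>\<^bsub>E\<^esub> w = v"
proof -
  obtain K x P y L z where AB: "A = (K, x)" "B = (P, y)" "A' = (L, z)" by (cases A, cases B, cases A')
  have "base v ` fst (fst A') \<subseteq> base u ` fst (fst A)" using sub by blast
  then obtain w where "convex_map (fst A') (fst A) w" "compose (fst (fst A')) (base u) w = base v"
    by (rule convex_map_factor[OF base_poset(1)[OF u] base_poset(1)[OF v] base_poset(2)[OF u]
      base_convex[OF u] base_convex[OF v]])
  then have w: "convex_map L K w" "compose (fst L) (base u) w = base v" by (simp_all add: AB)
  have wH: "(L, w, K) \<in> Hom poset_cat L K"
    using w(1) base_poset(1)[OF u] base_poset(1)[OF v] by (simp add: poset_cat_Hom AB)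
  have "fst u \<cdot>\<^bsub>poset_cat\<^esub> (L, w, K) = fst v"
  proof -
    obtain f g where "fst u = (K, f, P)" "fst v = (L, g, P)"
      using fst_E[OF u] fst_E[OF v] unfolding AB fst_conv by blast
    then show ?thesis using w(2) by (simp add: poset_cat_simps)
  qed
  from elements_cartesian[OF u[unfolded AB] v[unfolded AB] wH this]
  obtain w' where "w' \<in> Hom E (L, z) (K, x)" "u \<cdot>\<^bsub>E\<^esub> w' = v" by blast
  then show ?thesis using that[of w'] by (simp add: AB)
qed

text \<open>If \<open>e\<close> is onto, the identity of \<open>B\<close> factors through
  \<open>e\<close>. This gives a right inverse, which is two-sided because \<open>e\<close> is
  monic.\<close>

lemma E_iso_iff:
  assumes e: "e \<in> Hom E A B"
  shows "is_iso E e \<longleftrightarrow> fst (fst B) \<subseteq> base e ` fst (fst A)"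
proof
  interpret E: category E by (rule elements_category)
  assume "is_iso E e"
  then obtain g where g: "g \<in> Hom E B A" "e \<cdot>\<^bsub>E\<^esub> g = Id E B"
    using HomD[OF e] by (auto simp: is_iso_def inverse_arrows_def)
  have "q = base e (base g q)" if "q \<in> fst (fst B)" for q
    using base_Comp[OF g(1) e that] base_Id[OF that] g(2) by simp
  then show "fst (fst B) \<subseteq> base e ` fst (fst A)" using base_mem[OF g(1)] by blast
next
  interpret E: category E by (rule elements_category)
  assume *: "fst (fst B) \<subseteq> base e ` fst (fst A)"
  note B = E.Hom_Obj[OF e]
  obtain g where g: "g \<in> Hom E B A" "e \<cdot>\<^bsub>E\<^esub> g = Id E B"
  proof (rule E_factor[OF e E.Id_Hom[OF B(2)]])
    show "base (Id E B) q \<in> base e ` fst (fst A)" if "q \<in> fst (fst B)" for q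
      using that * by (simp add: base_Id subset_iff)
  qed
  have "g \<cdot>\<^bsub>E\<^esub> e = Id E A"
    using E_mono[OF e E.Comp_Hom[OF e g(1)] E.Id_Hom[OF B(1)]] E.Comp_assoc[OF e g(1) e]
      g(2) E.Comp_Id_left[OF e] E.Comp_Id_right[OF e] by simp
  then show "is_iso E e" using is_isoI[OF e g(1) _ g(2)] by simp
qed

end


section \<open>The simplex category\<close>

abbreviation app :: "smap \<Rightarrow> nat \<Rightarrow> nat" where
  "app a \<equiv> fst (snd a)"

lemma Delta_Hom:
  "a \<in> Hom Delta m n \<longleftrightarrow> (\<exists>f. a = (m, f, n) \<and> f \<in> {0..m} \<rightarrow>\<^sub>E {0..n} \<and> mono_on {0..m} f)"
  by (cases a) (auto simp: Hom_def Delta_def)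

lemma Delta_simps:
  "Obj Delta = UNIV"
  "(n', g, k) \<cdot>\<^bsub>Delta\<^esub> (m, f, n) = (m, compose {0..m} g f, k)"
  "Id Delta n = (n, (\<lambda>i \<in> {0..n}. i), n)"
  "Dom Delta (m, f, n) = m" "Cod Delta (m, f, n) = n"
  by (auto simp: Delta_def)

lemma category_Delta: "category Delta"
proof
  show "Dom Delta f \<in> Obj Delta" "Cod Delta f \<in> Obj Delta" for f
    by (auto simp: Delta_simps)
  show "Id Delta x \<in> Hom Delta x x" for x
    by (auto simp: Delta_simps Delta_Hom mono_on_def)
  show "g \<cdot>\<^bsub>Delta\<^esub> f \<in> Hom Delta x z" if "f \<in> Hom Delta x y" "g \<in> Hom Delta y z" for f g x y z
    using that by (auto simp: Delta_Hom Delta_simps compose_def mono_on_def PiE_iff)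
  show "f \<cdot>\<^bsub>Delta\<^esub> Id Delta x = f" "Id Delta y \<cdot>\<^bsub>Delta\<^esub> f = f" if "f \<in> Hom Delta x y" for f x y
    using that by (auto simp: Delta_Hom Delta_simps compose_def fun_eq_iff PiE_iff extensional_def; metis)+
  show "(h \<cdot>\<^bsub>Delta\<^esub> g) \<cdot>\<^bsub>Delta\<^esub> f = h \<cdot>\<^bsub>Delta\<^esub> (g \<cdot>\<^bsub>Delta\<^esub> f)"
    if "f \<in> Hom Delta w x" "g \<in> Hom Delta x y" "h \<in> Hom Delta y z" for f g h w x y z
    using that by (auto simp: Delta_Hom Delta_simps compose_def fun_eq_iff PiE_iff)
qed

lemma Delta_HomD:
  assumes "a \<in> Hom Delta m n"
  shows app_mono: "i \<le> j \<Longrightarrow> j \<le> m \<Longrightarrow> app a i \<le> app a j"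
    and app_le: "i \<le> m \<Longrightarrow> app a i \<le> n"
    and Delta_triple: "a = (m, app a, n)"
  using assms by (auto simp: Delta_Hom mono_on_def PiE_iff)

lemma app_Comp:
  assumes "a \<in> Hom Delta m n" "b \<in> Hom Delta n k" "i \<le> m"
  shows "app (b \<cdot>\<^bsub>Delta\<^esub> a) i = app b (app a i)"
  using assms by (auto simp: Delta_Hom Delta_simps compose_def)

lemma app_Id: "i \<le> n \<Longrightarrow> app (Id Delta n) i = i"
  by (simp add: Delta_simps)

lemma Delta_eqI:
  assumes "a \<in> Hom Delta m n" "b \<in> Hom Delta m n" "\<And>i. i \<le> m \<Longrightarrow> app a i = app b i"
  shows "a = b"
proof -
  have "app a = app b"
    using assms by (intro extensionalityI[of _ "{0..m}"]) (auto simp: Delta_Hom PiE_iff)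
  with Delta_triple[OF assms(1)] Delta_triple[OF assms(2)] show ?thesis by simp
qed

lemma generic_iff:
  assumes "a \<in> Hom Delta m n"
  shows "generic a \<longleftrightarrow> app a 0 = 0 \<and> app a m = n"
proof -
  obtain f where "a = (m, f, n)" using assms by (auto simp: Delta_Hom)
  then show ?thesis using HomD(1)[OF assms] by (simp add: generic_def)
qed

lemma free_iff:
  assumes "a \<in> Hom Delta m n"
  shows "free a \<longleftrightarrow> (\<forall>i \<le> m. app a i = i + app a 0)"
proof -
  obtain f where "a = (m, f, n)" using assms by (auto simp: Delta_Hom)
  then have "free a \<longleftrightarrow> (\<forall>i < m. app a (i + 1) = app a i + 1)"
    using HomD(1)[OF assms] by (simp add: free_def)
  also have "\<dots> \<longleftrightarrow> (\<forall>i \<le> m. app a i = i + app a 0)"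
  proof
    assume step: "\<forall>i < m. app a (i + 1) = app a i + 1"
    have "app a i = i + app a 0" if "i \<le> m" for i
      using that step by (induction i) auto
    then show "\<forall>i \<le> m. app a i = i + app a 0" by blast
  next
    assume shift: "\<forall>i \<le> m. app a i = i + app a 0"
    show "\<forall>i < m. app a (i + 1) = app a i + 1"
    proof (intro allI impI)
      fix i assume "i < m"
      then show "app a (i + 1) = app a i + 1" using shift[rule_format, of i] shift[rule_format, of "i + 1"] by simp
    qed
  qed
  finally show ?thesis .
qed

text \<open>The half-open intervals between consecutive values of a monotone map are disjoint. At
  \<open>i = 0\<close> truncated subtraction makes the interval empty, so this index creates no
  exception.\<close>

lemma layer_unique:
  assumes a: "a \<in> Hom Delta m n" and "i \<le> m" "app a (i - 1) < j" "j \<le> app a i"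
    and "k \<le> m" "app a (k - 1) < j" "j \<le> app a k"
  shows "i = k"
proof (rule ccontr)
  assume "i \<noteq> k"
  then consider "i \<le> k - 1" | "k \<le> i - 1" by linarith
  then show False
  proof cases
    case 1
    with app_mono[OF a, of i "k - 1"] assms show False by linarith
  next
    case 2
    with app_mono[OF a, of k "i - 1"] assms show False by linarith
  qed
qed

text \<open>The index is the least \<open>i\<close> with \<open>j \<le> app a i\<close>; it is
  positive because \<open>app a 0 < j\<close>. For generic maps this makes the \<open>THE\<close> in
  \<open>under_generic\<close> meaningful.\<close>

lemma ex1_layer:
  assumes a: "a \<in> Hom Delta m n" and j: "app a 0 < j" "j \<le> app a m"
  shows "\<exists>!i. i \<in> {1..m} \<and> app a (i - 1) < j \<and> j \<le> app a i"
proof (rule ex_ex1I)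
  define i where "i = (LEAST i. j \<le> app a i)"
  have i: "j \<le> app a i" "i \<le> m" using j(2) LeastI[of "\<lambda>i. j \<le> app a i" m] Least_le[of "\<lambda>i. j \<le> app a i" m]
    by (auto simp: i_def)
  have "i \<noteq> 0"
  proof
    assume "i = 0"
    with i(1) j(1) show False by simp
  qed
  moreover have "app a (i - 1) < j"
    using not_less_Least[of "i - 1" "\<lambda>i. j \<le> app a i"] \<open>i \<noteq> 0\<close> by (simp add: i_def)
  ultimately show "\<exists>i. i \<in> {1..m} \<and> app a (i - 1) < j \<and> j \<le> app a i"
    using i by (intro exI[of _ i]) auto
  show "k = k'" if "k \<in> {1..m} \<and> app a (k - 1) < j \<and> j \<le> app a k"
    "k' \<in> {1..m} \<and> app a (k' - 1) < j \<and> j \<le> app a k'" for k k'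
    using that by (intro layer_unique[OF a, of k j k']) auto
qed

lemma parts:
  assumes a: "a \<in> Hom Delta m n"
  shows generic_part_Hom: "generic_part a \<in> Hom Delta m (app a m - app a 0)"
    and app_generic_part: "i \<le> m \<Longrightarrow> app (generic_part a) i = app a i - app a 0"
    and free_part_Hom: "free_part a \<in> Hom Delta (app a m - app a 0) n"
    and app_free_part: "i \<le> app a m - app a 0 \<Longrightarrow> app (free_part a) i = i + app a 0"
    and generic_generic_part: "generic (generic_part a)"
proof -
  obtain f where f: "a = (m, f, n)" using a by (auto simp: Delta_Hom)
  have le: "f i \<le> f j" if "i \<le> j" "j \<le> m" for i j using app_mono[OF a that] by (simp add: f)
  have am: "f m \<le> n" using app_le[OF a, of m] by (simp add: f)
  show "generic_part a \<in> Hom Delta m (app a m - app a 0)"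
    by (auto simp: f generic_part_def Delta_Hom mono_on_def intro!: diff_le_mono le)
  show "i \<le> m \<Longrightarrow> app (generic_part a) i = app a i - app a 0"
    by (simp add: f generic_part_def)
  show "free_part a \<in> Hom Delta (app a m - app a 0) n"
    using am le[of 0 m] by (auto simp: f free_part_def Delta_Hom mono_on_def)
  show "i \<le> app a m - app a 0 \<Longrightarrow> app (free_part a) i = i + app a 0"
    by (simp add: f free_part_def)
  show "generic (generic_part a)"
    using generic_free_factorisation(1) HomD(1)[OF a] by blast
qed

section \<open>Arrows of structures over maps in the simplex category\<close>

abbreviation und :: "('a, 'o) lstr \<Rightarrow> 'a poset \<times> 'o" where
  "und x \<equiv> (fst x, snd (snd x))"

abbreviation lay :: "('a, 'o) lstr \<Rightarrow> 'a \<Rightarrow> nat" where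
  "lay x \<equiv> fst (snd x)"

abbreviation car :: "('a, 'o) lstr \<Rightarrow> 'a set" where
  "car x \<equiv> fst (fst x)"

abbreviation mid :: "('a, 'o, 'm) lstr_arrow \<Rightarrow> 'a pmap \<times> 'm \<times> 'o" where
  "mid d \<equiv> fst (snd d)"

lemma layered_Obj:
  "x \<in> Obj (layered R n) \<longleftrightarrow> finite_poset (fst x) \<and> layering n (fst x) (lay x) \<and> snd (snd x) \<in> Obj (grpd R (fst x))"
  by (cases x) (simp add: layered_def Let_def)

lemma layered_Comp: "(y, d, z) \<cdot>\<^bsub>layered R n\<^esub> (x, e, y') = (x, d \<cdot>\<^bsub>elements poset_cat R\<^esub> e, z)"
  by (simp add: layered_def Let_def)

lemma layered_Id: "Id (layered R n) x = (x, Id (elements poset_cat R) (und x), x)"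
  by (cases x) (simp add: layered_def Let_def)

lemma lay_bounds:
  assumes "x \<in> Obj (layered R n)" "p \<in> car x"
  shows "1 \<le> lay x p" "lay x p \<le> n"
  using assms by (auto simp: layered_Obj layering_def PiE_iff)

text \<open>The intervals are arranged in the order of their indices. Used to see that a layering
  stays monotone when it is pulled back along \<open>a\<close>.\<close>

lemma layer_le:
  assumes a: "a \<in> Hom Delta m n" and "i \<le> m" "app a (i - 1) < j" "j \<le> j'" "j' \<le> app a i'"
  shows "i \<le> i'"
proof (rule ccontr)
  assume "\<not> i \<le> i'"
  with app_mono[OF a, of i' "i - 1"] assms show False by linarith
qed

context species
begin

interpretation E: category E by (rule elements_category)
interpretation Delta: category Delta by (rule category_Delta)

text \<open>
  The arrows \<open>und x \<rightarrow> und y\<close> that restrict \<open>y\<close> along \<open>a\<close>: they identify \<open>x\<close> with the part of \<open>y\<close>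
  whose layers lie in the range of \<open>a\<close>.  For identities \<open>a\<close> these are the arrows of \<open>layered R n\<close>.
\<close>

definition over :: "smap \<Rightarrow> nat \<Rightarrow> nat \<Rightarrow> ('a, 'o) lstr \<Rightarrow> 'a pmap \<times> 'm \<times> 'o \<Rightarrow> ('a, 'o) lstr \<Rightarrow> bool" where
  "over a m n x e y \<longleftrightarrow>
     a \<in> Hom Delta m n \<and> x \<in> Obj (layered R m) \<and> y \<in> Obj (layered R n) \<and> e \<in> Hom E (und x) (und y) \<and>
     (\<forall>q \<in> car y. app a 0 < lay y q \<and> lay y q \<le> app a m \<longrightarrow> q \<in> base e ` car x) \<and>
     (\<forall>p \<in> car x. app a (lay x p - 1) < lay y (base e p) \<and> lay y (base e p) \<le> app a (lay x p))"

lemma overD: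
  assumes "over a m n x e y"
  shows over_Delta: "a \<in> Hom Delta m n" and over_source: "x \<in> Obj (layered R m)"
    and over_target: "y \<in> Obj (layered R n)" and over_Hom: "e \<in> Hom E (und x) (und y)"
    and over_surj: "q \<in> car y \<Longrightarrow> app a 0 < lay y q \<Longrightarrow> lay y q \<le> app a m \<Longrightarrow> q \<in> base e ` car x"
    and over_lay: "p \<in> car x \<Longrightarrow> app a (lay x p - 1) < lay y (base e p)"
      "p \<in> car x \<Longrightarrow> lay y (base e p) \<le> app a (lay x p)"
  using assms unfolding over_def by blast+

lemma over_mem:
  assumes "over a m n x e y" "p \<in> car x"
  shows "base e p \<in> car y"
  using base_mem[OF over_Hom[OF assms(1)]] assms(2) by simp

text \<open>Together with \<open>over_surj\<close> this determines the image of
  \<open>base e\<close> from \<open>a\<close> and the layering of \<open>y\<close> alone, so images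
  of such arrows can be compared by comparing ranges of layers.\<close>

lemma over_range:
  assumes e: "over a m n x e y" and p: "p \<in> car x"
  shows "app a 0 < lay y (base e p)" "lay y (base e p) \<le> app a m"
proof -
  note l = lay_bounds[OF over_source[OF e] p] and mono = app_mono[OF over_Delta[OF e]]
  show "app a 0 < lay y (base e p)"
    using over_lay(1)[OF e p] mono[of 0 "lay x p - 1"] l by linarith
  show "lay y (base e p) \<le> app a m"
    using over_lay(2)[OF e p] mono[of "lay x p" m] l by linarith
qed

text \<open>The interval of \<open>i\<close> for the composite is the union of the intervals of
  \<open>b\<close> indexed by the layers in the interval of \<open>i\<close> for
  \<open>a\<close>.\<close>

lemma over_Comp:
  assumes e: "over a m n x e y" and d: "over b n k y d z"
  shows "over (b \<cdot>\<^bsub>Delta\<^esub> a) m k x (d \<cdot>\<^bsub>E\<^esub> e) z"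
  unfolding over_def
proof (intro conjI ballI impI)
  note a = over_Delta[OF e] and b = over_Delta[OF d] and eH = over_Hom[OF e] and dH = over_Hom[OF d]
  show "b \<cdot>\<^bsub>Delta\<^esub> a \<in> Hom Delta m k" by (rule Delta.Comp_Hom[OF a b])
  show "d \<cdot>\<^bsub>E\<^esub> e \<in> Hom E (und x) (und z)" by (rule E.Comp_Hom[OF eH dH])
  have comp: "app (b \<cdot>\<^bsub>Delta\<^esub> a) i = app b (app a i)" if "i \<le> m" for i using app_Comp[OF a b that] .
  have base: "base (d \<cdot>\<^bsub>E\<^esub> e) p = base d (base e p)" if "p \<in> car x" for p
    using base_Comp[OF eH dH] that by simp
  {
    fix r assume r: "r \<in> car z" "app (b \<cdot>\<^bsub>Delta\<^esub> a) 0 < lay z r \<and> lay z r \<le> app (b \<cdot>\<^bsub>Delta\<^esub> a) m"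
    then have lr: "app b (app a 0) < lay z r" "lay z r \<le> app b (app a m)" by (simp_all add: comp)
    have "app b 0 < lay z r" "lay z r \<le> app b n"
      using app_mono[OF b, of 0 "app a 0"] app_mono[OF b, of "app a m" n] app_le[OF a, of 0] app_le[OF a, of m]
        lr by linarith+
    then obtain q where q: "q \<in> car y" "r = base d q" using over_surj[OF d r(1)] by blast
    have "app a 0 < lay y q"
    proof (rule ccontr)
      assume "\<not> ?thesis"
      then show False
        using app_mono[OF b, of "lay y q" "app a 0"] over_lay(2)[OF d q(1)] lr(1) q(2) app_le[OF a, of 0] by simp
    qed
    \<comment> \<open>Were \<open>lay y q\<close> larger, then
      \<open>app a m \<le> lay y q - 1\<close>, and the strict lower bound in \<open>over\<close>
      for \<open>d\<close> would put \<open>base d q\<close> above the range of the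
      composite.\<close>
    moreover have "lay y q \<le> app a m"
    proof (rule ccontr)
      assume "\<not> ?thesis"
      then have "app a m \<le> lay y q - 1" by simp
      then show False
        using app_mono[OF b, of "app a m" "lay y q - 1"] over_lay(1)[OF d q(1)] lr(2)[unfolded q(2)]
          lay_bounds[OF over_source[OF d] q(1)] by linarith
    qed
    ultimately obtain p where p: "p \<in> car x" "q = base e p" using over_surj[OF e q(1)] by blast
    with q base[OF p(1)] have "r = base (d \<cdot>\<^bsub>E\<^esub> e) p" by simp
    with p(1) show "r \<in> base (d \<cdot>\<^bsub>E\<^esub> e) ` car x" by blast
  }
  fix p assume p: "p \<in> car x"
  note q = over_mem[OF e p] and lp = lay_bounds[OF over_source[OF e] p]
  show "app (b \<cdot>\<^bsub>Delta\<^esub> a) (lay x p - 1) < lay z (base (d \<cdot>\<^bsub>E\<^esub> e) p)"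
    using over_lay(1)[OF e p] over_lay(1)[OF d q] lp app_le[OF over_Delta[OF e], of "lay x p - 1"]
      app_mono[OF b, of "app a (lay x p - 1)" "lay y (base e p) - 1"] lay_bounds[OF over_source[OF d] q]
      comp[of "lay x p - 1"]
    unfolding base[OF p] by linarith
  show "lay z (base (d \<cdot>\<^bsub>E\<^esub> e) p) \<le> app (b \<cdot>\<^bsub>Delta\<^esub> a) (lay x p)"
    using over_lay(2)[OF e p] over_lay(2)[OF d q] lp app_le[OF a, of "lay x p"]
      app_mono[OF b, of "lay y (base e p)" "app a (lay x p)"]
    by (simp add: base[OF p] comp)
qed (use over_source[OF e] over_target[OF d] in auto)

text \<open>The image of \<open>f\<close> consists of points of \<open>z\<close> whose layers lie in
  the range of \<open>b\<close>, so it is contained in that of \<open>d\<close> and the arrow exists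
  by \<open>E_factor\<close>. Its layer conditions are reflected along \<open>b\<close>: if one
  failed, monotonicity of \<open>b\<close> would push a point out of its interval for
  \<open>d\<close> or for \<open>f\<close>.\<close>

lemma over_factor:
  assumes d: "over b n k y d z" and f: "over (b \<cdot>\<^bsub>Delta\<^esub> a) m k x f z" and a: "a \<in> Hom Delta m n"
  obtains e where "over a m n x e y" "d \<cdot>\<^bsub>E\<^esub> e = f"
proof -
  note b = over_Delta[OF d] and dH = over_Hom[OF d] and fH = over_Hom[OF f]
  have comp: "app (b \<cdot>\<^bsub>Delta\<^esub> a) i = app b (app a i)" if "i \<le> m" for i using app_Comp[OF a b that] .
  have "base f p \<in> base d ` car y" if p: "p \<in> car x" for p
  proof -
    have "app b (app a 0) < lay z (base f p)" "lay z (base f p) \<le> app b (app a m)"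
      using over_range[OF f p] by (simp_all add: comp)
    then have "app b 0 < lay z (base f p)" "lay z (base f p) \<le> app b n"
      using app_mono[OF b, of 0 "app a 0"] app_mono[OF b, of "app a m" n] app_le[OF a, of 0] app_le[OF a, of m]
      by linarith+
    then show ?thesis using over_surj[OF d over_mem[OF f p]] by blast
  qed
  then obtain e where eH: "e \<in> Hom E (und x) (und y)" and de: "d \<cdot>\<^bsub>E\<^esub> e = f"
    by (rule E_factor[OF dH fH, unfolded fst_conv])
  have base: "base f p = base d (base e p)" if "p \<in> car x" for p
    using base_Comp[OF eH dH] that de by auto
  have mem: "base e p \<in> car y" if "p \<in> car x" for p using base_mem[OF eH] that by simp
  have "over a m n x e y"
    unfolding over_def
  proof (intro conjI ballI impI)
    fix q assume q: "q \<in> car y" "app a 0 < lay y q \<and> lay y q \<le> app a m"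
    note lq = lay_bounds[OF over_source[OF d] q(1)]
    have "app b (app a 0) < lay z (base d q)"
      using over_lay(1)[OF d q(1)] app_mono[OF b, of "app a 0" "lay y q - 1"] q(2) lq by linarith
    moreover have "lay z (base d q) \<le> app b (app a m)"
      using over_lay(2)[OF d q(1)] app_mono[OF b, of "lay y q" "app a m"] q app_le[OF a, of m] by simp
    ultimately obtain p where p: "p \<in> car x" "base d q = base f p"
      using over_surj[OF f over_mem[OF d q(1)]] by (auto simp: comp)
    have "q = base e p"
      using base_inj[OF dH] p q mem[OF p(1)] base[OF p(1)] by (auto dest: inj_onD)
    with p show "q \<in> base e ` car x" by blast
  next
    fix p assume p: "p \<in> car x"
    note lp = lay_bounds[OF over_source[OF f] p] and lq = lay_bounds[OF over_source[OF d] mem[OF p]]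
    have 1: "app b (app a (lay x p - 1)) < lay z (base f p)" "lay z (base f p) \<le> app b (app a (lay x p))"
      using over_lay[OF f p] lp by (simp_all add: comp)
    have 2: "app b (lay y (base e p) - 1) < lay z (base f p)" "lay z (base f p) \<le> app b (lay y (base e p))"
      using over_lay[OF d mem[OF p]] base[OF p] by simp_all
    show "app a (lay x p - 1) < lay y (base e p)"
    proof (rule ccontr)
      assume "\<not> ?thesis"
      with 1(1) 2(2) app_mono[OF b, of "lay y (base e p)" "app a (lay x p - 1)"] app_le[OF a, of "lay x p - 1"] lp
      show False by linarith
    qed
    show "lay y (base e p) \<le> app a (lay x p)"
    proof (rule ccontr)
      assume "\<not> ?thesis"
      with 1(2) 2(1) app_mono[OF b, of "app a (lay x p)" "lay y (base e p) - 1"] lq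
      show False by linarith
    qed
  qed (use a eH over_source[OF f] over_source[OF d] in auto)
  then show ?thesis using de by (rule that)
qed

lemma und_Obj: "x \<in> Obj (layered R n) \<Longrightarrow> und x \<in> Obj E"
  by (simp add: layered_Obj elements_Obj poset_cat_simps)

lemma over_Id:
  assumes x: "x \<in> Obj (layered R n)"
  shows "over (Id Delta n) n n x (Id E (und x)) x"
proof -
  have base: "base (Id E (und x)) p = p" if "p \<in> car x" for p using base_Id[of p "und x"] that by simp
  have "Id Delta n \<in> Hom Delta n n" by (rule Delta.Id_Hom) (simp add: Delta_simps)
  moreover have "q \<in> base (Id E (und x)) ` car x" if "q \<in> car x" for q
    using base[OF that] that by (metis image_eqI)
  ultimately show ?thesis
    using x E.Id_Hom[OF und_Obj[OF x]] lay_bounds[OF x] by (fastforce simp: over_def base app_Id)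
qed

text \<open>For an identity map the interval of \<open>i\<close> contains only \<open>i\<close>, so
  the layer condition becomes equality of layers; its range is everything, so the surjectivity
  condition becomes invertibility by \<open>E_iso_iff\<close>.\<close>

lemma layered_Hom:
  "d \<in> Hom (layered R n) x y \<longleftrightarrow> (\<exists>e. d = (x, e, y) \<and> over (Id Delta n) n n x e y)"
proof -
  have i: "Id Delta n \<in> Hom Delta n n" by (rule Delta.Id_Hom) (simp add: Delta_simps)
  have "over (Id Delta n) n n x e y \<longleftrightarrow> x \<in> Obj (layered R n) \<and> y \<in> Obj (layered R n) \<and>
      e \<in> Hom E (und x) (und y) \<and> is_iso E e \<and> (\<forall>p \<in> car x. lay y (base e p) = lay x p)" (is "_ \<longleftrightarrow> ?r") for e
  proof
    assume e: "over (Id Delta n) n n x e y"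
    note eH = over_Hom[OF e]
    have "car y \<subseteq> base e ` car x"
      using over_surj[OF e] lay_bounds[OF over_target[OF e]] by (fastforce simp: app_Id)
    then have "is_iso E e" using E_iso_iff[OF eH] by simp
    moreover have "lay y (base e p) = lay x p" if "p \<in> car x" for p
      using over_lay[OF e that] lay_bounds[OF over_source[OF e] that] by (simp add: app_Id)
    ultimately show ?r using over_source[OF e] over_target[OF e] eH by blast
  next
    assume r: ?r
    then have "car y \<subseteq> base e ` car x" using E_iso_iff[of e "und x" "und y"] by simp
    moreover have "app (Id Delta n) (lay x p - 1) < lay y (base e p) \<and> lay y (base e p) \<le> app (Id Delta n) (lay x p)"
      if "p \<in> car x" for p using r that lay_bounds[of x R n p] by (simp add: app_Id)
    ultimately show "over (Id Delta n) n n x e y"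
      using r i unfolding over_def by blast
  qed
  then show ?thesis
    by (cases d; cases x; cases y) (auto simp: Hom_def layered_def Let_def)
qed

lemma over_left_unit:
  assumes "over a m n x e y"
  shows "Id Delta n \<cdot>\<^bsub>Delta\<^esub> a = a" "a \<cdot>\<^bsub>Delta\<^esub> Id Delta m = a"
  using Delta.Comp_Id_left[OF over_Delta[OF assms]] Delta.Comp_Id_right[OF over_Delta[OF assms]] by auto

lemma layered_HomD:
  assumes "d \<in> Hom (layered R n) x y"
  shows "over (Id Delta n) n n x (mid d) y" "d = (x, mid d, y)" "mid d \<in> Hom E (und x) (und y)"
proof -
  obtain e where e: "d = (x, e, y)" "over (Id Delta n) n n x e y"
    using assms unfolding layered_Hom by blast
  show "over (Id Delta n) n n x (mid d) y" "d = (x, mid d, y)" "mid d \<in> Hom E (und x) (und y)"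
    using e(2) over_Hom[OF e(2)] by (simp_all add: e(1))
qed

text \<open>The form in which monomorphisms are used below: arrows of layered structures carry their
  source and target, so it remains to compare their middle components, and \<open>f\<close> cancels
  there.\<close>

lemma over_cancel:
  assumes f: "over b n k y f z" and d: "d \<in> Hom (layered R n) x y" "d' \<in> Hom (layered R n) x y"
    and eq: "f \<cdot>\<^bsub>E\<^esub> mid d = f \<cdot>\<^bsub>E\<^esub> mid d'"
  shows "d = d'"
proof -
  have "mid d = mid d'"
    by (rule E_mono[OF over_Hom[OF f] layered_HomD(3)[OF d(1)] layered_HomD(3)[OF d(2)] eq])
  then show ?thesis
    using layered_HomD(2)[OF d(1)] layered_HomD(2)[OF d(2)] by simp
qed

lemma category_layered: "category (layered R n)"
proof
  show "Dom (layered R n) f \<in> Obj (layered R n)" "Cod (layered R n) f \<in> Obj (layered R n)"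
    if "f \<in> Arr (layered R n)" for f
    using that by (auto simp: layered_def Let_def)
  show "Id (layered R n) x \<in> Hom (layered R n) x x" if "x \<in> Obj (layered R n)" for x
    using over_Id[OF that] by (simp add: layered_Id layered_Hom)
  fix f x y assume f: "f \<in> Hom (layered R n) x y"
  obtain e where e: "f = (x, e, y)" "over (Id Delta n) n n x e y" using f by (auto simp: layered_Hom)
  show "f \<cdot>\<^bsub>layered R n\<^esub> Id (layered R n) x = f" "Id (layered R n) y \<cdot>\<^bsub>layered R n\<^esub> f = f"
    using E.Comp_Id_left[OF over_Hom[OF e(2)]] E.Comp_Id_right[OF over_Hom[OF e(2)]]
    by (simp_all add: e(1) layered_Id layered_Comp)
  show "g \<cdot>\<^bsub>layered R n\<^esub> f \<in> Hom (layered R n) x z" if g: "g \<in> Hom (layered R n) y z" for g z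
  proof -
    obtain d where d: "g = (y, d, z)" "over (Id Delta n) n n y d z" using g unfolding layered_Hom by blast
    then show ?thesis
      using over_Comp[OF e(2) d(2)] over_left_unit[OF e(2)] by (simp add: e(1) d(1) layered_Hom layered_Comp)
  qed
  show "(h \<cdot>\<^bsub>layered R n\<^esub> g) \<cdot>\<^bsub>layered R n\<^esub> f = h \<cdot>\<^bsub>layered R n\<^esub> (g \<cdot>\<^bsub>layered R n\<^esub> f)"
    if gh: "g \<in> Hom (layered R n) y z" "h \<in> Hom (layered R n) z w" for g h z w
  proof -
    obtain d c where "g = (y, d, z)" "over (Id Delta n) n n y d z" "h = (z, c, w)" "over (Id Delta n) n n z c w"
      using gh unfolding layered_Hom by blast
    then show ?thesis
      using E.Comp_assoc[OF over_Hom[OF e(2)] over_Hom over_Hom] by (simp add: e(1) layered_Comp)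
  qed
qed

lemma mid_Comp:
  assumes "d \<in> Hom (layered R n) x y" "d' \<in> Hom (layered R n) y z"
  shows "mid (d' \<cdot>\<^bsub>layered R n\<^esub> d) = mid d' \<cdot>\<^bsub>E\<^esub> mid d"
  using assms by (auto simp: layered_Hom layered_Comp)

text \<open>A right inverse comes from factoring the identity of \<open>y\<close> through
  \<open>d\<close>, both being arrows over an identity map. It is a left inverse as well because
  \<open>d\<close> is monic.\<close>

lemma groupoid_layered: "groupoid (layered R n)"
proof (rule groupoidI[OF category_layered])
  interpret L: category "layered R n" by (rule category_layered)
  fix x y d assume d: "d \<in> Hom (layered R n) x y"
  note dx = layered_HomD[OF d] and xy = L.Hom_Obj[OF d]
  have "over (Id Delta n \<cdot>\<^bsub>Delta\<^esub> Id Delta n) n n y (Id E (und y)) y"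
    using over_Id[OF xy(2)] over_left_unit[OF over_Id[OF xy(2)]] by simp
  then obtain e where e: "over (Id Delta n) n n y e x" "mid d \<cdot>\<^bsub>E\<^esub> e = Id E (und y)"
    using over_Delta[OF dx(1)] by (rule over_factor[OF dx(1)])
  have g: "(y, e, x) \<in> Hom (layered R n) y x" using e by (simp add: layered_Hom)
  have dg: "d \<cdot>\<^bsub>layered R n\<^esub> (y, e, x) = Id (layered R n) y"
    by (subst dx(2)) (simp add: layered_Comp layered_Id e)
  have "(y, e, x) \<cdot>\<^bsub>layered R n\<^esub> d = Id (layered R n) x"
  proof (rule over_cancel[OF dx(1) L.Comp_Hom[OF d g] L.Id_Hom[OF xy(1)]])
    have "mid d \<cdot>\<^bsub>E\<^esub> mid ((y, e, x) \<cdot>\<^bsub>layered R n\<^esub> d) = mid (d \<cdot>\<^bsub>layered R n\<^esub> ((y, e, x) \<cdot>\<^bsub>layered R n\<^esub> d))"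
      using mid_Comp[OF L.Comp_Hom[OF d g] d] by simp
    also have "\<dots> = mid (d \<cdot>\<^bsub>layered R n\<^esub> Id (layered R n) x)"
      using L.Comp_assoc[OF d g d] dg L.Comp_Id_left[OF d] L.Comp_Id_right[OF d] by simp
    also have "\<dots> = mid d \<cdot>\<^bsub>E\<^esub> mid (Id (layered R n) x)"
      by (rule mid_Comp[OF L.Id_Hom[OF xy(1)] d])
    finally show "mid d \<cdot>\<^bsub>E\<^esub> mid ((y, e, x) \<cdot>\<^bsub>layered R n\<^esub> d) = mid d \<cdot>\<^bsub>E\<^esub> mid (Id (layered R n) x)" .
  qed
  with g dg show "\<exists>g \<in> Hom (layered R n) y x. g \<cdot>\<^bsub>layered R n\<^esub> d = Id (layered R n) x \<and>
      d \<cdot>\<^bsub>layered R n\<^esub> g = Id (layered R n) y" by blast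
qed

end


section \<open>Restriction along maps in the simplex category\<close>

lemma under_generic:
  assumes a: "a \<in> Hom Delta m n" and g: "generic a" and j: "j \<in> {1..n}"
  shows "under_generic a j \<in> {1..m}" "app a (under_generic a j - 1) < j" "j \<le> app a (under_generic a j)"
proof -
  obtain f where f: "a = (m, f, n)" using a by (auto simp: Delta_Hom)
  have "app a 0 < j" "j \<le> app a m" using g j by (auto simp: generic_iff[OF a])
  from theI'[OF ex1_layer[OF a this]]
  have "under_generic a j \<in> {1..m} \<and> app a (under_generic a j - 1) < j \<and> j \<le> app a (under_generic a j)"
    using j unfolding f under_generic_def by simp
  then show "under_generic a j \<in> {1..m}" "app a (under_generic a j - 1) < j" "j \<le> app a (under_generic a j)"
    by auto
qed

lemma act_obj_generic':
  assumes "a \<in> Hom Delta m n" "generic a"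
  shows "act_obj R a x = (fst x, compose (car x) (under_generic a) (lay x), snd (snd x))"
  using assms by (cases x) (simp add: act_obj_generic generic_act_def)

lemma restr_arrow_generic: "generic a \<Longrightarrow> restr_arrow R a x = Id (elements poset_cat R) (und x)"
  by (cases x) (simp add: restr_arrow_def)

text \<open>The map of layers belonging to the free part is a shift by \<open>app a 0\<close>: its
  image is the block of layers between \<open>app a 0\<close> and \<open>app a m\<close>, and its
  inverse is subtraction.\<close>

lemma preimage_poset_free_part:
  assumes a: "a \<in> Hom Delta m n"
  shows "preimage_poset (free_part a) P l = subposet P {p \<in> fst P. app a 0 < l p \<and> l p \<le> app a m}"
    and "j \<in> {app a 0 <.. app a m} \<Longrightarrow>
      inv_into {1..Dom Delta (free_part a)} (under_free (free_part a)) j = j - app a 0"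
proof -
  define k where "k = app a m - app a 0"
  obtain f where f: "free_part a = (k, f, n)" using free_part_Hom[OF a] by (auto simp: Delta_Hom k_def)
  have f0: "f 0 = app a 0" using app_free_part[OF a, of 0] by (simp add: f)
  have uf: "under_free (free_part a) i = i + app a 0" if "i \<in> {1..k}" for i
    using that by (simp add: f under_free_def f0)
  have D: "Dom Delta (free_part a) = k" by (simp add: f Delta_simps)
  have am: "app a 0 \<le> app a m" using app_mono[OF a, of 0 m] by simp
  have img: "j \<in> under_free (free_part a) ` {1..k} \<longleftrightarrow> app a 0 < j \<and> j \<le> app a m" for j
  proof
    assume "j \<in> under_free (free_part a) ` {1..k}"
    then show "app a 0 < j \<and> j \<le> app a m" using uf am by (auto simp: k_def)
  next
    assume *: "app a 0 < j \<and> j \<le> app a m"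
    then have "j - app a 0 \<in> {1..k}" by (auto simp: k_def)
    moreover from uf[OF this] * have "j = under_free (free_part a) (j - app a 0)" by simp
    ultimately show "j \<in> under_free (free_part a) ` {1..k}" by blast
  qed
  show "preimage_poset (free_part a) P l = subposet P {p \<in> fst P. app a 0 < l p \<and> l p \<le> app a m}"
    unfolding preimage_poset_def D img ..
  assume j: "j \<in> {app a 0 <.. app a m}"
  then have "j \<in> under_free (free_part a) ` {1..k}" using img by simp
  from inv_into_into[OF this] f_inv_into_f[OF this] uf
  show "inv_into {1..Dom Delta (free_part a)} (under_free (free_part a)) j = j - app a 0"
    unfolding D by (metis add_diff_cancel_right')
qed

context species
begin

interpretation E: category E by (rule elements_category)
interpretation Delta: category Delta by (rule category_Delta)

text \<open>Here the prescription by factorisation meets the intervals of \<open>over\<close>. A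
  generic map keeps the structure and sends each layer to the interval containing it. Otherwise the
  structure is cut down to the block of layers reached by \<open>a\<close>, the offset is removed,
  and the generic part relabels what remains.\<close>

lemma restr_over:
  assumes a: "a \<in> Hom Delta m n" and x: "x \<in> Obj (layered R n)"
  shows "over a m n (act_obj R a x) (restr_arrow R a x) x"
proof (cases "generic a")
  case True
  let ?l = "compose (car x) (under_generic a) (lay x)"
  have l: "?l p \<in> {1..m}" "app a (?l p - 1) < lay x p" "lay x p \<le> app a (?l p)" if "p \<in> car x" for p
    using under_generic[OF a True, of "lay x p"] lay_bounds[OF x that] that by (auto simp: compose_def)
  have "layering m (fst x) ?l"
    unfolding layering_def
  proof (intro conjI allI impI)
    show "?l \<in> car x \<rightarrow>\<^sub>E {1..m}" using l(1) by (auto simp: compose_def)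
    fix p q assume pq: "(p, q) \<in> snd (fst x)"
    then have "p \<in> car x" "q \<in> car x" "lay x p \<le> lay x q"
      using x poset_carrier[of "fst x"] by (auto simp: layered_Obj layering_def)
    then show "?l p \<le> ?l q" using layer_le[OF a, of "?l p" "lay x p" "lay x q" "?l q"] l[of p] l[of q] by simp
  qed
  then have "(fst x, ?l, snd (snd x)) \<in> Obj (layered R m)"
    using x by (simp add: layered_Obj)
  moreover have "base (Id E (und x)) p = p" if "p \<in> car x" for p
    using base_Id[of p "und x"] that by simp
  moreover from this have "p \<in> base (Id E (und x)) ` car x" if "p \<in> car x" for p
    using that by (metis image_eqI)
  ultimately show ?thesis
    using a x E.Id_Hom[OF und_Obj[OF x]] l
    unfolding act_obj_generic'[OF a True] restr_arrow_generic[OF True] over_def by simp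
next
  case False
  obtain P l X where x': "x = (P, l, X)" by (cases x)
  have P: "finite_poset P" and l: "layering n P l" and X: "X \<in> Obj (grpd R P)"
    using x by (auto simp: x' layered_Obj)
  define K where "K = {p \<in> fst P. app a 0 < l p \<and> l p \<le> app a m}"
  define Q where "Q = subposet P K"
  define l' where "l' = (\<lambda>p \<in> K. under_generic (generic_part a) (l p - app a 0))"
  define i where "i = inclusion Q P"
  have K: "K \<subseteq> fst P" by (auto simp: K_def)
  have Q: "finite_poset Q" "fst Q = K" "snd Q = Restr (snd P) K"
    unfolding Q_def using finite_poset_subposet[OF P K] by (simp_all add: subposet_def)
  have pre: "preimage_poset (free_part a) P l = Q"
    by (simp add: preimage_poset_free_part(1)[OF a] Q_def K_def)
  have act: "act_obj R a x = (Q, l', on_obj (pull R i) X)"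
    using False preimage_poset_free_part(2)[OF a]
    unfolding x' act_obj_def free_act_def generic_act_def Let_def
    by (auto simp: pre i_def l'_def compose_def Q(2) K_def fun_eq_iff restrict_def)
  have restr: "restr_arrow R a x = (i, Id (grpd R Q) (on_obj (pull R i) X), X)"
    using False unfolding x' restr_arrow_def Let_def by (simp add: pre i_def)
  note gH = generic_part_Hom[OF a] and g = generic_generic_part[OF a]
  have lay: "l' p \<in> {1..m}" "app a (l' p - 1) < l p" "l p \<le> app a (l' p)" if p: "p \<in> K" for p
  proof -
    have "l p - app a 0 \<in> {1..app a m - app a 0}" using p by (auto simp: K_def)
    from under_generic[OF gH g this]
    have u: "l' p \<in> {1..m}" "app (generic_part a) (l' p - 1) < l p - app a 0"
      "l p - app a 0 \<le> app (generic_part a) (l' p)"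
      using p by (simp_all add: l'_def)
    then show "l' p \<in> {1..m}" by simp
    \<comment> \<open>\<open>app a 0\<close> bounds both sides from below, so the offset subtracted
      in \<open>generic_part\<close> can be added back without truncation.\<close>
    show "app a (l' p - 1) < l p" using u app_generic_part[OF a, of "l' p - 1"] app_mono[OF a, of 0 "l' p - 1"] by fastforce
    show "l p \<le> app a (l' p)" using u app_generic_part[OF a, of "l' p"] app_mono[OF a, of 0 "l' p"] p
      by (auto simp: K_def)
  qed
  have mono: "l p \<le> l q" if "(p, q) \<in> snd P" for p q using l that by (simp add: layering_def)
  have "layering m Q l'"
    unfolding layering_def Q
  proof (intro conjI allI impI)
    show "l' \<in> K \<rightarrow>\<^sub>E {1..m}" using lay(1) by (auto simp: l'_def)
    fix p q assume "(p, q) \<in> Restr (snd P) K"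
    then show "l' p \<le> l' q"
      using layer_le[OF a, of "l' p" "l p" "l q" "l' q"] lay[of p] lay[of q] mono by auto
  qed
  moreover have i: "i \<in> Hom poset_cat Q P"
  proof -
    have "convex_map Q P (\<lambda>k \<in> K. k)"
      unfolding convex_map_iff[OF Q(1) P] Q(2)
    proof (intro conjI ballI impI)
      fix p q assume pq: "p \<in> K" "q \<in> K"
      then show "(((\<lambda>k \<in> K. k) p, (\<lambda>k \<in> K. k) q) \<in> snd P) = ((p, q) \<in> snd Q)" by (simp add: Q(3))
      \<comment> \<open>Convexity of the block: layers are monotone, so a point between two points
        of \<open>K\<close> has its layer between theirs, hence inside the block.\<close>
      fix y assume y: "y \<in> fst P" "((\<lambda>k \<in> K. k) p, y) \<in> snd P \<and> (y, (\<lambda>k \<in> K. k) q) \<in> snd P"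
      then have "l p \<le> l y" "l y \<le> l q" using mono pq by auto
      then have "y \<in> K" using y(1) pq by (simp add: K_def)
      then show "y \<in> (\<lambda>k \<in> K. k) ` K" by simp
    qed (use K in auto)
    then show ?thesis
      by (simp add: i_def inclusion_def poset_cat_Hom P Q(1,2))
  qed
  ultimately have "act_obj R a x \<in> Obj (layered R m)"
    using Q functor_Obj[OF pull_functor[OF i] X] by (simp add: act layered_Obj)
  moreover have "restr_arrow R a x \<in> Hom E (und (act_obj R a x)) (und x)"
  proof -
    interpret Q: groupoid "grpd R Q" by (rule grpd_groupoid) (simp add: poset_cat_simps Q)
    show ?thesis using i X Q.Id_Hom functor_Obj[OF pull_functor[OF i] X]
      unfolding restr act unfolding x' by (simp add: elements_Hom)
  qed
  moreover have base: "base (restr_arrow R a x) = (\<lambda>k \<in> K. k)"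
    by (simp add: restr i_def inclusion_def Q)
  moreover have "q \<in> (\<lambda>k \<in> K. k) ` K" if "q \<in> fst P" "app a 0 < l q \<and> l q \<le> app a m" for q
    using that by (simp add: K_def)
  moreover have "app a (l' p - 1) < l ((\<lambda>k \<in> K. k) p) \<and> l ((\<lambda>k \<in> K. k) p) \<le> app a (l' p)" if "p \<in> K" for p
    using lay[OF that] that by simp
  ultimately show ?thesis
    using a x unfolding over_def base act unfolding x' by (simp add: Q(2))
qed

text \<open>The common shape of the \<open>THE\<close> expressions in \<open>act_arr\<close>, in the
  compositor and in \<open>induced_map\<close>; each of them is unfolded to a \<open>lift\<close>
  once and afterwards known only through its defining equation.\<close>

definition lift :: "smap \<Rightarrow> ('a, 'o) lstr \<Rightarrow> 'a pmap \<times> 'm \<times> 'o \<Rightarrow> ('a, 'o) lstr \<Rightarrow> ('a, 'o, 'm) lstr_arrow" where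
  "lift a x f y = (THE d. d \<in> Hom (layered R (Dom Delta a)) x (act_obj R a y) \<and>
     restr_arrow R a y \<cdot>\<^bsub>E\<^esub> mid d = f)"

text \<open>Existence is \<open>over_factor\<close> for \<open>a\<close> written as \<open>a\<close>
  after an identity; uniqueness is \<open>over_cancel\<close>.\<close>

lemma lift:
  assumes f: "over a m n x f y"
  shows lift_Hom: "lift a x f y \<in> Hom (layered R m) x (act_obj R a y)"
    and restr_lift: "restr_arrow R a y \<cdot>\<^bsub>E\<^esub> mid (lift a x f y) = f"
    and lift_unique: "d \<in> Hom (layered R m) x (act_obj R a y) \<Longrightarrow> restr_arrow R a y \<cdot>\<^bsub>E\<^esub> mid d = f \<Longrightarrow>
      lift a x f y = d"
proof -
  note a = over_Delta[OF f] and r = restr_over[OF over_Delta[OF f] over_target[OF f]]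
  have "over (a \<cdot>\<^bsub>Delta\<^esub> Id Delta m) m n x f y" using f over_left_unit[OF f] by simp
  moreover have "Id Delta m \<in> Hom Delta m m" by (rule Delta.Id_Hom) (simp add: Delta_simps)
  ultimately obtain e where "over (Id Delta m) m m x e (act_obj R a y)" "restr_arrow R a y \<cdot>\<^bsub>E\<^esub> e = f"
    by (rule over_factor[OF r])
  then have d: "(x, e, act_obj R a y) \<in> Hom (layered R m) x (act_obj R a y)"
    "restr_arrow R a y \<cdot>\<^bsub>E\<^esub> mid (x, e, act_obj R a y) = f"
    by (simp_all add: layered_Hom)
  have eqI: "lift a x f y = d"
    if "d \<in> Hom (layered R m) x (act_obj R a y)" "restr_arrow R a y \<cdot>\<^bsub>E\<^esub> mid d = f" for d
    unfolding lift_def HomD(2)[OF a]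
  proof (rule the_equality)
    fix d' assume d': "d' \<in> Hom (layered R m) x (act_obj R a y) \<and> restr_arrow R a y \<cdot>\<^bsub>E\<^esub> mid d' = f"
    show "d' = d"
      by (rule over_cancel[OF r conjunct1[OF d'] that(1) trans[OF conjunct2[OF d'] sym[OF that(2)]]])
  qed (use that in blast)
  show "lift a x f y \<in> Hom (layered R m) x (act_obj R a y)" "restr_arrow R a y \<cdot>\<^bsub>E\<^esub> mid (lift a x f y) = f"
    unfolding eqI[OF d] by (rule d)+
  show "d \<in> Hom (layered R m) x (act_obj R a y) \<Longrightarrow> restr_arrow R a y \<cdot>\<^bsub>E\<^esub> mid d = f \<Longrightarrow>
      lift a x f y = d" by (rule eqI)
qed

end

section \<open>The simplicial groupoid: pullback functors, compositors and coherence\<close>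

lemma grpd_layered_space [simp]: "grpd (layered_space R) = layered R"
  and unitor_layered_space [simp]: "unitor (layered_space R) n = Id (layered R n)"
  by (simp_all add: layered_space_def)

text \<open>Holds on the nose because an identity map is treated as generic, so nothing is
  restricted. This is why the unitor can be an identity.\<close>

lemma act_obj_Id:
  assumes x: "x \<in> Obj (layered R n)"
  shows "act_obj R (Id Delta n) x = x"
proof -
  have i: "Id Delta n \<in> Hom Delta n n" using category.Id_Hom[OF category_Delta] by (simp add: Delta_simps)
  have g: "generic (Id Delta n)" by (simp add: generic_iff[OF i] app_Id)
  have l: "lay x \<in> car x \<rightarrow>\<^sub>E {1..n}" using x by (simp add: layered_Obj layering_def)
  have "compose (car x) (under_generic (Id Delta n)) (lay x) = lay x"
  proof (rule extensionalityI)
    show "compose (car x) (under_generic (Id Delta n)) (lay x) \<in> extensional (car x)" by (simp add: compose_def)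
    show "lay x \<in> extensional (car x)" using l by (simp add: PiE_iff)
    fix p assume p: "p \<in> car x"
    then have "lay x p \<in> {1..n}" using l by auto
    then show "compose (car x) (under_generic (Id Delta n)) (lay x) p = lay x p"
      using under_generic[OF i g, of "lay x p"] p by (simp add: compose_def app_Id)
  qed
  then show ?thesis by (cases x) (simp add: act_obj_generic'[OF i g])
qed

lemma restr_arrow_Id: "restr_arrow R (Id Delta n) x = Id (elements poset_cat R) (und x)"
proof -
  have i: "Id Delta n \<in> Hom Delta n n" using category.Id_Hom[OF category_Delta] by (simp add: Delta_simps)
  have "generic (Id Delta n)" by (simp add: generic_iff[OF i] app_Id)
  then show ?thesis by (rule restr_arrow_generic)
qed

lemma pull_obj_layered_space:
  assumes "a \<in> Hom Delta m n" "x \<in> Obj (layered R n)"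
  shows "on_obj (pull (layered_space R) a) x = act_obj R a x"
  using assms HomD[OF assms(1)] by (simp add: layered_space_def)

context species
begin

interpretation E: category E by (rule elements_category)
interpretation Delta: category Delta by (rule category_Delta)

lemma act_Obj:
  assumes "a \<in> Hom Delta m n" "x \<in> Obj (layered R n)"
  shows "act_obj R a x \<in> Obj (layered R m)"
  by (rule over_source[OF restr_over[OF assms]])

lemma restr_Hom:
  assumes "a \<in> Hom Delta m n" "x \<in> Obj (layered R n)"
  shows "restr_arrow R a x \<in> Hom E (und (act_obj R a x)) (und x)"
  by (rule over_Hom[OF restr_over[OF assms]])

text \<open>The definition of \<open>act_arr\<close> is opened only here; afterwards the action on
  arrows enters through its square with the restriction arrows.\<close>

lemma pull_arr_layered_space:
  assumes a: "a \<in> Hom Delta m n" and d: "d \<in> Hom (layered R n) x y"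
  shows pull_arr_Hom: "on_arr (pull (layered_space R) a) d \<in> Hom (layered R m) (act_obj R a x) (act_obj R a y)"
    and restr_pull_arr: "restr_arrow R a y \<cdot>\<^bsub>E\<^esub> mid (on_arr (pull (layered_space R) a) d) =
      mid d \<cdot>\<^bsub>E\<^esub> restr_arrow R a x"
proof -
  note dx = layered_HomD[OF d]
  have x: "x \<in> Obj (layered R n)" by (rule over_source[OF dx(1)])
  have "over (Id Delta n \<cdot>\<^bsub>Delta\<^esub> a) m n (act_obj R a x) (mid d \<cdot>\<^bsub>E\<^esub> restr_arrow R a x) y"
    by (rule over_Comp[OF restr_over[OF a x] dx(1)])
  then have o: "over a m n (act_obj R a x) (mid d \<cdot>\<^bsub>E\<^esub> restr_arrow R a x) y"
    using Delta.Comp_Id_left[OF a] by simp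
  have "act_arr R a (x, mid d, y) = lift a (act_obj R a x) (mid d \<cdot>\<^bsub>E\<^esub> restr_arrow R a x) y"
    by (simp add: act_arr_def lift_def)
  then have eq: "on_arr (pull (layered_space R) a) d = lift a (act_obj R a x) (mid d \<cdot>\<^bsub>E\<^esub> restr_arrow R a x) y"
    using HomD(1)[OF d] HomD(3)[OF a] dx(2) by (simp add: layered_space_def)
  show "on_arr (pull (layered_space R) a) d \<in> Hom (layered R m) (act_obj R a x) (act_obj R a y)"
    "restr_arrow R a y \<cdot>\<^bsub>E\<^esub> mid (on_arr (pull (layered_space R) a) d) = mid d \<cdot>\<^bsub>E\<^esub> restr_arrow R a x"
    unfolding eq using lift_Hom[OF o] restr_lift[OF o] .
qed

text \<open>Both functor laws are equations between arrows into a restriction. After composing with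
  the restriction arrow, they follow by pasting the squares \<open>restr_pull_arr\<close>.\<close>

lemma pull_functor_layered_space:
  assumes a: "a \<in> Hom Delta m n"
  shows "is_functor (layered R n) (layered R m) (pull (layered_space R) a)"
proof (rule is_functorI)
  let ?p = "pull (layered_space R) a"
  interpret Ln: category "layered R n" by (rule category_layered)
  interpret Lm: category "layered R m" by (rule category_layered)
  note obj = pull_obj_layered_space[OF a] and H = pull_arr_Hom[OF a] and r = restr_pull_arr[OF a]
  show "category (layered R n)" "category (layered R m)" by (rule category_layered)+
  show "on_obj ?p \<in> extensional (Obj (layered R n))" "on_arr ?p \<in> extensional (Arr (layered R n))"
    using HomD(3)[OF a] by (simp_all add: layered_space_def)
  show "on_obj ?p x \<in> Obj (layered R m)" if "x \<in> Obj (layered R n)" for x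
    using act_Obj[OF a that] by (simp add: obj[OF that])
  show "on_arr ?p d \<in> Hom (layered R m) (on_obj ?p x) (on_obj ?p y)" if "d \<in> Hom (layered R n) x y" for d x y
    using H[OF that] Ln.Hom_Obj[OF that] by (simp add: obj)
  show "on_arr ?p (Id (layered R n) x) = Id (layered R m) (on_obj ?p x)" if x: "x \<in> Obj (layered R n)" for x
    unfolding obj[OF x]
  proof (rule over_cancel[OF restr_over[OF a x] H[OF Ln.Id_Hom[OF x]] Lm.Id_Hom[OF act_Obj[OF a x]]])
    note h = restr_Hom[OF a x]
    show "restr_arrow R a x \<cdot>\<^bsub>E\<^esub> mid (on_arr ?p (Id (layered R n) x))
        = restr_arrow R a x \<cdot>\<^bsub>E\<^esub> mid (Id (layered R m) (act_obj R a x))"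
      unfolding r[OF Ln.Id_Hom[OF x]] using E.Comp_Id_left[OF h] E.Comp_Id_right[OF h]
      by (simp add: layered_Id)
  qed
  show "on_arr ?p (g \<cdot>\<^bsub>layered R n\<^esub> f) = on_arr ?p g \<cdot>\<^bsub>layered R m\<^esub> on_arr ?p f"
    if f: "f \<in> Hom (layered R n) x y" and g: "g \<in> Hom (layered R n) y z" for f g x y z
  proof (rule over_cancel[OF restr_over[OF a Ln.Hom_Obj(2)[OF g]] H[OF Ln.Comp_Hom[OF f g]]
        Lm.Comp_Hom[OF H[OF f] H[OF g]]])
    note xyz = Ln.Hom_Obj[OF f] Ln.Hom_Obj[OF g]
    note atoms = restr_Hom[OF a xyz(1)] restr_Hom[OF a xyz(2)] restr_Hom[OF a xyz(4)]
      layered_HomD(3)[OF f] layered_HomD(3)[OF g] layered_HomD(3)[OF H[OF f]] layered_HomD(3)[OF H[OF g]]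
    note simps = E.comp_simps E.comp_assoc atoms[THEN HomD(1)] atoms[THEN HomD(2)] atoms[THEN HomD(3)]
    have "restr_arrow R a z \<cdot>\<^bsub>E\<^esub> mid (on_arr ?p (g \<cdot>\<^bsub>layered R n\<^esub> f))
        = mid g \<cdot>\<^bsub>E\<^esub> (restr_arrow R a y \<cdot>\<^bsub>E\<^esub> mid (on_arr ?p f))"
      unfolding r[OF Ln.Comp_Hom[OF f g]] mid_Comp[OF f g] r[OF f] by (simp add: simps)
    also have "\<dots> = (restr_arrow R a z \<cdot>\<^bsub>E\<^esub> mid (on_arr ?p g)) \<cdot>\<^bsub>E\<^esub> mid (on_arr ?p f)"
      unfolding r[OF g] by (simp add: simps)
    also have "\<dots> = restr_arrow R a z \<cdot>\<^bsub>E\<^esub> mid (on_arr ?p g \<cdot>\<^bsub>layered R m\<^esub> on_arr ?p f)"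
      unfolding mid_Comp[OF H[OF f] H[OF g]] by (simp add: simps)
    finally show "restr_arrow R a z \<cdot>\<^bsub>E\<^esub> mid (on_arr ?p (g \<cdot>\<^bsub>layered R n\<^esub> f))
        = restr_arrow R a z \<cdot>\<^bsub>E\<^esub> mid (on_arr ?p g \<cdot>\<^bsub>layered R m\<^esub> on_arr ?p f)" .
  qed
qed

lemma pull_Id_layered_space: "pull (layered_space R) (Id Delta n) = id_funct (layered R n)"
proof -
  have i: "Id Delta n \<in> Hom Delta n n" using Delta.Id_Hom by (simp add: Delta_simps)
  interpret L: category "layered R n" by (rule category_layered)
  show ?thesis
  proof (rule functor_eqI[OF pull_functor_layered_space[OF i] id_functor[OF category_layered]])
    show "on_obj (pull (layered_space R) (Id Delta n)) x = on_obj (id_funct (layered R n)) x"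
      if "x \<in> Obj (layered R n)" for x
      using that by (simp add: pull_obj_layered_space[OF i] act_obj_Id)
    fix d x y assume d: "d \<in> Hom (layered R n) x y"
    note xy = L.Hom_Obj[OF d]
    have H: "on_arr (pull (layered_space R) (Id Delta n)) d \<in> Hom (layered R n) x y"
      using pull_arr_Hom[OF i d] by (simp add: act_obj_Id xy)
    have "on_arr (pull (layered_space R) (Id Delta n)) d = d"
    proof (rule over_cancel[OF over_Id[OF xy(2)] H d])
      show "Id E (und y) \<cdot>\<^bsub>E\<^esub> mid (on_arr (pull (layered_space R) (Id Delta n)) d) = Id E (und y) \<cdot>\<^bsub>E\<^esub> mid d"
        using restr_pull_arr[OF i d] E.Comp_Id_left[OF layered_HomD(3)[OF d]]
          E.Comp_Id_right[OF layered_HomD(3)[OF d]] by (simp add: restr_arrow_Id)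
    qed
    then show "on_arr (pull (layered_space R) (Id Delta n)) d = on_arr (id_funct (layered R n)) d"
      using d by simp
  qed
qed

lemma compositor_layered_space:
  assumes a: "a \<in> Hom Delta m n" and b: "b \<in> Hom Delta n k" and x: "x \<in> Obj (layered R k)"
  shows compositor_layered_Hom: "compositor (layered_space R) a b x \<in>
      Hom (layered R m) (act_obj R a (act_obj R b x)) (act_obj R (b \<cdot>\<^bsub>Delta\<^esub> a) x)"
    and restr_compositor: "restr_arrow R (b \<cdot>\<^bsub>Delta\<^esub> a) x \<cdot>\<^bsub>E\<^esub> mid (compositor (layered_space R) a b x)
      = restr_arrow R b x \<cdot>\<^bsub>E\<^esub> restr_arrow R a (act_obj R b x)"
proof -
  note o = over_Comp[OF restr_over[OF a act_Obj[OF b x]] restr_over[OF b x]]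
  have eq: "compositor (layered_space R) a b x =
      lift (b \<cdot>\<^bsub>Delta\<^esub> a) (act_obj R a (act_obj R b x)) (restr_arrow R b x \<cdot>\<^bsub>E\<^esub> restr_arrow R a (act_obj R b x)) x"
    using HomD(2)[OF a] HomD(2)[OF Delta.Comp_Hom[OF a b]] by (simp add: layered_space_def lift_def)
  show "compositor (layered_space R) a b x \<in>
      Hom (layered R m) (act_obj R a (act_obj R b x)) (act_obj R (b \<cdot>\<^bsub>Delta\<^esub> a) x)"
    "restr_arrow R (b \<cdot>\<^bsub>Delta\<^esub> a) x \<cdot>\<^bsub>E\<^esub> mid (compositor (layered_space R) a b x)
      = restr_arrow R b x \<cdot>\<^bsub>E\<^esub> restr_arrow R a (act_obj R b x)"
    unfolding eq using lift_Hom[OF o] restr_lift[OF o] .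
qed

text \<open>Composed with the restriction of \<open>y\<close> along the composite map, both sides
  become \<open>mid d\<close> after the two successive restrictions of \<open>x\<close>.\<close>

lemma compositor_natural_layered_space:
  assumes a: "a \<in> Hom Delta m n" and b: "b \<in> Hom Delta n k" and d: "d \<in> Hom (layered R k) x y"
  shows "compositor (layered_space R) a b y \<cdot>\<^bsub>layered R m\<^esub>
      on_arr (pull (layered_space R) a) (on_arr (pull (layered_space R) b) d)
    = on_arr (pull (layered_space R) (b \<cdot>\<^bsub>Delta\<^esub> a)) d \<cdot>\<^bsub>layered R m\<^esub> compositor (layered_space R) a b x"
    (is "?cy \<cdot>\<^bsub>_\<^esub> ?abd = ?bad \<cdot>\<^bsub>_\<^esub> ?cx")
proof -
  interpret Lk: category "layered R k" by (rule category_layered)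
  interpret Lm: category "layered R m" by (rule category_layered)
  note xy = Lk.Hom_Obj[OF d] and ba = Delta.Comp_Hom[OF a b]
  note bd = pull_arr_Hom[OF b d] note abd = pull_arr_Hom[OF a bd] and bad = pull_arr_Hom[OF ba d]
  note cx = compositor_layered_Hom[OF a b xy(1)] and cy = compositor_layered_Hom[OF a b xy(2)]
  let ?bx = "act_obj R b x" and ?by = "act_obj R b y" and ?ba = "b \<cdot>\<^bsub>Delta\<^esub> a"
  let ?bd = "on_arr (pull (layered_space R) b) d"
  note bx = act_Obj[OF b xy(1)] and "by" = act_Obj[OF b xy(2)]
  note mids = layered_HomD(3)
  note atoms = restr_Hom[OF a bx] restr_Hom[OF a "by"] restr_Hom[OF b xy(1)] restr_Hom[OF b xy(2)]
    restr_Hom[OF ba xy(1)] restr_Hom[OF ba xy(2)] mids[OF d] mids[OF bd] mids[OF abd] mids[OF bad] mids[OF cx] mids[OF cy]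
  note simps = E.comp_simps E.comp_assoc atoms[THEN HomD(1)] atoms[THEN HomD(2)] atoms[THEN HomD(3)]
  show ?thesis
  proof (rule over_cancel[OF restr_over[OF ba xy(2)] Lm.Comp_Hom[OF abd cy] Lm.Comp_Hom[OF cx bad]])
    have "restr_arrow R ?ba y \<cdot>\<^bsub>E\<^esub> mid (?cy \<cdot>\<^bsub>layered R m\<^esub> ?abd)
        = (restr_arrow R ?ba y \<cdot>\<^bsub>E\<^esub> mid ?cy) \<cdot>\<^bsub>E\<^esub> mid ?abd"
      unfolding mid_Comp[OF abd cy] by (simp add: simps)
    also have "\<dots> = restr_arrow R b y \<cdot>\<^bsub>E\<^esub> (restr_arrow R a ?by \<cdot>\<^bsub>E\<^esub> mid ?abd)"
      unfolding restr_compositor[OF a b xy(2)] by (simp add: simps)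
    also have "\<dots> = (restr_arrow R b y \<cdot>\<^bsub>E\<^esub> mid ?bd) \<cdot>\<^bsub>E\<^esub> restr_arrow R a ?bx"
      unfolding restr_pull_arr[OF a bd] by (simp add: simps)
    also have "\<dots> = mid d \<cdot>\<^bsub>E\<^esub> (restr_arrow R b x \<cdot>\<^bsub>E\<^esub> restr_arrow R a ?bx)"
      unfolding restr_pull_arr[OF b d] by (simp add: simps)
    also have "\<dots> = (mid d \<cdot>\<^bsub>E\<^esub> restr_arrow R ?ba x) \<cdot>\<^bsub>E\<^esub> mid ?cx"
      unfolding restr_compositor[OF a b xy(1), symmetric] by (simp add: simps)
    also have "\<dots> = restr_arrow R ?ba y \<cdot>\<^bsub>E\<^esub> mid (?bad \<cdot>\<^bsub>layered R m\<^esub> ?cx)"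
      unfolding restr_pull_arr[OF ba d, symmetric] mid_Comp[OF cx bad] by (simp add: simps)
    finally show "restr_arrow R ?ba y \<cdot>\<^bsub>E\<^esub> mid (?cy \<cdot>\<^bsub>layered R m\<^esub> ?abd)
        = restr_arrow R ?ba y \<cdot>\<^bsub>E\<^esub> mid (?bad \<cdot>\<^bsub>layered R m\<^esub> ?cx)" .
  qed
qed

text \<open>Composed with the restriction of \<open>y\<close> along the triple composite, both sides
  become the composite of the three successive restrictions along \<open>h\<close>, \<open>g\<close>
  and \<open>f\<close>.\<close>

lemma compositor_associative_layered_space:
  assumes f: "f \<in> Hom Delta a b" and g: "g \<in> Hom Delta b c" and h: "h \<in> Hom Delta c d"
    and y: "y \<in> Obj (layered R d)"
  shows "compositor (layered_space R) (g \<cdot>\<^bsub>Delta\<^esub> f) h y \<cdot>\<^bsub>layered R a\<^esub>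
      compositor (layered_space R) f g (act_obj R h y)
    = compositor (layered_space R) f (h \<cdot>\<^bsub>Delta\<^esub> g) y \<cdot>\<^bsub>layered R a\<^esub>
      on_arr (pull (layered_space R) f) (compositor (layered_space R) g h y)"
    (is "?k1 \<cdot>\<^bsub>_\<^esub> ?k2 = ?k3 \<cdot>\<^bsub>_\<^esub> ?k4")
proof -
  interpret La: category "layered R a" by (rule category_layered)
  let ?hy = "act_obj R h y" and ?gf = "g \<cdot>\<^bsub>Delta\<^esub> f" and ?hg = "h \<cdot>\<^bsub>Delta\<^esub> g"
  let ?ghy = "act_obj R g ?hy" and ?k5 = "compositor (layered_space R) g h y"
  note hy = act_Obj[OF h y] note ghy = act_Obj[OF g hy]
  note gf = Delta.Comp_Hom[OF f g] and hg = Delta.Comp_Hom[OF g h]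
  note hgy = act_Obj[OF hg y]
  \<comment> \<open>The two sides end at restrictions along differently bracketed composites;
    rewriting with this equation gives them the same target.\<close>
  note assoc = Delta.Comp_assoc[OF f g h]
  note k1 = compositor_layered_Hom[OF gf h y] and k2 = compositor_layered_Hom[OF f g hy]
  note k3 = compositor_layered_Hom[OF f hg y, unfolded assoc] and k5 = compositor_layered_Hom[OF g h y]
  note k4 = pull_arr_Hom[OF f k5] and hgf = Delta.Comp_Hom[OF gf h]
  note r1 = restr_compositor[OF gf h y] and r3 = restr_compositor[OF f hg y, unfolded assoc]
  note mids = layered_HomD(3)
  note atoms = restr_Hom[OF h y] restr_Hom[OF g hy] restr_Hom[OF f ghy] restr_Hom[OF gf hy] restr_Hom[OF hg y]
    restr_Hom[OF f hgy] restr_Hom[OF hgf y] mids[OF k1] mids[OF k2] mids[OF k3] mids[OF k4] mids[OF k5]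
  note simps = E.comp_simps E.comp_assoc atoms[THEN HomD(1)] atoms[THEN HomD(2)] atoms[THEN HomD(3)]
  let ?r = "restr_arrow R (h \<cdot>\<^bsub>Delta\<^esub> ?gf) y"
  show ?thesis
  proof (rule over_cancel[OF restr_over[OF hgf y] La.Comp_Hom[OF k2 k1] La.Comp_Hom[OF k4 k3]])
    have "?r \<cdot>\<^bsub>E\<^esub> mid (?k1 \<cdot>\<^bsub>layered R a\<^esub> ?k2) = (?r \<cdot>\<^bsub>E\<^esub> mid ?k1) \<cdot>\<^bsub>E\<^esub> mid ?k2"
      unfolding mid_Comp[OF k2 k1] by (simp add: simps)
    also have "\<dots> = restr_arrow R h y \<cdot>\<^bsub>E\<^esub> (restr_arrow R ?gf ?hy \<cdot>\<^bsub>E\<^esub> mid ?k2)"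
      unfolding r1 by (simp add: simps)
    also have "\<dots> = (restr_arrow R h y \<cdot>\<^bsub>E\<^esub> restr_arrow R g ?hy) \<cdot>\<^bsub>E\<^esub> restr_arrow R f ?ghy"
      unfolding restr_compositor[OF f g hy] by (simp add: simps)
    also have "\<dots> = restr_arrow R ?hg y \<cdot>\<^bsub>E\<^esub> (mid ?k5 \<cdot>\<^bsub>E\<^esub> restr_arrow R f ?ghy)"
      unfolding restr_compositor[OF g h y, symmetric] by (simp add: simps)
    also have "\<dots> = (restr_arrow R ?hg y \<cdot>\<^bsub>E\<^esub> restr_arrow R f (act_obj R ?hg y)) \<cdot>\<^bsub>E\<^esub> mid ?k4"
      unfolding restr_pull_arr[OF f k5, symmetric] by (simp add: simps)
    also have "\<dots> = ?r \<cdot>\<^bsub>E\<^esub> mid (?k3 \<cdot>\<^bsub>layered R a\<^esub> ?k4)"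
      unfolding r3[symmetric] mid_Comp[OF k4 k3] by (simp add: simps)
    finally show "?r \<cdot>\<^bsub>E\<^esub> mid (?k1 \<cdot>\<^bsub>layered R a\<^esub> ?k2) = ?r \<cdot>\<^bsub>E\<^esub> mid (?k3 \<cdot>\<^bsub>layered R a\<^esub> ?k4)" .
  qed
qed

text \<open>Restriction along an identity map is an identity arrow, so the defining equation of the
  compositor reduces to one that the identity also satisfies.\<close>

lemma compositor_Id_layered_space:
  assumes f: "f \<in> Hom Delta m n" and y: "y \<in> Obj (layered R n)"
  shows "compositor (layered_space R) f (Id Delta n) y = Id (layered R m) (act_obj R f y)"
    and "compositor (layered_space R) (Id Delta m) f y = Id (layered R m) (act_obj R f y)"
proof -
  interpret Lm: category "layered R m" by (rule category_layered)
  have i: "Id Delta n \<in> Hom Delta n n" for n using Delta.Id_Hom by (simp add: Delta_simps)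
  note r = restr_over[OF f y] and fy = act_Obj[OF f y] and rH = restr_Hom[OF f y]
  note k = compositor_layered_Hom[OF f i y, unfolded Delta.Comp_Id_left[OF f] act_obj_Id[OF y]]
  show "compositor (layered_space R) f (Id Delta n) y = Id (layered R m) (act_obj R f y)"
  proof (rule over_cancel[OF r k Lm.Id_Hom[OF fy]])
    show "restr_arrow R f y \<cdot>\<^bsub>E\<^esub> mid (compositor (layered_space R) f (Id Delta n) y)
        = restr_arrow R f y \<cdot>\<^bsub>E\<^esub> mid (Id (layered R m) (act_obj R f y))"
      unfolding restr_compositor[OF f i y, unfolded Delta.Comp_Id_left[OF f] act_obj_Id[OF y]]
      using E.Comp_Id_left[OF rH] E.Comp_Id_right[OF rH] by (simp add: restr_arrow_Id layered_Id)
  qed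
  note k = compositor_layered_Hom[OF i f y, unfolded Delta.Comp_Id_right[OF f] act_obj_Id[OF fy]]
  show "compositor (layered_space R) (Id Delta m) f y = Id (layered R m) (act_obj R f y)"
  proof (rule over_cancel[OF r k Lm.Id_Hom[OF fy]])
    show "restr_arrow R f y \<cdot>\<^bsub>E\<^esub> mid (compositor (layered_space R) (Id Delta m) f y)
        = restr_arrow R f y \<cdot>\<^bsub>E\<^esub> mid (Id (layered R m) (act_obj R f y))"
      unfolding restr_compositor[OF i f y, unfolded Delta.Comp_Id_right[OF f] act_obj_Id[OF fy]]
      using E.Comp_Id_right[OF rH] by (simp add: restr_arrow_Id layered_Id)
  qed
qed

lemma pseudofunctor_layered_space: "pseudofunctor Delta (layered_space R)"
proof (intro pseudofunctor.intro pseudofunctor_axioms.intro category_Delta, unfold grpd_layered_space unitor_layered_space)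
  show "groupoid (layered R c)" for c by (rule groupoid_layered)
  show "is_functor (layered R d) (layered R c) (pull (layered_space R) f)" if "f \<in> Hom Delta c d" for f c d
    by (rule pull_functor_layered_space[OF that])
  show "nat_iso (layered R c) (layered R c) (id_funct (layered R c)) (pull (layered_space R) (Id Delta c))
      (Id (layered R c))" for c
  proof -
    interpret L: category "layered R c" by (rule category_layered)
    show ?thesis
      unfolding pull_Id_layered_space
    proof (rule nat_isoI[OF groupoid_layered id_functor id_functor])
      show "Id (layered R c) x \<in> Hom (layered R c) (on_obj (id_funct (layered R c)) x) (on_obj (id_funct (layered R c)) x)"
        if "x \<in> Obj (layered R c)" for x using that L.Id_Hom by simp
      show "Id (layered R c) y \<cdot>\<^bsub>layered R c\<^esub> on_arr (id_funct (layered R c)) f =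
          on_arr (id_funct (layered R c)) f \<cdot>\<^bsub>layered R c\<^esub> Id (layered R c) x"
        if "f \<in> Hom (layered R c) x y" for f x y
        using that L.Comp_Id_left[OF that] L.Comp_Id_right[OF that] by simp
    qed (rule category_layered)+
  qed
  fix f g b c d assume f: "f \<in> Hom Delta b c" and g: "g \<in> Hom Delta c d"
  note obj = pull_obj_layered_space and gf = Delta.Comp_Hom[OF f g]
  show "nat_iso (layered R d) (layered R b) (comp_funct (layered R d) (pull (layered_space R) f) (pull (layered_space R) g))
      (pull (layered_space R) (g \<cdot>\<^bsub>Delta\<^esub> f)) (compositor (layered_space R) f g)"
  proof (rule nat_isoI[OF groupoid_layered comp_functor[OF pull_functor_layered_space[OF g] pull_functor_layered_space[OF f]]
        pull_functor_layered_space[OF gf]])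
    show "compositor (layered_space R) f g x \<in> Hom (layered R b)
        (on_obj (comp_funct (layered R d) (pull (layered_space R) f) (pull (layered_space R) g)) x)
        (on_obj (pull (layered_space R) (g \<cdot>\<^bsub>Delta\<^esub> f)) x)" if x: "x \<in> Obj (layered R d)" for x
      using compositor_layered_Hom[OF f g x] x by (simp add: obj[OF f] obj[OF g] obj[OF gf] act_Obj[OF g])
    show "compositor (layered_space R) f g y \<cdot>\<^bsub>layered R b\<^esub>
          on_arr (comp_funct (layered R d) (pull (layered_space R) f) (pull (layered_space R) g)) h
        = on_arr (pull (layered_space R) (g \<cdot>\<^bsub>Delta\<^esub> f)) h \<cdot>\<^bsub>layered R b\<^esub> compositor (layered_space R) f g x"
      if h: "h \<in> Hom (layered R d) x y" for h x y
      using compositor_natural_layered_space[OF f g h] h by simp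
  qed
next
  fix f c d y assume f: "f \<in> Hom Delta c d" and y: "y \<in> Obj (layered R d)"
  interpret Lc: category "layered R c" by (rule category_layered)
  note i = Lc.Id_Hom[OF act_Obj[OF f y]]
  show "compositor (layered_space R) f (Id Delta d) y \<cdot>\<^bsub>layered R c\<^esub>
      on_arr (pull (layered_space R) f) (Id (layered R d) y) = Id (layered R c) (on_obj (pull (layered_space R) f) y)"
    "compositor (layered_space R) (Id Delta c) f y \<cdot>\<^bsub>layered R c\<^esub>
      Id (layered R c) (on_obj (pull (layered_space R) f) y) = Id (layered R c) (on_obj (pull (layered_space R) f) y)"
    using Lc.Comp_Id_left[OF i]
    by (simp_all add: functor_Id[OF pull_functor_layered_space[OF f] y] compositor_Id_layered_space[OF f y]
        pull_obj_layered_space[OF f y])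
next
  fix f g h a b c d y assume f: "f \<in> Hom Delta a b" and g: "g \<in> Hom Delta b c" and h: "h \<in> Hom Delta c d"
    and y: "y \<in> Obj (layered R d)"
  show "compositor (layered_space R) (g \<cdot>\<^bsub>Delta\<^esub> f) h y \<cdot>\<^bsub>layered R a\<^esub>
        compositor (layered_space R) f g (on_obj (pull (layered_space R) h) y)
      = compositor (layered_space R) f (h \<cdot>\<^bsub>Delta\<^esub> g) y \<cdot>\<^bsub>layered R a\<^esub>
        on_arr (pull (layered_space R) f) (compositor (layered_space R) g h y)"
    using compositor_associative_layered_space[OF f g h y] by (simp add: pull_obj_layered_space[OF h y])
qed

end

section \<open>The simplicial map induced by a morphism of species\<close>

lemma induced_obj_simps [simp]:
  "fst (induced_obj \<phi> x) = fst x" "lay (induced_obj \<phi> x) = lay x"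
  "snd (snd (induced_obj \<phi> x)) = on_obj (cmpt \<phi> (fst x)) (snd (snd x))"
  by (simp_all add: induced_obj_def split_beta)

locale species_map = pseudonat poset_cat R' R \<phi>
  for R' :: "('a, 'o, 'm) species" and R :: "('a, 'p, 'n) species" and \<phi>
begin

sublocale F: species R' by (simp add: species_def F.pseudofunctor_axioms)
sublocale G: species R by (simp add: species_def G.pseudofunctor_axioms)

abbreviation "ind \<equiv> induced_obj \<phi>"
abbreviation "emap \<equiv> elements_map poset_cat R \<phi>"
abbreviation "imap \<equiv> induced_map R' R \<phi>"

lemma ind_Obj:
  assumes "x \<in> Obj (layered R' n)"
  shows "ind x \<in> Obj (layered R n)"
  using assms functor_Obj[OF cmpt_functor] by (simp add: layered_Obj poset_cat_simps)

lemma emap_Hom: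
  assumes "e \<in> Hom F.E (und x) (und y)"
  shows "emap e \<in> Hom G.E (und (ind x)) (und (ind y))"
  using elements_map_Hom[OF assms] by simp

text \<open>\<open>emap\<close> leaves the base map unchanged and \<open>ind\<close> leaves carriers
  and layers unchanged, so all conditions on points carry over verbatim.\<close>

lemma emap_over:
  assumes e: "F.over a m n x e y"
  shows "G.over a m n (ind x) (emap e) (ind y)"
  unfolding G.over_def induced_obj_simps fst_elements_map
proof (intro conjI ballI impI)
  show "a \<in> Hom Delta m n" "ind x \<in> Obj (layered R m)" "ind y \<in> Obj (layered R n)"
    using F.over_Delta[OF e] ind_Obj[OF F.over_source[OF e]] ind_Obj[OF F.over_target[OF e]] .
  show "emap e \<in> Hom G.E (fst x, on_obj (cmpt \<phi> (fst x)) (snd (snd x))) (fst y, on_obj (cmpt \<phi> (fst y)) (snd (snd y)))"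
    using elements_map_Hom[OF F.over_Hom[OF e]] .
qed (use F.over_surj[OF e] F.over_lay[OF e] in blast)+

lemma emap_Id: "x \<in> Obj (layered R' n) \<Longrightarrow> emap (Id F.E (und x)) = Id G.E (und (ind x))"
  using elements_map_Id[OF F.und_Obj] by simp

lemma induced_map_obj: "x \<in> Obj (layered R' n) \<Longrightarrow> on_obj (cmpt imap n) x = ind x"
  by (simp add: induced_map_def)

lemma induced_map_arr:
  assumes d: "d \<in> Hom (layered R' n) x y"
  shows "on_arr (cmpt imap n) d = (ind x, emap (mid d), ind y)"
proof -
  obtain e where "d = (x, e, y)" using d unfolding F.layered_Hom by blast
  with HomD(1)[OF d] show ?thesis by (simp add: induced_map_def)
qed

lemma induced_map_Hom:
  assumes d: "d \<in> Hom (layered R' n) x y"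
  shows "on_arr (cmpt imap n) d \<in> Hom (layered R n) (ind x) (ind y)"
  using emap_over[OF F.layered_HomD(1)[OF d]] by (simp add: induced_map_arr[OF d] G.layered_Hom)

lemma mid_induced_map:
  assumes d: "d \<in> Hom (layered R' n) x y"
  shows "mid (on_arr (cmpt imap n) d) = emap (mid d)"
  by (simp add: induced_map_arr[OF d])

lemma induced_map_functor: "is_functor (layered R' n) (layered R n) (cmpt imap n)"
proof (rule is_functorI)
  interpret L: category "layered R' n" by (rule F.category_layered)
  show "category (layered R' n)" "category (layered R n)" by (rule F.category_layered G.category_layered)+
  show "on_obj (cmpt imap n) \<in> extensional (Obj (layered R' n))" "on_arr (cmpt imap n) \<in> extensional (Arr (layered R' n))"
    by (simp_all add: induced_map_def)
  show "on_obj (cmpt imap n) x \<in> Obj (layered R n)" if "x \<in> Obj (layered R' n)" for x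
    using ind_Obj[OF that] by (simp add: induced_map_obj[OF that])
  show "on_arr (cmpt imap n) d \<in> Hom (layered R n) (on_obj (cmpt imap n) x) (on_obj (cmpt imap n) y)"
    if "d \<in> Hom (layered R' n) x y" for d x y
    using induced_map_Hom[OF that] L.Hom_Obj[OF that] by (simp add: induced_map_obj)
  show "on_arr (cmpt imap n) (Id (layered R' n) x) = Id (layered R n) (on_obj (cmpt imap n) x)"
    if x: "x \<in> Obj (layered R' n)" for x
    using emap_Id[OF x] unfolding induced_map_arr[OF L.Id_Hom[OF x]]
    by (simp add: induced_map_obj[OF x] layered_Id)
  show "on_arr (cmpt imap n) (g \<cdot>\<^bsub>layered R' n\<^esub> f) = on_arr (cmpt imap n) g \<cdot>\<^bsub>layered R n\<^esub> on_arr (cmpt imap n) f"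
    if f: "f \<in> Hom (layered R' n) x y" and g: "g \<in> Hom (layered R' n) y z" for f g x y z
    using elements_map_Comp[OF F.layered_HomD(3)[OF f] F.layered_HomD(3)[OF g]] F.mid_Comp[OF f g]
    by (simp add: induced_map_arr[OF f] induced_map_arr[OF g] induced_map_arr[OF L.Comp_Hom[OF f g]] layered_Comp)
qed

lemma nati_induced_map:
  assumes a: "a \<in> Hom Delta m n" and x: "x \<in> Obj (layered R' n)"
  shows nati_induced_Hom: "nati imap a x \<in> Hom (layered R m) (ind (act_obj R' a x)) (act_obj R a (ind x))"
    and restr_nati: "restr_arrow R a (ind x) \<cdot>\<^bsub>G.E\<^esub> mid (nati imap a x) = emap (restr_arrow R' a x)"
    and nati_unique: "d \<in> Hom (layered R m) (ind (act_obj R' a x)) (act_obj R a (ind x)) \<Longrightarrow>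
      restr_arrow R a (ind x) \<cdot>\<^bsub>G.E\<^esub> mid d = emap (restr_arrow R' a x) \<Longrightarrow> nati imap a x = d"
proof -
  note o = emap_over[OF F.restr_over[OF a x]]
  have eq: "nati imap a x = G.lift a (ind (act_obj R' a x)) (emap (restr_arrow R' a x)) (ind x)"
    using a x HomD[OF a] by (simp add: induced_map_def G.lift_def)
  show "nati imap a x \<in> Hom (layered R m) (ind (act_obj R' a x)) (act_obj R a (ind x))"
    "restr_arrow R a (ind x) \<cdot>\<^bsub>G.E\<^esub> mid (nati imap a x) = emap (restr_arrow R' a x)"
    "d \<in> Hom (layered R m) (ind (act_obj R' a x)) (act_obj R a (ind x)) \<Longrightarrow>
      restr_arrow R a (ind x) \<cdot>\<^bsub>G.E\<^esub> mid d = emap (restr_arrow R' a x) \<Longrightarrow> nati imap a x = d"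
    unfolding eq using G.lift_Hom[OF o] G.restr_lift[OF o] G.lift_unique[OF o] .
qed

interpretation E': category F.E by (rule F.elements_category)
interpretation E: category G.E by (rule G.elements_category)
interpretation Delta: category Delta by (rule category_Delta)

text \<open>Cancelling the restriction of \<open>ind y\<close> leaves the image under
  \<open>emap\<close> of the square that defines the action of \<open>a\<close> on
  \<open>h\<close>.\<close>

lemma nati_induced_natural:
  assumes a: "a \<in> Hom Delta m n" and h: "h \<in> Hom (layered R' n) x y"
  shows "nati imap a y \<cdot>\<^bsub>layered R m\<^esub> on_arr (cmpt imap m) (on_arr (pull (layered_space R') a) h)
    = on_arr (pull (layered_space R) a) (on_arr (cmpt imap n) h) \<cdot>\<^bsub>layered R m\<^esub> nati imap a x"
proof -
  interpret L': category "layered R' n" by (rule F.category_layered)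
  interpret L: category "layered R m" by (rule G.category_layered)
  note xy = L'.Hom_Obj[OF h] note nx = nati_induced_Hom[OF a xy(1)] and ny = nati_induced_Hom[OF a xy(2)]
  note ah = F.pull_arr_Hom[OF a h] and ih = induced_map_Hom[OF h]
  note iah = induced_map_Hom[OF ah] and aih = G.pull_arr_Hom[OF a ih]
  note mids = G.layered_HomD(3)
  note atoms = G.restr_Hom[OF a ind_Obj[OF xy(1)]] G.restr_Hom[OF a ind_Obj[OF xy(2)]]
    mids[OF nx] mids[OF ny] mids[OF ih] mids[OF iah] mids[OF aih]
  note simps = E.comp_simps E.comp_assoc atoms[THEN HomD(1)] atoms[THEN HomD(2)] atoms[THEN HomD(3)]
  let ?ah = "on_arr (pull (layered_space R') a) h" and ?ih = "on_arr (cmpt imap n) h"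
  let ?r = "restr_arrow R a (ind y)"
  show ?thesis
  proof (rule G.over_cancel[OF G.restr_over[OF a ind_Obj[OF xy(2)]] L.Comp_Hom[OF iah ny] L.Comp_Hom[OF nx aih]])
    have "?r \<cdot>\<^bsub>G.E\<^esub> mid (nati imap a y \<cdot>\<^bsub>layered R m\<^esub> on_arr (cmpt imap m) ?ah)
        = (?r \<cdot>\<^bsub>G.E\<^esub> mid (nati imap a y)) \<cdot>\<^bsub>G.E\<^esub> mid (on_arr (cmpt imap m) ?ah)"
      unfolding G.mid_Comp[OF iah ny] by (simp add: simps)
    also have "\<dots> = emap (restr_arrow R' a y \<cdot>\<^bsub>F.E\<^esub> mid ?ah)"
      unfolding restr_nati[OF a xy(2)] mid_induced_map[OF ah]
      by (rule elements_map_Comp[OF F.layered_HomD(3)[OF ah] F.restr_Hom[OF a xy(2)], symmetric])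
    also have "\<dots> = mid ?ih \<cdot>\<^bsub>G.E\<^esub> emap (restr_arrow R' a x)"
      unfolding F.restr_pull_arr[OF a h] mid_induced_map[OF h]
      by (rule elements_map_Comp[OF F.restr_Hom[OF a xy(1)] F.layered_HomD(3)[OF h]])
    also have "\<dots> = (mid ?ih \<cdot>\<^bsub>G.E\<^esub> restr_arrow R a (ind x)) \<cdot>\<^bsub>G.E\<^esub> mid (nati imap a x)"
      unfolding restr_nati[OF a xy(1), symmetric] by (simp add: simps)
    also have "\<dots> = ?r \<cdot>\<^bsub>G.E\<^esub> mid (on_arr (pull (layered_space R) a) ?ih \<cdot>\<^bsub>layered R m\<^esub> nati imap a x)"
      unfolding G.mid_Comp[OF nx aih] G.restr_pull_arr[OF a ih, symmetric] by (simp add: simps)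
    finally show "?r \<cdot>\<^bsub>G.E\<^esub> mid (nati imap a y \<cdot>\<^bsub>layered R m\<^esub> on_arr (cmpt imap m) ?ah)
        = ?r \<cdot>\<^bsub>G.E\<^esub> mid (on_arr (pull (layered_space R) a) ?ih \<cdot>\<^bsub>layered R m\<^esub> nati imap a x)" .
  qed
qed

text \<open>Cancelling the restriction of \<open>ind y\<close> leaves the image under
  \<open>emap\<close> of the defining equation of the compositor of \<open>R'\<close>.\<close>

lemma nati_induced_Comp:
  assumes a: "a \<in> Hom Delta m n" and b: "b \<in> Hom Delta n k" and y: "y \<in> Obj (layered R' k)"
  shows "nati imap (b \<cdot>\<^bsub>Delta\<^esub> a) y \<cdot>\<^bsub>layered R m\<^esub> on_arr (cmpt imap m) (compositor (layered_space R') a b y)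
    = (compositor (layered_space R) a b (ind y) \<cdot>\<^bsub>layered R m\<^esub>
        on_arr (pull (layered_space R) a) (nati imap b y)) \<cdot>\<^bsub>layered R m\<^esub> nati imap a (act_obj R' b y)"
    (is "?n1 \<cdot>\<^bsub>_\<^esub> ?ic = (?c \<cdot>\<^bsub>_\<^esub> ?an) \<cdot>\<^bsub>_\<^esub> ?n3")
proof -
  interpret L: category "layered R m" by (rule G.category_layered)
  note ba = Delta.Comp_Hom[OF a b] and bY = F.act_Obj[OF b y] and iy = ind_Obj[OF y]
  note n1 = nati_induced_Hom[OF ba y] and n2 = nati_induced_Hom[OF b y] and n3 = nati_induced_Hom[OF a bY]
  note c' = F.compositor_layered_Hom[OF a b y] and c = G.compositor_layered_Hom[OF a b iy]
  note ic = induced_map_Hom[OF c'] and an = G.pull_arr_Hom[OF a n2]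
  note can = L.Comp_Hom[OF an c]
  note mids = G.layered_HomD(3)
  note atoms = G.restr_Hom[OF ba iy] G.restr_Hom[OF b iy] G.restr_Hom[OF a G.act_Obj[OF b iy]]
    G.restr_Hom[OF a ind_Obj[OF bY]] mids[OF n1] mids[OF n2] mids[OF n3] mids[OF c] mids[OF ic] mids[OF an]
  note simps = E.comp_simps E.comp_assoc atoms[THEN HomD(1)] atoms[THEN HomD(2)] atoms[THEN HomD(3)]
  let ?r = "restr_arrow R (b \<cdot>\<^bsub>Delta\<^esub> a) (ind y)" and ?by = "act_obj R' b y" and ?n2 = "nati imap b y"
  show ?thesis
  proof (rule G.over_cancel[OF G.restr_over[OF ba iy] L.Comp_Hom[OF ic n1] L.Comp_Hom[OF n3 can]])
    have "?r \<cdot>\<^bsub>G.E\<^esub> mid (?n1 \<cdot>\<^bsub>layered R m\<^esub> ?ic) = (?r \<cdot>\<^bsub>G.E\<^esub> mid ?n1) \<cdot>\<^bsub>G.E\<^esub> mid ?ic"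
      unfolding G.mid_Comp[OF ic n1] by (simp add: simps)
    also have "\<dots> = emap (restr_arrow R' (b \<cdot>\<^bsub>Delta\<^esub> a) y \<cdot>\<^bsub>F.E\<^esub> mid (compositor (layered_space R') a b y))"
      unfolding restr_nati[OF ba y] mid_induced_map[OF c']
      by (rule elements_map_Comp[OF F.layered_HomD(3)[OF c'] F.restr_Hom[OF ba y], symmetric])
    also have "\<dots> = emap (restr_arrow R' b y) \<cdot>\<^bsub>G.E\<^esub> emap (restr_arrow R' a ?by)"
      unfolding F.restr_compositor[OF a b y]
      by (rule elements_map_Comp[OF F.restr_Hom[OF a bY] F.restr_Hom[OF b y]])
    also have "\<dots> = restr_arrow R b (ind y) \<cdot>\<^bsub>G.E\<^esub> ((mid ?n2 \<cdot>\<^bsub>G.E\<^esub> restr_arrow R a (ind ?by)) \<cdot>\<^bsub>G.E\<^esub> mid ?n3)"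
      unfolding restr_nati[OF b y, symmetric] restr_nati[OF a bY, symmetric] by (simp add: simps)
    also have "\<dots> = (restr_arrow R b (ind y) \<cdot>\<^bsub>G.E\<^esub> restr_arrow R a (act_obj R b (ind y))) \<cdot>\<^bsub>G.E\<^esub> (mid ?an \<cdot>\<^bsub>G.E\<^esub> mid ?n3)"
      unfolding G.restr_pull_arr[OF a n2, symmetric] by (simp add: simps)
    also have "\<dots> = ?r \<cdot>\<^bsub>G.E\<^esub> mid ((?c \<cdot>\<^bsub>layered R m\<^esub> ?an) \<cdot>\<^bsub>layered R m\<^esub> ?n3)"
      unfolding G.mid_Comp[OF n3 can] G.mid_Comp[OF an c] G.restr_compositor[OF a b iy, symmetric] by (simp add: simps)
    finally show "?r \<cdot>\<^bsub>G.E\<^esub> mid (?n1 \<cdot>\<^bsub>layered R m\<^esub> ?ic)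
        = ?r \<cdot>\<^bsub>G.E\<^esub> mid ((?c \<cdot>\<^bsub>layered R m\<^esub> ?an) \<cdot>\<^bsub>layered R m\<^esub> ?n3)" .
  qed
qed

text \<open>Both restriction arrows are identities here, so the defining equation of
  \<open>nati\<close> leaves nothing but an identity. This gives the unit law and reduces the CULF
  squares to statements about layers.\<close>

lemma nati_induced_generic:
  assumes g: "generic a" and a: "a \<in> Hom Delta m n" and x: "x \<in> Obj (layered R' n)"
  shows "mid (nati imap a x) = Id G.E (und (ind x))"
proof -
  have "und (act_obj R a (ind x)) = und (ind x)" by (simp add: act_obj_generic'[OF a g])
  then have "mid (nati imap a x) \<in> Hom G.E (und (ind (act_obj R' a x))) (und (ind x))"
    using G.layered_HomD(3)[OF nati_induced_Hom[OF a x]] by simp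
  from E.Comp_Id_left[OF this] show ?thesis
    using restr_nati[OF a x] emap_Id[OF x] by (simp add: restr_arrow_generic[OF g])
qed

lemma pseudonat_induced_map: "pseudonat Delta (layered_space R') (layered_space R) imap"
proof (rule pseudonatI[OF F.pseudofunctor_layered_space G.pseudofunctor_layered_space],
    unfold grpd_layered_space unitor_layered_space)
  show "cmpt imap \<in> extensional (Obj Delta)" by (simp add: Delta_simps extensional_def)
  show "nati imap \<in> extensional (Arr Delta)" by (simp add: induced_map_def)
  show "nati imap f \<in> extensional (Obj (layered R' (Cod Delta f)))" if "f \<in> Arr Delta" for f
    using that by (simp add: induced_map_def)
  show "is_functor (layered R' c) (layered R c) (cmpt imap c)" for c by (rule induced_map_functor)
next
  fix f c d y assume f: "f \<in> Hom Delta c d" and y: "y \<in> Obj (layered R' d)"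
  show "nati imap f y \<in> Hom (layered R c) (on_obj (cmpt imap c) (on_obj (pull (layered_space R') f) y))
      (on_obj (pull (layered_space R) f) (on_obj (cmpt imap d) y))"
    using nati_induced_Hom[OF f y]
    by (simp add: pull_obj_layered_space[OF f] y induced_map_obj[OF y] induced_map_obj[OF F.act_Obj[OF f y]] ind_Obj)
next
  fix f c d h x y assume "f \<in> Hom Delta c d" "h \<in> Hom (layered R' d) x y"
  then show "nati imap f y \<cdot>\<^bsub>layered R c\<^esub> on_arr (cmpt imap c) (on_arr (pull (layered_space R') f) h)
      = on_arr (pull (layered_space R) f) (on_arr (cmpt imap d) h) \<cdot>\<^bsub>layered R c\<^esub> nati imap f x"
    by (rule nati_induced_natural)
next
  fix c y assume y: "y \<in> Obj (layered R' c)"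
  interpret L: category "layered R c" by (rule G.category_layered)
  have i: "Id Delta c \<in> Hom Delta c c" using Delta.Id_Hom by (simp add: Delta_simps)
  have "generic (Id Delta c)" by (simp add: generic_iff[OF i] app_Id)
  note m = nati_induced_generic[OF this i y]
  note H = nati_induced_Hom[OF i y, unfolded act_obj_Id[OF y] act_obj_Id[OF ind_Obj[OF y]]]
  have "nati imap (Id Delta c) y = Id (layered R c) (ind y)"
    using G.layered_HomD(2)[OF H] m by (simp add: layered_Id)
  then show "nati imap (Id Delta c) y \<cdot>\<^bsub>layered R c\<^esub> on_arr (cmpt imap c) (Id (layered R' c) y)
      = Id (layered R c) (on_obj (cmpt imap c) y)"
    using L.Comp_Id_left[OF L.Id_Hom[OF ind_Obj[OF y]]]
    by (simp add: functor_Id[OF induced_map_functor y] induced_map_obj[OF y])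
next
  fix f g b c d y assume f: "f \<in> Hom Delta b c" and g: "g \<in> Hom Delta c d" and y: "y \<in> Obj (layered R' d)"
  show "nati imap (g \<cdot>\<^bsub>Delta\<^esub> f) y \<cdot>\<^bsub>layered R b\<^esub> on_arr (cmpt imap b) (compositor (layered_space R') f g y)
      = (compositor (layered_space R) f g (on_obj (cmpt imap d) y) \<cdot>\<^bsub>layered R b\<^esub>
          on_arr (pull (layered_space R) f) (nati imap g y)) \<cdot>\<^bsub>layered R b\<^esub>
        nati imap f (on_obj (pull (layered_space R') g) y)"
    unfolding induced_map_obj[OF y] pull_obj_layered_space[OF g y] by (rule nati_induced_Comp[OF f g y])
qed

end

section \<open>Strict compatibility of induced maps with identities and composition\<close>

lemma induced_map_id:
  assumes "species R"
  shows "induced_map R R (id_pnt poset_cat R) = id_pnt Delta (layered_space R)"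
proof -
  interpret R: species R by fact
  interpret I: species_map R R "id_pnt poset_cat R"
    using id_pseudonat[OF R.pseudofunctor_axioms] by (simp add: species_map_def)
  have ind: "I.ind x = x" if "x \<in> Obj (layered R n)" for x n
    using that by (cases x) (simp add: induced_obj_def id_pnt_def layered_Obj poset_cat_simps)
  show ?thesis
  proof (rule pseudonat_eqI[OF I.pseudonat_induced_map id_pseudonat[OF R.pseudofunctor_layered_space]])
    fix c
    interpret L: category "layered R c" by (rule R.category_layered)
    have "cmpt I.imap c = id_funct (layered R c)"
    proof (rule functor_eqI[OF I.induced_map_functor id_functor[OF L.category_axioms]])
      show "on_obj (cmpt I.imap c) x = on_obj (id_funct (layered R c)) x" if "x \<in> Obj (layered R c)" for x
        using that by (simp add: I.induced_map_obj ind)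
      show "on_arr (cmpt I.imap c) f = on_arr (id_funct (layered R c)) f" if f: "f \<in> Hom (layered R c) x y" for f x y
        using L.Hom_Obj[OF f] elements_map_id_pnt[OF R.pseudofunctor_axioms R.layered_HomD(3)[OF f]]
          R.layered_HomD(2)[OF f] f by (simp add: I.induced_map_arr[OF f] ind)
    qed
    then show "cmpt I.imap c = cmpt (id_pnt Delta (layered_space R)) c"
      by (simp add: id_pnt_def Delta_simps)
  next
    fix f c d y assume f: "f \<in> Hom Delta c d" and "y \<in> Obj (grpd (layered_space R) d)"
    then have y: "y \<in> Obj (layered R d)" by simp
    interpret L: category "layered R c" by (rule R.category_layered)
    interpret E: category R.E by (rule R.elements_category)
    note fy = R.act_Obj[OF f y] and r = R.restr_Hom[OF f y]
    have "nati I.imap f y = Id (layered R c) (act_obj R f y)"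
    proof (rule I.nati_unique[OF f y])
      show "Id (layered R c) (act_obj R f y) \<in> Hom (layered R c) (I.ind (act_obj R f y)) (act_obj R f (I.ind y))"
        using L.Id_Hom[OF fy] by (simp add: ind[OF fy] ind[OF y])
      show "restr_arrow R f (I.ind y) \<cdot>\<^bsub>R.E\<^esub> mid (Id (layered R c) (act_obj R f y)) = I.emap (restr_arrow R f y)"
        using E.Comp_Id_right[OF r] elements_map_id_pnt[OF R.pseudofunctor_axioms r]
        by (simp add: ind[OF y] layered_Id)
    qed
    then show "nati I.imap f y = nati (id_pnt Delta (layered_space R)) f y"
      using y HomD[OF f] by (simp add: id_pnt_def pull_obj_layered_space[OF f y])
  qed
qed

text \<open>The only component that is not immediate is \<open>nati\<close>; it is characterised by
  its equation with the restriction arrows, and the pasted component solves this equation because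
  \<open>emap\<close> for the composite is the composite of the two \<open>emap\<close>.\<close>

lemma induced_map_comp:
  assumes t: "species_map R1 R2 t" and u: "species_map R2 R3 u"
  shows "induced_map R1 R3 (comp_pnt poset_cat R1 R3 u t) =
    comp_pnt Delta (layered_space R1) (layered_space R3) (induced_map R2 R3 u) (induced_map R1 R2 t)"
proof -
  interpret t: species_map R1 R2 t by (rule t)
  interpret u: species_map R2 R3 u by (rule u)
  interpret ut: species_map R1 R3 "comp_pnt poset_cat R1 R3 u t"
    using comp_pseudonat[OF t.pseudonat_axioms u.pseudonat_axioms] by (simp add: species_map_def)
  have ind: "ut.ind x = u.ind (t.ind x)" if "x \<in> Obj (layered R1 n)" for x n
    using that by (cases x) (simp add: induced_obj_def comp_pnt_cmpt layered_Obj poset_cat_simps)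
  note emap = elements_map_comp_pnt[OF t.pseudonat_axioms u.pseudonat_axioms]
  show ?thesis
  proof (rule pseudonat_eqI[OF ut.pseudonat_induced_map comp_pseudonat[OF t.pseudonat_induced_map u.pseudonat_induced_map]])
    fix c
    interpret L: category "layered R1 c" by (rule t.F.category_layered)
    have "cmpt ut.imap c = comp_funct (layered R1 c) (cmpt u.imap c) (cmpt t.imap c)"
    proof (rule functor_eqI[OF ut.induced_map_functor comp_functor[OF t.induced_map_functor u.induced_map_functor]])
      show "on_obj (cmpt ut.imap c) x = on_obj (comp_funct (layered R1 c) (cmpt u.imap c) (cmpt t.imap c)) x"
        if "x \<in> Obj (layered R1 c)" for x
        using that t.ind_Obj[OF that] by (simp add: ut.induced_map_obj t.induced_map_obj u.induced_map_obj ind)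
      show "on_arr (cmpt ut.imap c) f = on_arr (comp_funct (layered R1 c) (cmpt u.imap c) (cmpt t.imap c)) f"
        if f: "f \<in> Hom (layered R1 c) x y" for f x y
        using L.Hom_Obj[OF f] emap[OF t.F.layered_HomD(3)[OF f]] f
        by (simp add: ut.induced_map_arr[OF f] u.induced_map_arr[OF t.induced_map_Hom[OF f]] t.mid_induced_map[OF f] ind)
    qed
    then show "cmpt ut.imap c = cmpt (comp_pnt Delta (layered_space R1) (layered_space R3) u.imap t.imap) c"
      by (simp add: comp_pnt_cmpt Delta_simps)
  next
    fix f c d y assume f: "f \<in> Hom Delta c d" and "y \<in> Obj (grpd (layered_space R1) d)"
    then have y: "y \<in> Obj (layered R1 d)" by simp
    interpret L: category "layered R3 c" by (rule u.G.category_layered)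
    interpret E: category u.G.E by (rule u.G.elements_category)
    note ty = t.ind_Obj[OF y] and fy = t.F.act_Obj[OF f y] and n = t.nati_induced_Hom[OF f y]
    note nu = u.nati_induced_Hom[OF f ty] and un = u.induced_map_Hom[OF n] and r = u.G.restr_Hom[OF f u.ind_Obj[OF ty]]
    let ?n = "nati u.imap f (t.ind y) \<cdot>\<^bsub>layered R3 c\<^esub> on_arr (cmpt u.imap c) (nati t.imap f y)"
    have "nati ut.imap f y = ?n"
    proof (rule ut.nati_unique[OF f y], unfold ind[OF y] ind[OF fy])
      show "?n \<in> Hom (layered R3 c) (u.ind (t.ind (act_obj R1 f y))) (act_obj R3 f (u.ind (t.ind y)))"
        by (rule L.Comp_Hom[OF un nu])
      have "restr_arrow R3 f (u.ind (t.ind y)) \<cdot>\<^bsub>u.G.E\<^esub> mid ?n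
          = (restr_arrow R3 f (u.ind (t.ind y)) \<cdot>\<^bsub>u.G.E\<^esub> mid (nati u.imap f (t.ind y))) \<cdot>\<^bsub>u.G.E\<^esub>
            mid (on_arr (cmpt u.imap c) (nati t.imap f y))"
        using E.Comp_assoc[OF u.G.layered_HomD(3)[OF un] u.G.layered_HomD(3)[OF nu] r]
        by (simp add: u.G.mid_Comp[OF un nu])
      also have "\<dots> = u.emap (restr_arrow R2 f (t.ind y) \<cdot>\<^bsub>t.G.E\<^esub> mid (nati t.imap f y))"
        unfolding u.restr_nati[OF f ty] u.mid_induced_map[OF n]
        by (rule u.elements_map_Comp[OF t.G.layered_HomD(3)[OF n] t.G.restr_Hom[OF f ty], symmetric])
      also have "\<dots> = ut.emap (restr_arrow R1 f y)"
        unfolding t.restr_nati[OF f y] emap[OF t.F.restr_Hom[OF f y]] ..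
      finally show "restr_arrow R3 f (u.ind (t.ind y)) \<cdot>\<^bsub>u.G.E\<^esub> mid ?n = ut.emap (restr_arrow R1 f y)" .
    qed
    then show "nati ut.imap f y = nati (comp_pnt Delta (layered_space R1) (layered_space R3) u.imap t.imap) f y"
      using y by (simp add: comp_pnt_nati[OF f] t.induced_map_obj)
  qed
qed

section \<open>CULF maps\<close>

context pseudonat
begin

text \<open>Formulated over an arbitrary base category, so that closure of CULF maps under
  identities and composition becomes a general fact about pseudo-natural transformations.\<close>

lemma nati_hpullback_iff:
  assumes f: "f \<in> Hom C c d"
  shows "is_hpullback (grpd F d) (grpd F c) (grpd G d) (grpd G c) (pull F f) (cmpt t d) (cmpt t c) (pull G f) (nati t f)
    \<longleftrightarrow>
    (\<forall>x \<in> Obj (grpd F d). \<forall>y \<in> Obj (grpd F d). \<forall>\<beta> \<in> Hom (grpd F c) (on_obj (pull F f) x) (on_obj (pull F f) y).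
       \<forall>\<gamma> \<in> Hom (grpd G d) (on_obj (cmpt t d) x) (on_obj (cmpt t d) y).
       on_arr (pull G f) \<gamma> \<cdot>\<^bsub>grpd G c\<^esub> nati t f x = nati t f y \<cdot>\<^bsub>grpd G c\<^esub> on_arr (cmpt t c) \<beta> \<longrightarrow>
       (\<exists>!h. h \<in> Hom (grpd F d) x y \<and> on_arr (pull F f) h = \<beta> \<and> on_arr (cmpt t d) h = \<gamma>)) \<and>
    (\<forall>b \<in> Obj (grpd F c). \<forall>y \<in> Obj (grpd G d). \<forall>\<delta> \<in> Hom (grpd G c) (on_obj (cmpt t c) b) (on_obj (pull G f) y).
       \<exists>x \<in> Obj (grpd F d). \<exists>\<beta> \<in> Hom (grpd F c) (on_obj (pull F f) x) b. \<exists>\<gamma> \<in> Hom (grpd G d) (on_obj (cmpt t d) x) y.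
         on_arr (pull G f) \<gamma> \<cdot>\<^bsub>grpd G c\<^esub> nati t f x = \<delta> \<cdot>\<^bsub>grpd G c\<^esub> on_arr (cmpt t c) \<beta>)"
proof -
  note cd = F.Hom_Obj[OF f]
  show ?thesis
    by (rule is_hpullback_iff[OF F.grpd_groupoid[OF cd(1)] G.grpd_groupoid[OF cd(2)] G.grpd_groupoid[OF cd(1)]
          cmpt_functor[OF cd(1)] G.pull_functor[OF f] F.grpd_groupoid[OF cd(2)] F.pull_functor[OF f]
          cmpt_functor[OF cd(2)] nati_iso[OF f]])
qed

end

text \<open>The components of the transformation are identities, so \<open>\<gamma>\<close> itself
  is the only candidate for \<open>h\<close>; for essential surjectivity take the object
  \<open>y\<close> and the inverse of \<open>\<delta>\<close>.\<close>

lemma hpullback_id_pnt: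
  assumes "pseudofunctor C F" and f: "f \<in> Hom C c d"
  shows "is_hpullback (grpd F d) (grpd F c) (grpd F d) (grpd F c) (pull F f) (cmpt (id_pnt C F) d)
    (cmpt (id_pnt C F) c) (pull F f) (nati (id_pnt C F) f)"
proof -
  interpret F: pseudofunctor C F by fact
  interpret I: pseudonat C F F "id_pnt C F" by (rule id_pseudonat[OF F.pseudofunctor_axioms])
  note cd = F.Hom_Obj[OF f]
  interpret Fc: groupoid "grpd F c" by (rule F.grpd_groupoid[OF cd(1)])
  interpret Fd: groupoid "grpd F d" by (rule F.grpd_groupoid[OF cd(2)])
  note P = F.pull_functor[OF f]
  have cm: "cmpt (id_pnt C F) c = id_funct (grpd F c)" "cmpt (id_pnt C F) d = id_funct (grpd F d)"
    using cd by (simp_all add: id_pnt_def)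
  have na: "nati (id_pnt C F) f x = Id (grpd F c) (on_obj (pull F f) x)" if "x \<in> Obj (grpd F d)" for x
    using that HomD[OF f] by (simp add: id_pnt_def)
  show ?thesis
    unfolding I.nati_hpullback_iff[OF f]
  proof (intro conjI ballI impI)
    fix x y \<beta> \<gamma> assume x: "x \<in> Obj (grpd F d)" and y: "y \<in> Obj (grpd F d)"
      and \<beta>: "\<beta> \<in> Hom (grpd F c) (on_obj (pull F f) x) (on_obj (pull F f) y)"
      and \<gamma>': "\<gamma> \<in> Hom (grpd F d) (on_obj (cmpt (id_pnt C F) d) x) (on_obj (cmpt (id_pnt C F) d) y)"
      and eq: "on_arr (pull F f) \<gamma> \<cdot>\<^bsub>grpd F c\<^esub> nati (id_pnt C F) f x
        = nati (id_pnt C F) f y \<cdot>\<^bsub>grpd F c\<^esub> on_arr (cmpt (id_pnt C F) c) \<beta>"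
    have \<gamma>: "\<gamma> \<in> Hom (grpd F d) x y" using \<gamma>' x y by (simp add: cm)
    have "on_arr (pull F f) \<gamma> = \<beta>"
      using eq unfolding na[OF x] na[OF y] cm id_funct_simps(3)[OF \<beta>] Fc.Comp_Id_right[OF functor_Hom[OF P \<gamma>]]
        Fc.Comp_Id_left[OF \<beta>] .
    moreover have idh: "on_arr (cmpt (id_pnt C F) d) h = h" if "h \<in> Hom (grpd F d) x y" for h
      unfolding cm using that by simp
    ultimately show "\<exists>!h. h \<in> Hom (grpd F d) x y \<and> on_arr (pull F f) h = \<beta> \<and> on_arr (cmpt (id_pnt C F) d) h = \<gamma>"
    proof (intro ex1I)
      show "\<gamma> \<in> Hom (grpd F d) x y \<and> on_arr (pull F f) \<gamma> = \<beta> \<and> on_arr (cmpt (id_pnt C F) d) \<gamma> = \<gamma>"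
        if "on_arr (pull F f) \<gamma> = \<beta>" using \<gamma> that idh[OF \<gamma>] by blast
      fix h assume h: "h \<in> Hom (grpd F d) x y \<and> on_arr (pull F f) h = \<beta> \<and> on_arr (cmpt (id_pnt C F) d) h = \<gamma>"
      from conjunct2[OF conjunct2[OF h]] show "h = \<gamma>" unfolding idh[OF conjunct1[OF h]] .
    qed
  next
    fix b y \<delta> assume b: "b \<in> Obj (grpd F c)" and y: "y \<in> Obj (grpd F d)"
      and "\<delta> \<in> Hom (grpd F c) (on_obj (cmpt (id_pnt C F) c) b) (on_obj (pull F f) y)"
    then have \<delta>: "\<delta> \<in> Hom (grpd F c) b (on_obj (pull F f) y)" by (simp add: cm)
    note i = Fd.Id_Hom[OF y] and \<delta>i = Fc.inv_Hom[OF \<delta>]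
    show "\<exists>x \<in> Obj (grpd F d). \<exists>\<beta> \<in> Hom (grpd F c) (on_obj (pull F f) x) b.
        \<exists>\<gamma> \<in> Hom (grpd F d) (on_obj (cmpt (id_pnt C F) d) x) y.
          on_arr (pull F f) \<gamma> \<cdot>\<^bsub>grpd F c\<^esub> nati (id_pnt C F) f x
            = \<delta> \<cdot>\<^bsub>grpd F c\<^esub> on_arr (cmpt (id_pnt C F) c) \<beta>"
    proof (intro bexI)
      show "on_arr (pull F f) (Id (grpd F d) y) \<cdot>\<^bsub>grpd F c\<^esub> nati (id_pnt C F) f y
            = \<delta> \<cdot>\<^bsub>grpd F c\<^esub> on_arr (cmpt (id_pnt C F) c) (inv_arr (grpd F c) \<delta>)"
        using Fc.Comp_Id_left[OF Fc.Id_Hom[OF functor_Obj[OF P y]]] \<delta>i Fc.inv_right[OF \<delta>]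
        by (simp add: na[OF y] cm functor_Id[OF P y])
    qed (use i \<delta>i y in \<open>simp_all add: cm\<close>)
  qed
qed

text \<open>The pasting of two homotopy pullback squares, carried out on the arrow criterion of
  \<open>nati_hpullback_iff\<close>.\<close>

lemma hpullback_comp_pnt:
  assumes t: "pseudonat C F G t" and u: "pseudonat C G H u" and f: "f \<in> Hom C c d"
    and pt: "is_hpullback (grpd F d) (grpd F c) (grpd G d) (grpd G c) (pull F f) (cmpt t d) (cmpt t c) (pull G f) (nati t f)"
    and pu: "is_hpullback (grpd G d) (grpd G c) (grpd H d) (grpd H c) (pull G f) (cmpt u d) (cmpt u c) (pull H f) (nati u f)"
  shows "is_hpullback (grpd F d) (grpd F c) (grpd H d) (grpd H c) (pull F f) (cmpt (comp_pnt C F H u t) d)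
    (cmpt (comp_pnt C F H u t) c) (pull H f) (nati (comp_pnt C F H u t) f)"
proof -
  interpret t: pseudonat C F G t by (rule t)
  interpret u: pseudonat C G H u by (rule u)
  interpret ut: pseudonat C F H "comp_pnt C F H u t" by (rule comp_pseudonat[OF t u])
  note cd = t.F.Hom_Obj[OF f]
  interpret Fc: groupoid "grpd F c" by (rule t.F.grpd_groupoid[OF cd(1)])
  interpret Fd: groupoid "grpd F d" by (rule t.F.grpd_groupoid[OF cd(2)])
  interpret Gc: groupoid "grpd G c" by (rule t.G.grpd_groupoid[OF cd(1)])
  interpret Gd: groupoid "grpd G d" by (rule t.G.grpd_groupoid[OF cd(2)])
  interpret Hc: groupoid "grpd H c" by (rule u.G.grpd_groupoid[OF cd(1)])
  interpret Hd: groupoid "grpd H d" by (rule u.G.grpd_groupoid[OF cd(2)])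
  note tff = conjunct1[OF pt[unfolded t.nati_hpullback_iff[OF f]], rule_format]
    and tes = conjunct2[OF pt[unfolded t.nati_hpullback_iff[OF f]], rule_format]
    and uff = conjunct1[OF pu[unfolded u.nati_hpullback_iff[OF f]], rule_format]
    and ues = conjunct2[OF pu[unfolded u.nati_hpullback_iff[OF f]], rule_format]
  let ?t = "on_arr (cmpt t c)" and ?u = "on_arr (cmpt u c)" and ?td = "on_obj (cmpt t d)"
  note T = t.cmpt_functor[OF cd(1)] and Td = t.cmpt_functor[OF cd(2)]
    and U = u.cmpt_functor[OF cd(1)] and Ud = u.cmpt_functor[OF cd(2)]
  note Ff = t.F.pull_functor[OF f] and Gf = t.G.pull_functor[OF f] and Hf = u.G.pull_functor[OF f]
  show ?thesis
    unfolding ut.nati_hpullback_iff[OF f]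
  proof (intro conjI ballI impI)
    fix x y \<beta> \<gamma> assume x: "x \<in> Obj (grpd F d)" and y: "y \<in> Obj (grpd F d)"
      and \<beta>: "\<beta> \<in> Hom (grpd F c) (on_obj (pull F f) x) (on_obj (pull F f) y)"
      and \<gamma>': "\<gamma> \<in> Hom (grpd H d) (on_obj (cmpt (comp_pnt C F H u t) d) x) (on_obj (cmpt (comp_pnt C F H u t) d) y)"
      and eq': "on_arr (pull H f) \<gamma> \<cdot>\<^bsub>grpd H c\<^esub> nati (comp_pnt C F H u t) f x
        = nati (comp_pnt C F H u t) f y \<cdot>\<^bsub>grpd H c\<^esub> on_arr (cmpt (comp_pnt C F H u t) c) \<beta>"
    have \<gamma>: "\<gamma> \<in> Hom (grpd H d) (on_obj (cmpt u d) (?td x)) (on_obj (cmpt u d) (?td y))"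
      using \<gamma>' x y by (simp add: comp_pnt_cmpt cd)
    have eq: "on_arr (pull H f) \<gamma> \<cdot>\<^bsub>grpd H c\<^esub> (nati u f (?td x) \<cdot>\<^bsub>grpd H c\<^esub> ?u (nati t f x))
        = (nati u f (?td y) \<cdot>\<^bsub>grpd H c\<^esub> ?u (nati t f y)) \<cdot>\<^bsub>grpd H c\<^esub> ?u (?t \<beta>)"
      using eq' HomD(1)[OF \<beta>] by (simp add: comp_pnt_cmpt cd comp_pnt_nati[OF f x] comp_pnt_nati[OF f y])
    note tx = functor_Obj[OF Td x] and ty = functor_Obj[OF Td y] and t\<beta> = functor_Hom[OF T \<beta>]
    note nx = t.nati_Hom[OF f x] and ny = t.nati_Hom[OF f y]
    note nux = u.nati_Hom[OF f tx] and nuy = u.nati_Hom[OF f ty]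
    \<comment> \<open>The image of \<open>\<beta>\<close> under \<open>t\<close>, conjugated by the
      invertible \<open>nati t f\<close>. It is the arrow at the middle stage \<open>G\<close> that
      the lower square needs in order to apply to \<open>\<gamma>\<close>.\<close>
    define \<beta>' where "\<beta>' = (nati t f y \<cdot>\<^bsub>grpd G c\<^esub> ?t \<beta>) \<cdot>\<^bsub>grpd G c\<^esub> inv_arr (grpd G c) (nati t f x)"
    note nyt = Gc.Comp_Hom[OF t\<beta> ny]
    have \<beta>'H: "\<beta>' \<in> Hom (grpd G c) (on_obj (pull G f) (?td x)) (on_obj (pull G f) (?td y))"
      unfolding \<beta>'_def by (rule Gc.Comp_Hom[OF Gc.inv_Hom[OF nx] nyt])
    have \<beta>'n: "\<beta>' \<cdot>\<^bsub>grpd G c\<^esub> nati t f x = nati t f y \<cdot>\<^bsub>grpd G c\<^esub> ?t \<beta>"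
      unfolding \<beta>'_def Gc.Comp_assoc[OF nx Gc.inv_Hom[OF nx] nyt] Gc.inv_left[OF nx]
      by (rule Gc.Comp_Id_right[OF nyt])
    note Unx = functor_Hom[OF U nx] and Uny = functor_Hom[OF U ny] and U\<beta>' = functor_Hom[OF U \<beta>'H]
      and H\<gamma> = functor_Hom[OF Hf \<gamma>]
    have sq: "on_arr (pull H f) \<gamma> \<cdot>\<^bsub>grpd H c\<^esub> nati u f (?td x) = nati u f (?td y) \<cdot>\<^bsub>grpd H c\<^esub> ?u \<beta>'"
    proof (rule Hc.right_cancel[OF Unx Hc.Comp_Hom[OF nux H\<gamma>] Hc.Comp_Hom[OF U\<beta>' nuy]])
      have "(on_arr (pull H f) \<gamma> \<cdot>\<^bsub>grpd H c\<^esub> nati u f (?td x)) \<cdot>\<^bsub>grpd H c\<^esub> ?u (nati t f x)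
          = (nati u f (?td y) \<cdot>\<^bsub>grpd H c\<^esub> ?u (nati t f y)) \<cdot>\<^bsub>grpd H c\<^esub> ?u (?t \<beta>)"
        using Hc.Comp_assoc[OF Unx nux H\<gamma>] eq by simp
      also have "\<dots> = nati u f (?td y) \<cdot>\<^bsub>grpd H c\<^esub> ?u (\<beta>' \<cdot>\<^bsub>grpd G c\<^esub> nati t f x)"
        unfolding \<beta>'n functor_Comp[OF U t\<beta> ny] by (rule Hc.Comp_assoc[OF functor_Hom[OF U t\<beta>] Uny nuy])
      also have "\<dots> = (nati u f (?td y) \<cdot>\<^bsub>grpd H c\<^esub> ?u \<beta>') \<cdot>\<^bsub>grpd H c\<^esub> ?u (nati t f x)"
        unfolding functor_Comp[OF U nx \<beta>'H] by (rule Hc.Comp_assoc[OF Unx U\<beta>' nuy, symmetric])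
      finally show "(on_arr (pull H f) \<gamma> \<cdot>\<^bsub>grpd H c\<^esub> nati u f (?td x)) \<cdot>\<^bsub>grpd H c\<^esub> ?u (nati t f x)
          = (nati u f (?td y) \<cdot>\<^bsub>grpd H c\<^esub> ?u \<beta>') \<cdot>\<^bsub>grpd H c\<^esub> ?u (nati t f x)" .
    qed
    note ex' = uff[OF tx ty \<beta>'H \<gamma> sq]
    then obtain \<gamma>'' where \<gamma>'': "\<gamma>'' \<in> Hom (grpd G d) (?td x) (?td y)" "on_arr (pull G f) \<gamma>'' = \<beta>'"
      "on_arr (cmpt u d) \<gamma>'' = \<gamma>" by (auto elim: ex1E)
    have "on_arr (pull G f) \<gamma>'' \<cdot>\<^bsub>grpd G c\<^esub> nati t f x = nati t f y \<cdot>\<^bsub>grpd G c\<^esub> ?t \<beta>"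
      using \<beta>'n \<gamma>''(2) by simp
    note ex = tff[OF x y \<beta> \<gamma>''(1) this]
    \<comment> \<open>Any \<open>h\<close> over \<open>\<beta>\<close> has an image under
      \<open>t\<close> lying over \<open>\<beta>'\<close>, because \<open>nati t f x\<close>
      cancels. As \<open>\<gamma>''\<close> is the only arrow over \<open>\<beta>'\<close> with
      image \<open>\<gamma>\<close>, the two conditions on \<open>h\<close> agree.\<close>
    have *: "h \<in> Hom (grpd F d) x y \<and> on_arr (pull F f) h = \<beta> \<and> on_arr (cmpt (comp_pnt C F H u t) d) h = \<gamma> \<longleftrightarrow>
        h \<in> Hom (grpd F d) x y \<and> on_arr (pull F f) h = \<beta> \<and> on_arr (cmpt t d) h = \<gamma>''" for h
    proof (intro conj_cong refl)
      assume h: "h \<in> Hom (grpd F d) x y" and \<beta>: "on_arr (pull F f) h = \<beta>"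
      note th = functor_Hom[OF Td h]
      have "on_arr (pull G f) (on_arr (cmpt t d) h) = \<beta>'"
        using Gc.right_cancel[OF nx functor_Hom[OF Gf th] \<beta>'H] t.nati_natural[OF f h] \<beta>'n \<beta> by simp
      then have "on_arr (cmpt u d) (on_arr (cmpt t d) h) = \<gamma> \<longleftrightarrow> on_arr (cmpt t d) h = \<gamma>''"
        using ex' th \<gamma>'' by (auto elim: ex1E)
      then show "on_arr (cmpt (comp_pnt C F H u t) d) h = \<gamma> \<longleftrightarrow> on_arr (cmpt t d) h = \<gamma>''"
        using HomD(1)[OF h] by (simp add: comp_pnt_cmpt cd)
    qed
    show "\<exists>!h. h \<in> Hom (grpd F d) x y \<and> on_arr (pull F f) h = \<beta> \<and> on_arr (cmpt (comp_pnt C F H u t) d) h = \<gamma>"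
      unfolding * by (rule ex)
  next
    fix b z \<delta> assume b: "b \<in> Obj (grpd F c)" and z: "z \<in> Obj (grpd H d)"
      and "\<delta> \<in> Hom (grpd H c) (on_obj (cmpt (comp_pnt C F H u t) c) b) (on_obj (pull H f) z)"
    then have \<delta>: "\<delta> \<in> Hom (grpd H c) (on_obj (cmpt u c) (on_obj (cmpt t c) b)) (on_obj (pull H f) z)"
      by (simp add: comp_pnt_cmpt cd)
    from ues[OF functor_Obj[OF T b] z \<delta>] obtain y \<beta>' \<gamma>' where y: "y \<in> Obj (grpd G d)"
      and \<beta>': "\<beta>' \<in> Hom (grpd G c) (on_obj (pull G f) y) (on_obj (cmpt t c) b)"
      and \<gamma>': "\<gamma>' \<in> Hom (grpd H d) (on_obj (cmpt u d) y) z"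
      and eq': "on_arr (pull H f) \<gamma>' \<cdot>\<^bsub>grpd H c\<^esub> nati u f y = \<delta> \<cdot>\<^bsub>grpd H c\<^esub> ?u \<beta>'"
      by blast
    \<comment> \<open>The square for \<open>u\<close> yields an arrow into the image of
      \<open>b\<close>, while the square for \<open>t\<close> asks for one out of it.\<close>
    note \<beta>i = Gc.inv_Hom[OF \<beta>']
    from tes[OF b y \<beta>i] obtain x \<beta> \<gamma> where x: "x \<in> Obj (grpd F d)"
      and \<beta>: "\<beta> \<in> Hom (grpd F c) (on_obj (pull F f) x) b" and \<gamma>: "\<gamma> \<in> Hom (grpd G d) (?td x) y"
      and eq: "on_arr (pull G f) \<gamma> \<cdot>\<^bsub>grpd G c\<^esub> nati t f x = inv_arr (grpd G c) \<beta>' \<cdot>\<^bsub>grpd G c\<^esub> ?t \<beta>"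
      by blast
    note nx = t.nati_Hom[OF f x] and tx = functor_Obj[OF Td x] and t\<beta> = functor_Hom[OF T \<beta>]
    note nux = u.nati_Hom[OF f tx] and ny = u.nati_Hom[OF f y] and U\<gamma> = functor_Hom[OF Ud \<gamma>]
      and G\<gamma> = functor_Hom[OF Gf \<gamma>]
    note atoms = functor_Hom[OF U nx] nux ny functor_Hom[OF Hf \<gamma>'] functor_Hom[OF Hf U\<gamma>] functor_Hom[OF U G\<gamma>]
      functor_Hom[OF U \<beta>'] \<delta> functor_Hom[OF U t\<beta>]
    note simps = Hc.comp_simps Hc.comp_assoc atoms[THEN HomD(1)] atoms[THEN HomD(2)] atoms[THEN HomD(3)]
    have "on_arr (pull H f) (\<gamma>' \<cdot>\<^bsub>grpd H d\<^esub> on_arr (cmpt u d) \<gamma>) \<cdot>\<^bsub>grpd H c\<^esub>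
          (nati u f (?td x) \<cdot>\<^bsub>grpd H c\<^esub> ?u (nati t f x))
        = on_arr (pull H f) \<gamma>' \<cdot>\<^bsub>grpd H c\<^esub> ((on_arr (pull H f) (on_arr (cmpt u d) \<gamma>) \<cdot>\<^bsub>grpd H c\<^esub> nati u f (?td x))
          \<cdot>\<^bsub>grpd H c\<^esub> ?u (nati t f x))"
      unfolding functor_Comp[OF Hf U\<gamma> \<gamma>'] by (simp add: simps)
    also have "\<dots> = (on_arr (pull H f) \<gamma>' \<cdot>\<^bsub>grpd H c\<^esub> nati u f y) \<cdot>\<^bsub>grpd H c\<^esub>
        ?u (on_arr (pull G f) \<gamma> \<cdot>\<^bsub>grpd G c\<^esub> nati t f x)"
      unfolding u.nati_natural[OF f \<gamma>, symmetric] functor_Comp[OF U nx G\<gamma>] by (simp add: simps)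
    also have "\<dots> = \<delta> \<cdot>\<^bsub>grpd H c\<^esub> (?u \<beta>' \<cdot>\<^bsub>grpd H c\<^esub> ?u (on_arr (pull G f) \<gamma> \<cdot>\<^bsub>grpd G c\<^esub> nati t f x))"
      unfolding eq' functor_Comp[OF U nx G\<gamma>] by (simp add: simps)
    also have "\<dots> = \<delta> \<cdot>\<^bsub>grpd H c\<^esub> ?u (\<beta>' \<cdot>\<^bsub>grpd G c\<^esub> (inv_arr (grpd G c) \<beta>' \<cdot>\<^bsub>grpd G c\<^esub> ?t \<beta>))"
      unfolding eq functor_Comp[OF U Gc.Comp_Hom[OF t\<beta> \<beta>i] \<beta>'] ..
    also have "\<dots> = \<delta> \<cdot>\<^bsub>grpd H c\<^esub> ?u (?t \<beta>)"
      unfolding Gc.Comp_inv_cancel_left[OF \<beta>' t\<beta>] ..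
    finally have eq'': "on_arr (pull H f) (\<gamma>' \<cdot>\<^bsub>grpd H d\<^esub> on_arr (cmpt u d) \<gamma>) \<cdot>\<^bsub>grpd H c\<^esub>
        nati (comp_pnt C F H u t) f x = \<delta> \<cdot>\<^bsub>grpd H c\<^esub> on_arr (cmpt (comp_pnt C F H u t) c) \<beta>"
      using HomD(1)[OF \<beta>] by (simp add: comp_pnt_nati[OF f x] comp_pnt_cmpt cd)
    show "\<exists>x \<in> Obj (grpd F d). \<exists>\<beta> \<in> Hom (grpd F c) (on_obj (pull F f) x) b.
        \<exists>\<gamma> \<in> Hom (grpd H d) (on_obj (cmpt (comp_pnt C F H u t) d) x) z.
          on_arr (pull H f) \<gamma> \<cdot>\<^bsub>grpd H c\<^esub> nati (comp_pnt C F H u t) f x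
            = \<delta> \<cdot>\<^bsub>grpd H c\<^esub> on_arr (cmpt (comp_pnt C F H u t) c) \<beta>"
    proof (intro bexI, rule eq'')
      show "\<gamma>' \<cdot>\<^bsub>grpd H d\<^esub> on_arr (cmpt u d) \<gamma> \<in> Hom (grpd H d) (on_obj (cmpt (comp_pnt C F H u t) d) x) z"
        using Hd.Comp_Hom[OF U\<gamma> \<gamma>'] x by (simp add: comp_pnt_cmpt cd)
    qed (fact \<beta> x)+
  qed
qed

lemma generic_Hom: "generic g \<Longrightarrow> g \<in> Hom Delta (Dom Delta g) (Cod Delta g)"
  by (auto simp: generic_def intro: HomI)

lemma culf_id:
  assumes "simplicial_groupoid X"
  shows "culf X X (id_pnt Delta X)"
  unfolding culf_def
proof (intro conjI allI impI)
  show "simplicial_map X X (id_pnt Delta X)" by (rule id_pseudonat[OF assms])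
qed (rule hpullback_id_pnt[OF assms generic_Hom])

lemma culf_comp:
  assumes t: "culf X Y t" and u: "culf Y Z u"
  shows "culf X Z (comp_pnt Delta X Z u t)"
  unfolding culf_def
proof (intro conjI allI impI)
  have t': "simplicial_map X Y t" and u': "simplicial_map Y Z u" using t u by (simp_all add: culf_def)
  show "simplicial_map X Z (comp_pnt Delta X Z u t)" by (rule comp_pseudonat[OF t' u'])
  fix g assume g: "generic g"
  note pt = conjunct2[OF t[unfolded culf_def], rule_format, OF g]
    and pu = conjunct2[OF u[unfolded culf_def], rule_format, OF g]
  show "is_hpullback (grpd X (Cod Delta g)) (grpd X (Dom Delta g)) (grpd Z (Cod Delta g)) (grpd Z (Dom Delta g))
      (pull X g) (cmpt (comp_pnt Delta X Z u t) (Cod Delta g)) (cmpt (comp_pnt Delta X Z u t) (Dom Delta g))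
      (pull Z g) (nati (comp_pnt Delta X Z u t) g)"
    by (rule hpullback_comp_pnt[OF t' u' generic_Hom[OF g] pt pu])
qed

section \<open>The CULF property of induced maps\<close>

context species
begin

lemma layered_eqI:
  assumes "d \<in> Hom (layered R n) x y" "d' \<in> Hom (layered R n) x y" "mid d = mid d'"
  shows "d = d'"
  using layered_HomD(2)[OF assms(1)] layered_HomD(2)[OF assms(2)] assms(3) by simp

lemma und_act_generic: "generic a \<Longrightarrow> a \<in> Hom Delta m n \<Longrightarrow> und (act_obj R a x) = und x"
  by (simp add: act_obj_generic')

text \<open>The restriction arrows of a generic map are identities, so the square defining the
  action on arrows leaves the middle component unchanged.\<close>

lemma mid_pull_generic:
  assumes g: "generic a" and a: "a \<in> Hom Delta m n" and d: "d \<in> Hom (layered R n) x y"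
  shows "mid (on_arr (pull (layered_space R) a) d) = mid d"
proof -
  interpret E: category E by (rule elements_category)
  have "mid (on_arr (pull (layered_space R) a) d) \<in> Hom E (und x) (und y)"
    using layered_HomD(3)[OF pull_arr_Hom[OF a d]] und_act_generic[OF g a] by metis
  from E.Comp_Id_left[OF this] E.Comp_Id_right[OF layered_HomD(3)[OF d]] restr_pull_arr[OF a d]
  show ?thesis by (simp add: restr_arrow_generic[OF g])
qed

end

context species_map
begin

lemma culf_induced_map: "culf (layered_space R') (layered_space R) imap"
  unfolding culf_def
proof (intro conjI allI impI)
  interpret I: pseudonat Delta "layered_space R'" "layered_space R" imap by (rule pseudonat_induced_map)
  show "pseudonat Delta (layered_space R') (layered_space R) imap" by (rule pseudonat_induced_map)
  fix g assume g: "generic g"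
  define n m where "n = Dom Delta g" and "m = Cod Delta g"
  have a: "g \<in> Hom Delta n m" unfolding n_def m_def by (rule generic_Hom[OF g])
  interpret E: category G.E by (rule G.elements_category)
  interpret E': category F.E by (rule F.elements_category)
  interpret Ln: category "layered R n" by (rule G.category_layered)
  interpret Ln': category "layered R' n" by (rule F.category_layered)
  interpret Lm': category "layered R' m" by (rule F.category_layered)
  note obj' = pull_obj_layered_space[OF a]
  show "is_hpullback (grpd (layered_space R') (Cod Delta g)) (grpd (layered_space R') (Dom Delta g))
      (grpd (layered_space R) (Cod Delta g)) (grpd (layered_space R) (Dom Delta g)) (pull (layered_space R') g)
      (cmpt imap (Cod Delta g)) (cmpt imap (Dom Delta g)) (pull (layered_space R) g) (nati imap g)"
    unfolding n_def[symmetric] m_def[symmetric] I.nati_hpullback_iff[OF a]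
    unfolding grpd_layered_space
  proof (intro conjI ballI impI)
    fix x y \<beta> \<gamma> assume x: "x \<in> Obj (layered R' m)" and y: "y \<in> Obj (layered R' m)"
      and "\<beta> \<in> Hom (layered R' n) (on_obj (pull (layered_space R') g) x) (on_obj (pull (layered_space R') g) y)"
      and "\<gamma> \<in> Hom (layered R m) (on_obj (cmpt imap m) x) (on_obj (cmpt imap m) y)"
      and eq: "on_arr (pull (layered_space R) g) \<gamma> \<cdot>\<^bsub>layered R n\<^esub> nati imap g x
        = nati imap g y \<cdot>\<^bsub>layered R n\<^esub> on_arr (cmpt imap n) \<beta>"
    then have \<beta>: "\<beta> \<in> Hom (layered R' n) (act_obj R' g x) (act_obj R' g y)"
      and \<gamma>: "\<gamma> \<in> Hom (layered R m) (ind x) (ind y)"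
      by (simp_all add: obj' induced_map_obj)
    note nx = nati_induced_Hom[OF a x] and ny = nati_induced_Hom[OF a y]
    have \<beta>E: "mid \<beta> \<in> Hom F.E (und x) (und y)"
      using F.layered_HomD(3)[OF \<beta>] unfolding F.und_act_generic[OF g a] .
    \<comment> \<open>Read in the category of elements, \<open>nati\<close> is an identity and
      pulling back along \<open>g\<close> changes nothing, so the compatibility of
      \<open>\<beta>\<close> and \<open>\<gamma>\<close> becomes an equation between their middle
      components.\<close>
    have "mid \<gamma> = mid (on_arr (pull (layered_space R) g) \<gamma> \<cdot>\<^bsub>layered R n\<^esub> nati imap g x)"
      unfolding G.mid_Comp[OF nx G.pull_arr_Hom[OF a \<gamma>]] G.mid_pull_generic[OF g a \<gamma>] nati_induced_generic[OF g a x]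
      using E.Comp_Id_right[OF G.layered_HomD(3)[OF \<gamma>]] by simp
    also have "\<dots> = emap (mid \<beta>)"
      unfolding eq G.mid_Comp[OF induced_map_Hom[OF \<beta>] ny] mid_induced_map[OF \<beta>] nati_induced_generic[OF g a y]
      by (rule E.Comp_Id_left[OF emap_Hom[OF \<beta>E]])
    finally have mid\<gamma>: "mid \<gamma> = emap (mid \<beta>)" .
    \<comment> \<open>The conditions on layers see only the base map, which is the same for
      \<open>emap (mid \<beta>)\<close> and \<open>mid \<beta>\<close>. They can therefore be read
      for \<open>R'\<close>.\<close>
    note o = G.layered_HomD(1)[OF \<gamma>, unfolded mid\<gamma>]
    have "F.over (Id Delta m) m m x (mid \<beta>) y"
      unfolding F.over_def
    proof (intro conjI ballI impI)
      show "Id Delta m \<in> Hom Delta m m" by (rule G.over_Delta[OF o])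
    qed (use x y \<beta>E G.over_surj[OF o] G.over_lay[OF o] in simp_all)
    then have h: "(x, mid \<beta>, y) \<in> Hom (layered R' m) x y" by (simp add: F.layered_Hom)
    show "\<exists>!h. h \<in> Hom (layered R' m) x y \<and> on_arr (pull (layered_space R') g) h = \<beta> \<and> on_arr (cmpt imap m) h = \<gamma>"
    proof (rule ex1I)
      have "on_arr (pull (layered_space R') g) (x, mid \<beta>, y) = \<beta>"
        by (rule F.layered_eqI[OF F.pull_arr_Hom[OF a h] \<beta>]) (simp add: F.mid_pull_generic[OF g a h])
      moreover have "on_arr (cmpt imap m) (x, mid \<beta>, y) = \<gamma>"
        by (rule G.layered_eqI[OF induced_map_Hom[OF h] \<gamma>]) (simp add: mid_induced_map[OF h] mid\<gamma>)
      ultimately show "(x, mid \<beta>, y) \<in> Hom (layered R' m) x y \<and>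
          on_arr (pull (layered_space R') g) (x, mid \<beta>, y) = \<beta> \<and> on_arr (cmpt imap m) (x, mid \<beta>, y) = \<gamma>"
        using h by blast
      fix h' assume h': "h' \<in> Hom (layered R' m) x y \<and> on_arr (pull (layered_space R') g) h' = \<beta> \<and>
          on_arr (cmpt imap m) h' = \<gamma>"
      then show "h' = (x, mid \<beta>, y)"
        using F.mid_pull_generic[OF g a, of h' x y] by (intro F.layered_eqI[OF _ h]) auto
    qed
  next
    fix b z \<delta> assume b: "b \<in> Obj (layered R' n)" and z: "z \<in> Obj (layered R m)"
      and "\<delta> \<in> Hom (layered R n) (on_obj (cmpt imap n) b) (on_obj (pull (layered_space R) g) z)"
    then have \<delta>: "\<delta> \<in> Hom (layered R n) (ind b) (act_obj R g z)"
      by (simp add: obj' induced_map_obj)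
    note o = G.layered_HomD(1)[OF \<delta>]
    have \<delta>E: "mid \<delta> \<in> Hom G.E (und (ind b)) (und z)"
      using G.layered_HomD(3)[OF \<delta>] unfolding G.und_act_generic[OF g a] .
    have mem: "base (mid \<delta>) p \<in> car z" if "p \<in> car b" for p using G.base_mem[OF \<delta>E] that by simp
    \<comment> \<open>The finer layering of \<open>z\<close>, transported along the bijection
      underlying \<open>\<delta>\<close>. The object \<open>x\<close> differs from \<open>b\<close>
      only in this layering.\<close>
    define l where "l = (\<lambda>p \<in> car b. lay z (base (mid \<delta>) p))"
    define x where "x = (fst b, l, snd (snd b))"
    have "layering m (fst b) l"
      unfolding layering_def
    proof (intro conjI allI impI)
      show "l \<in> car b \<rightarrow>\<^sub>E {1..m}" using lay_bounds[OF z mem] by (auto simp: l_def)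
      fix p q assume pq: "(p, q) \<in> snd (fst b)"
      then have m: "p \<in> car b" "q \<in> car b" using b poset_carrier[of "fst b"] by (auto simp: layered_Obj)
      then have "(base (mid \<delta>) p, base (mid \<delta>) q) \<in> snd (fst z)"
        using G.base_reflect[OF \<delta>E] pq by simp
      then show "l p \<le> l q" using z m by (simp add: l_def layered_Obj layering_def)
    qed
    then have x: "x \<in> Obj (layered R' m)" using b by (simp add: x_def layered_Obj)
    \<comment> \<open>Coarsening along \<open>g\<close> returns the layering of \<open>b\<close>
      exactly, so an identity can serve as \<open>\<beta>\<close> and only \<open>\<delta>\<close>
      has to be reinterpreted over \<open>[m]\<close>.\<close>
    have "compose (car b) (under_generic g) l = lay b"
    proof (rule extensionalityI)
      show "compose (car b) (under_generic g) l \<in> extensional (car b)" by (simp add: compose_def)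
      show "lay b \<in> extensional (car b)" using b by (simp add: layered_Obj layering_def PiE_iff)
      fix p assume p: "p \<in> car b"
      have "lay b p = lay (act_obj R g z) (base (mid \<delta>) p)"
        using G.over_lay[OF o, unfolded induced_obj_simps, OF p] lay_bounds[OF b p] by (simp add: app_Id)
      then show "compose (car b) (under_generic g) l p = lay b p"
        using p mem[OF p] by (simp add: compose_def l_def act_obj_generic'[OF a g])
    qed
    then have gx: "act_obj R' g x = b"
      by (cases b) (simp add: act_obj_generic'[OF a g] x_def)
    have "q \<in> base (mid \<delta>) ` car b" if "q \<in> car z" for q
    proof -
      have "q \<in> car (act_obj R g z)" using that by (simp add: act_obj_generic'[OF a g])
      with G.over_surj[OF o this] lay_bounds[OF G.act_Obj[OF a z] this] show ?thesis by (simp add: app_Id)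
    qed
    then have "G.over (Id Delta m) m m (ind x) (mid \<delta>) z"
      unfolding G.over_def
    proof (intro conjI ballI impI)
      show "Id Delta m \<in> Hom Delta m m" by (rule G.over_Delta[OF G.over_Id[OF z]])
      show "mid \<delta> \<in> Hom G.E (und (ind x)) (und z)" using \<delta>E by (simp add: x_def)
      fix p assume "p \<in> car (ind x)"
      then have p: "p \<in> car b" by (simp add: x_def)
      show "app (Id Delta m) (lay (ind x) p - 1) < lay z (base (mid \<delta>) p)"
        "lay z (base (mid \<delta>) p) \<le> app (Id Delta m) (lay (ind x) p)"
        using lay_bounds[OF z mem[OF p]] p by (simp_all add: x_def l_def app_Id)
    qed (use ind_Obj[OF x] z in \<open>simp_all add: x_def\<close>)
    then have \<gamma>: "(ind x, mid \<delta>, z) \<in> Hom (layered R m) (ind x) z" by (simp add: G.layered_Hom)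
    have mid_id: "mid (Id (layered R' n) b) = Id F.E (und b)" by (simp add: layered_Id)
    note nx = nati_induced_Hom[OF a x, unfolded gx] note ib = induced_map_Hom[OF Ln'.Id_Hom[OF b]]
    note g\<gamma> = G.pull_arr_Hom[OF a \<gamma>]
    have eq: "on_arr (pull (layered_space R) g) (ind x, mid \<delta>, z) \<cdot>\<^bsub>layered R n\<^esub> nati imap g x
        = \<delta> \<cdot>\<^bsub>layered R n\<^esub> on_arr (cmpt imap n) (Id (layered R' n) b)"
    proof (rule G.layered_eqI[OF Ln.Comp_Hom[OF nx g\<gamma>] Ln.Comp_Hom[OF ib \<delta>]])
      have "mid (on_arr (pull (layered_space R) g) (ind x, mid \<delta>, z) \<cdot>\<^bsub>layered R n\<^esub> nati imap g x) = mid \<delta>"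
        unfolding G.mid_Comp[OF nx g\<gamma>] G.mid_pull_generic[OF g a \<gamma>] nati_induced_generic[OF g a x]
        using E.Comp_Id_right[OF \<delta>E] by (simp add: x_def)
      moreover have "mid (\<delta> \<cdot>\<^bsub>layered R n\<^esub> on_arr (cmpt imap n) (Id (layered R' n) b)) = mid \<delta>"
        unfolding G.mid_Comp[OF ib \<delta>] mid_induced_map[OF Ln'.Id_Hom[OF b]] mid_id emap_Id[OF b]
        by (rule E.Comp_Id_right[OF \<delta>E])
      ultimately show "mid (on_arr (pull (layered_space R) g) (ind x, mid \<delta>, z) \<cdot>\<^bsub>layered R n\<^esub> nati imap g x)
          = mid (\<delta> \<cdot>\<^bsub>layered R n\<^esub> on_arr (cmpt imap n) (Id (layered R' n) b))" by simp
    qed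
    show "\<exists>x \<in> Obj (layered R' m). \<exists>\<beta> \<in> Hom (layered R' n) (on_obj (pull (layered_space R') g) x) b.
        \<exists>\<gamma> \<in> Hom (layered R m) (on_obj (cmpt imap m) x) z.
          on_arr (pull (layered_space R) g) \<gamma> \<cdot>\<^bsub>layered R n\<^esub> nati imap g x
            = \<delta> \<cdot>\<^bsub>layered R n\<^esub> on_arr (cmpt imap n) \<beta>"
    proof (intro bexI, rule eq)
      show "(ind x, mid \<delta>, z) \<in> Hom (layered R m) (on_obj (cmpt imap m) x) z"
        using \<gamma> by (simp add: induced_map_obj[OF x])
      show "Id (layered R' n) b \<in> Hom (layered R' n) (on_obj (pull (layered_space R') g) x) b"
        using Ln'.Id_Hom[OF b] by (simp add: obj'[OF x] gx)
    qed (rule x)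
  qed
qed

end

section \<open>Pushouts of generic and free maps\<close>

text \<open>The pushout of \<open>g\<close> along the free map with offset \<open>c\<close>: act as \<open>g\<close> on the block \<open>{c, \<dots>, c + n}\<close>.\<close>

definition stretch :: "(nat \<Rightarrow> nat) \<Rightarrow> nat \<Rightarrow> nat \<Rightarrow> nat \<Rightarrow> nat \<Rightarrow> nat" where
  "stretch g n m c i = (if i \<le> c then i else if i \<le> c + n then g (i - c) + c else i + m - n)"

text \<open>Below, on and above the block the values are at most \<open>c\<close>, between
  \<open>c\<close> and \<open>c + m\<close>, and above \<open>c + m\<close>; monotonicity of
  \<open>g\<close> matters only for two points of the block.\<close>

lemma stretch_mono:
  assumes g: "g \<in> Hom Delta n m" and ij: "i \<le> j"
  shows "stretch (app g) n m c i \<le> stretch (app g) n m c j"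
proof -
  consider "j \<le> c" | "i \<le> c" "c < j" "j \<le> c + n" | "i \<le> c" "c + n < j" | "c < i" "j \<le> c + n"
    | "c < i" "i \<le> c + n" "c + n < j" | "c + n < i" using ij by linarith
  then show ?thesis
  proof cases
    case 4
    then show ?thesis using ij app_mono[OF g, of "i - c" "j - c"] by (simp add: stretch_def)
  next
    case 5
    have "app g (i - c) \<le> m" using 5 by (intro app_le[OF g]) simp
    then show ?thesis using 5 by (simp add: stretch_def)
  qed (use ij in \<open>simp_all add: stretch_def\<close>)
qed

lemma inflationary:
  assumes "\<And>j. j < N \<Longrightarrow> h j < h (Suc j)" "j \<le> N"
  shows "j \<le> (h j :: nat)"
  using assms(2)
proof (induction j)
  case (Suc j)
  then show ?case using assms(1)[of j] by linarith
qed simp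

text \<open>Mutually inverse monotone maps are injective, hence strictly increasing, hence both
  dominate the identity by \<open>inflationary\<close>. Being inverse to each other, they are
  identities.\<close>

lemma inverse_maps_Delta:
  assumes h: "h \<in> Hom Delta l m" and k: "k \<in> Hom Delta m l"
    and kh: "\<And>i. i \<le> l \<Longrightarrow> app k (app h i) = i" and hk: "\<And>j. j \<le> m \<Longrightarrow> app h (app k j) = j"
  shows "l = m" "j \<le> m \<Longrightarrow> app k j = j"
proof -
  have strict: "app a j < app a (Suc j)"
    if a: "a \<in> Hom Delta p q" and inv: "\<And>i. i \<le> p \<Longrightarrow> b (app a i) = i" and j: "j < p" for a b p q j
  proof -
    have "app a j \<noteq> app a (Suc j)"
    proof
      assume "app a j = app a (Suc j)"
      then show False using inv[of j] inv[of "Suc j"] j by simp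
    qed
    then show ?thesis using app_mono[OF a, of j "Suc j"] j by simp
  qed
  have hi: "i \<le> app h i" if "i \<le> l" for i
  proof (rule inflationary[OF _ that])
    show "app h j < app h (Suc j)" if "j < l" for j by (rule strict[OF h _ that]) (rule kh)
  qed
  have ki: "j \<le> app k j" if "j \<le> m" for j
  proof (rule inflationary[OF _ that])
    show "app k j < app k (Suc j)" if "j < m" for j by (rule strict[OF k _ that]) (rule hk)
  qed
  show "l = m"
    using hi[of l] ki[of m] app_le[OF h, of l] app_le[OF k, of m] by simp
  show "app k j = j" if "j \<le> m"
    using hi[of "app k j"] ki[OF that] hk[OF that] app_le[OF k that] by simp
qed

text \<open>An explicit cocone \<open>F\<close>, \<open>G\<close> is compared with the given one:
  the universal property supplies \<open>h\<close> in one direction, gluing supplies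
  \<open>H\<close> in the other. Rigidity of the simplex category makes both identities, and the
  formulas for \<open>F\<close> and \<open>G\<close> become formulas for \<open>f'\<close> and
  \<open>g'\<close>.\<close>

lemma pushout_shape:
  assumes g: "g \<in> Hom Delta n m" and gen: "generic g" and f: "f \<in> Hom Delta n k" and fr: "free f"
    and f': "f' \<in> Hom Delta m l" and g': "g' \<in> Hom Delta k l" and comm: "f' \<cdot>\<^bsub>Delta\<^esub> g = g' \<cdot>\<^bsub>Delta\<^esub> f"
    and univ: "\<forall>z. \<forall>p \<in> Hom Delta m z. \<forall>q \<in> Hom Delta k z. p \<cdot>\<^bsub>Delta\<^esub> g = q \<cdot>\<^bsub>Delta\<^esub> f \<longrightarrow>
      (\<exists>!h. h \<in> Hom Delta l z \<and> h \<cdot>\<^bsub>Delta\<^esub> f' = p \<and> h \<cdot>\<^bsub>Delta\<^esub> g' = q)"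
  defines "c \<equiv> app f 0"
  shows "l = k + m - n" "n + c \<le> k" "j \<le> m \<Longrightarrow> app f' j = j + c"
    "i \<le> k \<Longrightarrow> app g' i = stretch (app g) n m c i"
proof -
  interpret Delta: category Delta by (rule category_Delta)
  note univ = univ[rule_format]
  have g0: "app g 0 = 0" "app g n = m" using gen by (auto simp: generic_iff[OF g])
  have fi: "app f i = i + c" if "i \<le> n" for i using fr that unfolding free_iff[OF f] c_def by blast
  show nck: "n + c \<le> k" using app_le[OF f, of n] fi[of n] by simp
  \<comment> \<open>The block of length \<open>n\<close> inside \<open>[k]\<close> is replaced by
    one of length \<open>m\<close>.\<close>
  define L where "L = k + m - n"
  have cm: "app f' (app g t) = app g' (t + c)" if "t \<le> n" for t
    using app_Comp[OF g f' that] app_Comp[OF f g' that] comm fi[OF that] by simp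
  define F where "F = (m, (\<lambda>j \<in> {0..m}. j + c), L)"
  define G where "G = (k, (\<lambda>i \<in> {0..k}. stretch (app g) n m c i), L)"
  have F: "F \<in> Hom Delta m L" using nck by (auto simp: F_def L_def Delta_Hom mono_on_def)
  have Fa: "app F j = j + c" if "j \<le> m" for j using that by (simp add: F_def)
  have "stretch (app g) n m c i \<le> L" if "i \<le> k" for i
  proof -
    have "app g (i - c) \<le> m" if "i \<le> c + n" using that by (intro app_le[OF g]) simp
    then show ?thesis using that nck by (auto simp: stretch_def L_def)
  qed
  then have G: "G \<in> Hom Delta k L"
    using stretch_mono[OF g] by (auto simp: G_def Delta_Hom mono_on_def)
  have Ga: "app G i = stretch (app g) n m c i" if "i \<le> k" for i using that by (simp add: G_def)
  have FG: "F \<cdot>\<^bsub>Delta\<^esub> g = G \<cdot>\<^bsub>Delta\<^esub> f"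
  proof (rule Delta_eqI[OF Delta.Comp_Hom[OF g F] Delta.Comp_Hom[OF f G]])
    fix i assume i: "i \<le> n"
    have "app F (app g i) = app g i + c" using Fa app_le[OF g i] by simp
    moreover have "app G (app f i) = app g i + c" using Ga[of "i + c"] i nck g0 by (simp add: fi stretch_def)
    ultimately show "app (F \<cdot>\<^bsub>Delta\<^esub> g) i = app (G \<cdot>\<^bsub>Delta\<^esub> f) i"
      by (simp add: app_Comp[OF g F i] app_Comp[OF f G i])
  qed
  obtain h where h: "h \<in> Hom Delta l L" "h \<cdot>\<^bsub>Delta\<^esub> f' = F" "h \<cdot>\<^bsub>Delta\<^esub> g' = G"
    using univ[OF F G FG] by (auto elim: ex1E)
  \<comment> \<open>The inverse comparison, glued from the given cocone: on the stretched block read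
    off \<open>f'\<close>, outside it read off \<open>g'\<close> at the unstretched index. Above the
    block \<open>j + n - m\<close> undoes the translation in \<open>stretch\<close>.\<close>
  define r where "r j = (if j \<le> c then app g' j else if j \<le> c + m then app f' (j - c) else app g' (j + n - m))" for j
  define H where "H = (L, (\<lambda>j \<in> {0..L}. r j), l)"
  \<comment> \<open>The given cocone agrees at both ends of the block, so the pieces of
    \<open>r\<close> fit together monotonically.\<close>
  have j0: "app g' c = app f' 0" "app f' m = app g' (n + c)" using cm[of 0] cm[of n] g0 by simp_all
  have r_mono: "r i \<le> r j" if ij: "i \<le> j" "j \<le> L" for i j
  proof -
    consider "j \<le> c" | "i \<le> c" "c < j" "j \<le> c + m" | "i \<le> c" "c + m < j" | "c < i" "j \<le> c + m"
      | "c < i" "i \<le> c + m" "c + m < j" | "c + m < i" using ij by linarith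
    then show ?thesis
    proof cases
      case 1
      then show ?thesis using ij nck app_mono[OF g', of i j] by (simp add: r_def)
    next
      case 2
      then have "r i = app g' i" "r j = app f' (j - c)" by (simp_all add: r_def)
      then show ?thesis using 2 nck app_mono[OF g', of i c] app_mono[OF f', of 0 "j - c"] j0 by linarith
    next
      case 3
      then have "r i = app g' i" "r j = app g' (j + n - m)" by (simp_all add: r_def)
      moreover have "i \<le> j + n - m" "j + n - m \<le> k" using 3 ij nck by (simp_all add: L_def)
      ultimately show ?thesis using app_mono[OF g'] by simp
    next
      case 4
      then show ?thesis using ij app_mono[OF f', of "i - c" "j - c"] by (simp add: r_def)
    next
      case 5
      then have "r i = app f' (i - c)" "r j = app g' (j + n - m)" by (simp_all add: r_def)
      moreover have "n + c \<le> j + n - m" "j + n - m \<le> k" using 5 ij nck by (simp_all add: L_def)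
      then have "app g' (n + c) \<le> app g' (j + n - m)" by (rule app_mono[OF g'])
      moreover have "i - c \<le> m" using 5 by simp
      then have "app f' (i - c) \<le> app f' m" by (rule app_mono[OF f']) simp
      ultimately show ?thesis using j0 by linarith
    next
      case 6
      then have "r i = app g' (i + n - m)" "r j = app g' (j + n - m)" using ij by (simp_all add: r_def)
      moreover have "i + n - m \<le> j + n - m" "j + n - m \<le> k" using 6 ij nck by (simp_all add: L_def)
      ultimately show ?thesis using app_mono[OF g'] by simp
    qed
  qed
  have "r j \<le> l" if "j \<le> L" for j
  proof -
    consider "j \<le> c" | "c < j" "j \<le> c + m" | "c + m < j" by linarith
    then show ?thesis
    proof cases
      case 1
      then have "app g' j \<le> l" using nck by (intro app_le[OF g']) simp
      then show ?thesis using 1 by (simp add: r_def)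
    next
      case 2
      then have "app f' (j - c) \<le> l" by (intro app_le[OF f']) simp
      then show ?thesis using 2 by (simp add: r_def)
    next
      case 3
      then have "app g' (j + n - m) \<le> l" using that nck by (intro app_le[OF g']) (simp add: L_def)
      then show ?thesis using 3 by (simp add: r_def)
    qed
  qed
  then have H: "H \<in> Hom Delta L l" using r_mono by (auto simp: H_def Delta_Hom mono_on_def)
  have Ha: "app H j = r j" if "j \<le> L" for j using that by (simp add: H_def)
  have HF: "H \<cdot>\<^bsub>Delta\<^esub> F = f'"
  proof (rule Delta_eqI[OF Delta.Comp_Hom[OF F H] f'])
    fix j assume j: "j \<le> m"
    have "j + c \<le> L" using j nck by (simp add: L_def)
    then show "app (H \<cdot>\<^bsub>Delta\<^esub> F) j = app f' j"
      using j j0 by (simp add: app_Comp[OF F H j] Fa Ha r_def)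
  qed
  have HG: "H \<cdot>\<^bsub>Delta\<^esub> G = g'"
  proof (rule Delta_eqI[OF Delta.Comp_Hom[OF G H] g'])
    fix i assume i: "i \<le> k"
    have sL: "stretch (app g) n m c i \<le> L" using app_le[OF G i] by (simp add: Ga[OF i])
    consider "i \<le> c" | "c < i" "i \<le> c + n" | "c + n < i" by linarith
    then have "r (stretch (app g) n m c i) = app g' i"
    proof cases
      case 1 then show ?thesis by (simp add: r_def stretch_def)
    next
      case 2
      then have t: "i - c \<le> n" by simp
      then have "r (app g (i - c) + c) = app f' (app g (i - c))"
        using app_le[OF g t] j0 by (simp add: r_def)
      then show ?thesis using 2 cm[OF t] by (simp add: stretch_def)
    next
      case 3
      then have "c + m < i + m - n" "i + m - n + n - m = i" by linarith+
      then show ?thesis using 3 by (simp add: r_def stretch_def)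
    qed
    then show "app (H \<cdot>\<^bsub>Delta\<^esub> G) i = app g' i"
      by (simp add: app_Comp[OF G H i] Ga[OF i] Ha[OF sL])
  qed
  have i: "Id Delta l \<in> Hom Delta l l" by (rule Delta.Id_Hom) (simp add: Delta_simps)
  \<comment> \<open>Both arrows mediate from the given cocone to itself, so the uniqueness part of
    the universal property identifies them.\<close>
  have "H \<cdot>\<^bsub>Delta\<^esub> h = Id Delta l"
  proof -
    note the = the1_equality[OF univ[OF f' g' comm]]
    show ?thesis
    proof (rule trans[OF sym[OF the] the])
      show "H \<cdot>\<^bsub>Delta\<^esub> h \<in> Hom Delta l l \<and> (H \<cdot>\<^bsub>Delta\<^esub> h) \<cdot>\<^bsub>Delta\<^esub> f' = f' \<and> (H \<cdot>\<^bsub>Delta\<^esub> h) \<cdot>\<^bsub>Delta\<^esub> g' = g'"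
        unfolding Delta.Comp_assoc[OF f' h(1) H] Delta.Comp_assoc[OF g' h(1) H] h(2,3) HF HG
        using Delta.Comp_Hom[OF h(1) H] by simp
      show "Id Delta l \<in> Hom Delta l l \<and> Id Delta l \<cdot>\<^bsub>Delta\<^esub> f' = f' \<and> Id Delta l \<cdot>\<^bsub>Delta\<^esub> g' = g'"
        using i Delta.Comp_Id_left[OF f'] Delta.Comp_Id_left[OF g'] by simp
    qed
  qed
  then have Hh: "app H (app h i) = i" if "i \<le> l" for i
    using app_Comp[OF h(1) H that] that by (simp add: app_Id)
  have hf': "app h (app f' j) = j + c" if "j \<le> m" for j
    using app_Comp[OF f' h(1) that] Fa[OF that] h(2) by simp
  have hg': "app h (app g' i) = stretch (app g) n m c i" if "i \<le> k" for i
    using app_Comp[OF g' h(1) that] Ga[OF that] h(3) by simp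
  \<comment> \<open>The other composite is computed piece by piece: \<open>h\<close> is known on the
    values of \<open>f'\<close> and \<open>g'\<close>, and \<open>r\<close> takes only such
    values.\<close>
  have hH: "app h (app H j) = j" if j: "j \<le> L" for j
  proof -
    consider "j \<le> c" | "c < j" "j \<le> c + m" | "c + m < j" by linarith
    then show ?thesis
    proof cases
      case 1 then show ?thesis using nck hg'[of j] by (simp add: Ha[OF j] r_def stretch_def)
    next
      case 2 then show ?thesis using hf'[of "j - c"] by (simp add: Ha[OF j] r_def)
    next
      case 3
      then have "j + n - m \<le> k" using j nck by (simp add: L_def)
      moreover have "c + n < j + n - m" "j + n - m + m - n = j" using 3 by linarith+
      ultimately show ?thesis using 3 hg'[of "j + n - m"] by (simp add: Ha[OF j] r_def stretch_def)
    qed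
  qed
  note inv = inverse_maps_Delta[OF h(1) H Hh hH]
  show "l = k + m - n" using inv(1) by (simp add: L_def)
  show "app f' j = j + c" if "j \<le> m"
  proof -
    have "j + c \<le> L" using app_le[OF F that] by (simp add: Fa[OF that])
    then show ?thesis using app_Comp[OF F H that] HF inv(2) by (simp add: Fa[OF that])
  qed
  show "app g' i = stretch (app g) n m c i" if "i \<le> k"
  proof -
    have "stretch (app g) n m c i \<le> L" using app_le[OF G that] by (simp add: Ga[OF that])
    then show ?thesis using app_Comp[OF G H that] HG inv(2) by (simp add: Ga[OF that])
  qed
qed


section \<open>The decomposition space property\<close>

text \<open>The formulas of \<open>pushout_shape\<close> stand in for the universal property;
  \<open>c\<close> is the offset of the free map \<open>f\<close>.\<close>

locale pushout_square = species R for R :: "('a, 'o, 'm) species" +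
  fixes g f f' g' :: smap and n m k l c :: nat
  assumes g: "g \<in> Hom Delta n m" and gen: "generic g" and f: "f \<in> Hom Delta n k"
    and f': "f' \<in> Hom Delta m l" and g': "g' \<in> Hom Delta k l" and comm: "f' \<cdot>\<^bsub>Delta\<^esub> g = g' \<cdot>\<^bsub>Delta\<^esub> f"
    and l: "l = k + m - n" and nck: "n + c \<le> k"
    and app_f: "i \<le> n \<Longrightarrow> app f i = i + c" and app_f': "j \<le> m \<Longrightarrow> app f' j = j + c"
    and app_g': "i \<le> k \<Longrightarrow> app g' i = stretch (app g) n m c i"
begin

interpretation E: category E by (rule elements_category)
interpretation Delta: category Delta by (rule category_Delta)
interpretation Ln: groupoid "layered R n" by (rule groupoid_layered)
interpretation Lm: groupoid "layered R m" by (rule groupoid_layered)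
interpretation Lk: groupoid "layered R k" by (rule groupoid_layered)
interpretation Ll: groupoid "layered R l" by (rule groupoid_layered)

lemma g_ends: "app g 0 = 0" "app g n = m"
  using gen by (auto simp: generic_iff[OF g])

lemma app_g'_block:
  assumes "t \<le> n"
  shows "app g' (t + c) = app g t + c"
  using assms app_g'[of "t + c"] nck g_ends by (cases "t = 0") (simp_all add: stretch_def)

text \<open>The boundary index \<open>c + n\<close> falls under the earlier clauses of
  \<open>stretch\<close>; they agree with the translation there because a generic \<open>g\<close>
  sends \<open>n\<close> to \<open>m\<close>.\<close>

lemma app_g'_above:
  assumes "c + n \<le> i" "i \<le> k"
  shows "app g' i = i + m - n"
proof (cases "i = n + c")
  case True
  then show ?thesis using app_g'_block[of n] g_ends by simp
next
  case False
  with assms have "c + n < i" by simp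
  then show ?thesis using assms app_g'[of i] by (simp add: stretch_def)
qed

text \<open>Stretching preserves both ends. Hence pulling back along \<open>g'\<close> as well as
  along \<open>g\<close> changes only layerings.\<close>

lemma gen': "generic g'"
  using nck app_g'[of 0] app_g'_above[of k] by (simp add: generic_iff[OF g'] l stretch_def)

abbreviation "X \<equiv> layered_space R"

definition \<alpha> :: "('a, 'o) lstr \<Rightarrow> ('a, 'o, 'm) lstr_arrow" where
  "\<alpha> x = inv_arr (layered R n) (compositor X f g' x) \<cdot>\<^bsub>layered R n\<^esub> compositor X g f' x"

lemma \<alpha>_Hom:
  assumes x: "x \<in> Obj (layered R l)"
  shows "\<alpha> x \<in> Hom (layered R n) (act_obj R g (act_obj R f' x)) (act_obj R f (act_obj R g' x))"
  unfolding \<alpha>_def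
  using Ln.Comp_Hom[OF compositor_layered_Hom[OF g f' x, unfolded comm] Ln.inv_Hom[OF compositor_layered_Hom[OF f g' x]]] .

text \<open>As \<open>g\<close> and \<open>g'\<close> are generic, \<open>\<alpha> x\<close> is the comparison of two restrictions of the same structure.\<close>

lemma restr_\<alpha>:
  assumes x: "x \<in> Obj (layered R l)"
  shows "restr_arrow R f (act_obj R g' x) \<cdot>\<^bsub>E\<^esub> mid (\<alpha> x) = restr_arrow R f' x"
proof -
  note k1 = compositor_layered_Hom[OF g f' x, unfolded comm] and k2 = compositor_layered_Hom[OF f g' x]
  note f'x = act_Obj[OF f' x] and g'x = act_Obj[OF g' x] and gf = Delta.Comp_Hom[OF f g']
  note \<alpha>x = \<alpha>_Hom[OF x]
  have k: "compositor X f g' x \<cdot>\<^bsub>layered R n\<^esub> \<alpha> x = compositor X g f' x"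
    unfolding \<alpha>_def by (rule Ln.Comp_inv_cancel_left[OF k2 k1])
  have r: "restr_arrow R f (act_obj R g' x) \<in> Hom E (und (act_obj R f (act_obj R g' x))) (und x)"
    using restr_Hom[OF f g'x] unfolding und_act_generic[OF gen' g'] .
  note r\<alpha> = E.Comp_Hom[OF layered_HomD(3)[OF \<alpha>x] r]
  note atoms = restr_Hom[OF gf x] layered_HomD(3)[OF k2] layered_HomD(3)[OF \<alpha>x]
  have "restr_arrow R f' x = restr_arrow R f' x \<cdot>\<^bsub>E\<^esub> restr_arrow R g (act_obj R f' x)"
    unfolding restr_arrow_generic[OF gen] by (rule E.Comp_Id_right[OF restr_Hom[OF f' x], symmetric])
  also have "\<dots> = restr_arrow R (g' \<cdot>\<^bsub>Delta\<^esub> f) x \<cdot>\<^bsub>E\<^esub> mid (compositor X g f' x)"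
    by (rule restr_compositor[OF g f' x, unfolded comm, symmetric])
  also have "\<dots> = (restr_arrow R (g' \<cdot>\<^bsub>Delta\<^esub> f) x \<cdot>\<^bsub>E\<^esub> mid (compositor X f g' x)) \<cdot>\<^bsub>E\<^esub> mid (\<alpha> x)"
    unfolding k[symmetric] mid_Comp[OF \<alpha>x k2] by (rule E.Comp_assoc[OF atoms(3,2,1), symmetric])
  also have "\<dots> = restr_arrow R g' x \<cdot>\<^bsub>E\<^esub> (restr_arrow R f (act_obj R g' x) \<cdot>\<^bsub>E\<^esub> mid (\<alpha> x))"
    unfolding restr_compositor[OF f g' x]
    by (rule E.Comp_assoc[OF layered_HomD(3)[OF \<alpha>x] restr_Hom[OF f g'x] restr_Hom[OF g' x]])
  also have "\<dots> = restr_arrow R f (act_obj R g' x) \<cdot>\<^bsub>E\<^esub> mid (\<alpha> x)"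
    unfolding restr_arrow_generic[OF gen'] by (rule E.Comp_Id_left[OF r\<alpha>])
  finally show ?thesis ..
qed

text \<open>Composition with the restriction of \<open>act_obj R g' y\<close> along \<open>f\<close>
  is injective on arrows and turns \<open>\<alpha>\<close> into restriction along \<open>f'\<close>.
  As \<open>g\<close> and \<open>g'\<close> are generic, they leave no trace in the resulting
  equation.\<close>

lemma \<alpha>_square:
  assumes x: "x \<in> Obj (layered R l)" and y: "y \<in> Obj (layered R l)"
    and \<beta>: "\<beta> \<in> Hom (layered R m) (act_obj R f' x) (act_obj R f' y)"
    and \<gamma>: "\<gamma> \<in> Hom (layered R k) (act_obj R g' x) (act_obj R g' y)"
  shows "on_arr (pull X f) \<gamma> \<cdot>\<^bsub>layered R n\<^esub> \<alpha> x = \<alpha> y \<cdot>\<^bsub>layered R n\<^esub> on_arr (pull X g) \<beta> \<longleftrightarrow>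
    mid \<gamma> \<cdot>\<^bsub>E\<^esub> restr_arrow R f' x = restr_arrow R f' y \<cdot>\<^bsub>E\<^esub> mid \<beta>" (is "?l = ?r \<longleftrightarrow> _")
proof -
  note \<alpha>x = \<alpha>_Hom[OF x] and \<alpha>y = \<alpha>_Hom[OF y] and f\<gamma> = pull_arr_Hom[OF f \<gamma>] and g\<beta> = pull_arr_Hom[OF g \<beta>]
  note g'x = act_Obj[OF g' x] and g'y = act_Obj[OF g' y]
  let ?rx = "restr_arrow R f (act_obj R g' x)" and ?ry = "restr_arrow R f (act_obj R g' y)"
  have "?ry \<cdot>\<^bsub>E\<^esub> mid ?l = (?ry \<cdot>\<^bsub>E\<^esub> mid (on_arr (pull X f) \<gamma>)) \<cdot>\<^bsub>E\<^esub> mid (\<alpha> x)"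
    unfolding mid_Comp[OF \<alpha>x f\<gamma>]
    by (rule E.Comp_assoc[OF layered_HomD(3)[OF \<alpha>x] layered_HomD(3)[OF f\<gamma>] restr_Hom[OF f g'y], symmetric])
  also have "\<dots> = mid \<gamma> \<cdot>\<^bsub>E\<^esub> (?rx \<cdot>\<^bsub>E\<^esub> mid (\<alpha> x))"
    unfolding restr_pull_arr[OF f \<gamma>]
    by (rule E.Comp_assoc[OF layered_HomD(3)[OF \<alpha>x] restr_Hom[OF f g'x] layered_HomD(3)[OF \<gamma>]])
  finally have 1: "?ry \<cdot>\<^bsub>E\<^esub> mid ?l = mid \<gamma> \<cdot>\<^bsub>E\<^esub> restr_arrow R f' x" unfolding restr_\<alpha>[OF x] .
  have "?ry \<cdot>\<^bsub>E\<^esub> mid ?r = (?ry \<cdot>\<^bsub>E\<^esub> mid (\<alpha> y)) \<cdot>\<^bsub>E\<^esub> mid (on_arr (pull X g) \<beta>)"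
    unfolding mid_Comp[OF g\<beta> \<alpha>y]
    by (rule E.Comp_assoc[OF layered_HomD(3)[OF g\<beta>] layered_HomD(3)[OF \<alpha>y] restr_Hom[OF f g'y], symmetric])
  then have 2: "?ry \<cdot>\<^bsub>E\<^esub> mid ?r = restr_arrow R f' y \<cdot>\<^bsub>E\<^esub> mid \<beta>"
    unfolding restr_\<alpha>[OF y] mid_pull_generic[OF gen g \<beta>] .
  show ?thesis
  proof
    assume eq: "?l = ?r"
    show "mid \<gamma> \<cdot>\<^bsub>E\<^esub> restr_arrow R f' x = restr_arrow R f' y \<cdot>\<^bsub>E\<^esub> mid \<beta>"
      unfolding 1[symmetric] 2[symmetric] eq ..
  next
    assume eq: "mid \<gamma> \<cdot>\<^bsub>E\<^esub> restr_arrow R f' x = restr_arrow R f' y \<cdot>\<^bsub>E\<^esub> mid \<beta>"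
    show "?l = ?r"
      by (rule over_cancel[OF restr_over[OF f g'y] Ln.Comp_Hom[OF \<alpha>x f\<gamma>] Ln.Comp_Hom[OF g\<beta> \<alpha>y]])
        (unfold 1 2 eq, rule refl)
  qed
qed

lemma \<alpha>_nat_iso:
  "nat_iso (layered R l) (layered R n) (comp_funct (layered R l) (pull X g) (pull X f'))
     (comp_funct (layered R l) (pull X f) (pull X g')) \<alpha>"
proof (rule nat_isoI[OF groupoid_layered])
  show "is_functor (layered R l) (layered R n) (comp_funct (layered R l) (pull X g) (pull X f'))"
    "is_functor (layered R l) (layered R n) (comp_funct (layered R l) (pull X f) (pull X g'))"
    by (rule comp_functor[OF pull_functor_layered_space[OF f'] pull_functor_layered_space[OF g]]
        comp_functor[OF pull_functor_layered_space[OF g'] pull_functor_layered_space[OF f]])+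
  show "\<alpha> x \<in> Hom (layered R n) (on_obj (comp_funct (layered R l) (pull X g) (pull X f')) x)
      (on_obj (comp_funct (layered R l) (pull X f) (pull X g')) x)" if x: "x \<in> Obj (layered R l)" for x
    using \<alpha>_Hom[OF x] x by (simp add: pull_obj_layered_space[OF f'] pull_obj_layered_space[OF g']
        pull_obj_layered_space[OF f] pull_obj_layered_space[OF g] act_Obj[OF f'] act_Obj[OF g'])
  fix h x y assume h: "h \<in> Hom (layered R l) x y"
  note xy = Ll.Hom_Obj[OF h]
  have "mid (on_arr (pull X g') h) \<cdot>\<^bsub>E\<^esub> restr_arrow R f' x = restr_arrow R f' y \<cdot>\<^bsub>E\<^esub> mid (on_arr (pull X f') h)"
    unfolding mid_pull_generic[OF gen' g' h] restr_pull_arr[OF f' h] ..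
  then show "\<alpha> y \<cdot>\<^bsub>layered R n\<^esub> on_arr (comp_funct (layered R l) (pull X g) (pull X f')) h
      = on_arr (comp_funct (layered R l) (pull X f) (pull X g')) h \<cdot>\<^bsub>layered R n\<^esub> \<alpha> x"
    unfolding \<alpha>_square[OF xy pull_arr_Hom[OF f' h] pull_arr_Hom[OF g' h], symmetric]
    using HomD(1)[OF h] by simp
qed

text \<open>Outside the stretched block \<open>g'\<close> is a translation, so its interval ending
  at \<open>t\<close> contains the single layer \<open>t\<close>; coarsening along \<open>g'\<close>
  loses nothing there.\<close>

lemma singleton_layer:
  assumes t: "1 \<le> t" "t \<le> l" "t \<le> c \<or> c + m < t"
  obtains i where "i \<in> {1..k}" "app g' (i - 1) = t - 1" "app g' i = t"
proof (cases "t \<le> c")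
  case True
  then have "app g' t = t" "app g' (t - 1) = t - 1"
    using app_g'[of t] app_g'[of "t - 1"] nck by (auto simp: stretch_def)
  then show ?thesis using that[of t] True t nck by simp
next
  case False
  define i where "i = t + n - m"
  have t': "c + m < t" using False t by simp
  have i: "c + n < i" "i \<le> k" using t' t nck by (auto simp: i_def l)
  have "app g' i = t" using app_g'_above[of i] i t' by (simp add: i_def)
  moreover have "app g' (i - 1) = t - 1" using app_g'_above[of "i - 1"] i t' by (simp add: i_def)
  ultimately show ?thesis using that[of i] i by simp
qed

text \<open>As \<open>g'\<close> is generic, \<open>h\<close> must have the middle component of
  \<open>\<gamma>\<close>; the question is whether this respects the finer layers over
  \<open>[l]\<close>. Outside the block \<open>\<gamma>\<close> already controls them, since layers
  are not merged there, and inside the block \<open>\<beta>\<close> does.\<close>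

lemma fully_faithful:
  assumes x: "x \<in> Obj (layered R l)" and y: "y \<in> Obj (layered R l)"
    and \<beta>: "\<beta> \<in> Hom (layered R m) (act_obj R f' x) (act_obj R f' y)"
    and \<gamma>: "\<gamma> \<in> Hom (layered R k) (act_obj R g' x) (act_obj R g' y)"
    and eq: "mid \<gamma> \<cdot>\<^bsub>E\<^esub> restr_arrow R f' x = restr_arrow R f' y \<cdot>\<^bsub>E\<^esub> mid \<beta>"
  shows "\<exists>!h. h \<in> Hom (layered R l) x y \<and> on_arr (pull X f') h = \<beta> \<and> on_arr (pull X g') h = \<gamma>"
proof -
  let ?e = "mid \<gamma>"
  have e: "?e \<in> Hom E (und x) (und y)"
    using layered_HomD(3)[OF \<gamma>] unfolding und_act_generic[OF gen' g'] .
  note o = layered_HomD(1)[OF \<gamma>] and o\<beta> = layered_HomD(1)[OF \<beta>]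
  note fx = restr_over[OF f' x] and fy = restr_over[OF f' y]
  note g'x = act_Obj[OF g' x] and g'y = act_Obj[OF g' y]
  have gx: "over g' k l (act_obj R g' x) (Id E (und x)) x" and gy: "over g' k l (act_obj R g' y) (Id E (und y)) y"
    using restr_over[OF g' x] restr_over[OF g' y] unfolding restr_arrow_generic[OF gen'] .
  have car: "car (act_obj R g' x) = car x" "car (act_obj R g' y) = car y"
    by (simp_all add: act_obj_generic'[OF g' gen'])
  have lay_eq: "lay (act_obj R g' y) (base ?e p) = lay (act_obj R g' x) p" if "p \<in> car x" for p
    using over_lay[OF o, unfolded car, OF that] lay_bounds[OF g'x, unfolded car, OF that] by (simp add: app_Id)
  have lx: "app g' (lay (act_obj R g' x) p - 1) < lay x p" "lay x p \<le> app g' (lay (act_obj R g' x) p)"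
    if "p \<in> car x" for p
    using over_lay[OF gx, unfolded car, OF that] base_Id[of p "und x"] that by simp_all
  have ly: "app g' (lay (act_obj R g' y) q - 1) < lay y q" "lay y q \<le> app g' (lay (act_obj R g' y) q)"
    if "q \<in> car y" for q
    using over_lay[OF gy, unfolded car, OF that] base_Id[of q "und y"] that by simp_all
  have mem: "base ?e p \<in> car y" if "p \<in> car x" for p using base_mem[OF e] that by simp
  have lay: "lay y (base ?e p) = lay x p" if p: "p \<in> car x" for p
  proof (cases "lay x p \<le> c \<or> c + m < lay x p")
    case True
    obtain i where i: "i \<in> {1..k}" "app g' (i - 1) = lay x p - 1" "app g' i = lay x p"
      using singleton_layer[OF lay_bounds[OF x p] True] .
    have "lay (act_obj R g' x) p = i"
    proof (rule layer_unique[OF g' _ lx[OF p]])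
      show "lay (act_obj R g' x) p \<le> k" using lay_bounds[OF g'x, unfolded car, OF p] by simp
      show "i \<le> k" "app g' (i - 1) < lay x p" "lay x p \<le> app g' i" using i lay_bounds[OF x p] by auto
    qed
    then show ?thesis using ly[OF mem[OF p]] i lay_bounds[OF x p] by (simp add: lay_eq[OF p])
  next
    case False
    \<comment> \<open>The layers from \<open>c + 1\<close> to \<open>c + m\<close> are the range of
      \<open>f'\<close>, so \<open>p\<close> comes from the restriction along \<open>f'\<close>.
      There \<open>\<beta>\<close> preserves layers, and both restrictions shift them by the same
      \<open>c\<close>.\<close>
    then have "p \<in> base (restr_arrow R f' x) ` car (act_obj R f' x)"
      using over_surj[OF fx p] app_f'[of 0] app_f'[of m] by simp
    then obtain r where r: "r \<in> car (act_obj R f' x)" "p = base (restr_arrow R f' x) r" by blast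
    note s = over_mem[OF o\<beta> r(1)]
    have "base ?e p = base (restr_arrow R f' y) (base (mid \<beta>) r)"
      using base_Comp[OF over_Hom[OF fx] e, of r] base_Comp[OF over_Hom[OF o\<beta>] over_Hom[OF fy], of r] r eq by simp
    moreover have "lay (act_obj R f' y) (base (mid \<beta>) r) = lay (act_obj R f' x) r"
      using over_lay[OF o\<beta> r(1)] lay_bounds[OF over_source[OF o\<beta>] r(1)] by (simp add: app_Id)
    moreover have "lay x p = lay (act_obj R f' x) r + c"
      using over_lay[OF fx r(1)] lay_bounds[OF over_source[OF o\<beta>] r(1)] by (simp add: r(2) app_f')
    moreover have "lay y (base (restr_arrow R f' y) (base (mid \<beta>) r)) = lay (act_obj R f' y) (base (mid \<beta>) r) + c"
      using over_lay[OF fy s] lay_bounds[OF over_target[OF o\<beta>] s] by (simp add: app_f')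
    ultimately show ?thesis by simp
  qed
  have "over (Id Delta l) l l x ?e y"
    unfolding over_def
  proof (intro conjI ballI impI)
    show "Id Delta l \<in> Hom Delta l l" by (rule over_Delta[OF over_Id[OF x]])
    fix q assume q: "q \<in> car y"
    show "q \<in> base ?e ` car x"
      using over_surj[OF o, unfolded car, OF q] lay_bounds[OF g'y, unfolded car, OF q] by (simp add: app_Id)
  next
    fix p assume p: "p \<in> car x"
    show "app (Id Delta l) (lay x p - 1) < lay y (base ?e p)" "lay y (base ?e p) \<le> app (Id Delta l) (lay x p)"
      using lay_bounds[OF x p] by (simp_all add: lay[OF p] app_Id)
  qed (use x y e in auto)
  then have h: "(x, ?e, y) \<in> Hom (layered R l) x y" by (simp add: layered_Hom)
  show ?thesis
  proof (rule ex1I)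
    have "on_arr (pull X f') (x, ?e, y) = \<beta>"
    proof (rule over_cancel[OF fy pull_arr_Hom[OF f' h] \<beta>])
      show "restr_arrow R f' y \<cdot>\<^bsub>E\<^esub> mid (on_arr (pull X f') (x, ?e, y)) = restr_arrow R f' y \<cdot>\<^bsub>E\<^esub> mid \<beta>"
        unfolding restr_pull_arr[OF f' h] fst_conv snd_conv by (rule eq)
    qed
    moreover have "on_arr (pull X g') (x, ?e, y) = \<gamma>"
      by (rule layered_eqI[OF pull_arr_Hom[OF g' h] \<gamma>]) (simp add: mid_pull_generic[OF gen' g' h])
    ultimately show "(x, ?e, y) \<in> Hom (layered R l) x y \<and> on_arr (pull X f') (x, ?e, y) = \<beta> \<and>
        on_arr (pull X g') (x, ?e, y) = \<gamma>" using h by blast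
    fix h' assume h': "h' \<in> Hom (layered R l) x y \<and> on_arr (pull X f') h' = \<beta> \<and> on_arr (pull X g') h' = \<gamma>"
    \<comment> \<open>Pulling back along the generic map \<open>g'\<close> does not change the
      middle component, so \<open>h'\<close> has that of \<open>\<gamma>\<close>.\<close>
    have "mid h' = ?e" using mid_pull_generic[OF gen' g' conjunct1[OF h']] h' by simp
    then show "h' = (x, ?e, y)" using layered_HomD(2)[OF conjunct1[OF h']] by simp
  qed
qed

text \<open>
  An object of \<open>layered R m\<close> refines the layering of the block \<open>{c + 1, \<dots>, c + n}\<close> of layers of \<open>w\<close>.
\<close>

lemma ess_surj:
  assumes b: "b \<in> Obj (layered R m)" and w: "w \<in> Obj (layered R k)"
    and \<delta>: "\<delta> \<in> Hom (layered R n) (act_obj R g b) (act_obj R f w)"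
  obtains z e where "z \<in> Obj (layered R l)" "act_obj R g' z = w" "over f' m l b e z"
    "e = restr_arrow R f w \<cdot>\<^bsub>E\<^esub> mid \<delta>"
proof -
  \<comment> \<open>Identifies the poset of \<open>b\<close> with the points of \<open>w\<close> in
    the block; this fits because coarsening \<open>b\<close> along \<open>g\<close> keeps its
    underlying structure.\<close>
  define e where "e = restr_arrow R f w \<cdot>\<^bsub>E\<^esub> mid \<delta>"
  have oe: "over f n k (act_obj R g b) e w"
    using over_Comp[OF layered_HomD(1)[OF \<delta>] restr_over[OF f w]] Delta.Comp_Id_right[OF f] by (simp add: e_def)
  have eH: "e \<in> Hom E (und b) (und w)" using over_Hom[OF oe] unfolding und_act_generic[OF gen g] .
  have carb: "car (act_obj R g b) = car b" by (simp add: act_obj_generic'[OF g gen])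
  have gb: "over g n m (act_obj R g b) (Id E (und b)) b"
    using restr_over[OF g b] unfolding restr_arrow_generic[OF gen] .
  define r where "r p = lay (act_obj R g b) p" for p
  have r: "1 \<le> r p" "r p \<le> n" "app g (r p - 1) < lay b p" "lay b p \<le> app g (r p)" "lay w (base e p) = r p + c"
    if p: "p \<in> car b" for p
  proof -
    show rb: "1 \<le> r p" "r p \<le> n" using lay_bounds[OF act_Obj[OF g b], unfolded carb, OF p] by (simp_all add: r_def)
    show "app g (r p - 1) < lay b p" "lay b p \<le> app g (r p)"
      using over_lay[OF gb, unfolded carb, OF p] base_Id[of p "und b"] p by (simp_all add: r_def)
    show "lay w (base e p) = r p + c"
      using over_lay[OF oe, unfolded carb, OF p] rb by (simp add: r_def app_f)
  qed
  have mem: "base e p \<in> car w" if "p \<in> car b" for p using base_mem[OF eH] that by simp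
  define i where "i = inv_into (car b) (base e)"
  have i_e: "i (base e p) = p" if "p \<in> car b" for p
    using base_inj[OF eH] that by (simp add: i_def inv_into_f_f)
  have mid_image: "\<exists>p \<in> car b. q = base e p" if "q \<in> car w" "c < lay w q" "lay w q \<le> c + n" for q
    using over_surj[OF oe that(1)] that(2,3) app_f[of 0] app_f[of n] by (auto simp: carb)
  \<comment> \<open>The layering on \<open>w\<close> that is forced by the two data: unchanged below
    the block, that of \<open>b\<close> shifted by \<open>c\<close> on it, and translated by the
    change of length above it.\<close>
  define L where "L = (\<lambda>q \<in> car w. if lay w q \<le> c then lay w q
    else if lay w q \<le> c + n then lay b (i q) + c else lay w q + m - n)"
  have L1: "L q = lay w q" if "q \<in> car w" "lay w q \<le> c" for q using that by (simp add: L_def)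
  have L2: "L (base e p) = lay b p + c" if "p \<in> car b" for p
    using mem[OF that] r[OF that] by (simp add: L_def i_e[OF that])
  have L3: "L q = lay w q + m - n" if "q \<in> car w" "c + n < lay w q" for q using that by (simp add: L_def)
  have cases: "lay w q \<le> c \<or> (\<exists>p \<in> car b. q = base e p) \<or> c + n < lay w q" if "q \<in> car w" for q
    using mid_image[OF that] by linarith
  define z where "z = (fst w, L, snd (snd w))"
  have bounds: "1 \<le> L q" "L q \<le> l" if q: "q \<in> car w" for q
  proof -
    note lw = lay_bounds[OF w q]
    have "1 \<le> L q \<and> L q \<le> l"
      using cases[OF q]
    proof (elim disjE bexE)
      fix p assume "p \<in> car b" "q = base e p"
      then show ?thesis using L2[of p] lay_bounds[OF b, of p] nck by (simp add: l)
    qed (use L1[OF q] L3[OF q] lw nck l in auto)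
    then show "1 \<le> L q" "L q \<le> l" by auto
  qed
  have mono: "L q \<le> L q'" if q: "(q, q') \<in> snd (fst w)" for q q'
  proof -
    have m: "q \<in> car w" "q' \<in> car w" and le: "lay w q \<le> lay w q'"
      using w q poset_carrier[of "fst w"] by (auto simp: layered_Obj layering_def)
    have lb: "lay b p \<le> lay b p'" if "p \<in> car b" "p' \<in> car b" "q = base e p" "q' = base e p'" for p p'
    proof -
      have "(p, p') \<in> snd (fst b)" using base_reflect[OF eH, of p p'] that q by simp
      then show ?thesis using b by (simp add: layered_Obj layering_def)
    qed
    from cases[OF m(1)] cases[OF m(2)] show ?thesis
    proof (elim disjE bexE)
      fix p p' assume "p \<in> car b" "p' \<in> car b" "q = base e p" "q' = base e p'"
      then show ?thesis using lb L2 by simp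
    next
      fix p assume "p \<in> car b" "q = base e p" "lay w q' \<le> c"
      then show ?thesis using r(1,5)[of p] le by simp
    next
      fix p assume "p \<in> car b" "q = base e p" "c + n < lay w q'"
      then show ?thesis using L2[of p] L3[OF m(2)] lay_bounds[OF b, of p] by simp
    next
      fix p assume "p \<in> car b" "q' = base e p" "lay w q \<le> c"
      then show ?thesis using L2[of p] L1[OF m(1)] by simp
    next
      fix p assume "p \<in> car b" "q' = base e p" "c + n < lay w q"
      then show ?thesis using r(2,5)[of p] le by simp
    qed (use L1[OF m(1)] L1[OF m(2)] L3[OF m(1)] L3[OF m(2)] le in auto)
  qed
  have z: "z \<in> Obj (layered R l)"
    using w bounds mono by (auto simp: z_def layered_Obj layering_def) (auto simp: L_def)
  have "compose (car w) (under_generic g') L = lay w"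
  proof (rule extensionalityI)
    show "compose (car w) (under_generic g') L \<in> extensional (car w)" by (simp add: compose_def)
    show "lay w \<in> extensional (car w)" using w by (simp add: layered_Obj layering_def PiE_iff)
    fix q assume q: "q \<in> car w"
    note lw = lay_bounds[OF w q]
    have u: "under_generic g' (L q) \<in> {1..k}" "app g' (under_generic g' (L q) - 1) < L q"
      "L q \<le> app g' (under_generic g' (L q))"
      using under_generic[OF g' gen', of "L q"] bounds[OF q] by auto
    \<comment> \<open>By uniqueness of layers it suffices that \<open>L q\<close> lies in the
      interval of \<open>g'\<close> belonging to \<open>lay w q\<close>. On the block, this interval
      is the one of \<open>g\<close> for \<open>r p\<close>, shifted by \<open>c\<close>.\<close>
    have "app g' (lay w q - 1) < L q \<and> L q \<le> app g' (lay w q)"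
      using cases[OF q]
    proof (elim disjE bexE)
      assume "lay w q \<le> c"
      then show ?thesis using L1[OF q] lw nck by (simp add: app_g' stretch_def)
    next
      fix p assume p: "p \<in> car b" "q = base e p"
      have "app g' (lay w q) = app g (r p) + c" using r[OF p(1)] p app_g'_block[of "r p"] by simp
      moreover have "lay w q - 1 = r p - 1 + c" using r[OF p(1)] p by simp
      then have "app g' (lay w q - 1) = app g (r p - 1) + c"
        using r(2)[OF p(1)] app_g'_block[of "r p - 1"] by simp
      ultimately show ?thesis using r[OF p(1)] L2[OF p(1)] p by simp
    next
      assume a: "c + n < lay w q"
      then have "app g' (lay w q) = lay w q + m - n" using lw app_g'_above[of "lay w q"] by simp
      moreover have "app g' (lay w q - 1) = lay w q - 1 + m - n"
        using a lw app_g'_above[of "lay w q - 1"] by simp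
      ultimately show ?thesis using L3[OF q a] a by simp
    qed
    then have "under_generic g' (L q) = lay w q"
      using u lw by (intro layer_unique[OF g', of _ "L q"]) auto
    then show "compose (car w) (under_generic g') L q = lay w q" using q by (simp add: compose_def)
  qed
  then have "act_obj R g' z = w"
    by (cases w) (simp add: act_obj_generic'[OF g' gen'] z_def)
  moreover have "over f' m l b e z"
    unfolding over_def
  proof (intro conjI ballI impI)
    show "e \<in> Hom E (und b) (und z)" using eH by (simp add: z_def)
    fix q assume "q \<in> car z" "app f' 0 < lay z q \<and> lay z q \<le> app f' m"
    then have q: "q \<in> car w" "c < L q" "L q \<le> c + m" by (simp_all add: z_def app_f')
    from cases[OF q(1)] show "q \<in> base e ` car b"
    proof (elim disjE bexE)
      assume "lay w q \<le> c" then show ?thesis using L1[OF q(1)] q by simp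
    next
      assume "c + n < lay w q" then show ?thesis using L3[OF q(1)] q by simp
    qed blast
  next
    fix p assume p: "p \<in> car b"
    show "app f' (lay b p - 1) < lay z (base e p)" "lay z (base e p) \<le> app f' (lay b p)"
      using lay_bounds[OF b p] L2[OF p] by (simp_all add: z_def app_f')
  qed (use f' b z in auto)
  ultimately show ?thesis using that[OF z] e_def by blast
qed

lemma hpullback:
  "is_hpullback (layered R l) (layered R m) (layered R k) (layered R n) (pull X f') (pull X g') (pull X g) (pull X f) \<alpha>"
  unfolding is_hpullback_iff[OF groupoid_layered groupoid_layered groupoid_layered pull_functor_layered_space[OF g]
      pull_functor_layered_space[OF f] groupoid_layered pull_functor_layered_space[OF f']
      pull_functor_layered_space[OF g'] \<alpha>_nat_iso]
proof (intro conjI ballI impI)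
  fix x y \<beta> \<gamma> assume x: "x \<in> Obj (layered R l)" and y: "y \<in> Obj (layered R l)"
    and "\<beta> \<in> Hom (layered R m) (on_obj (pull X f') x) (on_obj (pull X f') y)"
    and "\<gamma> \<in> Hom (layered R k) (on_obj (pull X g') x) (on_obj (pull X g') y)"
    and eq: "on_arr (pull X f) \<gamma> \<cdot>\<^bsub>layered R n\<^esub> \<alpha> x = \<alpha> y \<cdot>\<^bsub>layered R n\<^esub> on_arr (pull X g) \<beta>"
  then have \<beta>: "\<beta> \<in> Hom (layered R m) (act_obj R f' x) (act_obj R f' y)"
    and \<gamma>: "\<gamma> \<in> Hom (layered R k) (act_obj R g' x) (act_obj R g' y)"
    by (simp_all add: pull_obj_layered_space[OF f'] pull_obj_layered_space[OF g'])
  show "\<exists>!h. h \<in> Hom (layered R l) x y \<and> on_arr (pull X f') h = \<beta> \<and> on_arr (pull X g') h = \<gamma>"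
    by (rule fully_faithful[OF x y \<beta> \<gamma> eq[unfolded \<alpha>_square[OF x y \<beta> \<gamma>]]])
next
  fix b w \<delta> assume b: "b \<in> Obj (layered R m)" and w: "w \<in> Obj (layered R k)"
    and "\<delta> \<in> Hom (layered R n) (on_obj (pull X g) b) (on_obj (pull X f) w)"
  then have \<delta>: "\<delta> \<in> Hom (layered R n) (act_obj R g b) (act_obj R f w)"
    by (simp add: pull_obj_layered_space[OF g] pull_obj_layered_space[OF f])
  obtain z e where z: "z \<in> Obj (layered R l)" "act_obj R g' z = w" and e: "over f' m l b e z"
    and e_def: "e = restr_arrow R f w \<cdot>\<^bsub>E\<^esub> mid \<delta>"
    using ess_surj[OF b w \<delta>] .
  \<comment> \<open>The chosen restriction of \<open>z\<close> and \<open>e\<close> are both arrows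
    over \<open>f'\<close> into \<open>z\<close>; factoring the former through the latter yields the
    component in \<open>layered R m\<close>.\<close>
  have "over (f' \<cdot>\<^bsub>Delta\<^esub> Id Delta m) m l (act_obj R f' z) (restr_arrow R f' z) z"
    using restr_over[OF f' z(1)] Delta.Comp_Id_right[OF f'] by simp
  then obtain \<beta>0 where \<beta>0: "over (Id Delta m) m m (act_obj R f' z) \<beta>0 b" "e \<cdot>\<^bsub>E\<^esub> \<beta>0 = restr_arrow R f' z"
    using over_Delta[OF over_Id[OF b]] by (rule over_factor[OF e])
  define \<beta> where "\<beta> = (act_obj R f' z, \<beta>0, b)"
  have \<beta>: "\<beta> \<in> Hom (layered R m) (act_obj R f' z) b" and mid\<beta>: "mid \<beta> = \<beta>0"
    using \<beta>0 by (simp_all add: \<beta>_def layered_Hom)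
  \<comment> \<open>Coarsening \<open>z\<close> along \<open>g'\<close> gives \<open>w\<close>
    itself, so the component in \<open>layered R k\<close> can be an identity.\<close>
  have i: "Id (layered R k) w \<in> Hom (layered R k) (act_obj R g' z) w" using Lk.Id_Hom[OF w] by (simp add: z(2))
  have \<alpha>z: "\<alpha> z \<in> Hom (layered R n) (act_obj R g (act_obj R f' z)) (act_obj R f w)"
    using \<alpha>_Hom[OF z(1)] by (simp add: z(2))
  note g\<beta> = pull_arr_Hom[OF g \<beta>]
  have "\<alpha> z = \<delta> \<cdot>\<^bsub>layered R n\<^esub> on_arr (pull X g) \<beta>"
  proof (rule over_cancel[OF restr_over[OF f w] \<alpha>z Ln.Comp_Hom[OF g\<beta> \<delta>]])
    have "restr_arrow R f w \<cdot>\<^bsub>E\<^esub> mid (\<alpha> z) = restr_arrow R f' z"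
      using restr_\<alpha>[OF z(1)] by (simp add: z(2))
    also have "\<dots> = e \<cdot>\<^bsub>E\<^esub> mid (on_arr (pull X g) \<beta>)"
      unfolding mid_pull_generic[OF gen g \<beta>] mid\<beta> by (rule \<beta>0(2)[symmetric])
    also have "\<dots> = restr_arrow R f w \<cdot>\<^bsub>E\<^esub> (mid \<delta> \<cdot>\<^bsub>E\<^esub> mid (on_arr (pull X g) \<beta>))"
      unfolding e_def by (rule E.Comp_assoc[OF layered_HomD(3)[OF g\<beta>] layered_HomD(3)[OF \<delta>] restr_Hom[OF f w]])
    finally show "restr_arrow R f w \<cdot>\<^bsub>E\<^esub> mid (\<alpha> z)
        = restr_arrow R f w \<cdot>\<^bsub>E\<^esub> mid (\<delta> \<cdot>\<^bsub>layered R n\<^esub> on_arr (pull X g) \<beta>)"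
      unfolding mid_Comp[OF g\<beta> \<delta>] .
  qed
  moreover have "on_arr (pull X f) (Id (layered R k) w) \<cdot>\<^bsub>layered R n\<^esub> \<alpha> z = \<alpha> z"
    using functor_Id[OF pull_functor_layered_space[OF f] w] Ln.Comp_Id_left[OF \<alpha>z]
    by (simp add: pull_obj_layered_space[OF f w])
  ultimately have eq: "on_arr (pull X f) (Id (layered R k) w) \<cdot>\<^bsub>layered R n\<^esub> \<alpha> z
      = \<delta> \<cdot>\<^bsub>layered R n\<^esub> on_arr (pull X g) \<beta>" by simp
  show "\<exists>x \<in> Obj (layered R l). \<exists>\<beta> \<in> Hom (layered R m) (on_obj (pull X f') x) b.
      \<exists>\<gamma> \<in> Hom (layered R k) (on_obj (pull X g') x) w.
        on_arr (pull X f) \<gamma> \<cdot>\<^bsub>layered R n\<^esub> \<alpha> x = \<delta> \<cdot>\<^bsub>layered R n\<^esub> on_arr (pull X g) \<beta>"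
  proof (intro bexI, rule eq)
    show "Id (layered R k) w \<in> Hom (layered R k) (on_obj (pull X g') z) w"
      using i by (simp add: pull_obj_layered_space[OF g' z(1)])
    show "\<beta> \<in> Hom (layered R m) (on_obj (pull X f') z) b"
      using \<beta> by (simp add: pull_obj_layered_space[OF f' z(1)])
  qed (rule z(1))
qed

end

lemma decomposition_space_layered_space:
  assumes "species R"
  shows "decomposition_space (layered_space R)"
  unfolding decomposition_space_def
proof (intro conjI allI impI)
  interpret species R by fact
  show "pseudofunctor Delta (layered_space R)" by (rule pseudofunctor_layered_space)
  fix g f f' g' assume *: "generic g \<and> free f \<and> is_pushout Delta g f f' g'"
  then obtain n m k l where H: "g \<in> Hom Delta n m" "f \<in> Hom Delta n k" "f' \<in> Hom Delta m l" "g' \<in> Hom Delta k l"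
    and comm: "f' \<cdot>\<^bsub>Delta\<^esub> g = g' \<cdot>\<^bsub>Delta\<^esub> f"
    and univ: "\<forall>z. \<forall>p \<in> Hom Delta m z. \<forall>q \<in> Hom Delta k z. p \<cdot>\<^bsub>Delta\<^esub> g = q \<cdot>\<^bsub>Delta\<^esub> f \<longrightarrow>
      (\<exists>!h. h \<in> Hom Delta l z \<and> h \<cdot>\<^bsub>Delta\<^esub> f' = p \<and> h \<cdot>\<^bsub>Delta\<^esub> g' = q)"
    unfolding is_pushout_def by blast
  have gen: "generic g" and fr: "free f" using * by auto
  note shape = pushout_shape[OF H(1) gen H(2) fr H(3,4) comm univ]
  interpret pushout_square R g f f' g' n m k l "app f 0"
  proof unfold_locales
    show "app f i = i + app f 0" if "i \<le> n" for i using fr that unfolding free_iff[OF H(2)] by blast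
  qed (fact H gen comm shape | rule shape, assumption)+
  show "is_hpullback (grpd (layered_space R) (Cod Delta f')) (grpd (layered_space R) (Cod Delta g))
      (grpd (layered_space R) (Cod Delta f)) (grpd (layered_space R) (Dom Delta g))
      (pull (layered_space R) f') (pull (layered_space R) g') (pull (layered_space R) g) (pull (layered_space R) f)
      (\<lambda>x. inv_arr (grpd (layered_space R) (Dom Delta g)) (compositor (layered_space R) f g' x)
         \<cdot>\<^bsub>grpd (layered_space R) (Dom Delta g)\<^esub> compositor (layered_space R) g f' x)"
    using hpullback unfolding \<alpha>_def[abs_def] grpd_layered_space HomD(2,3)[OF H(1)] HomD(3)[OF H(2)] HomD(3)[OF H(3)] .
qed


section \<open>Functoriality\<close>

lemma species_if_directed: "directed_restriction_species R \<Longrightarrow> species R"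
  by (simp add: directed_restriction_species_def species_def)

lemma category_species_cat: "category species_cat"
  unfolding species_cat_def
proof (rule psf_subcategory, goal_cases)
  case (3 F)
  then show ?case using id_pseudonat[of poset_cat F] by (auto simp: directed_restriction_species_def)
next
  case (4 F t G u H)
  then show ?case using comp_pseudonat[of poset_cat F G t H u] by auto
qed (auto simp: directed_restriction_species_def)

lemma category_decomposition_cat: "category decomposition_cat"
  unfolding decomposition_cat_def
proof (rule psf_subcategory, goal_cases)
  case (3 F)
  then show ?case using culf_id[of F] by (auto simp: decomposition_space_def)
next
  case (4 F t G u H)
  then show ?case using culf_comp[of F G t H u] by auto
qed (auto simp: decomposition_space_def culf_def)

lemma species_cat_simps:
  "Obj species_cat = {R. directed_restriction_species R}"
  "Arr species_cat = {(R', \<phi>, R). directed_restriction_species R' \<and> directed_restriction_species R \<and>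
    pseudonat poset_cat R' R \<phi>}"
  "Dom species_cat (R', \<phi>, R) = R'" "Cod species_cat (R', \<phi>, R) = R"
  "Id species_cat R = (R, id_pnt poset_cat R, R)"
  "(G, u, H) \<cdot>\<^bsub>species_cat\<^esub> (F, t, G') = (F, comp_pnt poset_cat F H u t, H)"
  by (auto simp: species_cat_def psf_cat_def)

lemma decomposition_cat_simps:
  "Obj decomposition_cat = {X. decomposition_space X}"
  "Arr decomposition_cat = {(X, t, Y). decomposition_space X \<and> decomposition_space Y \<and> culf X Y t}"
  "Dom decomposition_cat (X, t, Y) = X" "Cod decomposition_cat (X, t, Y) = Y"
  "Id decomposition_cat X = (X, id_pnt Delta X, X)"
  "(Y, u, Z) \<cdot>\<^bsub>decomposition_cat\<^esub> (X, t, Y') = (X, comp_pnt Delta X Z u t, Z)"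
  by (auto simp: decomposition_cat_def psf_cat_def)

text \<open>Arrows of both categories record their source and target, so the functor laws are
  equalities of triples and rest on the strict equalities \<open>induced_map_id\<close> and
  \<open>induced_map_comp\<close>.\<close>

lemma is_functor_layered_functor:
  "is_functor (species_cat :: (('a, 'o, 'm) species, ('a, 'o, 'm) species_arrow) cat) decomposition_cat layered_functor"
proof (rule is_functorI[OF category_species_cat category_decomposition_cat])
  let ?S = "species_cat :: (('a, 'o, 'm) species, ('a, 'o, 'm) species_arrow) cat"
  have obj: "on_obj layered_functor R = layered_space R" if "directed_restriction_species R"
    for R :: "('a, 'o, 'm) species"
    using that by (simp add: layered_functor_def species_cat_simps)
  have arr: "on_arr layered_functor (R', \<phi>, R) = (layered_space R', induced_map R' R \<phi>, layered_space R)"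
    if "(R', \<phi>, R) \<in> Arr ?S" for R' R \<phi>
    using that by (simp add: layered_functor_def)
  have Hom: "\<exists>\<phi>. h = (R', \<phi>, R) \<and> (R', \<phi>, R) \<in> Arr ?S" if "h \<in> Hom ?S R' R" for h R' R
    using that by (cases h) (auto simp: Hom_def species_cat_simps)
  have arrD: "directed_restriction_species R'" "directed_restriction_species R" "species_map R' R \<phi>"
    if "(R', \<phi>, R) \<in> Arr ?S" for R' R \<phi>
    using that by (simp_all add: species_cat_simps species_map_def)
  interpret S: category ?S by (rule category_species_cat)
  show "on_obj layered_functor \<in> extensional (Obj ?S)" "on_arr layered_functor \<in> extensional (Arr ?S)"
    by (simp_all add: layered_functor_def)
  show "on_obj layered_functor R \<in> Obj decomposition_cat" if "R \<in> Obj ?S" for R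
    using that decomposition_space_layered_space[OF species_if_directed]
    by (simp add: species_cat_simps obj decomposition_cat_simps)
  show "on_arr layered_functor h \<in> Hom decomposition_cat (on_obj layered_functor R') (on_obj layered_functor R)"
    if hH: "h \<in> Hom ?S R' R" for h R' R
  proof -
    obtain \<phi> where h: "h = (R', \<phi>, R)" "(R', \<phi>, R) \<in> Arr ?S" using Hom[OF hH] by blast
    note D = arrD[OF h(2)]
    show ?thesis
      using species_map.culf_induced_map[OF D(3)] decomposition_space_layered_space[OF species_if_directed[OF D(1)]]
        decomposition_space_layered_space[OF species_if_directed[OF D(2)]]
      by (simp add: h(1) arr[OF h(2)] obj[OF D(1)] obj[OF D(2)] Hom_def decomposition_cat_simps)
  qed
  show "on_arr layered_functor (Id ?S R) = Id decomposition_cat (on_obj layered_functor R)" if R: "R \<in> Obj ?S" for R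
  proof -
    have d: "directed_restriction_species R" using R by (simp add: species_cat_simps)
    have "(R, id_pnt poset_cat R, R) \<in> Arr ?S" using HomD(1)[OF S.Id_Hom[OF R]] by (simp add: species_cat_simps(5))
    then show ?thesis
      using induced_map_id[OF species_if_directed[OF d]]
      by (simp add: species_cat_simps(5) arr obj[OF d] decomposition_cat_simps)
  qed
  show "on_arr layered_functor (k \<cdot>\<^bsub>?S\<^esub> h) = on_arr layered_functor k \<cdot>\<^bsub>decomposition_cat\<^esub> on_arr layered_functor h"
    if h: "h \<in> Hom ?S R1 R2" and k: "k \<in> Hom ?S R2 R3" for h k R1 R2 R3
  proof -
    obtain t where t: "h = (R1, t, R2)" "(R1, t, R2) \<in> Arr ?S" using Hom[OF h] by blast
    obtain u where u: "k = (R2, u, R3)" "(R2, u, R3) \<in> Arr ?S" using Hom[OF k] by blast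
    have "(R1, comp_pnt poset_cat R1 R3 u t, R3) \<in> Arr ?S"
      using HomD(1)[OF S.Comp_Hom[OF h k]] by (simp add: t(1) u(1) species_cat_simps(6))
    then show ?thesis
      using induced_map_comp[OF arrD(3)[OF t(2)] arrD(3)[OF u(2)]]
      by (simp add: t(1) u(1) species_cat_simps(6) arr t(2) u(2) decomposition_cat_simps)
  qed
qed

theorem theorem7p5:
  shows "(\<forall>R :: ('a::infinite, 'o, 'm) species.
            directed_restriction_species R \<longrightarrow> decomposition_space (layered_space R)) \<and>
         (\<forall>(R' :: ('a, 'o, 'm) species) (R :: ('a, 'o, 'm) species) \<phi>.
            directed_restriction_species R' \<and> directed_restriction_species R \<and>
            pseudonat poset_cat R' R \<phi> \<longrightarrow>
            culf (layered_space R') (layered_space R) (induced_map R' R \<phi>)) \<and>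
         is_functor
           (species_cat :: (('a, 'o, 'm) species, ('a, 'o, 'm) species_arrow) cat)
           decomposition_cat
           layered_functor"
proof (intro conjI allI impI)
  show "decomposition_space (layered_space R)" if "directed_restriction_species R" for R :: "('a, 'o, 'm) species"
    by (rule decomposition_space_layered_space[OF species_if_directed[OF that]])
  show "culf (layered_space R') (layered_space R) (induced_map R' R \<phi>)"
    if "directed_restriction_species R' \<and> directed_restriction_species R \<and> pseudonat poset_cat R' R \<phi>"
    for R' R :: "('a, 'o, 'm) species" and \<phi>
    by (rule species_map.culf_induced_map) (use that in \<open>simp add: species_map_def\<close>)
qed (rule is_functor_layered_functor)

end
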